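(* Let $\Omega=\mathbb{T}^n$, $T>0$. For each $\varepsilon>0$ let $\rho^\varepsilon$ be the solution on $[0,T]$ of the Fokker–Planck equation $$\partial_t\rho^\varepsilon_t=\nabla\cdot\Big(\rho^\varepsilon_tB_\varepsilon^{-1}\nabla\log\frac{\rho^\varepsilon_t}{\pi_\varepsilon}\Big)$$ (equivalently, $f^\varepsilon:=\rho^\varepsilon/\pi_\varepsilon$ solves $\partial_tf^\varepsilon=\frac1{\pi_\varepsilon}\nabla\cdot(\pi_\varepsilon B_\varepsilon^{-1}\nabla f^\varepsilon)$), with initial data $\rho^\varepsilon_0$ bounded away from zero and from above uniformly in $\varepsilon$, and such that, with $f^\varepsilon_0=\rho^\varepsilon_0/\pi_\varepsilon$ and $h^\varepsilon_0=\partial_tf^\varepsilon_t|_{t=0}$, the quantities $$\sup_\varepsilon\int_\Omega(f^\varepsilon_0)^2\pi_\varepsilon,\ \ \sup_\varepsilon\int_\Omega\langle\nabla f^\varepsilon_0,B_\varepsilon^{-1}\pi_\varepsilon\nabla f^\varepsilon_0\rangle,\ \ \sup_\varepsilon\int_\Omega(h^\varepsilon_0)^2\pi_\varepsilon,\ \ \sup_\varepsilon\int_\Omega\langle\nabla h^\varepsilon_0,B_\varepsilon^{-1}\pi_\varepsilon\nabla h^\varepsilon_0\rangle$$ are finite. Let $\rho_0$ be the limit of $\rho^\varepsilon_0$ in $(\mathcal{P}(\Omega),W_2)$ and assume well-preparedness: $\rho^\varepsilon_0\rightharpoonup\rho_0$ and $E_\varepsilon(\rho^\varepsilon_0)\to\overline{E}(\rho_0)$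 as $\varepsilon\to0$. Then: (i) there exist a subsequence $\rho^\varepsilon$ and $\rho\in C([0,T];L^2(\Omega))$ such that $W_2^2(\rho^\varepsilon_t,\rho_t)\to0$ uniformly in $t\in[0,T]$; (ii) for a.e. $t\in[0,T]$, $\liminf_{\varepsilon\to0}E_\varepsilon(\rho^\varepsilon_t)\ge\overline{E}(\rho_t)$; (iii) for any $t\in[0,T]$, $$\liminf_{\varepsilon\to0}\int_0^t\psi^*_\varepsilon\Big(\rho^\varepsilon_\tau,-\frac{\delta E_\varepsilon}{\delta\rho}(\rho^\varepsilon_\tau)\Big)d\tau\ge\int_0^t\psi^*\Big(\rho_\tau,-\frac{\delta\overline E}{\delta\rho}(\rho_\tau)\Big)d\tau;$$ (iv) for any $t\in[0,T]$, $$\liminf_{\varepsilon\to0}\int_0^t\psi_\varepsilon(\rho^\varepsilon_\tau,\partial_\tau\rho^\varepsilon_\tau)\,d\tau\ge\int_0^t\psi(\rho_\tau,\partial_\tau\rho_\tau)\,d\tau.$$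
   Context: $\Omega=\mathbb{T}^n$; $\mathcal{P}(\Omega)$ denotes probability densities on $\Omega$ and $W_2$ the standard quadratic Wasserstein distance. $B:\mathbb{T}^n\to\mathbb{R}^{n\times n}$ is smooth, $1$-periodic, symmetric with $C_1I\le B(y)\le C_2I$, $0<C_1\le C_2$; $B_\varepsilon(x):=B(x/\varepsilon)$. $\pi(x,y)$ is smooth in $(x,y)$, $1$-periodic in $y$, bounded above and away from zero uniformly; $\pi_\varepsilon(x):=\pi(x,x/\varepsilon)$ (written $e^{-U_\varepsilon}$), $\overline\pi(x):=\int_{\mathbb{T}^n}\pi(x,y)\,dy$. Energies: $E_\varepsilon(\rho)=\int_\Omega\rho\log\frac{\rho}{\pi_\varepsilon}dx$, $\overline E(\rho)=\int_\Omega\rho\log\frac{\rho}{\overline\pi}dx$, with first variations $\frac{\delta E_\varepsilon}{\delta\rho}=\log\frac{\rho}{\pi_\varepsilon}+1$, $\frac{\delta\overline E}{\delta\rho}=\log\frac{\rho}{\overline\pi}+1$. Dissipations: $\psi_\varepsilon(\rho,s)=\frac12\int_\Omega\langle\nabla u,B_\varepsilon^{-1}\nabla u\rangle\rho\,dx$ where $s=-\nabla\cdot(\rho B_\varepsilon^{-1}\nabla u)$; $\psi^*_\varepsilon(\rho,\xi)=\frac12\int_\Omega\langle\nabla\xi,B_\varepsilon^{-1}\nabla\xi\rangle\rho\,dx$; $\psi(\rho,s)=\frac12\int_\Omega\langle\nabla u,\overline B^{-1}\nabla u\rangle\rho\,dx$ where $s=-\nabla\cdot(\rho\overline B^{-1}\nabla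 u)$; $\psi^*(\rho,\xi)=\frac12\int_\Omega\langle\nabla\xi,\overline B^{-1}\nabla\xi\rangle\rho\,dx$. Effective matrix: let $D(x,y):=\pi(x,y)B^{-1}(y)$; for $i=1,\dots,n$ let $w_i(x,\cdot)\in H^1(\mathbb{T}^n)$ solve the cell problem $\nabla_y\cdot(D(x,y)\nabla_yw_i)+\nabla_y\cdot(D(x,y)e_i)=0$; set $\overline D(x)=\int_{\mathbb{T}^n}D(x,y)\,dy$ and $\overline G(x)$ the matrix whose $i$-th column is $\int_{\mathbb{T}^n}D(x,y)\nabla_yw_i(x,y)\,dy$; then $\overline B(x):=\big((\overline D(x)+\overline G(x))/\overline\pi(x)\big)^{-1}$. Equivalently, $\langle(\overline D+\overline G)(x)p,p\rangle=\inf_{v\in H^1(\mathbb{T}^n)}\int_{\mathbb{T}^n}\langle D(x,y)(\nabla v+p),\nabla v+p\rangle dy$. In (ii)–(iv), $\rho$ is the limit from (i). *)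

theory Defs
  imports "HOL-Analysis.Analysis"
begin

fun iter_pd :: "'a::real_normed_vector list \<Rightarrow> ('a \<Rightarrow> real) \<Rightarrow> 'a \<Rightarrow> real" where
  "iter_pd [] f = f"
| "iter_pd (v # vs) f = (\<lambda>x. frechet_derivative (iter_pd vs f) (at x) v)"

definition smooth_fun :: "('a::real_normed_vector \<Rightarrow> real) \<Rightarrow> bool" where
  "smooth_fun f \<longleftrightarrow> (\<forall>vs x. iter_pd vs f differentiable (at x))"

text \<open>Unit cell [0,1]^n, a fundamental domain of the torus T^n.\<close>
definition cell :: "(real^'n) set" where
  "cell = cbox 0 One"

definition periodic :: "(real^'n \<Rightarrow> 'b) \<Rightarrow> bool" where
  "periodic f \<longleftrightarrow> (\<forall>x i. f (x + axis i 1) = f x)"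

text \<open>Smooth functions on the torus = smooth 1-periodic functions; used as test functions.\<close>
definition test_fun :: "(real^'n \<Rightarrow> real) \<Rightarrow> bool" where
  "test_fun \<phi> \<longleftrightarrow> smooth_fun \<phi> \<and> periodic \<phi>"

definition pgrad :: "(real^'n \<Rightarrow> real) \<Rightarrow> real^'n \<Rightarrow> real^'n" where
  "pgrad \<phi> x = (\<chi> i. frechet_derivative \<phi> (at x) (axis i 1))"

text \<open>Integrals over the torus = integrals over the unit cell.\<close>
abbreviation tint :: "(real^'n \<Rightarrow> real) \<Rightarrow> real" where
  "tint f \<equiv> integral\<^sup>L (lebesgue_on cell) f"

abbreviation tintegrable :: "(real^'n \<Rightarrow> real) \<Rightarrow> bool" where
  "tintegrable f \<equiv> integrable (lebesgue_on cell) f"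

abbreviation tnn :: "(real^'n \<Rightarrow> real) \<Rightarrow> ennreal" where
  "tnn f \<equiv> (\<integral>\<^sup>+ x. ennreal (f x) \<partial>lebesgue_on cell)"

definition has_weak_grad :: "(real^'n \<Rightarrow> real) \<Rightarrow> (real^'n \<Rightarrow> real^'n) \<Rightarrow> bool" where
  "has_weak_grad u g \<longleftrightarrow> tintegrable u \<and> (\<forall>i. tintegrable (\<lambda>x. g x $ i)) \<and>
     (\<forall>\<phi>. test_fun \<phi> \<longrightarrow> (\<forall>i. tint (\<lambda>x. u x * pgrad \<phi> x $ i) = - tint (\<lambda>x. g x $ i * \<phi> x)))"

definition wgrad :: "(real^'n \<Rightarrow> real) \<Rightarrow> real^'n \<Rightarrow> real^'n" where
  "wgrad u = (SOME g. has_weak_grad u g)"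

definition is_density :: "(real^'n \<Rightarrow> real) \<Rightarrow> bool" where
  "is_density p \<longleftrightarrow> p \<in> borel_measurable lebesgue \<and> (\<forall>x\<in>cell. 0 \<le> p x) \<and> tintegrable p \<and> tint p = 1"

definition tdist :: "real^'n \<Rightarrow> real^'n \<Rightarrow> real" where
  "tdist x y = Inf {norm (x - y - k) | k. \<forall>i. k $ i \<in> \<int>}"

definition couplings :: "(real^'n \<Rightarrow> real) \<Rightarrow> (real^'n \<Rightarrow> real) \<Rightarrow> ((real^'n) \<times> (real^'n)) measure set" where
  "couplings p q = {\<gamma>. sets \<gamma> = sets borel \<and> emeasure \<gamma> (UNIV - cell \<times> cell) = 0 \<and>
     (\<forall>A\<in>sets borel. emeasure \<gamma> (A \<times> UNIV) = (\<integral>\<^sup>+x\<in>A \<inter> cell. ennreal (p x) \<partial>lborel)) \<and>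
     (\<forall>A\<in>sets borel. emeasure \<gamma> (UNIV \<times> A) = (\<integral>\<^sup>+x\<in>A \<inter> cell. ennreal (q x) \<partial>lborel))}"

definition W2sq :: "(real^'n \<Rightarrow> real) \<Rightarrow> (real^'n \<Rightarrow> real) \<Rightarrow> ennreal" where
  "W2sq p q = (INF \<gamma>\<in>couplings p q. \<integral>\<^sup>+ z. ennreal ((tdist (fst z) (snd z))\<^sup>2) \<partial>\<gamma>)"

definition weak_conv :: "('i \<Rightarrow> real^'n \<Rightarrow> real) \<Rightarrow> (real^'n \<Rightarrow> real) \<Rightarrow> 'i filter \<Rightarrow> bool" where
  "weak_conv ps p F \<longleftrightarrow> (\<forall>\<phi>. continuous_on UNIV \<phi> \<and> periodic \<phi> \<longrightarrow>
      ((\<lambda>e. tint (\<lambda>x. ps e x * \<phi> x)) \<longlongrightarrow> tint (\<lambda>x. p x * \<phi> x)) F)"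

definition rel_entropy :: "(real^'n \<Rightarrow> real) \<Rightarrow> (real^'n \<Rightarrow> real) \<Rightarrow> ereal" where
  "rel_entropy ref p = (if tintegrable (\<lambda>x. p x * ln (p x / ref x))
     then ereal (tint (\<lambda>x. p x * ln (p x / ref x))) else \<infinity>)"

text \<open>psi^*(rho, xi) = 1/2 int <grad xi, M grad xi> rho, with M the given matrix field
  (M = B_eps^{-1} resp. Bbar^{-1}); +infinity if xi has no weak gradient.\<close>
definition psi_star :: "(real^'n \<Rightarrow> real^'n^'n) \<Rightarrow> (real^'n \<Rightarrow> real) \<Rightarrow> (real^'n \<Rightarrow> real) \<Rightarrow> ennreal" where
  "psi_star M p \<xi> = (if \<exists>g. has_weak_grad \<xi> g
     then tnn (\<lambda>x. (1/2) * (wgrad \<xi> x \<bullet> (M x *v wgrad \<xi> x)) * p x) else \<infinity>)"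

text \<open>Time-integrated dissipation  int_0^t psi(rho_tau, d_tau rho_tau) dtau  for a curve rho:
  infimum of 1/2 int_0^t int <grad u, M grad u> rho over all potentials u with
  d_tau rho = - div(rho M grad u) weakly on [0,t] (infinity if there is none).\<close>
definition represents :: "(real^'n \<Rightarrow> real^'n^'n) \<Rightarrow> (real \<Rightarrow> real^'n \<Rightarrow> real) \<Rightarrow> real \<Rightarrow> (real \<Rightarrow> real^'n \<Rightarrow> real) \<Rightarrow> bool" where
  "represents M \<rho> t u \<longleftrightarrow> (\<forall>\<tau>\<in>{0..t}. \<exists>g. has_weak_grad (u \<tau>) g) \<and>
     (\<forall>\<phi>. test_fun \<phi> \<longrightarrow>
        (\<forall>\<tau>\<in>{0..t}. tintegrable (\<lambda>x. \<rho> \<tau> x * ((M x *v wgrad (u \<tau>) x) \<bullet> pgrad \<phi> x))) \<and>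
        integrable (lebesgue_on {0..t}) (\<lambda>\<tau>. tint (\<lambda>x. \<rho> \<tau> x * ((M x *v wgrad (u \<tau>) x) \<bullet> pgrad \<phi> x))) \<and>
        (\<forall>s\<in>{0..t}. tint (\<lambda>x. \<rho> s x * \<phi> x) - tint (\<lambda>x. \<rho> 0 x * \<phi> x) =
            integral\<^sup>L (lebesgue_on {0..s}) (\<lambda>\<tau>. tint (\<lambda>x. \<rho> \<tau> x * ((M x *v wgrad (u \<tau>) x) \<bullet> pgrad \<phi> x)))))"

definition action :: "(real^'n \<Rightarrow> real^'n^'n) \<Rightarrow> (real \<Rightarrow> real^'n \<Rightarrow> real) \<Rightarrow> real \<Rightarrow> ennreal" where
  "action M \<rho> t = (INF u\<in>{u. represents M \<rho> t u}.
     \<integral>\<^sup>+\<tau>\<in>{0..t}. tnn (\<lambda>x. (1/2) * (wgrad (u \<tau>) x \<bullet> (M x *v wgrad (u \<tau>) x)) * \<rho> \<tau> x) \<partial>lborel)"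

definition B_eps :: "(real^'n \<Rightarrow> real^'n^'n) \<Rightarrow> real \<Rightarrow> real^'n \<Rightarrow> real^'n^'n" where
  "B_eps B \<epsilon> x = B ((1/\<epsilon>) *\<^sub>R x)"

definition pi_eps :: "(real^'n \<Rightarrow> real^'n \<Rightarrow> real) \<Rightarrow> real \<Rightarrow> real^'n \<Rightarrow> real" where
  "pi_eps \<pi> \<epsilon> x = \<pi> x ((1/\<epsilon>) *\<^sub>R x)"

definition pi_bar :: "(real^'n \<Rightarrow> real^'n \<Rightarrow> real) \<Rightarrow> real^'n \<Rightarrow> real" where
  "pi_bar \<pi> x = tint (\<pi> x)"

definition Dmat :: "(real^'n \<Rightarrow> real^'n^'n) \<Rightarrow> (real^'n \<Rightarrow> real^'n \<Rightarrow> real) \<Rightarrow> real^'n \<Rightarrow> real^'n \<Rightarrow> real^'n^'n" where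
  "Dmat B \<pi> x y = \<pi> x y *\<^sub>R matrix_inv (B y)"

definition cell_sol :: "(real^'n \<Rightarrow> real^'n^'n) \<Rightarrow> (real^'n \<Rightarrow> real^'n \<Rightarrow> real) \<Rightarrow> real^'n \<Rightarrow> 'n \<Rightarrow> (real^'n \<Rightarrow> real) \<Rightarrow> bool" where
  "cell_sol B \<pi> x i w \<longleftrightarrow> (\<exists>g. has_weak_grad w g) \<and> tintegrable (\<lambda>y. (w y)\<^sup>2) \<and>
     tintegrable (\<lambda>y. (norm (wgrad w y))\<^sup>2) \<and>
     (\<forall>\<phi>. test_fun \<phi> \<longrightarrow> tint (\<lambda>y. (Dmat B \<pi> x y *v (wgrad w y + axis i 1)) \<bullet> pgrad \<phi> y) = 0)"

definition cell_w :: "(real^'n \<Rightarrow> real^'n^'n) \<Rightarrow> (real^'n \<Rightarrow> real^'n \<Rightarrow> real) \<Rightarrow> real^'n \<Rightarrow> 'n \<Rightarrow> real^'n \<Rightarrow> real" where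
  "cell_w B \<pi> x i = (SOME w. cell_sol B \<pi> x i w)"

definition Dbar :: "(real^'n \<Rightarrow> real^'n^'n) \<Rightarrow> (real^'n \<Rightarrow> real^'n \<Rightarrow> real) \<Rightarrow> real^'n \<Rightarrow> real^'n^'n" where
  "Dbar B \<pi> x = (\<chi> j k. tint (\<lambda>y. Dmat B \<pi> x y $ j $ k))"

definition Gbar :: "(real^'n \<Rightarrow> real^'n^'n) \<Rightarrow> (real^'n \<Rightarrow> real^'n \<Rightarrow> real) \<Rightarrow> real^'n \<Rightarrow> real^'n^'n" where
  "Gbar B \<pi> x = (\<chi> j i. tint (\<lambda>y. (Dmat B \<pi> x y *v wgrad (cell_w B \<pi> x i) y) $ j))"

definition Bbar :: "(real^'n \<Rightarrow> real^'n^'n) \<Rightarrow> (real^'n \<Rightarrow> real^'n \<Rightarrow> real) \<Rightarrow> real^'n \<Rightarrow> real^'n^'n" where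
  "Bbar B \<pi> x = matrix_inv ((1 / pi_bar \<pi> x) *\<^sub>R (Dbar B \<pi> x + Gbar B \<pi> x))"

text \<open>rho weakly solves d_t rho = div(rho M grad log(rho/p)) = div(p M grad f), f = rho/p, on [0,T],
  in the standard energy class f in L^infty(0,T;L^2(p)) \<inter> L^2(0,T;H^1).\<close>
definition FP_solution :: "(real^'n \<Rightarrow> real^'n^'n) \<Rightarrow> (real^'n \<Rightarrow> real) \<Rightarrow> real \<Rightarrow> (real \<Rightarrow> real^'n \<Rightarrow> real) \<Rightarrow> bool" where
  "FP_solution M p T \<rho> \<longleftrightarrow>
     (\<forall>t\<in>{0..T}. is_density (\<rho> t)) \<and>
     (\<exists>C. \<forall>t\<in>{0..T}. tnn (\<lambda>x. (\<rho> t x / p x)\<^sup>2 * p x) \<le> ennreal C) \<and>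
     (\<forall>t\<in>{0..T}. \<exists>g. has_weak_grad (\<lambda>x. \<rho> t x / p x) g) \<and>
     (\<integral>\<^sup>+t\<in>{0..T}. tnn (\<lambda>x. (norm (wgrad (\<lambda>x. \<rho> t x / p x) x))\<^sup>2) \<partial>lborel) < \<infinity> \<and>
     (\<forall>\<phi>. test_fun \<phi> \<longrightarrow>
        (\<forall>t\<in>{0..T}. tintegrable (\<lambda>x. p x * ((M x *v wgrad (\<lambda>x. \<rho> t x / p x) x) \<bullet> pgrad \<phi> x))) \<and>
        integrable (lebesgue_on {0..T}) (\<lambda>t. tint (\<lambda>x. p x * ((M x *v wgrad (\<lambda>x. \<rho> t x / p x) x) \<bullet> pgrad \<phi> x))) \<and>
        (\<forall>t\<in>{0..T}. tint (\<lambda>x. \<rho> t x * \<phi> x) - tint (\<lambda>x. \<rho> 0 x * \<phi> x) =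
          - integral\<^sup>L (lebesgue_on {0..t}) (\<lambda>s. tint (\<lambda>x. p x * ((M x *v wgrad (\<lambda>x. \<rho> s x / p x) x) \<bullet> pgrad \<phi> x)))))"

text \<open>h = (1/p) div(p M grad f) weakly, i.e. the value of d_t f at t = 0 given by the equation.\<close>
definition is_initial_dt :: "(real^'n \<Rightarrow> real^'n^'n) \<Rightarrow> (real^'n \<Rightarrow> real) \<Rightarrow> (real^'n \<Rightarrow> real) \<Rightarrow> (real^'n \<Rightarrow> real) \<Rightarrow> bool" where
  "is_initial_dt M p f h \<longleftrightarrow> (\<exists>g. has_weak_grad f g) \<and> tintegrable (\<lambda>x. h x * p x) \<and>
     (\<forall>\<phi>. test_fun \<phi> \<longrightarrow> tint (\<lambda>x. h x * p x * \<phi> x) = - tint (\<lambda>x. p x * ((M x *v wgrad f x) \<bullet> pgrad \<phi> x)))"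

end

theory Submission
  imports Defs "HOL-Complex_Analysis.Great_Picard"
begin

text \<open>
  In terms of \<open>f = \<rho> / \<pi>\<^sub>\<epsilon>\<close> the equation is a linear parabolic equation in divergence form. The bounds on the initial
  data make \<open>f\<close> Lipschitz in time with values in \<open>L\<^sup>2\<close>, uniformly in \<open>\<epsilon>\<close>; the flux \<open>D\<^sub>\<epsilon> \<nabla>f\<close> is then bounded in \<open>H\<^sup>1\<close>
  duality by the \<open>L\<^sup>2\<close> norm of the test function, the maximum principle keeps \<open>f\<close> between positive constants, and Rellich
  compactness gives a limit that is strong in \<open>L\<^sup>2\<close> and uniform in time. The fluxes converge weakly to the homogenized flux, by
  oscillating test functions built from the cell correctors, with the slow variable frozen on the cells of a fine partition.
  Since the flux only sees the \<open>L\<^sup>2\<close> norm of a test function, it may be paired with the strongly converging \<open>log f\<close>: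
  the dissipation \<open>\<psi>\<^sup>*\<close> converges at every time, which yields (iii) by Fatou's lemma. The potential \<open>- log f\<close> is optimal
  in the action at both levels by Young's inequality, which reduces (iv) to (iii); strong convergence turns (ii) into an equality.
\<close>

text \<open>The subsequence is taken among the scales \<open>1 / real (Suc N)\<close>: dilating a
  1-periodic function by an integer gives a 1-periodic function, so oscillating test functions stay
  on the torus. The obstacle that shapes the proof is low regularity in time. A weak solution has no
  time derivative, and its spatial gradient is known to be square integrable only for almost every
  time, whereas the passage to the limit is made time by time. No semigroup is constructed. Instead
  the given solution, smoothed by two resolvents, is recognised as the limit of implicit Euler
  iterates; contraction, Lipschitz continuity in time and pointwise bounds are then read off from a
  single resolvent step. Real Fourier series carry the rest: they identify weak gradients with
  limits of smooth ones, give Rellich compactness with an explicit tail, and make the energy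
  measurable in time. The oscillating, the cell and the effective problem share one structure, a
  weight and an elliptic matrix field, so the same lemmas serve at all three levels.\<close>

notation (input) scaleR (infixr "*R" 75)
abbreviation (input) LIMSEQ_ascii (infix "---->" 60) where "f ----> l \<equiv> f \<longlonglongrightarrow> l"
abbreviation (input) lc :: "(real^'n) measure" where "lc \<equiv> lebesgue_on cell"
lemmas integral_plus = Bochner_Integration.integral_add and integrable_plus = Bochner_Integration.integrable_add
 and integrable_dom = Bochner_Integration.integrable_bound
abbreviation (input) "bmc \<equiv> borel_measurable (lebesgue_on cell)"

section \<open>The Hilbert space of square integrable functions on the cell\<close>

definition sqi :: "(real^'n => 'b::euclidean_space) => bool" where
 "sqi f \<longleftrightarrow> f : bmc & integrable lc (%x. (norm (f x))^2)"

definition l2rel :: "(real^'n => 'b::euclidean_space) => (real^'n => 'b) => bool" where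
 "l2rel f g \<longleftrightarrow> sqi f & sqi g & (AE x in lc. f x = g x)"

lemma sqi_0 [simp]: "sqi (%x. 0)" by (simp add: sqi_def)

lemma sqi_inner:
 assumes "sqi f" "sqi g" shows "integrable lc (%x. f x \<bullet> g x)"
proof (rule integrable_dom)
 show "integrable lc (%x. (norm (f x))^2 + (norm (g x))^2)"
  using assms by (auto simp: sqi_def)
 show "(%x. f x \<bullet> g x) : bmc"
  using assms by (auto simp: sqi_def)
 show "AE x in lc. norm (f x \<bullet> g x) <= norm ((norm (f x))^2 + (norm (g x))^2)"
 proof (rule AE_I2)
  fix x
  have "\<bar>f x \<bullet> g x\<bar> <= norm (f x) * norm (g x)" by (rule Cauchy_Schwarz_ineq2)
  also have "... <= (norm (f x))^2 + (norm (g x))^2"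
  proof -
   have "0 <= (norm (f x) - norm (g x))^2 + (norm (f x))^2 + (norm (g x))^2" by simp
   thus ?thesis by (simp add: power2_eq_square algebra_simps)
  qed
  finally show "norm (f x \<bullet> g x) <= norm ((norm (f x))^2 + (norm (g x))^2)" by simp
 qed
qed

lemma sqi_scale: "sqi f ==> sqi (%x. c *R f x)"
 by (auto simp: sqi_def power_mult_distrib)

lemma sqi_add:
 assumes "sqi f" "sqi g" shows "sqi (%x. f x + g x)"
proof -
 have "(%x. (norm (f x + g x))^2) = (%x. (norm (f x))^2 + 2 * (f x \<bullet> g x) + (norm (g x))^2)"
  by (auto simp: power2_norm_eq_inner inner_add_left inner_add_right inner_commute)
 thus ?thesis using assms sqi_inner[OF assms] by (auto simp: sqi_def)
qed

lemma sqi_diff: "sqi f ==> sqi g ==> sqi (%x. f x - g x)"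
 using sqi_add[of f "%x. (-1) *R g x"] sqi_scale[of g "-1"] by simp

lemma sqi_minus: "sqi f ==> sqi (%x. - f x)"
 using sqi_scale[of f "-1"] by simp

lemma part_equivp_l2rel: "part_equivp (l2rel :: (real^'n => 'b::euclidean_space) => _)"
proof (rule part_equivpI)
 show "EX x. l2rel x (x::real^'n => 'b)" by (rule exI[of _ "%x. 0"]) (simp add: l2rel_def)
 show "symp (l2rel :: (real^'n => 'b) => _)" by (auto simp: symp_def l2rel_def elim: AE_mp)
 show "transp (l2rel :: (real^'n => 'b) => _)" unfolding transp_def l2rel_def by auto
qed

\<comment> \<open>L2 as a type of its own: with the class instances for inner products and
  completeness, Hilbert space arguments run without carrier sets, and pairs of a function and its
  gradient live in an ordinary product type. The relation is partial because only square integrable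
  functions are to be classified.\<close>
quotient_type (overloaded) ('n, 'b) l2 = "(real, 'n::finite) vec => 'b::euclidean_space" / partial: l2rel
 by (rule part_equivp_l2rel)

instantiation l2 :: (finite, euclidean_space) real_vector
begin

lift_definition zero_l2 :: "('a, 'b) l2" is "%x. 0" by (simp add: l2rel_def)
lift_definition plus_l2 :: "('a, 'b) l2 => ('a, 'b) l2 => ('a, 'b) l2" is "%f g x. f x + g x"
 by (auto simp: l2rel_def sqi_add)
lift_definition minus_l2 :: "('a, 'b) l2 => ('a, 'b) l2 => ('a, 'b) l2" is "%f g x. f x - g x"
 by (auto simp: l2rel_def sqi_diff)
lift_definition uminus_l2 :: "('a, 'b) l2 => ('a, 'b) l2" is "%f x. - f x"
 by (auto simp: l2rel_def sqi_minus)
lift_definition scaleR_l2 :: "real => ('a, 'b) l2 => ('a, 'b) l2" is "%c f x. c *R f x"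
 by (auto simp: l2rel_def sqi_scale)
instance
proof
 fix u v w :: "('a, 'b) l2" and r s :: real
 show "u + v + w = u + (v + w)" by transfer (auto simp: l2rel_def intro!: sqi_add simp: add.assoc)
 show "u + v = v + u" by transfer (auto simp: l2rel_def intro!: sqi_add simp: add.commute)
 show "0 + u = u" by transfer (auto simp: l2rel_def)
 show "- u + u = 0" by transfer (auto simp: l2rel_def)
 show "u - v = u + - v" by transfer (auto simp: l2rel_def intro!: sqi_diff)
 show "r *R (u + v) = r *R u + r *R v"
  by transfer (auto simp: l2rel_def scaleR_add_right intro!: sqi_add sqi_scale)
 show "(r + s) *R u = r *R u + s *R u"
  by transfer (auto simp: l2rel_def scaleR_add_left intro!: sqi_add sqi_scale)
 show "r *R s *R u = (r * s) *R u"
  by transfer (auto simp: l2rel_def intro!: sqi_scale)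
 show "1 *R u = u" by transfer (auto simp: l2rel_def)
qed

end

instantiation l2 :: (finite, euclidean_space) real_inner
begin

lift_definition inner_l2 :: "('a, 'b) l2 => ('a, 'b) l2 => real"
 is "%f g. tint (%x. f x \<bullet> g x)"
proof -
 fix f f' g g' :: "real^'a => 'b"
 assume "l2rel f f'" "l2rel g g'"
 thus "tint (%x. f x \<bullet> g x) = tint (%x. f' x \<bullet> g' x)"
  unfolding l2rel_def
  by (intro integral_cong_AE) (auto simp: sqi_def)
qed
definition "norm_l2 (u::('a, 'b) l2) = sqrt (u \<bullet> u)"
definition "sgn_l2 (u::('a, 'b) l2) = u /\<^sub>R norm u"
definition "dist_l2 (u::('a, 'b) l2) v = norm (u - v)"
definition uniformity_l2 :: "(('a, 'b) l2 \<times> ('a, 'b) l2) filter" where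
 "uniformity_l2 = (INF e\<in>{0 <..}. principal {(x, y). dist x y < e})"
definition open_l2 :: "('a, 'b) l2 set => bool" where
 "open_l2 U \<longleftrightarrow> (ALL x:U. \<forall>\<^sub>F (x', y) in uniformity. x' = x --> y : U)"

instance
proof
 fix u v w :: "('a, 'b) l2" and r :: real
 show "dist u v = norm (u - v)" by (rule dist_l2_def)
 show "sgn u = inverse (norm u) *R u" by (rule sgn_l2_def)
 show "(uniformity :: (('a, 'b) l2 \<times> ('a, 'b) l2) filter) = (INF e\<in>{0 <..}. principal {(x, y). dist x y < e})"
  by (rule uniformity_l2_def)
 show "open U \<longleftrightarrow> (ALL x:U. \<forall>\<^sub>F (x', y) in uniformity. x' = x --> y : U)" for U :: "('a, 'b) l2 set"
  by (rule open_l2_def)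
 show "u \<bullet> v = v \<bullet> u" by transfer (simp add: inner_commute)
 show "(u + v) \<bullet> w = u \<bullet> w + v \<bullet> w"
  by transfer (auto simp: l2rel_def inner_add_left sqi_inner)
 show "(r *R u) \<bullet> v = r * (u \<bullet> v)"
  by transfer (auto simp: l2rel_def)
 show "0 <= u \<bullet> u" by transfer auto
 show "(u \<bullet> u = 0) = (u = 0)"
 proof (transfer)
  fix f :: "real^'a => 'b" assume "l2rel f f"
  hence f: "sqi f" by (simp add: l2rel_def)
  have "tint (%x. f x \<bullet> f x) = 0 \<longleftrightarrow> (AE x in lc. f x \<bullet> f x = 0)"
   by (rule integral_nonneg_eq_0_iff_AE[OF sqi_inner[OF f f]]) auto
  thus "(tint (%x. f x \<bullet> f x) = 0) = l2rel f (%x. 0)" using f by (simp add: l2rel_def)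
 qed
 show "norm u = sqrt (u \<bullet> u)" by (rule norm_l2_def)
qed

end

text \<open>A chosen representative, determined only almost everywhere; hence the almost-everywhere
  form of the computation rules that follow.\<close>

abbreviation fn :: "('n::finite, 'b::euclidean_space) l2 => real^'n => 'b" where "fn \<equiv> rep_l2"
abbreviation tol2 :: "(real^'n => 'b) => ('n::finite, 'b::euclidean_space) l2" where "tol2 \<equiv> abs_l2"

lemma sqi_fn [simp]: "sqi (fn u)"
 using Quotient3_rep_reflp[OF Quotient3_l2] by (auto simp: l2rel_def)

lemma tol2_fn [simp]: "tol2 (fn u) = u"
 by (rule Quotient3_abs_rep[OF Quotient3_l2])

lemma tol2_eqI: "sqi f ==> sqi g ==> (AE x in lc. f x = g x) ==> tol2 f = tol2 g"
 using Quotient3_rel[OF Quotient3_l2, of f g] by (auto simp: l2rel_def)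

lemma fn_tol2: "sqi f ==> AE x in lc. fn (tol2 f) x = f x"
 using Quotient3_rel_abs Quotient3_l2 rep_abs_rsp_left[OF Quotient3_l2, of f f] by (auto simp: l2rel_def)

lemma l2_eqI: "(AE x in lc. fn u x = fn v x) ==> u = v"
 using tol2_eqI[of "fn u" "fn v"] by simp

lemma inner_tol2: "sqi f ==> sqi g ==> tol2 f \<bullet> tol2 g = tint (%x. f x \<bullet> g x)"
 by (rule inner_l2.abs_eq) (auto simp: l2rel_def)

lemma inner_fn: "u \<bullet> v = tint (%x. fn u x \<bullet> fn v x)"
 using inner_tol2[of "fn u" "fn v"] by simp

lemma add_tol2: "sqi f ==> sqi g ==> tol2 f + tol2 g = tol2 (%x. f x + g x)"
 by (rule plus_l2.abs_eq) (auto simp: l2rel_def)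
lemma diff_tol2: "sqi f ==> sqi g ==> tol2 f - tol2 g = tol2 (%x. f x - g x)"
 by (rule minus_l2.abs_eq) (auto simp: l2rel_def)
lemma scaleR_tol2: "sqi f ==> c *R tol2 f = tol2 (%x. c *R f x)"
 by (rule scaleR_l2.abs_eq) (auto simp: l2rel_def)
lemma zero_tol2: "0 = tol2 (%x. 0)"
 by (rule zero_l2.abs_eq)

lemma fn_add: "AE x in lc. fn (u + v) x = fn u x + fn v x"
 using fn_tol2[OF sqi_add[OF sqi_fn[of u] sqi_fn[of v]]] add_tol2[of "fn u" "fn v"] by simp
lemma fn_diff: "AE x in lc. fn (u - v) x = fn u x - fn v x"
 using fn_tol2[OF sqi_diff[OF sqi_fn[of u] sqi_fn[of v]]] diff_tol2[of "fn u" "fn v"] by simp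
lemma fn_scaleR: "AE x in lc. fn (c *R u) x = c *R fn u x"
 using fn_tol2[OF sqi_scale[OF sqi_fn[of u]]] scaleR_tol2[of "fn u" c] by simp

lemma norm_l2_sq: "(norm u)^2 = tint (%x. (norm (fn u x))^2)"
 by (simp add: power2_norm_eq_inner inner_fn)

lemma norm_tol2_sq: "sqi f ==> (norm (tol2 f))^2 = tint (%x. (norm (f x))^2)"
 by (simp add: power2_norm_eq_inner inner_tol2)

section \<open>The unit cell as a probability space\<close>

lemma cell_meas [measurable, simp]: "cell : sets lebesgue" by (simp add: cell_def)

lemma One_nth: "(One :: real^'n) $ i = 1"
proof -
 have b: "(axis i 1 :: real^'n) : Basis" by (auto simp: Basis_vec_def)
 have "(One :: real^'n) \<bullet> axis i 1 = (SUM x:Basis. if x = (axis i 1 :: real^'n) then 1 else 0)"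
  unfolding inner_sum_left by (rule sum.cong) (auto simp: inner_Basis b)
 thus ?thesis using b by (simp add: inner_axis)
qed

lemma mem_cell: "x : cell \<longleftrightarrow> (ALL i. 0 <= x $ i & x $ i <= 1)" for x :: "real^'n"
 by (simp add: cell_def mem_box_cart One_nth del: sum_component)

lemma measure_cell: "measure lebesgue (cell :: (real^'n) set) = 1"
proof -
 have "cbox 0 (One :: real^'n) ~= {}" using mem_cell[of 0] by (auto simp: cell_def)
 thus ?thesis unfolding cell_def by (simp add: content_cbox_cart One_nth del: sum_component)
qed

lemma emeasure_cell: "emeasure lc (cell :: (real^'n) set) = 1"
proof -
 have "emeasure lebesgue (cell :: (real^'n) set) = ennreal (measure lebesgue (cell :: (real^'n) set))"
  by (rule emeasure_eq_ennreal_measure) (simp add: cell_def emeasure_lborel_cbox_eq)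
 thus ?thesis by (simp add: measure_cell emeasure_restrict_space)
qed

lemma finite_measure_cell [simp]: "finite_measure (lebesgue_on (cell :: (real^'n) set))"
 by (rule finite_measureI) (simp add: emeasure_cell)

lemma space_cell [simp]: "space lc = cell" by simp

lemma tint_const [simp]: "tint (%x::real^'n. c) = c"
 by (simp add: measure_cell measure_restrict_space)

lemma tintegrable_const [simp]: "integrable (lebesgue_on (cell::(real^'n) set)) (%x. c :: 'b::{banach,second_countable_topology})"
 by (rule finite_measure.integrable_const) simp

lemma sqi_bounded:
 assumes "f : bmc" "AE x in lc. norm (f x) <= K"
 shows "sqi f"
 unfolding sqi_def
proof
 show "integrable lc (%x. (norm (f x))^2)"
 proof (rule integrable_dom)
  show "integrable lc (%x::real^'a. K^2)" by simp
  show "AE x in lc. norm ((norm (f x))^2) <= norm (K^2)"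
   using assms(2) by eventually_elim (auto intro: power_mono)
 qed (use assms(1) in measurable)
qed (rule assms(1))

lemma sqi_const [simp]: "sqi (%x. c)"
 by (rule sqi_bounded[where K="norm c"]) auto

lemma sqi_measurable: "sqi f ==> f : bmc"
 by (simp add: sqi_def)

lemma fn_measurable [measurable]: "fn u : bmc"
 using sqi_fn sqi_measurable by blast

lemma sqi_integrable: "sqi f ==> integrable lc f"
proof (rule integrable_dom)
 assume f: "sqi f"
 show "integrable lc (%x. (norm (f x))^2 + 1)" using f by (auto simp: sqi_def)
 show "AE x in lc. norm (f x) <= norm ((norm (f x))^2 + 1)"
 proof (rule AE_I2)
  fix x have "0 <= (norm (f x) - 1)^2 + (norm (f x))^2 + 1" by simp
  hence "norm (f x) <= (norm (f x))^2 + 1" by (simp add: power2_eq_square algebra_simps)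
  thus "norm (f x) <= norm ((norm (f x))^2 + 1)" by simp
 qed
qed (simp add: sqi_def)

lemma nn_norm_sq: assumes "sqi f"
 shows "(\<integral>\<^sup>+ x. ennreal ((norm (f x))^2) \<partial>lc) = ennreal ((norm (tol2 f))^2)"
 using assms by (subst nn_integral_eq_integral) (auto simp: sqi_def norm_tol2_sq)

text \<open>Turns a bound on a nonnegative integral, which is the form taken by the hypotheses on
  the solutions, into membership in L2 together with a norm bound.\<close>

lemma nn_sqi:
 assumes "f : bmc"
  "(\<integral>\<^sup>+ x. ennreal ((norm (f x))^2) \<partial>lc) <= ennreal (K^2)"  "0 <= K"
 shows "sqi f" "norm (tol2 f) <= K"
proof -
 show s: "sqi f" unfolding sqi_def
 proof
  show "integrable lc (%x. (norm (f x))^2)"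
   using assms by (intro integrableI_nonneg) (auto intro: order.strict_trans1)
 qed (rule assms)
 have "(norm (tol2 f))^2 <= K^2" using assms(2) nn_norm_sq[OF s] by simp
 thus "norm (tol2 f) <= K" using assms(3) by (rule power2_le_imp_le)
qed

section \<open>Completeness of L2 and almost everywhere convergent subsequences\<close>

lemma fast_subseq:
 fixes X :: "nat => 'a::metric_space"
 assumes "Cauchy X"
 obtains r where "strict_mono r" "!!k n. n >= r k ==> dist (X (r k)) (X n) < (1/2)^k"
proof -
 have "EX N. ALL m>=N. ALL n>=N. dist (X m) (X n) < (1/2)^k" for k
  using assms by (intro metric_CauchyD) auto
 then obtain N where N: "!!k m n. m >= N k ==> n >= N k ==> dist (X m) (X n) < (1/2)^k"
  by metis
 \<comment> \<open>The partial sums dominate each \<open>N k\<close>, and the added \<open>k\<close>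
   makes \<open>r\<close> strictly increasing.\<close>
 define r where "r k = (\<Sum>i\<le>k. N i) + k" for k :: nat
 have "strict_mono r" by (auto simp: strict_mono_Suc_iff r_def)
 moreover have "N k <= r k" for k
  unfolding r_def by (induction k) auto
 ultimately show ?thesis using that N by (meson le_trans)
qed

text \<open>Along a subsequence with increments below \<open>(1/2)^k\<close> the sum of the
  pointwise increments has finite integral, so the representatives converge almost everywhere;
  Fatou's lemma then gives convergence in norm. The pointwise subsequence is part of the conclusion
  because bounds on solutions are carried to limits through it.\<close>

lemma l2_Cauchy_AE:
 fixes X :: "nat => ('n::finite, 'b::euclidean_space) l2"
 assumes "Cauchy X"
 obtains r f where "strict_mono r" "sqi f" "X ----> tol2 f"
  "AE x in lc. (%k. fn (X (r k)) x) ----> f x"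
proof -
 obtain r where r: "strict_mono r" "!!k n. n >= r k ==> dist (X (r k)) (X n) < (1/2)^k"
  using fast_subseq[OF assms] by blast
 define d where "d k x = norm (fn (X (r (Suc k))) x - fn (X (r k)) x)" for k x
 have dm[measurable]: "d k : bmc" for k unfolding d_def by measurable
 have dint: "(\<integral>\<^sup>+ x. ennreal (d k x) \<partial>lc) <= ennreal ((1/2)^k)" for k
 proof -
  have s: "sqi (%x. fn (X (r (Suc k))) x - fn (X (r k)) x)" by (intro sqi_diff) auto
  have n: "norm (X (r (Suc k)) - X (r k)) <= (1/2)^k"
   using r(2)[of k "r (Suc k)"] strict_monoD[OF r(1), of k "Suc k"] by (simp add: dist_norm norm_minus_commute)
  have i2: "integrable lc (%x. (d k x)^2)" using s by (simp add: d_def sqi_def)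
  have "tint (%x. (d k x)^2) = (norm (X (r (Suc k)) - X (r k)))^2"
   using norm_tol2_sq[OF s] by (simp add: d_def diff_tol2[symmetric])
  also have "... <= ((1/2)^k)^2" using n by (intro power_mono) auto
  finally have i3: "tint (%x. (d k x)^2) <= ((1/2)^k)^2" .
  have di: "integrable lc (d k)"
   unfolding d_def using sqi_integrable[OF s] by (rule Bochner_Integration.integrable_norm)
  \<comment> \<open>Young's inequality with weight \<open>2^k\<close>: as the cell has mass one, the
    L2 bound \<open>(1/2)^k\<close> becomes the same bound in L1.\<close>
  have "tint (d k) <= tint (%x. 2^k/2 * (d k x)^2 + (1/2)^k/2)"
  proof (rule integral_mono)
   fix x
   have "0 <= 2^k/2 * (d k x - (1/2)^k)^2" by simp
   also have "... = 2^k/2 * (d k x)^2 + (1/2)^k/2 - d k x"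
   proof -
    have "(2::real)^k * (1/2)^k = 1" by (simp add: power_mult_distrib[symmetric])
    thus ?thesis by (simp add: power2_eq_square algebra_simps)
   qed
   finally show "d k x <= 2^k/2 * (d k x)^2 + (1/2)^k/2" by simp
  qed (use di i2 in auto)
  also have "... = 2^k/2 * tint (%x. (d k x)^2) + (1/2)^k/2"
   using i2 by (subst integral_plus) (auto simp: measure_cell measure_restrict_space)
  also have "... <= 2^k/2 * ((1/2)^k)^2 + (1/2)^k/2" using i3 by (auto intro: mult_left_mono)
  also have "... = (1/2)^k" by (simp add: power2_eq_square field_simps)
  finally show ?thesis using di by (subst nn_integral_eq_integral) (auto simp: d_def)
 qed
 have "(\<integral>\<^sup>+ x. (\<Sum>k. ennreal (d k x)) \<partial>lc) = (\<Sum>k. \<integral>\<^sup>+ x. ennreal (d k x) \<partial>lc)"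
  by (rule nn_integral_suminf) measurable
 also have "... <= (\<Sum>k. ennreal ((1/2)^k))" by (intro suminf_le dint) auto
 also have "... = ennreal (\<Sum>k. (1/2)^k)" by (rule suminf_ennreal2) (auto intro!: summable_geometric)
 also have "... < \<infinity>" by simp
 finally have "AE x in lc. (\<Sum>k. ennreal (d k x)) ~= \<infinity>"
  by (intro nn_integral_PInf_AE) auto
 hence AEc: "AE x in lc. (%k. fn (X (r k)) x) ----> lim (%k. fn (X (r k)) x)"
 proof eventually_elim
  fix x assume "(\<Sum>k. ennreal (d k x)) ~= \<infinity>"
  hence "summable (%k. d k x)" by (intro summable_suminf_not_top) (auto simp: d_def)
  hence "summable (%k. fn (X (r (Suc k))) x - fn (X (r k)) x)"
   unfolding d_def by (rule summable_norm_cancel)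
  hence "convergent (%n. \<Sum>k<n. fn (X (r (Suc k))) x - fn (X (r k)) x)"
   by (simp add: summable_iff_convergent)
  hence "convergent (%n. fn (X (r n)) x - fn (X (r 0)) x)"
   using sum_lessThan_telescope[of "%k. fn (X (r k)) x"] by simp
  hence "convergent (%n. (fn (X (r n)) x - fn (X (r 0)) x) + fn (X (r 0)) x)"
   by (rule convergent_add) (rule convergent_const)
  thus "(%k. fn (X (r k)) x) ----> lim (%k. fn (X (r k)) x)"
   by (simp add: convergent_LIMSEQ_iff)
 qed
 define f where "f x = lim (%k. fn (X (r k)) x)" for x
 have fm[measurable]: "f : bmc"
  unfolding f_def by (rule borel_measurable_lim_metric) measurable
 \<comment> \<open>Fatou's lemma against a fixed member of the sequence shows both that the limit
   function is square integrable and that the whole sequence, not only the subsequence, converges to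
   it.\<close>
 have est: "sqi (%x. f x - fn (X n) x) & norm (tol2 (%x. f x - fn (X n) x)) <= e"
  if e: "e > 0" and N: "!!m. m >= n ==> dist (X m) (X n) <= e" for e n
 proof -
  have "(\<integral>\<^sup>+ x. ennreal ((norm (f x - fn (X n) x))^2) \<partial>lc)
    <= (\<integral>\<^sup>+ x. liminf (%j. ennreal ((norm (fn (X (r j)) x - fn (X n) x))^2)) \<partial>lc)"
  proof (rule nn_integral_mono_AE, use AEc in eventually_elim)
   fix x assume "(%k. fn (X (r k)) x) ----> lim (%k. fn (X (r k)) x)"
   hence "(%j. ennreal ((norm (fn (X (r j)) x - fn (X n) x))^2)) ----> ennreal ((norm (f x - fn (X n) x))^2)"
    unfolding f_def by (intro tendsto_intros)
   thus "ennreal ((norm (f x - fn (X n) x))^2) <= liminf (%j. ennreal ((norm (fn (X (r j)) x - fn (X n) x))^2))"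
    using lim_imp_Liminf[OF trivial_limit_sequentially] by fastforce
  qed
  also have "... <= liminf (%j. \<integral>\<^sup>+ x. ennreal ((norm (fn (X (r j)) x - fn (X n) x))^2) \<partial>lc)"
   by (rule nn_integral_liminf) measurable
  also have "... <= ennreal (e^2)"
  proof (rule Liminf_le)
   show "\<forall>\<^sub>F j in sequentially. (\<integral>\<^sup>+ x. ennreal ((norm (fn (X (r j)) x - fn (X n) x))^2) \<partial>lc) <= ennreal (e^2)"
    using eventually_ge_at_top[of n]
   proof eventually_elim
    fix j assume "j >= n"
    hence "dist (X (r j)) (X n) <= e" using N[of "r j"] seq_suble[OF r(1), of j] by linarith
    thus "(\<integral>\<^sup>+ x. ennreal ((norm (fn (X (r j)) x - fn (X n) x))^2) \<partial>lc) <= ennreal (e^2)"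
    using nn_norm_sq[OF sqi_diff[OF sqi_fn[of "X (r j)"] sqi_fn[of "X n"]]]
    by (auto simp: diff_tol2[symmetric] dist_norm intro!: ennreal_leI power_mono)
   qed
  qed simp
  finally have "(\<integral>\<^sup>+ x. ennreal ((norm (f x - fn (X n) x))^2) \<partial>lc) <= ennreal (e^2)" .
  thus ?thesis using e nn_sqi[where K=e and f="%x. f x - fn (X n) x"] by simp
 qed
 obtain n0 where "!!m. m >= n0 ==> dist (X m) (X n0) <= 1"
  using metric_CauchyD[OF assms, of 1] by (meson le_refl less_imp_le zero_less_one)
 hence "sqi (%x. f x - fn (X n0) x)" using est[of 1 n0] by simp
 from sqi_add[OF this sqi_fn[of "X n0"]] have sf: "sqi f" by simp
 have "X ----> tol2 f"
 proof (rule metric_LIMSEQ_I)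
  fix e :: real assume e: "0 < e"
  obtain N where N: "!!m n. m >= N ==> n >= N ==> dist (X m) (X n) < e/2"
   using metric_CauchyD[OF assms, of "e/2"] e by auto
  have "dist (X n) (tol2 f) < e" if "n >= N" for n
  proof -
   have "norm (tol2 (%x. f x - fn (X n) x)) <= e/2"
    using est[of "e/2" n] e N that by (meson half_gt_zero le_trans less_imp_le)
   hence "norm (tol2 f - X n) <= e/2" using diff_tol2[OF sf sqi_fn[of "X n"]] by simp
   thus ?thesis using e by (simp add: dist_norm norm_minus_commute)
  qed
  thus "EX N. ALL n>=N. dist (X n) (tol2 f) < e" by auto
 qed
 thus ?thesis using that[OF r(1) sf] AEc by (simp add: f_def)
qed

instance l2 :: (finite, euclidean_space) complete_space
proof
 fix X :: "nat => ('a, 'b) l2" assume "Cauchy X"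
 thus "convergent X" by (auto elim!: l2_Cauchy_AE simp: convergent_def)
qed

lemma l2_tendsto_AE_subseq:
 fixes X :: "nat => ('n::finite, 'b::euclidean_space) l2"
 assumes "X ----> u"
 obtains r where "strict_mono r" "AE x in lc. (%k. fn (X (r k)) x) ----> fn u x"
proof -
 obtain r f where r: "strict_mono r" "sqi f" "X ----> tol2 f"
  "AE x in lc. (%k. fn (X (r k)) x) ----> f x"
  using l2_Cauchy_AE LIMSEQ_imp_Cauchy[OF assms] by blast
 hence u: "u = tol2 f" using assms LIMSEQ_unique by blast
 have "AE x in lc. (%k. fn (X (r k)) x) ----> fn u x"
  using r(4) fn_tol2[OF r(2)] by eventually_elim (simp add: u)
 thus ?thesis using that r(1) by blast
qed

text \<open>A bounded field of linear maps. Measurability is expressed as preservation of measurable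
  functions, so that multiplication by scalars and by matrix fields are covered alike; linearity and
  the bound are asked at every point of the cell, which later forces truncations of functions
  bounded only almost everywhere.\<close>

definition bpw :: "(real^'n => 'a::euclidean_space => 'b::euclidean_space) => real => bool" where
 "bpw A K \<longleftrightarrow> 0 <= K & (ALL f:bmc. (%x. A x (f x)) : bmc) \<and>
   (ALL x:cell. linear (A x) & (ALL v. norm (A x v) <= K * norm v))"

definition pw :: "(real^'n => 'a::euclidean_space => 'b::euclidean_space) => ('n::finite, 'a) l2 => ('n, 'b) l2" where
 "pw A u = tol2 (%x. A x (fn u x))"

lemma sqi_pw: assumes "bpw A K" "sqi f" shows "sqi (%x. A x (f x))"
 unfolding sqi_def
proof
 show m: "(%x. A x (f x)) : bmc" using assms by (auto simp: bpw_def sqi_def)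
 show "integrable lc (%x. (norm (A x (f x)))^2)"
 proof (rule integrable_dom)
  show "integrable lc (%x. K^2 * (norm (f x))^2)" using assms by (auto simp: sqi_def)
  show "(%x. (norm (A x (f x)))^2) : bmc" using m by measurable
  show "AE x in lc. norm ((norm (A x (f x)))^2) <= norm (K^2 * (norm (f x))^2)"
  proof (rule AE_I2)
   fix x assume "x : space (lebesgue_on (cell :: (real^'a) set))"
   hence "norm (A x (f x)) <= K * norm (f x)" using assms by (auto simp: bpw_def)
   hence "(norm (A x (f x)))^2 <= (K * norm (f x))^2" by (rule power_mono) simp
   thus "norm ((norm (A x (f x)))^2) <= norm (K^2 * (norm (f x))^2)" by (simp add: power_mult_distrib)
  qed
 qed
qed

lemma pw_tol2: assumes "bpw A K" "sqi f" shows "pw A (tol2 f) = tol2 (%x. A x (f x))"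
 unfolding pw_def
proof (rule tol2_eqI)
 show "AE x in lc. A x (fn (tol2 f) x) = A x (f x)"
  using fn_tol2[OF assms(2)] by eventually_elim simp
qed (use assms sqi_pw[OF assms(1)] in auto)

lemma fn_pw: "bpw A K ==> AE x in lc. fn (pw A u) x = A x (fn u x)"
 unfolding pw_def by (rule fn_tol2) (auto intro: sqi_pw)

lemma norm_pw: assumes "bpw A K" shows "norm (pw A u) <= K * norm u"
proof -
 have "(norm (pw A u))^2 = tint (%x. (norm (A x (fn u x)))^2)"
  unfolding pw_def by (rule norm_tol2_sq) (rule sqi_pw[OF assms sqi_fn])
 also have "... <= tint (%x. K^2 * (norm (fn u x))^2)"
 proof (rule integral_mono)
  fix x assume "x : space (lebesgue_on (cell :: (real^'a) set))"
  hence "norm (A x (fn u x)) <= K * norm (fn u x)" using assms by (auto simp: bpw_def)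
  hence "(norm (A x (fn u x)))^2 <= (K * norm (fn u x))^2" by (rule power_mono) simp
  thus "(norm (A x (fn u x)))^2 <= K^2 * (norm (fn u x))^2" by (simp add: power_mult_distrib)
 qed (use sqi_pw[OF assms sqi_fn[of u]] sqi_fn[of u] in \<open>auto simp: sqi_def\<close>)
 also have "... = (K * norm u)^2" by (simp add: norm_l2_sq power_mult_distrib)
 finally show ?thesis by (rule power2_le_imp_le) (use assms in \<open>auto simp: bpw_def\<close>)
qed

lemma bounded_linear_pw: assumes "bpw A K" shows "bounded_linear (pw A)"
proof (rule bounded_linear_intro[where K=K])
 fix u v :: "('a, 'b) l2" and c :: real
 show "pw A (u + v) = pw A u + pw A v"
 proof (rule l2_eqI)
  show "AE x in lc. fn (pw A (u + v)) x = fn (pw A u + pw A v) x"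
   using fn_pw[OF assms, of "u+v"] fn_add[of u v] fn_add[of "pw A u" "pw A v"] fn_pw[OF assms, of u] fn_pw[OF assms, of v] AE_space
  proof eventually_elim
   case (elim x) thus ?case using assms by (auto simp: bpw_def linear_add)
  qed
 qed
 show "pw A (c *R u) = c *R pw A u"
 proof (rule l2_eqI)
  show "AE x in lc. fn (pw A (c *R u)) x = fn (c *R pw A u) x"
   using fn_pw[OF assms, of "c *R u"] fn_scaleR[of c u] fn_scaleR[of c "pw A u"] fn_pw[OF assms, of u] AE_space
  proof eventually_elim
   case (elim x) thus ?case using assms by (auto simp: bpw_def linear_cmul)
  qed
 qed
 show "norm (pw A u) <= norm u * K" using norm_pw[OF assms, of u] by (simp add: mult.commute)
qed

lemma bpw_scalar:
 assumes "c : bmc" "!!x. x : cell ==> \<bar>c x\<bar> <= K" "0 <= K"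
 shows "bpw (%x v. c x *R v :: 'b::euclidean_space) K"
 using assms unfolding bpw_def by (auto intro!: mult_right_mono linearI simp: scaleR_add_right)

lemma bpw_matrix:
 fixes D :: "real^'n => real^'m^'k"
 assumes "!!i j. (%x. D x $ i $ j) : bmc"
  "!!x v. x : cell ==> norm (D x *v v) <= K * norm v" "0 <= K"
 shows "bpw (%x v. D x *v v) K"
 unfolding bpw_def
proof (intro conjI ballI allI)
 fix f :: "real^'n => real^'m" assume f: "f : bmc"
 have fi: "(%x. f x $ i) : bmc" for i
  using borel_measurable_inner[OF f borel_measurable_const[of "axis i 1"]] by (simp add: inner_axis)
 show "(%x. D x *v f x) : bmc"
 proof (subst borel_measurable_euclidean_space, rule ballI)
  fix b :: "real^'k" assume "b : Basis"
  then obtain i where b: "b = axis i 1" by (auto simp: Basis_vec_def)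
  have "(%x. SUM j:UNIV. D x $ i $ j * f x $ j) : bmc"
   using assms(1) fi by measurable
  thus "(%x. (D x *v f x) \<bullet> b) : bmc"
   by (simp add: b inner_axis matrix_vector_mult_def)
 qed
qed (use assms in auto)

section \<open>Monotone operators and the parabolic flow\<close>

lemma subspace_closure: fixes S :: "'a::real_normed_vector set"
 assumes "subspace S" shows "subspace (closure S)"
 unfolding subspace_def
proof (intro conjI ballI allI)
 show "0 : closure S" using assms closure_subset by (auto simp: subspace_def)
 fix x y assume "x : closure S" "y : closure S"
 then obtain X Y where "!!n. X n : S" "X ----> x" "!!n. Y n : S" "Y ----> y"
  by (auto simp: closure_sequential)
 thus "x + y : closure S" unfolding closure_sequential
  by (intro exI[of _ "%n. X n + Y n"]) (auto intro: tendsto_add subspace_add[OF assms])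
next
 fix c x assume "x : closure S"
 then obtain X where "!!n. X n : S" "X ----> x" by (auto simp: closure_sequential)
 thus "c *R x : closure S" unfolding closure_sequential
  by (intro exI[of _ "%n. c *R X n"]) (auto intro: tendsto_scaleR subspace_scale[OF assms])
qed

text \<open>Symmetry makes the solution the minimiser of \<open>J w = a w w - 2 * l w\<close> on
  \<open>W\<close>. The parallelogram identity \<open>par\<close> and coercivity show that every
  minimising sequence is Cauchy, and closedness of \<open>W\<close> keeps its limit
  admissible.\<close>

lemma lax_milgram:
 fixes W :: "'a::{real_inner,complete_space} set" and a :: "'a => 'a => real"
 assumes W: "subspace W" "closed W" and a: "bounded_bilinear a" and sym: "!!x y. a x y = a y x"
  and c: "0 < c" "!!w. w : W ==> c * (norm w)^2 <= a w w" and l: "bounded_linear l"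
 obtains w where "w : W" "!!z. z : W ==> a w z = l z"
proof -
 interpret a: bounded_bilinear a by fact
 interpret l: bounded_linear l by fact
 define J where "J w = a w w - 2 * l w" for w
 obtain K where K: "K >= 0" "!!x. norm (l x) <= norm x * K" using l.nonneg_bounded by blast
 have bdd: "- (K^2 / c) <= J w" if "w : W" for w
 proof -
  have "l w <= norm w * K" using K(2)[of w] by auto
  moreover have "0 <= c * (norm w - K / c)^2" using c by simp
  moreover have "c * (norm w - K / c)^2 = c * (norm w)^2 - 2 * (norm w * K) + K^2 / c"
   using c(1) by (simp add: power2_eq_square field_simps)
  ultimately show ?thesis using c(2)[OF that] unfolding J_def by linarith
 qed
 define m where "m = Inf (J ` W)"
 have ne: "J ` W ~= {}" and bb: "bdd_below (J ` W)"
  using subspace_0[OF W(1)] bdd by (auto intro!: bdd_belowI2)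
 have mle: "m <= J w" if "w : W" for w unfolding m_def using that bb by (auto intro: cInf_lower)
 have "EX w:W. J w < m + 1 / real (Suc n)" for n
  using cInf_lessD[OF ne, of "m + 1 / real (Suc n)"] by (auto simp: m_def)
 then obtain w where w: "!!n. w n : W" "!!n. J (w n) < m + 1 / real (Suc n)" by metis
 have par: "a (x - y) (x - y) = 2 * J x + 2 * J y - 4 * J ((1/2) *R (x + y))" for x y
  by (simp add: J_def a.add_left a.add_right a.diff_left a.diff_right a.scaleR_left a.scaleR_right
    l.add l.scaleR sym[of y x] algebra_simps)
 have cau: "c * (norm (w i - w j))^2 <= 2 / real (Suc i) + 2 / real (Suc j)" for i j
 proof -
  have "c * (norm (w i - w j))^2 <= a (w i - w j) (w i - w j)"
   by (intro c(2) subspace_diff W w)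
  also have "... = 2 * J (w i) + 2 * J (w j) - 4 * J ((1/2) *R (w i + w j))" by (rule par)
  also have "... <= 2 * J (w i) + 2 * J (w j) - 4 * m"
   using mle[of "(1/2) *R (w i + w j)"] W w by (auto intro: subspace_scale subspace_add)
  also have "... <= 2 / real (Suc i) + 2 / real (Suc j)" using w(2)[of i] w(2)[of j] by linarith
  finally show ?thesis .
 qed
 have "Cauchy w"
 proof (rule metric_CauchyI)
  fix e :: real assume e: "0 < e"
  obtain N where N: "4 / (c * e^2) < real (Suc N)" using reals_Archimedean2 by (meson lessI less_trans of_nat_less_iff)
  have "dist (w i) (w j) < e" if "i >= N" "j >= N" for i j
  proof -
   have "2 / real (Suc i) <= 2 / real (Suc N)" "2 / real (Suc j) <= 2 / real (Suc N)"
    using that by (auto intro!: divide_left_mono)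
   hence "c * (norm (w i - w j))^2 <= 4 / real (Suc N)" using cau[of i j] by linarith
   also have "... < c * e^2" using N c e by (simp add: field_simps)
   finally have "(norm (w i - w j))^2 < e^2" using c by simp
   thus ?thesis using e by (simp add: dist_norm power2_less_imp_less)
  qed
  thus "EX M. ALL m>=M. ALL n>=M. dist (w m) (w n) < e" by blast
 qed
 then obtain u where u: "w ----> u" by (auto simp: Cauchy_convergent_iff convergent_def)
 hence uW: "u : W" using W(2) w(1) closed_sequentially by blast
 have "(%n. J (w n)) ----> J u" unfolding J_def
  by (intro tendsto_intros a.tendsto l.tendsto u)
 moreover have "(%n. m + 1 / real (Suc n)) ----> m + 0" by (intro tendsto_intros LIMSEQ_Suc[OF lim_1_over_n])
 ultimately have "J u <= m + 0" by (rule LIMSEQ_le) (use w(2) in \<open>auto intro!: exI[of _ 0] less_imp_le\<close>)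
 hence Ju: "J u <= J z" if "z : W" for z using mle[OF that] by simp
 have "a u z = l z" if z: "z : W" for z
 proof -
  define r where "r = a u z - l z"
  define A where "A = a z z"
  have A: "A >= 0" unfolding A_def using c(2)[OF z] c(1) by (smt (verit) mult_nonneg_nonneg zero_le_power2)
  \<comment> \<open>The optimal step would be \<open>- r / A\<close>. Adding one protects against
    \<open>A = 0\<close> and still leads to \<open>r^2 * (A + 2) <= 0\<close>.\<close>
  define t where "t = - r / (A + 1)"
  have "J u <= J (u + t *R z)" by (intro Ju subspace_add subspace_scale W uW z)
  also have "... = J u + 2 * t * r + t^2 * A"
   by (simp add: J_def r_def A_def a.add_left a.add_right a.scaleR_left a.scaleR_right l.add l.scaleR
    sym[of z u] power2_eq_square algebra_simps)
  finally have "0 <= 2 * t * r + t^2 * A" by simp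
  hence ge: "0 <= (A + 1)^2 * (2 * t * r + t^2 * A)" by simp
  have t: "t * (A + 1) = - r" using A by (simp add: t_def)
  have "(A + 1)^2 * (2 * t * r + t^2 * A) = 2 * (A + 1) * (t * (A + 1)) * r + (t * (A + 1))^2 * A"
   by (simp add: power2_eq_square algebra_simps)
  also have "... = - (r^2 * (A + 2))" unfolding t by (simp add: power2_eq_square algebra_simps)
  finally have "r^2 * (A + 2) <= 0" using ge by simp
  hence "r = 0" using A by (smt (verit) mult_pos_pos zero_less_power2)
  thus ?thesis by (simp add: r_def)
 qed
 thus ?thesis using that uW by blast
qed

text \<open>\<open>W\<close> plays the role of the graph of a closed gradient and \<open>a\<close>
  is a form on gradients. Together they encode a nonnegative self-adjoint operator A, given by (A u,
  w) = \<open>a g k\<close> for all (w, k) in \<open>W\<close> when (u, g) is in \<open>W\<close>,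
  without a type or a set for its domain.\<close>

locale parabolic =
 fixes W :: "('h::{real_inner,complete_space} \<times> 'v::{real_inner,complete_space}) set"
  and a :: "'v => 'v => real" and c :: real
 assumes W_sub: "subspace W" and W_cl: "closed W" and a_bb: "bounded_bilinear a"
  and a_sym: "a g k = a k g" and c_pos: "0 < c" and a_coer: "c * (norm g)^2 <= a g g"
  and W_dense: "closure (fst ` W) = UNIV"
begin

interpretation a: bounded_bilinear a by (rule a_bb)

lemma a_nonneg: "0 <= a g g" using a_coer[of g] c_pos by (smt (verit) mult_nonneg_nonneg zero_le_power2)

text \<open>This is (1 + eta A) u = phi in weak form. The form controls the full norm of the pair
  with constant \<open>min 1 (eta * c)\<close>: the first component through the inner product, the
  second through \<open>a\<close>. Hence Lax-Milgram applies on the graph.\<close>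

lemma res_ex: assumes "0 < eta"
 shows "EX p:W. ALL q:W. fst p \<bullet> fst q + eta * a (snd p) (snd q) = phi \<bullet> fst q"
proof -
 have "bounded_bilinear (%p q :: 'h \<times> 'v. fst p \<bullet> fst q + eta * a (snd p) (snd q))"
 proof -
  obtain K where K: "!!x y. norm (a x y) <= norm x * norm y * K" "K >= 0" using a.nonneg_bounded by blast
  show ?thesis
  proof
   show "EX K. ALL p q :: 'h \<times> 'v. norm (fst p \<bullet> fst q + eta * a (snd p) (snd q)) <= norm p * norm q * K"
   proof (rule exI[of _ "1 + eta * K"], intro allI)
    fix p q :: "'h \<times> 'v"
    have n: "norm (fst p) <= norm p" "norm (snd p) <= norm p" "norm (fst q) <= norm q" "norm (snd q) <= norm q"
    by (cases p; cases q; simp add: norm_fst_le norm_snd_le)+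
    have "norm (fst p \<bullet> fst q + eta * a (snd p) (snd q)) <= \<bar>fst p \<bullet> fst q\<bar> + eta * \<bar>a (snd p) (snd q)\<bar>"
    using assms by (simp add: abs_triangle_ineq[THEN order_trans] abs_mult)
    also have "... <= norm (fst p) * norm (fst q) + eta * (norm (snd p) * norm (snd q) * K)"
    using K(1)[of "snd p" "snd q"] assms by (intro add_mono Cauchy_Schwarz_ineq2 mult_left_mono) auto
    also have "... <= norm p * norm q + eta * (norm p * norm q * K)"
    using n K(2) assms by (intro add_mono mult_mono mult_nonneg_nonneg) auto
    finally show "norm (fst p \<bullet> fst q + eta * a (snd p) (snd q)) <= norm p * norm q * (1 + eta * K)"
    by (simp add: algebra_simps)
   qed
  qed (auto simp: inner_add_left inner_add_right a.add_left a.add_right a.scaleR_left a.scaleR_right algebra_simps)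
 qed
 moreover have "min 1 (eta * c) * (norm w)^2 <= fst w \<bullet> fst w + eta * a (snd w) (snd w)" for w :: "'h \<times> 'v"
 proof -
  have "(norm w)^2 = (norm (fst w))^2 + (norm (snd w))^2" by (simp add: norm_prod_def)
  hence "min 1 (eta * c) * (norm w)^2 = min 1 (eta * c) * (norm (fst w))^2 + min 1 (eta * c) * (norm (snd w))^2"
   by (simp add: algebra_simps)
  also have "... <= 1 * (norm (fst w))^2 + (eta * c) * (norm (snd w))^2"
   by (intro add_mono mult_right_mono) auto
  also have "... <= fst w \<bullet> fst w + eta * a (snd w) (snd w)"
   using mult_left_mono[OF a_coer[of "snd w"], of eta] assms by (simp add: power2_norm_eq_inner mult.assoc)
  finally show ?thesis .
 qed
 moreover have "bounded_linear (%q :: 'h \<times> 'v. phi \<bullet> fst q)"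
  by (intro bounded_linear_compose[OF bounded_linear_inner_right] bounded_linear_fst)
 ultimately show ?thesis
 proof -
  assume bb: "bounded_bilinear (%p q :: 'h \<times> 'v. fst p \<bullet> fst q + eta * a (snd p) (snd q))"
   and co: "!!w :: 'h \<times> 'v. min 1 (eta * c) * (norm w)^2 <= fst w \<bullet> fst w + eta * a (snd w) (snd w)"
   and l: "bounded_linear (%q :: 'h \<times> 'v. phi \<bullet> fst q)"
  have sy: "fst p \<bullet> fst q + eta * a (snd p) (snd q) = fst q \<bullet> fst p + eta * a (snd q) (snd p)" for p q :: "'h \<times> 'v"
   by (simp add: inner_commute a_sym[of "snd p"])
  have pos: "0 < min 1 (eta * c)" using assms c_pos by simp
  show ?thesis by (rule lax_milgram[OF W_sub W_cl bb sy pos co l]) blast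
 qed
qed

definition "res eta phi = (SOME p. p : W & (ALL q:W. fst p \<bullet> fst q + eta * a (snd p) (snd q) = phi \<bullet> fst q))"
definition "R eta phi = fst (res eta phi)"
definition "Gr eta phi = snd (res eta phi)"
text \<open>The Yosida approximation. By \<open>Yo_eq\<close> it is A applied to
  \<open>R eta phi\<close>, and it is a bounded operator of norm at most
  \<open>2 / eta\<close>.\<close>

definition "Yo eta phi = (phi - R eta phi) /\<^sub>R eta"

lemma res_props:
 assumes "0 < eta"
 shows R_in: "(R eta phi, Gr eta phi) : W"
  and R_eq: "!!w k. (w, k) : W ==> R eta phi \<bullet> w + eta * a (Gr eta phi) k = phi \<bullet> w"
proof -
 have "res eta phi : W & (ALL q:W. fst (res eta phi) \<bullet> fst q + eta * a (snd (res eta phi)) (snd q) = phi \<bullet> fst q)"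
  unfolding res_def by (rule someI_ex) (use res_ex[OF assms, of phi] in blast)
 thus "(R eta phi, Gr eta phi) : W" "!!w k. (w, k) : W ==> R eta phi \<bullet> w + eta * a (Gr eta phi) k = phi \<bullet> w"
  unfolding R_def Gr_def by auto
qed

lemma Yo_eq: assumes "0 < eta" "(w, k) : W" shows "a (Gr eta phi) k = Yo eta phi \<bullet> w"
 using R_eq[OF assms, of phi] assms(1) by (simp add: Yo_def inner_diff_left field_simps)

lemma R_unique:
 assumes "0 < eta" "(v, g) : W" "!!w k. (w, k) : W ==> v \<bullet> w + eta * a g k = phi \<bullet> w"
 shows "R eta phi = v" "Gr eta phi = g"
proof -
 have d: "(R eta phi - v, Gr eta phi - g) : W" using subspace_diff[OF W_sub R_in[OF assms(1)] assms(2)] by simp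
 have "(R eta phi - v) \<bullet> (R eta phi - v) + eta * a (Gr eta phi - g) (Gr eta phi - g) = 0"
  using R_eq[OF assms(1) d, of phi] assms(3)[OF d] by (simp add: inner_diff_left a.diff_left algebra_simps)
 moreover have "0 <= eta * a (Gr eta phi - g) (Gr eta phi - g)" using a_nonneg assms(1) by simp
 moreover have "0 <= (R eta phi - v) \<bullet> (R eta phi - v)" by simp
 ultimately have z: "(R eta phi - v) \<bullet> (R eta phi - v) = 0" "eta * a (Gr eta phi - g) (Gr eta phi - g) = 0" by linarith+
 thus "R eta phi = v" by simp
 have "c * (norm (Gr eta phi - g))^2 <= 0" using z(2) a_coer[of "Gr eta phi - g"] assms(1) by simp
 thus "Gr eta phi = g" using c_pos by (simp add: mult_le_0_iff)
qed

lemma R_diff: assumes "0 < eta" shows "R eta (x - y) = R eta x - R eta y"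
 by (rule R_unique(1)[OF assms, of _ "Gr eta x - Gr eta y"])
   (use subspace_diff[OF W_sub R_in[OF assms, of x] R_in[OF assms, of y]] R_eq[OF assms] in
   \<open>auto simp: inner_diff_left a.diff_left algebra_simps\<close>)

lemma R_scaleR: assumes "0 < eta" shows "R eta (r *R x) = r *R R eta x"
proof (rule R_unique(1)[OF assms, of _ "r *R Gr eta x"])
 show "(r *R R eta x, r *R Gr eta x) : W" using subspace_scale[OF W_sub R_in[OF assms, of x], of r] by simp
 fix w k assume "(w, k) : W"
 from R_eq[OF assms this, of x] show "(r *R R eta x) \<bullet> w + eta * a (r *R Gr eta x) k = (r *R x) \<bullet> w"
  by (simp add: a.scaleR_left) (metis distrib_left mult.left_commute)
qed

lemma R_contr: assumes "0 < eta" shows "norm (R eta x) <= norm x"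
proof -
 have "(norm (R eta x))^2 <= R eta x \<bullet> R eta x + eta * a (Gr eta x) (Gr eta x)"
  using a_nonneg assms by (simp add: power2_norm_eq_inner)
 also have "... = x \<bullet> R eta x" by (rule R_eq[OF assms R_in[OF assms]])
 also have "... <= norm x * norm (R eta x)" by (rule norm_cauchy_schwarz)
 finally show ?thesis by (cases "R eta x = 0") (auto simp: power2_eq_square)
qed

lemma R_sym: assumes "0 < eta" shows "R eta x \<bullet> y = x \<bullet> R eta y"
 using R_eq[OF assms R_in[OF assms, of y], of x] R_eq[OF assms R_in[OF assms, of x], of y]
 by (simp add: inner_commute a_sym)

lemma Yo_diff: "0 < eta ==> Yo eta (x - y) = Yo eta x - Yo eta y"
 by (simp add: Yo_def R_diff scaleR_diff_right)

lemma Yo_sym: "0 < eta ==> Yo eta x \<bullet> y = x \<bullet> Yo eta y"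
 by (simp add: Yo_def R_sym inner_diff_left inner_diff_right)

lemma Yo_norm: assumes "0 < eta" shows "norm (Yo eta x) <= 2 / eta * norm x"
proof -
 have "norm (x - R eta x) <= norm x + norm x" using norm_triangle_ineq4[of x "R eta x"] R_contr[OF assms, of x] by linarith
 hence "inverse eta * norm (x - R eta x) <= inverse eta * (norm x + norm x)"
  using assms by (intro mult_left_mono) auto
 moreover have "norm (Yo eta x) = inverse eta * norm (x - R eta x)" using assms by (simp add: Yo_def)
 ultimately show ?thesis using assms by (simp add: divide_inverse mult_ac)
qed

lemma R_Yo_commute: assumes "0 < eta" shows "R eta (Yo eta x) = Yo eta (R eta x)"
 by (simp add: Yo_def R_scaleR[OF assms] R_diff[OF assms])

text \<open>The argument on the left is 1 + \<mu> A applied to \<open>R eta g\<close>. An implicit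
  Euler step started there thus ends exactly at \<open>R eta g\<close>, which is what allows the
  scheme to be compared with a solution smoothed by resolvents.\<close>

lemma R_step: assumes "0 < eta" "0 < \<mu>" shows "R \<mu> (R eta g + \<mu> *R Yo eta g) = R eta g"
 by (rule R_unique(1)[OF assms(2) R_in[OF assms(1)]]) (simp add: inner_add_left Yo_eq[OF assms(1)])

text \<open>Test the resolvent equation with the difference to \<open>x\<close> and use that the
  form is nonnegative at the difference of the gradients. The resulting rate, the square root of
  eta, holds on the graph; density and contraction then give convergence everywhere.\<close>

lemma R_approx_W: assumes "0 < eta" "(x, g) : W" shows "(norm (R eta x - x))^2 <= eta * a g g"
proof -
 have d: "(R eta x - x, Gr eta x - g) : W" using subspace_diff[OF W_sub R_in[OF assms(1)] assms(2)] by simp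
 have eq: "(R eta x - x) \<bullet> (R eta x - x) + eta * a (Gr eta x) (Gr eta x - g) = 0"
  using R_eq[OF assms(1) d, of x] by (simp add: inner_diff_left)
 have "0 <= a (Gr eta x - g) (Gr eta x - g)" by (rule a_nonneg)
 moreover have "a (Gr eta x - g) (Gr eta x - g) = a (Gr eta x) (Gr eta x - g) - a (Gr eta x) g + a g g"
  using a_sym[of g "Gr eta x"] by (simp add: a.diff_left a.diff_right)
 moreover have "a (Gr eta x) (Gr eta x - g) = a (Gr eta x) (Gr eta x) - a (Gr eta x) g" by (simp add: a.diff_right)
 ultimately have "- a (Gr eta x) (Gr eta x - g) <= a g g"
  using a_nonneg[of "Gr eta x"] a_nonneg[of g] by linarith
 hence "eta * (- a (Gr eta x) (Gr eta x - g)) <= eta * a g g" using assms(1) by (intro mult_left_mono) auto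
 thus ?thesis using eq by (simp add: power2_norm_eq_inner)
qed

lemma R_approx:
 assumes pos: "!!n. 0 < eta n" and l0: "eta ----> 0" shows "(%n::nat. R (eta n) x) ----> x"
proof (rule metric_LIMSEQ_I)
 fix e :: real assume e: "0 < e"
 have "x : closure (fst ` W)" by (simp add: W_dense)
 then obtain p where p: "p : W" "dist (fst p) x < e/3" using e by (metis closure_approachable imageE divide_pos_pos zero_less_numeral)
 obtain y g where yg: "p = (y, g)" by fastforce
 have "(%n. eta n * a g g) ----> 0 * a g g" by (intro tendsto_intros l0)
 hence "\<forall>\<^sub>F n in sequentially. eta n * a g g < (e/3)^2" using e by (intro order_tendstoD(2)[where a = "(e/3)^2"]) auto
 then obtain N where N: "!!n. n >= N ==> eta n * a g g < (e/3)^2" by (auto simp: eventually_sequentially)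
 have "dist (R (eta n) x) x < e" if "n >= N" for n
 proof -
  have "(norm (R (eta n) y - y))^2 < (e/3)^2" using R_approx_W[OF pos, of y g n] p(1) yg N[OF that] by auto
  hence 1: "norm (R (eta n) y - y) < e/3" by (rule power2_less_imp_less) (use e in simp)
  have "R (eta n) x - x = R (eta n) (x - y) + (R (eta n) y - y) + (y - x)" by (simp add: R_diff[OF pos])
  hence "norm (R (eta n) x - x) <= norm (R (eta n) (x - y)) + norm (R (eta n) y - y) + norm (y - x)"
   using norm_triangle_ineq[of "R (eta n) (x - y) + (R (eta n) y - y)" "y - x"]
    norm_triangle_ineq[of "R (eta n) (x - y)" "R (eta n) y - y"] by simp
  thus ?thesis using R_contr[OF pos, of n "x - y"] 1 p(2) yg by (simp add: dist_norm norm_minus_commute)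
 qed
 thus "EX no. ALL n>=no. dist (R (eta n) x) x < e" by blast
qed

lemma RR_approx:
 assumes pos: "!!n. 0 < eta n" and l0: "eta ----> 0" shows "(%n::nat. R (eta n) (R (eta n) x)) ----> x"
proof -
 have 1: "(%n. R (eta n) x - x) ----> 0" using R_approx[OF assms, of x] by (simp add: LIM_zero)
 have "(%n. R (eta n) (R (eta n) x - x)) ----> 0"
  by (rule Lim_null_comparison[OF _ tendsto_norm_zero[OF 1]]) (simp add: R_contr pos)
 hence "(%n. R (eta n) (R (eta n) x - x) + R (eta n) x) ----> 0 + x" by (intro tendsto_add R_approx assms)
 thus ?thesis by (simp add: R_diff pos)
qed

end

text \<open>A very weak solution of f' = - A f: the integrated equation is tested with the vectors
  \<open>R eta phi\<close>, on which A acts as \<open>Yo eta phi\<close>. Since no value of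
  \<open>f\<close> needs to have a gradient, the definition covers weak solutions at exceptional
  times as well as increments over a time lag.\<close>

locale evolution = parabolic W a c
 for W :: "('h::{real_inner,complete_space} \<times> 'v::{real_inner,complete_space}) set" and a c +
 fixes f :: "real => 'h" and T M :: real
 assumes f_bd: "!!t. t : {0..T} ==> norm (f t) <= M"
  and ev: "!!eta phi t. 0 < eta ==> t : {0..T} ==>
   ((%r. f r \<bullet> Yo eta phi) has_integral (- ((f t - f 0) \<bullet> R eta phi))) {0..t}"
begin

interpretation a: bounded_bilinear a by (rule a_bb)

lemma ev2: assumes "0 < eta" "0 <= s" "s <= t" "t <= T"
 shows "((%r. f r \<bullet> Yo eta phi) has_integral (- ((f t - f s) \<bullet> R eta phi))) {s..t}"
proof -
 let ?F = "%r. f r \<bullet> Yo eta phi"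
 have 1: "(?F has_integral (- ((f t - f 0) \<bullet> R eta phi))) {0..t}" "(?F has_integral (- ((f s - f 0) \<bullet> R eta phi))) {0..s}"
  using ev assms by auto
 have "?F integrable_on {s..t}" using 1(1) assms by (meson has_integral_integrable integrable_subinterval_real atLeastatMost_subset_iff order_refl)
 then obtain j where j: "(?F has_integral j) {s..t}" by (auto simp: integrable_on_def)
 have "(?F has_integral (- ((f s - f 0) \<bullet> R eta phi) + j)) {0..t}"
  by (rule has_integral_combine[OF assms(2,3) 1(2) j])
 hence "- ((f s - f 0) \<bullet> R eta phi) + j = - ((f t - f 0) \<bullet> R eta phi)" using 1(1) has_integral_unique by blast
 hence "j = - ((f t - f s) \<bullet> R eta phi)" by (simp add: inner_diff_left)
 thus ?thesis using j by simp
qed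

lemma M_nonneg: "0 <= T ==> 0 <= M" using f_bd[of 0] by (smt (verit) norm_ge_zero atLeastAtMost_iff)

lemma norm_by_inner: assumes "!!phi. x \<bullet> phi <= K * norm phi" "0 <= K" shows "norm (x::'h) <= K"
 using assms(1)[of x] assms(2) by (cases "x = 0") (auto simp: power2_norm_eq_inner[symmetric] power2_eq_square)

text \<open>The curve itself is only bounded, but after one resolvent its rate of change is tested
  with \<open>Yo eta phi\<close>, whose norm is at most \<open>2 / eta\<close> times that of
  \<open>phi\<close>.\<close>

lemma R_lipschitz: assumes l: "0 < eta" and st: "0 <= s" "s <= t" "t <= T"
 shows "norm (R eta (f t) - R eta (f s)) <= 2 * M / eta * (t - s)"
proof (rule norm_by_inner)
 fix phi
 have "norm (- ((f t - f s) \<bullet> R eta phi)) <= (2 / eta * norm phi * M) * measure lborel (cbox s t)"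
 proof (rule has_integral_bound)
  show "((%r. f r \<bullet> Yo eta phi) has_integral - ((f t - f s) \<bullet> R eta phi)) (cbox s t)" using ev2[OF l st] by simp
  show "0 <= 2 / eta * norm phi * M" using l M_nonneg st by simp
  fix r assume "r : cbox s t"
  hence r: "r : {0..T}" using st by auto
  have "norm (f r \<bullet> Yo eta phi) <= norm (f r) * norm (Yo eta phi)" by (simp add: Cauchy_Schwarz_ineq2)
  also have "... <= M * (2 / eta * norm phi)" using f_bd[OF r] Yo_norm[OF l, of phi] M_nonneg st by (intro mult_mono) auto
  finally show "norm (f r \<bullet> Yo eta phi) <= 2 / eta * norm phi * M" by (simp add: mult_ac)
 qed
 hence "\<bar>(f t - f s) \<bullet> R eta phi\<bar> <= (2 / eta * norm phi * M) * (t - s)" using st by simp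
 thus "(R eta (f t) - R eta (f s)) \<bullet> phi <= 2 * M / eta * (t - s) * norm phi"
  by (simp add: R_diff[OF l, symmetric] R_sym[OF l] mult_ac abs_le_iff)
qed (use l M_nonneg st in simp)

text \<open>Two resolvents, because the local error of the Euler scheme needs one to make the curve
  Lipschitz in time and one to absorb the operator.\<close>

definition "Q eta t = R eta (R eta (f t))"

text \<open>By \<open>R_step\<close> and contraction the local error is at most the norm of
  \<open>?d\<close>. That vector is the time integral over one step of A applied to the increment of
  the twice smoothed curve; each resolvent contributes a factor \<open>2 / eta\<close>, the
  Lipschitz bound one factor \<mu> and the length of the step another.\<close>

lemma euler_step: assumes l: "0 < eta" and "0 <= t" "0 < \<mu>" "t + \<mu> <= T"
 shows "norm (Q eta (t + \<mu>) - R \<mu> (Q eta t)) <= 4 * M / eta^2 * \<mu>^2"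
proof -
 let ?g = "%t. R eta (f t)"
 let ?d = "Q eta (t + \<mu>) - Q eta t + \<mu> *R Yo eta (?g (t + \<mu>))"
 have T: "0 <= T" using assms by simp
 have "Q eta (t + \<mu>) = R \<mu> (Q eta (t + \<mu>) + \<mu> *R Yo eta (?g (t + \<mu>)))"
  unfolding Q_def by (rule R_step[OF l, symmetric]) fact
 hence "Q eta (t + \<mu>) - R \<mu> (Q eta t) = R \<mu> (Q eta (t + \<mu>) + \<mu> *R Yo eta (?g (t + \<mu>))) - R \<mu> (Q eta t)" by simp
 also have "... = R \<mu> ?d" unfolding R_diff[OF assms(3), symmetric] by (simp add: algebra_simps)
 finally have "Q eta (t + \<mu>) - R \<mu> (Q eta t) = R \<mu> ?d" .
 hence "norm (Q eta (t + \<mu>) - R \<mu> (Q eta t)) <= norm ?d" using R_contr[OF assms(3)] by simp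
 also have "... <= 4 * M / eta^2 * \<mu>^2"
 proof (rule norm_by_inner)
  fix phi
  have i1: "((%r. f r \<bullet> Yo eta (R eta phi)) has_integral (- ((f (t+\<mu>) - f t) \<bullet> R eta (R eta phi)))) {t..t+\<mu>}"
   using ev2[OF l, of t "t+\<mu>"] assms by auto
  have i2: "((%r. f (t+\<mu>) \<bullet> Yo eta (R eta phi)) has_integral (\<mu> * (f (t+\<mu>) \<bullet> Yo eta (R eta phi)))) {t..t+\<mu>}"
   using has_integral_const_real[of "f (t+\<mu>) \<bullet> Yo eta (R eta phi)" t "t+\<mu>"] assms by simp
  have i3: "((%r. (f (t+\<mu>) - f r) \<bullet> Yo eta (R eta phi)) has_integral
    (\<mu> * (f (t+\<mu>) \<bullet> Yo eta (R eta phi)) - (- ((f (t+\<mu>) - f t) \<bullet> R eta (R eta phi))))) (cbox t (t+\<mu>))"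
   using has_integral_diff[OF i2 i1] by (simp add: inner_diff_left)
  have eq: "\<mu> * (f (t+\<mu>) \<bullet> Yo eta (R eta phi)) - (- ((f (t+\<mu>) - f t) \<bullet> R eta (R eta phi))) = ?d \<bullet> phi"
   by (simp add: Q_def inner_add_left inner_diff_left R_sym[OF l] Yo_sym[OF l] R_Yo_commute[OF l, symmetric])
  have "norm (?d \<bullet> phi) <= (4 * M / eta^2 * \<mu> * norm phi) * measure lborel (cbox t (t+\<mu>))"
  proof (rule has_integral_bound[OF _ i3[unfolded eq]])
   show "0 <= 4 * M / eta^2 * \<mu> * norm phi" using M_nonneg[OF T] assms by simp
   fix r assume r: "r : cbox t (t+\<mu>)"
   have "(f (t+\<mu>) - f r) \<bullet> Yo eta (R eta phi) = (R eta (f (t+\<mu>)) - R eta (f r)) \<bullet> Yo eta phi"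
    by (simp add: R_Yo_commute[OF l, symmetric] R_sym[OF l] R_diff[OF l, symmetric])
   hence "norm ((f (t+\<mu>) - f r) \<bullet> Yo eta (R eta phi)) <= norm (R eta (f (t+\<mu>)) - R eta (f r)) * norm (Yo eta phi)"
    by (simp add: Cauchy_Schwarz_ineq2)
   also have "... <= (2 * M / eta * (t + \<mu> - r)) * (2 / eta * norm phi)"
    using r assms M_nonneg[OF T] by (intro mult_mono R_lipschitz Yo_norm l) auto
   also have "... <= (2 * M / eta * \<mu>) * (2 / eta * norm phi)"
    using r assms M_nonneg[OF T] by (intro mult_right_mono mult_left_mono) auto
   finally show "norm ((f (t+\<mu>) - f r) \<bullet> Yo eta (R eta phi)) <= 4 * M / eta^2 * \<mu> * norm phi"
    by (simp add: power2_eq_square mult_ac)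
  qed
  thus "?d \<bullet> phi <= 4 * M / eta^2 * \<mu>^2 * norm phi"
   using assms by (simp add: power2_eq_square mult_ac abs_le_iff)
 qed (use M_nonneg[OF T] in simp)
 finally show ?thesis .
qed

lemma euler_iterate: assumes l: "0 < eta" and "0 < \<mu>" "real k * \<mu> <= T"
 shows "norm (Q eta (real k * \<mu>) - (R \<mu> ^^ k) (Q eta 0)) <= real k * (4 * M / eta^2 * \<mu>^2)"
 using assms(3)
proof (induction k)
 case (Suc k)
 have k: "real k * \<mu> <= T" "real k * \<mu> + \<mu> <= T" using Suc.prems assms(2) by (simp_all add: algebra_simps)
 have e: "real (Suc k) * \<mu> = real k * \<mu> + \<mu>" by (simp add: algebra_simps)
 have "norm (Q eta (real k * \<mu> + \<mu>) - (R \<mu> ^^ Suc k) (Q eta 0))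
   = norm ((Q eta (real k * \<mu> + \<mu>) - R \<mu> (Q eta (real k * \<mu>))) + R \<mu> (Q eta (real k * \<mu>) - (R \<mu> ^^ k) (Q eta 0)))"
  using assms(2) by (simp add: R_diff)
 also have "... <= 4 * M / eta^2 * \<mu>^2 + real k * (4 * M / eta^2 * \<mu>^2)"
 proof (rule order_trans[OF norm_triangle_ineq], rule add_mono)
  show "norm (Q eta (real k * \<mu> + \<mu>) - R \<mu> (Q eta (real k * \<mu>))) <= 4 * M / eta^2 * \<mu>^2"
   by (rule euler_step) (use l assms k in auto)
  show "norm (R \<mu> (Q eta (real k * \<mu>) - (R \<mu> ^^ k) (Q eta 0))) <= real k * (4 * M / eta^2 * \<mu>^2)"
   using R_contr[OF assms(2)] Suc.IH[OF k(1)] order_trans by blast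
 qed
 also have "... = real (Suc k) * (4 * M / eta^2 * \<mu>^2)" by (simp only: of_nat_Suc distrib_right mult_1)
 finally show ?case unfolding e .
qed simp

text \<open>There are n steps of length t / n with errors of order (t / n)^2, and errors do not grow
  because resolvents contract. In particular the solution is determined by its initial
  value.\<close>

lemma euler: assumes l: "0 < eta" and t: "0 < t" "t <= T"
 shows "(%n. (R (t / real (Suc n)) ^^ Suc n) (Q eta 0)) ----> Q eta t"
proof -
 have "(%n. (R (t / real (Suc n)) ^^ Suc n) (Q eta 0) - Q eta t) ----> 0"
 proof (rule Lim_null_comparison)
  have "(%n. 4 * M / eta^2 * t^2 * (1 / real (Suc n))) ----> 4 * M / eta^2 * t^2 * 0"
   by (intro tendsto_intros LIMSEQ_Suc[OF lim_1_over_n])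
  thus "(%n. 4 * M / eta^2 * t^2 * (1 / real (Suc n))) ----> 0" by simp
  show "\<forall>\<^sub>F n in sequentially. norm ((R (t / real (Suc n)) ^^ Suc n) (Q eta 0) - Q eta t) <= 4 * M / eta^2 * t^2 * (1 / real (Suc n))"
  proof (rule always_eventually, rule allI)
   fix n
   have "norm (Q eta (real (Suc n) * (t / real (Suc n))) - (R (t / real (Suc n)) ^^ Suc n) (Q eta 0))
    <= real (Suc n) * (4 * M / eta^2 * (t / real (Suc n))^2)"
    by (rule euler_iterate) (use l t in \<open>auto simp del: of_nat_Suc\<close>)
   moreover have "real (Suc n) * (4 * M / eta^2 * (t / real (Suc n))^2) = 4 * M / eta^2 * t^2 * (1 / real (Suc n))"
    by (simp add: power2_eq_square del: of_nat_Suc)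
   ultimately show "norm ((R (t / real (Suc n)) ^^ Suc n) (Q eta 0) - Q eta t) <= 4 * M / eta^2 * t^2 * (1 / real (Suc n))"
    by (simp add: norm_minus_commute del: of_nat_Suc)
  qed
 qed
 thus ?thesis by (simp add: LIM_zero_iff)
qed

lemma Q_approx: "(%n. Q (1 / real (Suc n)) t) ----> f t"
 unfolding Q_def by (rule RR_approx) (simp, rule LIMSEQ_Suc[OF lim_1_over_n])

text \<open>Euler iterates of a point of \<open>K\<close> stay in \<open>K\<close>, hence so do
  their limits \<open>Q eta t\<close>, and so does \<open>f t\<close> when eta tends to zero. With
  balls this gives decay of the norm, with one-sided pointwise bounds the maximum principle.\<close>

lemma invariant_set:
 assumes K: "closed K" "!!\<mu> x. 0 < \<mu> ==> x : K ==> R \<mu> x : K" "f 0 : K" and t: "t : {0..T}"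
 shows "f t : K"
proof (cases "t = 0")
 case False
 have "Q (1 / real (Suc n)) t : K" for n
 proof (rule closed_sequentially[OF K(1) _ euler])
  have Q0: "Q (1 / real (Suc n)) 0 : K" unfolding Q_def by (intro K) auto
  have "(R \<mu> ^^ k) (Q (1 / real (Suc n)) 0) : K" if "0 < \<mu>" for k \<mu>
   by (induction k) (use Q0 K(2) that in auto)
  thus "(R (t / real (Suc i)) ^^ Suc i) (Q (1 / real (Suc n)) 0) : K" for i
   using t False by (simp del: funpow.simps)
 qed (use t False in auto)
 thus ?thesis by (rule closed_sequentially[OF K(1) _ Q_approx])
qed (use K in simp)

lemma norm_decay: "t : {0..T} ==> norm (f t) <= norm (f 0)"
 using invariant_set[of "cball 0 (norm (f 0))" t] by (auto intro: order_trans[OF R_contr])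

end

text \<open>Linearity and invariance under time translation. Norm decay applied to the increment
  over a fixed lag compares the increment at a later time with the one at time zero.\<close>

lemma (in evolution) shift:
 assumes s: "0 <= s" "s <= T" shows "evolution W a c (%r. f (r + s) - f r) (T - s) (2 * M)"
proof
 show "norm (f (t + s) - f t) <= 2 * M" if "t : {0..T - s}" for t
  using f_bd[of t] f_bd[of "t + s"] that s norm_triangle_ineq4[of "f (t+s)" "f t"] by auto
 fix eta phi t assume l: "0 < (eta::real)" and t: "t : {0..T - s}"
 have "((%r. f r \<bullet> Yo eta phi) has_integral (- ((f (t + s) - f s) \<bullet> R eta phi))) (cbox s (t + s))"
  using ev2[OF l s(1), of "t + s"] t by simp
 from has_integral_affinity[OF this, of 1 s]
 have 1: "((%r. f (r + s) \<bullet> Yo eta phi) has_integral (- ((f (t + s) - f s) \<bullet> R eta phi))) {0..t}"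
 proof -
  have "(%x. x - s) ` {s..t + s} = {0..t}" by (auto simp: image_iff intro!: bexI[of _ "_ + s"])
  thus ?thesis using \<open>1 ~= 0 ==> _\<close> by simp
 qed
 have 2: "((%r. f r \<bullet> Yo eta phi) has_integral (- ((f t - f 0) \<bullet> R eta phi))) {0..t}"
  using ev[OF l, of t] t s by auto
 from has_integral_diff[OF 1 2]
 show "((%r. (f (r + s) - f r) \<bullet> Yo eta phi) has_integral - ((f (t + s) - f t - (f (0 + s) - f 0)) \<bullet> R eta phi)) {0..t}"
  by (simp add: inner_diff_left algebra_simps)
qed

context evolution
begin

interpretation a: bounded_bilinear a by (rule a_bb)

text \<open>The hypotheses place the initial value in the domain of A with image \<open>- h\<close>.
  Therefore \<open>Yo eta (f 0) = - R eta h\<close>, each Euler step moves the initial value by at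
  most \<open>\<mu> * norm h\<close>, and \<open>shift\<close> extends the estimate from time zero
  to all times.\<close>

lemma lipschitz:
 assumes g0: "(f 0, g0) : W" and h: "!!w k. (w, k) : W ==> a g0 k = - (h \<bullet> w)"
  and st: "s : {0..T}" "t : {0..T}"
 shows "norm (f t - f s) <= norm h * \<bar>t - s\<bar>"
proof -
 have Yo0: "Yo eta (f 0) = - R eta h" if l: "0 < eta" for eta
 proof -
  have "R eta (f 0) = f 0 + eta *R R eta h"
  proof (rule R_unique(1)[OF l])
   show "(f 0 + eta *R R eta h, g0 + eta *R Gr eta h) : W"
    using subspace_add[OF W_sub g0 subspace_scale[OF W_sub R_in[OF l, of h], of eta]] by simp
   fix w k assume wk: "(w, k) : W"
   have "eta * (R eta h \<bullet> w) + eta * (eta * a (Gr eta h) k) = eta * (h \<bullet> w)"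
    using R_eq[OF l wk, of h] by (metis distrib_left)
   thus "(f 0 + eta *R R eta h) \<bullet> w + eta * a (g0 + eta *R Gr eta h) k = f 0 \<bullet> w"
    using h[OF wk] by (simp add: inner_add_left a.add_left a.scaleR_left algebra_simps)
  qed
  thus ?thesis using l by (simp add: Yo_def)
 qed
 have from0: "norm (f t - f 0) <= norm h * t" if t: "t : {0..T}" for t
 proof (cases "t = 0")
  case False
  have "norm (Q eta t - Q eta 0) <= norm h * t" if l: "0 < eta" for eta
  proof -
   have it: "norm ((R \<mu> ^^ k) (Q eta 0) - Q eta 0) <= real k * (\<mu> * norm h)" if m: "0 < \<mu>" for k \<mu>
   proof (induction k)
    case (Suc k)
    have "R \<mu> (Q eta 0) - Q eta 0 = R \<mu> (Q eta 0) - R \<mu> (Q eta 0 + \<mu> *R Yo eta (R eta (f 0)))"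
    unfolding Q_def by (simp add: R_step[OF l m])
    also have "... = R \<mu> (- (\<mu> *R Yo eta (R eta (f 0))))"
    by (subst R_diff[OF m, symmetric]) simp
    finally have "norm (R \<mu> (Q eta 0) - Q eta 0) <= norm (\<mu> *R Yo eta (R eta (f 0)))"
    using R_contr[OF m, of "- (\<mu> *R Yo eta (R eta (f 0)))"] by simp
    also have "Yo eta (R eta (f 0)) = R eta (- R eta h)" by (simp add: R_Yo_commute[OF l, symmetric] Yo0[OF l])
    also have "norm (\<mu> *R R eta (- R eta h)) <= \<mu> * norm h"
    using R_contr[OF l, of "- R eta h"] R_contr[OF l, of h] m by simp
    finally have 1: "norm (R \<mu> (Q eta 0) - Q eta 0) <= \<mu> * norm h" .
    have "(R \<mu> ^^ Suc k) (Q eta 0) - Q eta 0 = R \<mu> ((R \<mu> ^^ k) (Q eta 0) - Q eta 0) + (R \<mu> (Q eta 0) - Q eta 0)"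
    by (simp add: R_diff[OF m])
    hence "norm ((R \<mu> ^^ Suc k) (Q eta 0) - Q eta 0) <= norm (R \<mu> ((R \<mu> ^^ k) (Q eta 0) - Q eta 0)) + norm (R \<mu> (Q eta 0) - Q eta 0)"
    by (metis norm_triangle_ineq)
    also have "... <= real k * (\<mu> * norm h) + \<mu> * norm h"
    using order_trans[OF R_contr[OF m] Suc.IH] 1 by (rule add_mono)
    finally show ?case by (simp add: algebra_simps)
   qed simp
   have "(%n. norm ((R (t / real (Suc n)) ^^ Suc n) (Q eta 0) - Q eta 0)) ----> norm (Q eta t - Q eta 0)"
    using t False by (intro tendsto_intros euler l) auto
   thus ?thesis
   proof (rule LIMSEQ_le_const2, intro exI allI impI)
    fix n
    have "norm ((R (t / real (Suc n)) ^^ Suc n) (Q eta 0) - Q eta 0) <= real (Suc n) * (t / real (Suc n) * norm h)"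
    by (rule it) (use t False in \<open>auto simp del: of_nat_Suc\<close>)
    thus "norm ((R (t / real (Suc n)) ^^ Suc n) (Q eta 0) - Q eta 0) <= norm h * t" by (simp add: mult.commute del: of_nat_Suc funpow.simps)
   qed
  qed
  moreover have "(%n. norm (Q (1 / real (Suc n)) t - Q (1 / real (Suc n)) 0)) ----> norm (f t - f 0)"
   by (intro tendsto_intros Q_approx)
  ultimately show ?thesis by (intro LIMSEQ_le_const2) auto
 qed simp
 have main: "norm (f t - f s) <= norm h * (t - s)" if "0 <= s" "s <= t" "t <= T" for s t
 proof -
  interpret sh: evolution W a c "%r. f (r + (t - s)) - f r" "T - (t - s)" "2 * M"
   by (rule shift) (use that in auto)
  have "norm (f (s + (t - s)) - f s) <= norm (f (0 + (t - s)) - f 0)" by (rule sh.norm_decay) (use that in auto)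
  also have "... <= norm h * (t - s)" using from0[of "t - s"] that by simp
  finally show ?thesis by simp
 qed
 show ?thesis
 proof (cases "s <= t")
  case True thus ?thesis using main[of s t] st by auto
 next
  case False thus ?thesis using main[of t s] st by (auto simp: norm_minus_commute)
 qed
qed

text \<open>Up to an error that vanishes with the time step, \<open>Yo eta (f s)\<close> is a
  difference quotient of the curve, so its norm is at most \<open>L\<close> for every eta.
  Coercivity then makes the gradients of \<open>R eta (f s)\<close> Cauchy as eta tends to zero. The
  outcome holds at each single time: the slice lies in the domain of A and its image has norm at
  most \<open>L\<close>.\<close>

lemma slice_regularity:
 assumes lip: "!!s t. s : {0..T} ==> t : {0..T} ==> norm (f t - f s) <= L * \<bar>t - s\<bar>"
  and T: "0 < T" and s: "s : {0..T}"
 obtains G where "(f s, G) : W" "!!w k. (w, k) : W ==> \<bar>a G k\<bar> <= L * norm w"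
proof -
 have L: "0 <= L" using lip[of 0 T] T by (smt (verit) norm_ge_zero atLeastAtMost_iff mult_nonneg_nonneg mult_pos_pos zero_less_mult_iff mult_less_0_iff)
 have Yo_le: "norm (Yo eta (f s)) <= L" if l: "0 < eta" and s: "s : {0..<T}" for eta s
 proof (rule norm_by_inner[OF _ L])
  fix phi
  show "Yo eta (f s) \<bullet> phi <= L * norm phi"
  proof (rule field_le_epsilon)
   fix e :: real assume e: "0 < e"
   define N where "N = L * norm (Yo eta phi) + 1"
   have N: "N > 0" using L by (simp add: N_def add_nonneg_pos)
   \<comment> \<open>The step remains inside the time interval, and the motion of \<open>f\<close>
     during it contributes at most \<open>e\<close>.\<close>
   define d where "d = min (e / N) (T - s)"
   have d: "0 < d" "s + d <= T" "d * N <= e" using e N s by (auto simp: d_def min_def field_simps)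
   have i1: "((%r. f r \<bullet> Yo eta phi) has_integral (- ((f (s+d) - f s) \<bullet> R eta phi))) {s..s+d}"
    using ev2[OF l, of s "s+d"] s d by auto
   have i2: "((%r. f s \<bullet> Yo eta phi) has_integral (d * (f s \<bullet> Yo eta phi))) {s..s+d}"
    using has_integral_const_real[of "f s \<bullet> Yo eta phi" s "s+d"] d by simp
   have i3: "((%r. (f s - f r) \<bullet> Yo eta phi) has_integral
    (d * (f s \<bullet> Yo eta phi) + (f (s+d) - f s) \<bullet> R eta phi)) (cbox s (s+d))"
    using has_integral_diff[OF i2 i1] by (simp add: inner_diff_left algebra_simps)
   have "norm (d * (f s \<bullet> Yo eta phi) + (f (s+d) - f s) \<bullet> R eta phi) <= (d * N) * measure lborel (cbox s (s+d))"
   proof (rule has_integral_bound[OF _ i3])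
    fix r assume r: "r : cbox s (s+d)"
    have "norm ((f s - f r) \<bullet> Yo eta phi) <= norm (f s - f r) * norm (Yo eta phi)" by (simp add: Cauchy_Schwarz_ineq2)
    also have "... <= (L * d) * norm (Yo eta phi)"
    proof (rule mult_right_mono)
    have "norm (f s - f r) <= L * \<bar>s - r\<bar>" using r s d by (intro lip) auto
    also have "... <= L * d" using r L by (intro mult_left_mono) auto
    finally show "norm (f s - f r) <= L * d" .
    qed simp
    also have "... <= d * N" using d unfolding N_def by (simp add: algebra_simps)
    finally show "norm ((f s - f r) \<bullet> Yo eta phi) <= d * N" .
   qed (use d N in auto)
   hence "d * (f s \<bullet> Yo eta phi) <= d * (d * N) - (f (s+d) - f s) \<bullet> R eta phi" using d by (simp add: abs_le_iff algebra_simps)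
   also have "... <= d * (d * N) + norm (f (s+d) - f s) * norm (R eta phi)"
    using Cauchy_Schwarz_ineq2[of "f (s+d) - f s" "R eta phi"] by (simp add: abs_le_iff)
   also have "... <= d * (d * N) + (L * d) * norm phi"
    using lip[of s "s+d"] s d R_contr[OF l, of phi] L by (intro add_left_mono mult_mono) auto
   finally have "d * (f s \<bullet> Yo eta phi) <= d * (d * N + L * norm phi)" by (simp add: algebra_simps)
   hence "f s \<bullet> Yo eta phi <= d * N + L * norm phi" using d by simp
   thus "Yo eta (f s) \<bullet> phi <= L * norm phi + e" using d by (simp add: Yo_sym[OF l])
  qed
 qed
 have Yo_le': "norm (Yo eta (f s)) <= L" if l: "0 < eta" for eta
 proof (cases "s < T")
  case False
  hence sT: "s = T" using s by simp
  \<comment> \<open>At the final time there is no forward difference quotient; the bound is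
    transported from earlier times by continuity of \<open>Yo eta\<close>.\<close>
  define t where "t n = T - T / real (Suc n)" for n
  have tin: "t n : {0..<T}" for n using T by (auto simp: t_def field_simps)
  have tl: "(%n. L * \<bar>t n - T\<bar>) ----> 0"
  proof -
   have "(%n. L * (T * (1 / real (Suc n)))) ----> L * (T * 0)" by (intro tendsto_intros LIMSEQ_Suc[OF lim_1_over_n])
   thus ?thesis using T by (simp add: t_def abs_mult)
  qed
  have ft: "(%n. f (t n) - f T) ----> 0"
  proof (rule Lim_null_comparison[OF _ tl], rule always_eventually, rule allI)
   fix n show "norm (f (t n) - f T) <= L * \<bar>t n - T\<bar>" using tin[of n] T by (intro lip) auto
  qed
  have "(%n. Yo eta (f (t n)) - Yo eta (f T)) ----> 0"
  proof (rule Lim_null_comparison)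
   show "(%n. 2 / eta * norm (f (t n) - f T)) ----> 0"
    using tendsto_mult[OF tendsto_const tendsto_norm_zero[OF ft], of "2/eta"] by simp
   show "\<forall>\<^sub>F n in sequentially. norm (Yo eta (f (t n)) - Yo eta (f T)) <= 2 / eta * norm (f (t n) - f T)"
    using Yo_norm[OF l] by (simp add: Yo_diff[OF l, symmetric])
  qed
  hence "(%n. norm (Yo eta (f (t n)))) ----> norm (Yo eta (f T))" by (intro tendsto_intros) (simp add: LIM_zero_iff)
  thus ?thesis unfolding sT by (rule LIMSEQ_le_const2) (use Yo_le[OF l tin] in auto)
 qed (use Yo_le[OF l] s in auto)
 define l where "l n = 1 / real (Suc n)" for n
 have l: "0 < l n" for n by (simp add: l_def)
 have Rl: "(%n. R (l n) (f s)) ----> f s" by (rule R_approx[OF l]) (unfold l_def, rule LIMSEQ_Suc[OF lim_1_over_n])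
 have aest: "\<bar>a (Gr (l n) (f s)) k\<bar> <= L * norm w" if "(w, k) : W" for n w k
 proof -
  have "\<bar>a (Gr (l n) (f s)) k\<bar> <= norm (Yo (l n) (f s)) * norm w" by (simp add: Yo_eq[OF l that] Cauchy_Schwarz_ineq2)
  also have "... <= L * norm w" by (intro mult_right_mono Yo_le' l) auto
  finally show ?thesis .
 qed
 have dest: "c * (norm (Gr (l i) (f s) - Gr (l j) (f s)))^2 <= 2 * L * norm (R (l i) (f s) - R (l j) (f s))" for i j
 proof -
  let ?k = "Gr (l i) (f s) - Gr (l j) (f s)" let ?w = "R (l i) (f s) - R (l j) (f s)"
  have W: "(?w, ?k) : W" using subspace_diff[OF W_sub R_in[OF l] R_in[OF l]] by simp
  have "c * (norm ?k)^2 <= a ?k ?k" by (rule a_coer)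
  also have "... = a (Gr (l i) (f s)) ?k - a (Gr (l j) (f s)) ?k" by (simp add: a.diff_left)
  also have "... <= 2 * L * norm ?w" using aest[OF W, of i] aest[OF W, of j] by (simp add: abs_le_iff)
  finally show ?thesis .
 qed
 have "Cauchy (%n. Gr (l n) (f s))"
 proof (rule metric_CauchyI)
  fix e :: real assume e: "0 < e"
  define d where "d = c * e^2 / (2 * L + 1)"
  have d: "0 < d" using c_pos e L by (simp add: d_def)
  then obtain N where N: "!!i j. i >= N ==> j >= N ==> dist (R (l i) (f s)) (R (l j) (f s)) < d"
   using metric_CauchyD[OF LIMSEQ_imp_Cauchy[OF Rl]] by metis
  have "dist (Gr (l i) (f s)) (Gr (l j) (f s)) < e" if "i >= N" "j >= N" for i j
  proof -
   have "c * (norm (Gr (l i) (f s) - Gr (l j) (f s)))^2 <= 2 * L * d"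
    using dest[of i j] N[OF that] L by (smt (verit) dist_norm mult_left_mono)
   also have "... < (2 * L + 1) * d" using d by simp
   also have "... = c * e^2" using L by (simp add: d_def)
   finally have "(norm (Gr (l i) (f s) - Gr (l j) (f s)))^2 < e^2" using c_pos by simp
   thus ?thesis using e by (simp add: dist_norm power2_less_imp_less)
  qed
  thus "EX M. ALL m>=M. ALL n>=M. dist (Gr (l m) (f s)) (Gr (l n) (f s)) < e" by blast
 qed
 then obtain G where G: "(%n. Gr (l n) (f s)) ----> G" by (auto simp: Cauchy_convergent_iff convergent_def)
 have "(f s, G) : W"
  by (rule closed_sequentially[OF W_cl _ tendsto_Pair[OF Rl G]]) (rule R_in[OF l])
 moreover have "\<bar>a G k\<bar> <= L * norm w" if "(w, k) : W" for w k
 proof -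
  have "(%n. \<bar>a (Gr (l n) (f s)) k\<bar>) ----> \<bar>a G k\<bar>" by (intro tendsto_intros a.tendsto G)
  thus ?thesis by (rule LIMSEQ_le_const2) (use aest[OF that] in auto)
 qed
 ultimately show ?thesis using that by blast
qed

end

section \<open>Periodic test functions and Fourier series\<close>

lemma cell_compact [simp]: "compact (cell :: (real^'n) set)" by (simp add: cell_def)

lemma tintegrable_cont:
 fixes f :: "real^'n => 'b::euclidean_space"
 assumes "continuous_on cell f"
 shows "f : bmc" "sqi f" "integrable lc f"
proof -
 show m: "f : bmc"
  by (rule continuous_imp_measurable_on_sets_lebesgue[OF assms]) simp
 obtain K where "!!x. x : cell ==> norm (f x) <= K"
  using compact_imp_bounded[OF compact_continuous_image[OF assms cell_compact]] by (auto simp: bounded_iff)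
 thus s: "sqi f" by (intro sqi_bounded[OF m, of K]) (rule AE_I2, simp)
 show "integrable lc f" by (rule sqi_integrable[OF s])
qed

lemma bounded_cell:
 fixes f :: "real^'n => 'b::euclidean_space"
 assumes "continuous_on UNIV f"
 obtains K where "0 <= K" "!!x. x : cell ==> norm (f x) <= K"
proof -
 obtain K where K: "!!x. x : cell ==> norm (f x) <= K"
  using compact_imp_bounded[OF compact_continuous_image[OF continuous_on_subset[OF assms subset_UNIV] cell_compact]]
  by (auto simp: bounded_iff)
 show ?thesis using that[of "\<bar>K\<bar>"] K by force
qed

text \<open>The shifted cell is cut at the hyperplane where the i-th coordinate equals one, and the
  part beyond it is moved back by one period.\<close>

lemma periodic_translate_integral:
 fixes f :: "real^'n => real"
 assumes f: "continuous_on UNIV f" and p: "periodic f" and t: "0 <= t" "t <= 1"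
 shows "tint (%x. f (x + t *R axis i 1)) = tint f"
proof -
 let ?e = "axis i 1 :: real^'n"
 have eB: "?e : Basis" by (auto simp: Basis_vec_def)
 have cf: "continuous_on S f" for S using f continuous_on_subset by blast
 have ion: "f integrable_on cbox a b" for a b by (rule integrable_continuous[OF cf])
 have ti: "tint g = integral cell g" if "continuous_on UNIV g" for g :: "real^'n => real"
  by (rule lebesgue_integral_eq_integral)
    (auto intro: tintegrable_cont(3) continuous_on_subset[OF that])
 have inn: "x \<bullet> ?e = x $ i" for x by (simp add: inner_axis)
 have one: "(One :: real^'n) $ j = 1" for j by (rule One_nth)
 have axj: "?e $ j = (if j = i then 1 else 0)" for j by (simp add: axis_def)
 have mb: "x : cbox a b \<longleftrightarrow> (a $ i <= x $ i & x $ i <= b $ i) & (ALL j. j ~= i --> a $ j <= x $ j & x $ j <= b $ j)"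
  for x a b :: "real^'n" by (auto simp: mem_box_cart)
 have s1: "cbox (t *R ?e) (One + t *R ?e) \<inter> {x. x \<bullet> ?e <= 1} = cbox (t *R ?e) One"
  unfolding set_eq_iff Int_iff mem_Collect_eq mb inn using t by (auto simp: one axj simp del: sum_component)
 have s2: "cbox (t *R ?e) (One + t *R ?e) \<inter> {x. x \<bullet> ?e >= 1} = cbox (0 + ?e) ((One + (t - 1) *R ?e) + ?e)"
  unfolding set_eq_iff Int_iff mem_Collect_eq mb inn using t by (auto simp: one axj simp del: sum_component)
 have s3: "cbox 0 One \<inter> {x. x \<bullet> ?e <= t} = cbox 0 (One + (t - 1) *R ?e)"
  unfolding set_eq_iff Int_iff mem_Collect_eq mb inn using t by (auto simp: one axj simp del: sum_component)
 have s4: "cbox 0 One \<inter> {x. x \<bullet> ?e >= t} = cbox (t *R ?e) One"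
  unfolding set_eq_iff Int_iff mem_Collect_eq mb inn using t by (auto simp: one axj simp del: sum_component)
 have "tint (%x. f (x + t *R ?e)) = integral (cbox 0 One) (%x. f (x + t *R ?e))"
  unfolding cell_def[symmetric] by (rule ti) (intro continuous_on_compose2[OF f] continuous_intros, auto)
 also have "... = integral (cbox (t *R ?e) (One + t *R ?e)) f"
  using integral_shift_cbox_plus[of 0 One f "t *R ?e"] by (simp add: o_def add.commute)
 also have "... = integral (cbox (t *R ?e) One) f + integral (cbox (0 + ?e) ((One + (t - 1) *R ?e) + ?e)) f"
  using integral_split[OF ion eB, of "t *R ?e" "One + t *R ?e" 1] by (simp only: s1 s2)
 also have "integral (cbox (0 + ?e) ((One + (t - 1) *R ?e) + ?e)) f = integral (cbox 0 (One + (t - 1) *R ?e)) (%x. f (x + ?e))"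
  using integral_shift_cbox_plus[of 0 "One + (t - 1) *R ?e" f ?e] by (simp only: o_def add.commute[of ?e])
 also have "(%x. f (x + ?e)) = f" using p by (auto simp: periodic_def)
 also have "integral (cbox (t *R ?e) One) f + integral (cbox 0 (One + (t - 1) *R ?e)) f = integral (cbox 0 One) f"
  using integral_split[OF ion eB, of 0 One t] by (simp only: s3 s4)
 also have "... = tint f" unfolding cell_def[symmetric] by (rule ti[symmetric, OF f])
 finally show ?thesis .
qed

text \<open>Periodic C^1 functions with the gradient carried along. This class is visibly closed
  under products, integer dilations and composition with C^1 maps of the line, and it contains the
  smooth test functions.\<close>

definition C1p :: "(real^'n => real) => (real^'n => real^'n) => bool" where
 "C1p f g \<longleftrightarrow> periodic f & (ALL x. (f has_derivative (%v. g x \<bullet> v)) (at x)) & continuous_on UNIV g"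

lemma C1p_cont: "C1p f g ==> continuous_on UNIV f"
 by (auto simp: C1p_def intro!: continuous_at_imp_continuous_on has_derivative_continuous)

text \<open>Difference quotients have zero integral by translation invariance; they converge to the
  partial derivative and are bounded by the mean value theorem, so dominated convergence
  applies.\<close>

lemma C1p_integral_zero:
 fixes f :: "real^'n => real"
 assumes fg: "C1p f g" shows "tint (%x. g x $ i) = 0"
proof -
 let ?e = "axis i 1 :: real^'n"
 define D where "D n x = real (Suc n) * (f (x + (1 / real (Suc n)) *R ?e) - f x)" for n x
 have cf: "continuous_on UNIV f" and cg: "continuous_on UNIV g" and p: "periodic f"
  and der: "!!x. (f has_derivative (%v. g x \<bullet> v)) (at x)"
  using fg C1p_cont by (auto simp: C1p_def)
 have cfs: "continuous_on UNIV (%x. f (x + t *R ?e))" for t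
  by (intro continuous_on_compose2[OF cf] continuous_intros) auto
 have D0: "tint (D n) = 0" for n
 proof -
  have "tint (D n) = real (Suc n) * (tint (%x. f (x + (1 / real (Suc n)) *R ?e)) - tint f)"
   unfolding D_def by (simp add: tintegrable_cont(3)[OF continuous_on_subset[OF cfs subset_UNIV]]
    tintegrable_cont(3)[OF continuous_on_subset[OF cf subset_UNIV]] del: of_nat_Suc)
  also have "tint (%x. f (x + (1 / real (Suc n)) *R ?e)) = tint f"
   by (rule periodic_translate_integral[OF cf p]) auto
  finally show ?thesis by simp
 qed
 have ray: "((%s. f (x + s *R ?e)) has_real_derivative g (x + s *R ?e) $ i) (at s)" for x s
 proof -
  have "((%s. f (x + s *R ?e)) has_derivative (%h. g (x + s *R ?e) \<bullet> (h *R ?e))) (at s)"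
   by (rule has_derivative_compose[OF _ der]) (auto intro!: derivative_eq_intros)
  moreover have "(%h. g (x + s *R ?e) \<bullet> (h *R ?e)) = (*) (g (x + s *R ?e) $ i)"
   by (rule ext) (simp add: inner_axis mult.commute)
  ultimately show ?thesis by (simp only: has_field_derivative_def)
 qed
 \<comment> \<open>The intermediate point of the mean value theorem may leave the cell by up to one
   unit, hence the doubled box.\<close>
 obtain K where K: "!!x. x : cbox 0 (2 *R One) ==> norm (g x) <= K"
  using compact_imp_bounded[OF compact_continuous_image[OF continuous_on_subset[OF cg subset_UNIV] compact_cbox]]
  by (metis bounded_iff image_eqI)
 have bd: "\<bar>D n x\<bar> <= K" if x: "x : cell" for n x
 proof -
  let ?t = "1 / real (Suc n)"
  obtain z where z: "0 < z" "z < ?t" "f (x + ?t *R ?e) - f (x + 0 *R ?e) = (?t - 0) * (g (x + z *R ?e) $ i)"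
   using MVT2[of 0 ?t "%s. f (x + s *R ?e)" "%s. g (x + s *R ?e) $ i"] ray by (auto simp del: of_nat_Suc)
  have "?t <= 1" by simp
  hence z1: "z <= 1" using z by linarith
  have "x + z *R ?e : cbox 0 (2 *R One)"
   unfolding mem_box_cart
  proof
   fix j
   have "0 <= x $ j" "x $ j <= 1" using x by (auto simp: mem_cell)
   moreover have "0 <= (z *R ?e) $ j" "(z *R ?e) $ j <= 1" using z z1 by (auto simp: axis_def)
   moreover have "(2 *R (One :: real^'n)) $ j = 2" by (simp only: vector_scaleR_component One_nth) simp
   ultimately show "0 $ j <= (x + z *R ?e) $ j & (x + z *R ?e) $ j <= (2 *R One) $ j"
    by (simp only: vector_add_component zero_index) linarith
  qed
  hence "norm (g (x + z *R ?e)) <= K" by (rule K)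
  moreover have "\<bar>g (x + z *R ?e) $ i\<bar> <= norm (g (x + z *R ?e))" by (rule component_le_norm_cart)
  moreover have "D n x = g (x + z *R ?e) $ i" using z(3) by (simp add: D_def del: of_nat_Suc)
  ultimately show ?thesis by linarith
 qed
 have lim: "(%n. D n x) ----> g x $ i" for x
 proof -
  have "((%h. (f (x + h *R ?e) - f x) / h) \<longlongrightarrow> g x $ i) (at 0)"
   using ray[of x 0] by (simp add: DERIV_def)
  moreover have "filterlim (%n. 1 / real (Suc n)) (at 0) sequentially"
   by (rule filterlim_atI) (auto intro: LIMSEQ_Suc[OF lim_1_over_n] simp del: of_nat_Suc)
  ultimately have "(%n. (f (x + (1 / real (Suc n)) *R ?e) - f x) / (1 / real (Suc n))) ----> g x $ i"
   by (rule filterlim_compose)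
  thus ?thesis by (simp add: D_def mult.commute del: of_nat_Suc)
 qed
 have "(%n. tint (D n)) ----> tint (%x. g x $ i)"
 proof (rule integral_dominated_convergence[where w="%x. K"])
  show "(%x. g x $ i) : bmc"
   by (rule tintegrable_cont(1)) (auto intro!: continuous_intros continuous_on_subset[OF cg])
  show "D n : bmc" for n
   unfolding D_def by (rule tintegrable_cont(1)) (auto intro!: continuous_intros continuous_on_subset[OF cfs] continuous_on_subset[OF cf])
  show "AE x in lc. (%n. D n x) ----> g x $ i" using lim by auto
  show "AE x in lc. norm (D n x) <= K" for n by (rule AE_I2) (simp add: bd)
 qed simp
 thus ?thesis using D0 LIMSEQ_unique[of "%n. tint (D n)" 0] by simp
qed

lemma C1p_mult:
 assumes "C1p f g" "C1p f' g'" shows "C1p (%x. f x * f' x) (%x. f x *R g' x + f' x *R g x)"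
proof -
 have d: "(f has_derivative (%v. g x \<bullet> v)) (at x)" "(f' has_derivative (%v. g' x \<bullet> v)) (at x)" for x
  using assms by (auto simp: C1p_def)
 have "((%x. f x * f' x) has_derivative (%v. (f x *R g' x + f' x *R g x) \<bullet> v)) (at x)" for x
  by (rule has_derivative_eq_rhs[OF has_derivative_mult[OF d]]) (auto simp: inner_add_left algebra_simps)
 thus ?thesis using assms C1p_cont[OF assms(1)] C1p_cont[OF assms(2)]
  unfolding C1p_def by (auto simp: periodic_def intro!: continuous_intros)
qed

lemma test_fun_C1p: assumes "test_fun phi" shows "C1p phi (pgrad phi)"
 unfolding C1p_def
proof (intro conjI allI)
 have d: "iter_pd vs phi differentiable (at x)" for vs x using assms by (auto simp: test_fun_def smooth_fun_def)
 show "periodic phi" using assms by (simp add: test_fun_def)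
 fix x
 have hd: "(phi has_derivative frechet_derivative phi (at x)) (at x)"
  using d[of "[]" x] by (simp add: frechet_derivative_works)
 hence lin: "linear (frechet_derivative phi (at x))" using has_derivative_linear by blast
 have "frechet_derivative phi (at x) v = pgrad phi x \<bullet> v" for v
 proof -
  have "frechet_derivative phi (at x) v = frechet_derivative phi (at x) (SUM i:UNIV. v $ i *R axis i 1)"
   by (simp add: basis_expansion[of v, unfolded scalar_mult_eq_scaleR])
  also have "... = pgrad phi x \<bullet> v"
   by (simp add: linear_sum[OF lin] linear_cmul[OF lin] pgrad_def inner_vec_def mult.commute)
  finally show ?thesis .
 qed
 thus "(phi has_derivative (%v. pgrad phi x \<bullet> v)) (at x)" using hd by (metis (no_types, lifting) ext)
next
 have "continuous_on UNIV (%x. pgrad phi x $ i)" for i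
 proof -
  have "iter_pd [axis i 1] phi differentiable (at x)" for x
   using assms unfolding test_fun_def smooth_fun_def by blast
  hence "continuous (at x) (%x. frechet_derivative phi (at x) (axis i 1))" for x
   using differentiable_imp_continuous_within[of "iter_pd [axis i 1] phi" x UNIV] by simp
  thus ?thesis by (simp add: pgrad_def continuous_at_imp_continuous_on)
 qed
 thus "continuous_on UNIV (pgrad phi)"
  using continuous_on_vec_lambda[of UNIV "%i x. pgrad phi x $ i"] by (simp add: vec_lambda_beta)
qed

lemma C1p_pgrad: assumes "C1p f g" shows "pgrad f = g"
proof
 fix x
 have "(f has_derivative (%v. g x \<bullet> v)) (at x)" using assms by (simp add: C1p_def)
 hence "frechet_derivative f (at x) = (%v. g x \<bullet> v)" by (rule frechet_derivative_at[symmetric])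
 thus "pgrad f x = g x" by (simp add: pgrad_def vec_eq_iff inner_axis)
qed

lemma C1p_weak_grad: assumes "C1p f g" shows "has_weak_grad f g"
 unfolding has_weak_grad_def
proof (intro conjI allI impI)
 have cf: "continuous_on S f" and cg: "continuous_on S g" for S
  using C1p_cont[OF assms] assms continuous_on_subset unfolding C1p_def by blast+
 show "tintegrable f" by (rule tintegrable_cont(3)[OF cf])
 show "tintegrable (%x. g x $ i)" for i by (rule tintegrable_cont(3)) (intro continuous_intros cg)
 fix phi :: "real^'a => real" and i assume "test_fun phi"
 hence phi: "C1p phi (pgrad phi)" by (rule test_fun_C1p)
 have cp: "continuous_on S phi" and cpg: "continuous_on S (pgrad phi)" for S
  using C1p_cont[OF phi] phi continuous_on_subset unfolding C1p_def by blast+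
 have "tint (%x. (f x *R pgrad phi x + phi x *R g x) $ i) = 0"
  by (rule C1p_integral_zero[OF C1p_mult[OF assms phi]])
 hence "tint (%x. f x * pgrad phi x $ i + g x $ i * phi x) = 0" by (simp add: mult.commute)
 moreover have "tint (%x. f x * pgrad phi x $ i + g x $ i * phi x) = tint (%x. f x * pgrad phi x $ i) + tint (%x. g x $ i * phi x)"
  by (rule integral_plus) (rule tintegrable_cont(3), intro continuous_intros cf cg cp cpg)+
 ultimately show "tint (%x. f x * pgrad phi x $ i) = - tint (%x. g x $ i * phi x)" by linarith
qed

text \<open>The Hartley functions cos + sin form a real orthonormal basis indexed by the full lattice.\<close>

definition kv :: "int^'n => real^'n" where "kv k = (\<chi> i. 2 * pi * of_int (k $ i))"
definition cas :: "int^'n => real^'n => real" where "cas k x = cos (kv k \<bullet> x) + sin (kv k \<bullet> x)"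

lemma kv_minus: "kv (- k) = - kv k" and kv_add: "kv (k + l) = kv k + kv l" and kv_diff: "kv (k - l) = kv k - kv l"
 and kv_0 [simp]: "kv 0 = 0"
 by (auto simp: kv_def vec_eq_iff algebra_simps)

lemma cas_0 [simp]: "cas 0 x = 1" by (simp add: cas_def)

lemma cas_bound: "\<bar>cas k x\<bar> <= 2"
 unfolding cas_def using abs_cos_le_one[of "kv k \<bullet> x"] abs_sin_le_one[of "kv k \<bullet> x"] by linarith

lemma kv_axis: "kv k \<bullet> axis i 1 = 2 * pi * of_int (k $ i)" by (simp add: kv_def inner_axis)

lemma tg_C1p: "C1p (%x. A * cos (kv k \<bullet> x) + B * sin (kv k \<bullet> x))
  (%x. (B * cos (kv k \<bullet> x) - A * sin (kv k \<bullet> x)) *R kv k)"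
 unfolding C1p_def
proof (intro conjI allI)
 show "periodic (%x. A * cos (kv k \<bullet> x) + B * sin (kv k \<bullet> x))"
  by (simp add: periodic_def inner_add_right kv_axis cos_add sin_add sin_int_2pin cos_int_2pin)
 show "((%x. A * cos (kv k \<bullet> x) + B * sin (kv k \<bullet> x)) has_derivative
   (%v. ((B * cos (kv k \<bullet> x) - A * sin (kv k \<bullet> x)) *R kv k) \<bullet> v)) (at x)" for x
  by (auto intro!: derivative_eq_intros simp: algebra_simps)
qed (intro continuous_intros)

text \<open>Differentiation sends the index \<open>k\<close> to \<open>- k\<close>. The same flip
  explains the negated indices in all later Fourier formulas for gradients.\<close>

lemma cas_C1p: "C1p (cas k) (%x. cas (- k) x *R kv k)"
 using tg_C1p[of 1 k 1] by (simp add: cas_def kv_minus cas_def[abs_def])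

lemma cas_cont: "continuous_on S (cas k)"
 using C1p_cont[OF cas_C1p] continuous_on_subset by blast

text \<open>All iterated directional derivatives remain in the span of one cosine and one sine,
  whose members are differentiable.\<close>

lemma cas_test: "test_fun (cas k)"
proof -
 have "EX A B. iter_pd vs (cas k) = (%x. A * cos (kv k \<bullet> x) + B * sin (kv k \<bullet> x))" for vs
 proof (induction vs)
  case Nil
  show ?case by (rule exI[of _ 1], rule exI[of _ 1]) (simp add: cas_def[abs_def])
 next
  case (Cons v vs)
  then obtain A B where e: "iter_pd vs (cas k) = (%x. A * cos (kv k \<bullet> x) + B * sin (kv k \<bullet> x))" by blast
  have "frechet_derivative (iter_pd vs (cas k)) (at x) v = (B * cos (kv k \<bullet> x) - A * sin (kv k \<bullet> x)) * (kv k \<bullet> v)" for x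
  proof -
   have "(iter_pd vs (cas k) has_derivative (%v. ((B * cos (kv k \<bullet> x) - A * sin (kv k \<bullet> x)) *R kv k) \<bullet> v)) (at x)"
    unfolding e using tg_C1p[of A k B] by (simp add: C1p_def)
   from frechet_derivative_at[OF this, symmetric] show ?thesis by simp
  qed
  thus ?case
   by (intro exI[of _ "B * (kv k \<bullet> v)"] exI[of _ "- A * (kv k \<bullet> v)"]) (auto simp: algebra_simps)
 qed
 moreover have "(%x. A * cos (kv k \<bullet> x) + B * sin (kv k \<bullet> x)) differentiable (at x)" for A B x
  using tg_C1p[of A k B] unfolding C1p_def differentiable_def by blast
 ultimately have "iter_pd vs (cas k) differentiable (at x)" for vs x by metis
 thus ?thesis using cas_C1p[of k] by (auto simp: test_fun_def smooth_fun_def C1p_def)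
qed

lemma cas_mult: "cas k x * cas l x = cos (kv (k - l) \<bullet> x) + sin (kv (k + l) \<bullet> x)"
 by (simp add: cas_def kv_diff kv_add inner_diff_left inner_add_left cos_diff sin_add algebra_simps)

lemma kv_eq_0: "kv k = 0 \<longleftrightarrow> k = 0" by (auto simp: kv_def vec_eq_iff)

lemma tint_tg:
 assumes "k ~= 0" shows "tint (%x. cos (kv k \<bullet> x)) = 0" "tint (%x. sin (kv k \<bullet> x)) = 0"
proof -
 obtain i where i: "kv k $ i ~= 0" using assms kv_eq_0[of k] by (auto simp: vec_eq_iff)
 from C1p_integral_zero[OF tg_C1p[of 0 k 1], of i] i show "tint (%x. cos (kv k \<bullet> x)) = 0" by simp
 from C1p_integral_zero[OF tg_C1p[of "-1" k 0], of i] i show "tint (%x. sin (kv k \<bullet> x)) = 0" by simp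
qed

lemma tint_cas: "tint (cas k) = (if k = 0 then 1 else 0)"
proof (cases "k = 0")
 case False
 thus ?thesis unfolding cas_def
  by (subst integral_plus)
    (auto simp: tint_tg intro!: tintegrable_cont continuous_intros)
qed (simp add: cas_def[abs_def] measure_cell measure_restrict_space)

lemma cas_orthonormal: "tint (%x. cas k x * cas l x) = (if k = l then 1 else 0)"
proof -
 have c: "tint (%x. cos (kv (k - l) \<bullet> x)) = (if k = l then 1 else 0)"
  using tint_tg(1)[of "k - l"] by (auto simp: measure_cell measure_restrict_space)
 have s: "tint (%x. sin (kv (k + l) \<bullet> x)) = 0"
  using tint_tg(2)[of "k + l"] by (cases "k + l = 0") auto
 show ?thesis unfolding cas_mult
  by (subst integral_plus)
    (auto simp: c s intro!: tintegrable_cont continuous_intros)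
qed

text \<open>Trigonometric polynomials in the fast variable with continuous coefficients in the slow
  one: the class on which averages of oscillating functions can be computed mode by mode.\<close>

inductive txp :: "(real^'n => real^'n => real) => bool" where
 base: "continuous_on UNIV a ==> txp (%x y. a x * cas k y)"
| add: "txp F ==> txp G ==> txp (%x y. F x y + G x y)"

lemma txp_x: "continuous_on UNIV a ==> txp (%x y. a x)"
 using txp.base[of a 0] by simp

text \<open>A product of two Hartley functions contains one cosine and one sine; each of these is
  half a sum or difference of Hartley functions at opposite frequencies, which gives four
  terms.\<close>

lemma txp_cmul_cas: assumes "continuous_on UNIV a" "txp F" shows "txp (%x y. a x * cas l y * F x y)"
 using assms(2)
proof induction
 case (base b k)
 have c: "continuous_on UNIV (%x. a x * b x * (1/2))" "continuous_on UNIV (%x. a x * b x * (-1/2))"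
  using assms(1) base by (auto intro!: continuous_intros)
 have "a x * cas l y * (b x * cas k y) = (a x * b x * (1/2) * cas (l - k) y + a x * b x * (1/2) * cas (k - l) y)
   + (a x * b x * (1/2) * cas (l + k) y + a x * b x * (-1/2) * cas (- (l + k)) y)" for x y
 proof -
  have "cos (kv (l - k) \<bullet> y) = (cas (l - k) y + cas (k - l) y) / 2"
   using kv_minus[of "l - k"] by (simp add: cas_def)
  moreover have "sin (kv (l + k) \<bullet> y) = (cas (l + k) y - cas (- (l + k)) y) / 2"
   unfolding cas_def kv_minus by simp
  ultimately have "cas l y * cas k y = (cas (l - k) y + cas (k - l) y) / 2 + (cas (l + k) y - cas (- (l + k)) y) / 2"
   by (simp only: cas_mult)
  moreover have "a x * cas l y * (b x * cas k y) = (a x * b x) * (cas l y * cas k y)" by simp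
  moreover have "p * ((u + v) / 2 + (w - z) / 2) = (p * (1/2) * u + p * (1/2) * v) + (p * (1/2) * w + p * (-1/2) * z)"
   for p u v w z :: real by (simp add: field_simps)
  ultimately show ?thesis by (simp only:)
 qed
 thus ?case by (simp only:) (intro txp.intros c)
next
 case (add F G)
 thus ?case by (simp only: distrib_left) (rule txp.add)
qed

lemma txp_mult: "txp F ==> txp G ==> txp (%x y. F x y * G x y)"
proof (induction rule: txp.induct)
 case (base a k)
 thus ?case by (rule txp_cmul_cas)
next
 case (add F F')
 thus ?case by (simp only: distrib_right) (intro txp.add; simp)
qed

lemma txp_sum: "finite I ==> (!!i. i : I ==> txp (F i)) ==> txp (%x y. SUM i:I. F i x y)"
proof (induction rule: finite_induct)
 case empty thus ?case using txp_x[of "%x. 0"] by simp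
next
 case (insert i I) thus ?case by (simp add: txp.add)
qed

text \<open>The embedding of the torus into Euclidean space by cosines and sines. Points have the
  same image exactly when they differ by an integer vector, and polynomials in the image are
  trigonometric polynomials.\<close>

definition circ :: "real^'n => (real^'n) \<times> (real^'n)" where
 "circ y = ((\<chi> i. cos (2 * pi * y $ i)), (\<chi> i. sin (2 * pi * y $ i)))"

lemma circ_cont: "continuous_on S circ"
 unfolding circ_def by (intro continuous_intros)

lemma txp_cos: "txp (%x (y::real^'n). cos (2 * pi * y $ i))" and txp_sin: "txp (%x (y::real^'n). sin (2 * pi * y $ i))"
proof -
 define k :: "int^'n" where "k = axis i 1"
 have kv: "kv k \<bullet> y = 2 * pi * y $ i" for y
 proof -
  have "kv k = (2 * pi) *R axis i 1" by (auto simp: kv_def k_def vec_eq_iff axis_def)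
  thus ?thesis by (simp add: inner_axis' )
 qed
 have "cos (2 * pi * y $ i) = 1/2 * cas k y + 1/2 * cas (- k) y" "sin (2 * pi * y $ i) = 1/2 * cas k y + (-1/2) * cas (- k) y" for y
  unfolding cas_def kv_minus by (simp_all add: kv field_simps)
 thus "txp (%x (y::real^'n). cos (2 * pi * y $ i))" "txp (%x (y::real^'n). sin (2 * pi * y $ i))"
  by (simp_all only:) (intro txp.add txp.base continuous_intros)+
qed

lemma txp_poly: assumes "real_polynomial_function p" shows "txp (%x y. p (x, circ y))"
 using assms
proof induction
 case (linear f)
 interpret f: bounded_linear f by fact
 have "f (x, circ y) = f (x, 0, 0) + ((SUM i:UNIV. f (0, axis i 1, 0) * cos (2 * pi * y $ i))
    + (SUM i:UNIV. f (0, 0, axis i 1) * sin (2 * pi * y $ i)))" for x y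
 proof -
  have v: "v = (SUM i:UNIV. v $ i *R axis i 1)" for v :: "real^'b"
   by (simp add: basis_expansion[of v, unfolded scalar_mult_eq_scaleR])
  have "(x, circ y) = (x, 0, 0) + ((SUM i:UNIV. cos (2 * pi * y $ i) *R (0, axis i 1, 0)) + (SUM i:UNIV. sin (2 * pi * y $ i) *R (0, 0, axis i 1)))"
   using v[of "fst (circ y)"] v[of "snd (circ y)"]
   by (simp add: prod_eq_iff fst_sum snd_sum circ_def)
  thus ?thesis by (simp add: f.add f.sum f.scaleR mult.commute del: scaleR_Pair)
 qed
 moreover have "continuous_on UNIV (%x. f (x, 0, 0))"
  by (intro f.continuous_on continuous_intros)
 ultimately show ?case
  by (simp only:) (intro txp.add txp_x txp_sum txp_mult txp_cos txp_sin continuous_intros; simp)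
next
 case (const c) show ?case by (rule txp_x) (intro continuous_intros)
next
 case (add f g) show ?case by (rule txp.add[OF add.IH])
next
 case (mult f g) thus ?case by (intro txp_mult)
qed

text \<open>A function that agrees on identified points descends to the compact image of
  \<open>cell \<times> cell\<close>. The descended function is continuous because preimages of
  closed sets are continuous images of compact sets, and there ordinary polynomials approximate it
  uniformly.\<close>

lemma torus_stone_weierstrass:
 fixes F :: "real^'n => real^'n => real"
 assumes c: "continuous_on (cell \<times> cell) (%z. F (fst z) (snd z))"
  and p: "!!x y y'. x : cell ==> y : cell ==> y' : cell ==> circ y = circ y' ==> F x y = F x y'" and d: "0 < d"
 obtains G where "txp G" "!!x y. x : cell ==> y : cell ==> \<bar>F x y - G x y\<bar> < d"
proof -
 let ?E = "%z :: (real^'n) \<times> (real^'n). (fst z, circ (snd z))"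
 let ?C = "cell \<times> cell :: ((real^'n) \<times> (real^'n)) set"
 define S where "S = ?E ` ?C"
 have cE: "continuous_on A ?E" for A
  by (intro continuous_intros continuous_on_compose2[OF circ_cont[of UNIV]]) auto
 have cS: "compact S" unfolding S_def by (intro compact_continuous_image cE compact_Times cell_compact)
 define F' where "F' s = F (fst s) (SOME y. y : cell & circ y = snd s)" for s
 have F': "F' (x, circ y) = F x y" if "x : cell" "y : cell" for x y
 proof -
  have "(SOME y'. y' : cell & circ y' = circ y) : cell & circ (SOME y'. y' : cell & circ y' = circ y) = circ y"
   by (rule someI_ex[of "%y'. y' : cell & circ y' = circ y"]) (use that in auto)
  thus ?thesis using p[OF that(1) _ that(2), of "SOME y'. y' : cell & circ y' = circ y"] by (simp add: F'_def)
 qed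
 have "continuous_on S F'"
 proof (subst continuous_on_closed_vimage[OF compact_imp_closed[OF cS]], intro allI impI)
  fix B :: "real set" assume "closed B"
  have "F' -` B \<inter> S = ?E ` (?C \<inter> (%z. F (fst z) (snd z)) -` B)"
  proof (intro set_eqI iffI)
   fix s assume s: "s : F' -` B \<inter> S"
   then obtain x y where xy: "x : cell" "y : cell" "s = (x, circ y)" by (auto simp: S_def)
   hence "(x, y) : ?C \<inter> (%z. F (fst z) (snd z)) -` B" using s F'[of x y] by simp
   moreover have "s = ?E (x, y)" using xy by simp
   ultimately show "s : ?E ` (?C \<inter> (%z. F (fst z) (snd z)) -` B)" by (rule rev_image_eqI)
  next
   fix s assume "s : ?E ` (?C \<inter> (%z. F (fst z) (snd z)) -` B)"
   then obtain x y where "x : cell" "y : cell" "F x y : B" "s = (x, circ y)" by auto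
   thus "s : F' -` B \<inter> S" using F'[of x y] by (auto simp: S_def intro!: image_eqI[of _ _ "(x, y)"])
  qed
  moreover have "compact (?C \<inter> (%z. F (fst z) (snd z)) -` B)"
  proof -
   have "closed (?C \<inter> (%z. F (fst z) (snd z)) -` B)"
    by (rule continuous_closed_preimage[OF c _ \<open>closed B\<close>]) (intro compact_imp_closed compact_Times cell_compact)
   hence "compact (?C \<inter> (?C \<inter> (%z. F (fst z) (snd z)) -` B))" by (intro compact_Int_closed compact_Times cell_compact)
   thus ?thesis by (simp add: Int_absorb1 Int_assoc[symmetric])
  qed
  ultimately show "closed (F' -` B \<inter> S)" by (simp only:) (intro compact_imp_closed compact_continuous_image cE)
 qed
 from Stone_Weierstrass_real_polynomial_function[OF cS this d]
 obtain g where g: "real_polynomial_function g" "!!s. s : S ==> \<bar>F' s - g s\<bar> < d" by blast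
 show ?thesis
 proof (rule that[OF txp_poly[OF g(1)]])
  fix x y :: "real^'n" assume "x : cell" "y : cell"
  thus "\<bar>F x y - g (x, circ y)\<bar> < d" using g(2)[of "(x, circ y)"] F'[of x y] image_eqI[of "(x, circ y)" ?E "(x, y)" ?C]
   by (simp add: S_def)
 qed
qed

section \<open>Periodicity and uniqueness of Fourier coefficients\<close>

lemma circ_eqD: assumes "circ y = circ y'" shows "EX n::int. y $ i = y' $ i + of_int n"
proof -
 have "sin (2 * pi * y $ i) = sin (2 * pi * y' $ i)" "cos (2 * pi * y $ i) = cos (2 * pi * y' $ i)"
  using assms by (auto simp: circ_def vec_eq_iff)
 then obtain n :: int where "2 * pi * y $ i = 2 * pi * y' $ i + 2 * pi * of_int n" using sin_cos_eq_iff by blast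
 hence "2 * pi * y $ i = 2 * pi * (y' $ i + of_int n)" by (simp add: algebra_simps)
 thus ?thesis using pi_neq_zero by (metis mult_cancel_left mult_eq_0_iff zero_neq_numeral)
qed

lemma periodic_int_axis:
 assumes "periodic f" shows "f (x + of_int n *R axis i 1) = f x"
proof -
 have nat: "f (x + real m *R axis i 1) = f x" for m x
 proof (induction m)
  case (Suc m)
  have "x + real (Suc m) *R axis i 1 = (x + real m *R axis i 1) + axis i 1" by (simp add: scaleR_add_left)
  thus ?case using Suc assms unfolding periodic_def by metis
 qed simp
 show ?thesis
 proof (cases "n >= 0")
  case True thus ?thesis using nat[of x "nat n"] by simp
 next
  case False
  have "f (x + of_int n *R axis i 1) = f ((x + of_int n *R axis i 1) + real (nat (- n)) *R axis i 1)" by (intro nat[symmetric])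
  also have "real (nat (- n)) = - of_int n" using False by simp
  also have "(x + of_int n *R axis i 1) + (- of_int n) *R axis i 1 = x" by simp
  finally show ?thesis .
 qed
qed

lemma periodic_int:
 fixes f :: "real^'n => 'b"
 assumes "periodic f" "!!i. EX n::int. y $ i = y' $ i + of_int n" shows "f y = f y'"
proof -
 obtain n :: "'n => int" where n: "!!i. y $ i = y' $ i + of_int (n i)" using assms(2) by metis
 have "f (x + (SUM i:I. of_int (n i) *R axis i 1)) = f x" if "finite I" for I x
  using that
 proof (induction I arbitrary: x rule: finite_induct)
  case (insert i I)
  thus ?case using periodic_int_axis[OF assms(1), of x "n i" i] by (simp add: add.assoc[symmetric])
 qed simp
 from this[OF finite, of y' UNIV] show ?thesis
 proof -
  have "y' + (SUM i:UNIV. of_int (n i) *R axis i 1) = y"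
   using n by (auto simp: vec_eq_iff axis_def if_distrib[of "%x. _ * x"] cong: if_cong)
  thus ?thesis using \<open>f (y' + _) = f y'\<close> by simp
 qed
qed

lemma tint_txp_zero:
 assumes "txp F" "tintegrable g" "!!k. tint (%y. cas k y * g y) = 0"
 shows "tintegrable (%y. F x y * g y) & tint (%y. F x y * g y) = 0"
 using assms(1)
proof induction
 case (base a k)
 have "tintegrable (%y. cas k y * g y)"
 proof (rule integrable_dom)
  show "tintegrable (%y. 2 * g y)" using assms(2) by simp
  show "(%y. cas k y * g y) : bmc"
   using assms(2) tintegrable_cont(1)[OF cas_cont] by measurable
  show "AE y in lc. norm (cas k y * g y) <= norm (2 * g y)"
   using cas_bound by (intro AE_I2) (auto simp: abs_mult intro!: mult_right_mono)
 qed
 thus ?case using assms(3)[of k] by (simp add: mult.assoc)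
next
 case (add F G)
 thus ?case by (simp add: distrib_right)
qed

text \<open>Vanishing coefficients make \<open>g\<close> orthogonal to all continuous functions on
  the torus. Multiplication by \<open>b\<close>, which vanishes on the boundary of the cell, turns
  any continuous function into one of these, so approximating the sign of \<open>g\<close> shows
  that \<open>b * |g|\<close> has integral zero. It is stated in L1 because the weak gradients of
  the hypotheses are merely integrable.\<close>

lemma L1_uniqueness:
 fixes g :: "real^'n => real"
 assumes g: "tintegrable g" "!!k. tint (%y. cas k y * g y) = 0"
 shows "AE y in lc. g y = 0"
proof -
 define b where "b y = (\<Prod>i\<in>UNIV. y $ i * (1 - y $ i))" for y :: "real^'n"
 have cb: "continuous_on S b" for S unfolding b_def by (intro continuous_intros)
 have b0: "0 <= b y" "b y <= 1" if "y : cell" for y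
 proof -
  have "0 <= y $ i * (1 - y $ i) & y $ i * (1 - y $ i) <= 1" for i
  proof -
   have "0 <= y $ i" "y $ i <= 1" using that by (auto simp: mem_cell)
   thus ?thesis using mult_le_one[of "y $ i" "1 - y $ i"] by auto
  qed
  thus "0 <= b y" "b y <= 1" unfolding b_def by (auto intro!: prod_nonneg prod_le_1)
 qed
 \<comment> \<open>Distinct points of the cell with the same image lie on opposite faces, where a
   factor of \<open>b\<close> is zero.\<close>
 have bcirc: "y = y' | (b y = 0 & b y' = 0)" if yc: "y : cell" "y' : cell" "circ y = circ y'" for y y'
 proof (cases "y = y'")
  case False
  then obtain i where i: "y $ i ~= y' $ i" by (auto simp: vec_eq_iff)
  obtain n :: int where n: "y $ i = y' $ i + of_int n" using circ_eqD[OF yc(3)] by blast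
  have r: "0 <= y $ i" "y $ i <= 1" "0 <= y' $ i" "y' $ i <= 1" using yc by (auto simp: mem_cell)
  have "n ~= 0" using i n by auto
  moreover have "-1 <= n" "n <= 1" using r n by linarith+
  ultimately have "n = 1 | n = -1" by auto
  hence "(y $ i = 0 | y $ i = 1) & (y' $ i = 0 | y' $ i = 1)" using r n by auto
  hence "y $ i * (1 - y $ i) = 0 & y' $ i * (1 - y' $ i) = 0" by auto
  hence "EX i:UNIV. y $ i * (1 - y $ i) = 0" "EX i:UNIV. y' $ i * (1 - y' $ i) = 0" by blast+
  thus ?thesis unfolding b_def by (intro disjI2 conjI prod_zero finite)
 qed simp
 have zero: "tint (%y. phi y * b y * g y) = 0" if c: "continuous_on UNIV phi" for phi :: "real^'n => real"
 proof -
  let ?f = "%y. phi y * b y"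
  have cf: "continuous_on S ?f" for S by (intro continuous_intros cb continuous_on_subset[OF c]) simp
  have int: "tintegrable (%y. ?f y * g y)"
  proof -
   obtain K where K: "0 <= K" "!!x. x : cell ==> norm (?f x) <= K" using bounded_cell[OF cf] by blast
   show ?thesis
   proof (rule integrable_dom)
    show "tintegrable (%y. K * g y)" using g by simp
    show "(%y. ?f y * g y) : bmc"
    using g(1) tintegrable_cont(1)[OF cf] by measurable
    show "AE y in lc. norm (?f y * g y) <= norm (K * g y)"
    using K by (intro AE_I2) (auto simp: abs_mult[of _ "g _"] intro!: mult_right_mono)
   qed
  qed
  have le: "\<bar>tint (%y. ?f y * g y)\<bar> <= d * tint (%y. \<bar>g y\<bar>)" if d: "0 < d" for d
  proof -
   obtain G where G: "txp G" "!!x y. x : cell ==> y : cell ==> \<bar>?f y - G x y\<bar> < d"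
   proof (rule torus_stone_weierstrass[of "%x y. ?f y" d])
    show "continuous_on (cell \<times> cell) (%z. ?f (snd z))"
    by (rule continuous_on_compose2[OF cf[of UNIV]]) (auto intro!: continuous_intros)
    show "?f y = ?f y'" if "y : cell" "y' : cell" "circ y = circ y'" for y y' :: "real^'n" using bcirc[OF that] by auto
   qed (use d in auto)
   have z: "0 : (cell :: (real^'n) set)" by (simp add: mem_cell)
   have "\<bar>tint (%y. ?f y * g y)\<bar> = \<bar>tint (%y. (?f y - G 0 y) * g y)\<bar>"
    using tint_txp_zero[OF G(1) g, of 0] int by (simp add: left_diff_distrib)
   also have "... <= tint (%y. \<bar>(?f y - G 0 y) * g y\<bar>)" by (rule integral_abs_bound)
   also have "... <= tint (%y. d * \<bar>g y\<bar>)"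
   proof (rule integral_mono)
    show "tintegrable (%y. \<bar>(?f y - G 0 y) * g y\<bar>)"
    unfolding left_diff_distrib using tint_txp_zero[OF G(1) g, of 0] int
    by (intro Bochner_Integration.integrable_abs Bochner_Integration.integrable_diff) auto
    show "tintegrable (%y. d * \<bar>g y\<bar>)" using g(1) by simp
    fix y :: "real^'n" assume "y : space lc"
    hence "\<bar>?f y - G 0 y\<bar> <= d" using G(2)[OF z, of y] by simp
    thus "\<bar>(?f y - G 0 y) * g y\<bar> <= d * \<bar>g y\<bar>" unfolding abs_mult by (rule mult_right_mono) simp
   qed
   finally show ?thesis by simp
  qed
  have "\<bar>tint (%y. ?f y * g y)\<bar> <= 0"
  proof (rule field_le_epsilon)
   fix e :: real assume e: "0 < e"
   define I where "I = tint (%y. \<bar>g y\<bar>)"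
   have I: "0 <= I" unfolding I_def by (rule Bochner_Integration.integral_nonneg) auto
   have "e / (I + 1) * I <= e" using I e by (simp add: field_simps)
   moreover have "\<bar>tint (%y. ?f y * g y)\<bar> <= e / (I + 1) * I"
    unfolding I_def by (rule le) (use e I in \<open>simp add: I_def[symmetric]\<close>)
   ultimately show "\<bar>tint (%y. ?f y * g y)\<bar> <= 0 + e" by linarith
  qed
  thus ?thesis by simp
 qed
 have gm: "g : bmc" using g(1) by measurable
 hence "(%y. sgn (g y)) : bmc" by measurable
 \<comment> \<open>\<open>measurable_on\<close> supplies continuous functions that converge to the
   sign off a negligible set; clipping them to [-1, 1] makes the convergence dominated.\<close>
 hence "(%y. sgn (g y)) measurable_on cell" by (simp add: measurable_on_iff_borel_measurable)
 then obtain N f where N: "negligible N" "!!n. continuous_on UNIV (f n)"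
   "!!x. x \<notin> N ==> (%n. f n x) ----> (if x : cell then sgn (g x) else (0::real))"
  by (auto simp: measurable_on_def)
 define f' where "f' n y = max (-1) (min 1 (f n y))" for n :: nat and y
 have cf': "continuous_on UNIV (f' n)" for n unfolding f'_def by (intro continuous_intros N)
 have AEN: "AE x in lc. x \<notin> N"
  using N(1) by (auto simp: AE_restrict_space_iff negligible_iff_null_sets intro!: AE_I'[of N])
 have "(%n. tint (%y. f' n y * b y * g y)) ----> tint (%y. sgn (g y) * b y * g y)"
 proof (rule integral_dominated_convergence[where w="%y. \<bar>g y\<bar>"])
  show "(%y. sgn (g y) * b y * g y) : bmc"
   using gm tintegrable_cont(1)[OF cb] by measurable
  show "(%y. f' n y * b y * g y) : bmc" for n
   using gm tintegrable_cont(1)[OF cb] tintegrable_cont(1)[OF continuous_on_subset[OF cf' subset_UNIV]] by measurable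
  show "AE y in lc. (%n. f' n y * b y * g y) ----> sgn (g y) * b y * g y"
   using AEN AE_space
  proof eventually_elim
   case (elim y)
   hence "(%n. f n y) ----> sgn (g y)" using N(3)[of y] by auto
   hence "(%n. f' n y) ----> max (-1) (min 1 (sgn (g y)))" unfolding f'_def by (intro tendsto_intros)
   moreover have "max (-1) (min 1 (sgn (g y))) = sgn (g y)" by (auto simp: sgn_if)
   ultimately show ?case by (intro tendsto_intros) simp
  qed
  show "AE y in lc. norm (f' n y * b y * g y) <= \<bar>g y\<bar>" for n
  proof (rule AE_I2)
   fix y :: "real^'n" assume "y : space lc"
   hence "0 <= b y" "b y <= 1" using b0 by auto
   moreover have "\<bar>f' n y\<bar> <= 1" by (auto simp: f'_def)
   ultimately have "\<bar>f' n y * b y\<bar> <= 1" by (auto simp: abs_mult intro!: mult_le_one)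
   thus "norm (f' n y * b y * g y) <= \<bar>g y\<bar>" by (simp add: abs_mult[of _ "g y"] mult_left_le_one_le)
  qed
 qed (use g in auto)
 hence "(%n::nat. 0) ----> tint (%y. sgn (g y) * b y * g y)" by (simp only: zero[OF cf'])
 hence z0: "tint (%y. sgn (g y) * b y * g y) = 0" by (rule LIMSEQ_unique[OF _ tendsto_const])
 have "sgn (g y) * b y * g y = b y * \<bar>g y\<bar>" for y by (simp add: abs_sgn)
 hence i0: "tint (%y. b y * \<bar>g y\<bar>) = 0" using z0 by (simp only:)
 have int: "tintegrable (%y. b y * \<bar>g y\<bar>)"
 proof (rule integrable_dom)
  show "(%y. b y * \<bar>g y\<bar>) : bmc"
   using gm tintegrable_cont(1)[OF cb] by measurable
  show "AE y in lc. norm (b y * \<bar>g y\<bar>) <= norm (g y)"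
   using b0 by (intro AE_I2) (auto simp: abs_mult mult_left_le_one_le)
 qed (rule g)
 have "AE y in lc. b y * \<bar>g y\<bar> = 0"
 proof -
  have nn: "AE y in lc. 0 <= b y * \<bar>g y\<bar>" by (rule AE_I2) (simp add: b0)
  show ?thesis using integral_nonneg_eq_0_iff_AE[OF int nn] i0 by blast
 qed
 moreover have "AE y in lebesgue_on (cell::(real^'n) set). y : box 0 One"
 proof -
  have "negligible (cell - box 0 (One::real^'n))"
   using negligible_frontier_interval[of 0 "One::real^'n"] by (simp add: cell_def)
  thus ?thesis
   by (auto simp: AE_restrict_space_iff negligible_iff_null_sets intro!: AE_I'[of "cell - box 0 One"])
 qed
 ultimately show ?thesis
 proof eventually_elim
  case (elim y)
  hence "0 < y $ i & y $ i < 1" for i by (auto simp: mem_box_cart One_nth simp del: sum_component)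
  hence "b y ~= 0" unfolding b_def by (auto simp: less_imp_neq[symmetric])
  thus ?case using elim by simp
 qed
qed

section \<open>Fourier series of scalar functions and vector fields\<close>

lemma inner_right: "sqi f ==> u \<bullet> tol2 f = tint (%x. fn u x \<bullet> f x)"
 using inner_tol2[of "fn u" f] by simp

lemma inner_left: "sqi f ==> tol2 f \<bullet> u = tint (%x. f x \<bullet> fn u x)"
 using inner_tol2[of f "fn u"] by simp

definition ecas :: "int^'n => 'b::euclidean_space => ('n, 'b) l2" where "ecas k b = tol2 (%x. cas k x *R b)"
text \<open>The coefficient takes values in the range space: its components are the inner products
  with \<open>ecas k b\<close>. Scalar functions and gradient fields thus share one Fourier
  calculus.\<close>

definition cf :: "int^'n => ('n, 'b::euclidean_space) l2 => 'b" where
 "cf k G = (SUM b:Basis. (ecas k b \<bullet> G) *R b)"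

lemma sqi_ecas [simp]: "sqi (%x. cas k x *R b)"
 by (rule tintegrable_cont(2)) (intro continuous_intros cas_cont)

lemma linear_ecas: "linear (ecas k)"
 by (rule linearI) (simp_all add: ecas_def add_tol2 scaleR_tol2 scaleR_add_right mult.commute)

lemma ecas_inner: "ecas k b \<bullet> ecas l c = (if k = l then b \<bullet> c else 0)"
 unfolding ecas_def by (subst inner_tol2) (simp_all add: mult.assoc[symmetric] cas_orthonormal)

lemma cf_inner: "ecas k b \<bullet> G = b \<bullet> cf k G"
proof -
 have "ecas k b \<bullet> G = ecas k (SUM c:Basis. (b \<bullet> c) *R c) \<bullet> G" by (simp add: euclidean_representation)
 also have "... = b \<bullet> cf k G"
  by (simp add: linear_sum[OF linear_ecas] linear_cmul[OF linear_ecas] cf_def inner_sum_left inner_sum_right mult.commute)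
 finally show ?thesis .
qed

lemma cf_eqI: "(!!b. b : Basis ==> ecas k b \<bullet> G = b \<bullet> v) ==> cf k G = v"
 unfolding cf_inner by (rule euclidean_eqI) (simp add: inner_commute)

lemma bounded_linear_cf: "bounded_linear (cf k)"
 unfolding cf_def[abs_def]
 by (intro bounded_linear_sum bounded_linear_compose[OF bounded_linear_scaleR_left] bounded_linear_inner_right)

lemmas cf_diff = linear_diff[OF bounded_linear.linear[OF bounded_linear_cf]]
lemmas cf_linear_sum = linear_sum[OF bounded_linear.linear[OF bounded_linear_cf]]
lemmas cf_tendsto = bounded_linear.tendsto[OF bounded_linear_cf]

lemma cf_real: "cf k u = tint (%x. cas k x * fn u x)"
proof -
 have "cf k u = ecas k 1 \<bullet> u" by (simp add: cf_inner)
 thus ?thesis unfolding ecas_def inner_left[OF sqi_ecas] by simp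
qed

lemma cf_component: "cf k G $ i = tint (%x. cas k x * fn G x $ i)"
proof -
 have "cf k G $ i = ecas k (axis i 1) \<bullet> G" by (simp add: cf_inner inner_axis')
 thus ?thesis by (simp add: ecas_def inner_left[OF sqi_ecas] inner_axis')
qed

lemma cf_ecas: "cf l (ecas k b) = (if k = l then b else 0)"
 by (rule cf_eqI) (simp add: ecas_inner)

lemma cf_sum: "finite F ==> cf l (SUM k:F. ecas k (c k)) = (if l : F then c l else 0)"
 by (simp add: cf_linear_sum cf_ecas)

lemma norm_ecas_sum: "finite F ==> (norm (SUM k:F. ecas k (c k)))^2 = (SUM k:F. (norm (c k))^2)"
 by (simp add: power2_norm_eq_inner inner_sum_left inner_sum_right ecas_inner)

lemma bessel: assumes "finite F" shows "(SUM k:F. (norm (cf k G))^2) <= (norm G)^2"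
proof -
 let ?S = "SUM k:F. ecas k (cf k G)"
 have "?S \<bullet> G = (SUM k:F. (norm (cf k G))^2)" by (simp add: inner_sum_left cf_inner power2_norm_eq_inner)
 moreover have "0 <= (norm (G - ?S))^2" by simp
 moreover have "(norm (G - ?S))^2 = (norm G)^2 - 2 * (?S \<bullet> G) + (norm ?S)^2"
  using inner_commute[of ?S G] by (simp only: power2_norm_eq_inner inner_diff_left inner_diff_right)
 ultimately show ?thesis by (simp add: norm_ecas_sum[OF assms])
qed

lemma cf_unique: assumes "!!k. cf k G = 0" shows "G = 0"
proof (rule l2_eqI)
 have z: "AE x in lc. fn (0 :: ('a, 'b) l2) x = 0"
  using fn_tol2[OF sqi_0] by (simp add: zero_tol2[symmetric])
 have "AE x in lc. b \<bullet> fn G x = 0" if b: "b : Basis" for b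
 proof (rule L1_uniqueness)
  show "tintegrable (%x. b \<bullet> fn G x)" by (rule sqi_inner) auto
  show "tint (%x. cas k x * (b \<bullet> fn G x)) = 0" for k
   using cf_inner[of k b G] assms by (simp add: ecas_def inner_left[OF sqi_ecas])
 qed
 hence "AE x in lc. ALL b:Basis. b \<bullet> fn G x = 0" by (simp add: AE_finite_allI)
 thus "AE x in lc. fn G x = fn 0 x" using z
 proof eventually_elim
  case (elim x)
  show ?case unfolding elim(2)
  proof (rule euclidean_eqI)
   fix b :: 'b assume "b : Basis"
   thus "fn G x \<bullet> b = 0 \<bullet> b" using elim(1) inner_commute[of "fn G x" b] by simp
  qed
 qed
qed

text \<open>Cubes of frequencies, symmetric under negation as the index flip in gradients demands,
  and exhausting the lattice.\<close>

definition Kb :: "nat => (int^'n) set" where "Kb N = {k. ALL i. \<bar>k $ i\<bar> <= int N}"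

lemma finite_Kb [simp]: "finite (Kb N :: (int^'n) set)"
proof -
 have "(Kb N :: (int^'n) set) \<subseteq> vec_lambda ` (PiE UNIV (%_. {- int N..int N}))"
  by (auto simp: Kb_def image_iff abs_le_iff minus_le_iff intro!: bexI[of _ "vec_nth _"])
 thus ?thesis by (rule finite_subset) (auto intro!: finite_imageI finite_PiE)
qed

lemma Kb_mono: "N <= M ==> Kb N \<subseteq> Kb M" by (auto simp: Kb_def intro: order_trans)
lemma Kb_minus: "(- k : Kb N) = (k : Kb N)" by (simp add: Kb_def)
lemma Kb_0: "0 : Kb N" by (simp add: Kb_def)
lemma Kb_ex: "EX N. k : (Kb N :: (int^'n) set)"
proof -
 have "\<bar>k $ i\<bar> <= int (nat (Max (range (%i. \<bar>k $ i\<bar>))))" for i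
 proof -
  have "\<bar>k $ i\<bar> <= Max (range (%i. \<bar>k $ i\<bar>))" by (rule Max_ge) auto
  thus ?thesis by linarith
 qed
 thus ?thesis unfolding Kb_def by blast
qed

lemma Kb_reindex: "(SUM k:Kb N. f (- k)) = (SUM k:Kb N. f k)"
 by (rule sum.reindex_bij_witness[of _ uminus uminus]) (auto simp: Kb_minus)

text \<open>By orthogonality the squared norm of a difference of partial sums is a difference of the
  sums \<open>s\<close>, which increase and are bounded. The norm bound on the result is kept
  because it turns energy bounds into bounds on gradients.\<close>

lemma riesz_fischer:
 fixes c :: "int^'n => 'b::euclidean_space"
 assumes B: "!!N. (SUM k:Kb N. (norm (c k))^2) <= B"
 obtains G where "(%N. SUM k:Kb N. ecas k (c k)) ----> G" "!!k. cf k G = c k" "(norm G)^2 <= B"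
proof -
 define s where "s N = (SUM k:(Kb N :: (int^'n) set). (norm (c k))^2)" for N
 define S where "S N = (SUM k:(Kb N :: (int^'n) set). ecas k (c k))" for N
 have "incseq s" unfolding s_def incseq_def
 proof (intro allI impI)
  fix m n :: nat assume "m <= n"
  thus "(SUM k:(Kb m :: (int^'n) set). (norm (c k))^2) <= (SUM k:Kb n. (norm (c k))^2)"
   by (intro sum_mono2 finite_Kb Kb_mono) auto
 qed
 hence "convergent s" by (rule incseq_convergent[of s B]) (use B in \<open>auto simp: s_def convergent_def\<close>)
 hence cs: "Cauchy s" by (simp add: Cauchy_convergent_iff)
 have diff: "(norm (S M - S N))^2 = s M - s N" if "N <= M" for M N
 proof -
  have sub: "(Kb N :: (int^'n) set) \<subseteq> Kb M" using Kb_mono that .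
  have "S M - S N = (SUM k:Kb M - Kb N. ecas k (c k))" unfolding S_def by (simp add: sum_diff[OF _ sub])
  hence "(norm (S M - S N))^2 = (SUM k:Kb M - Kb N. (norm (c k))^2)" by (simp add: norm_ecas_sum)
  also have "... = s M - s N" unfolding s_def by (simp add: sum_diff[OF _ sub])
  finally show ?thesis .
 qed
 have "Cauchy S"
 proof (rule metric_CauchyI)
  fix e :: real assume e: "0 < e"
  then obtain N0 where N0: "!!m n. m >= N0 ==> n >= N0 ==> dist (s m) (s n) < e^2"
   using metric_CauchyD[OF cs, of "e^2"] by auto
  have le: "dist (S m) (S n) < e" if "n >= N0" "n <= m" for m n
  proof -
   have "(norm (S m - S n))^2 < e^2" unfolding diff[OF that(2)] using N0[of m n] that by (simp add: dist_real_def)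
   thus ?thesis using e by (simp add: dist_norm power2_less_imp_less)
  qed
  have "dist (S m) (S n) < e" if "m >= N0" "n >= N0" for m n
   using le[of n m] le[of m n] that by (cases "n <= m") (auto simp: dist_commute)
  thus "EX N0. ALL m>=N0. ALL n>=N0. dist (S m) (S n) < e" by blast
 qed
 then obtain G where G: "S ----> G" by (auto simp: Cauchy_convergent_iff convergent_def)
 have cfG: "cf k G = c k" for k
 proof -
  obtain N0 where N0: "k : Kb N0" using Kb_ex by blast
  have "(%N. cf k (S N)) ----> cf k G" by (intro cf_tendsto G)
  moreover have "\<forall>\<^sub>F N in sequentially. cf k (S N) = c k"
   using eventually_ge_at_top[of N0] by eventually_elim (use N0 Kb_mono in \<open>auto simp: S_def cf_sum\<close>)
  ultimately show ?thesis using tendsto_eventually[of "%N. cf k (S N)" "c k" sequentially] LIMSEQ_unique by blast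
 qed
 have "(norm G)^2 <= B"
 proof (rule LIMSEQ_le_const2)
  show "(%N. (norm (S N))^2) ----> (norm G)^2" by (intro tendsto_intros G)
  show "EX N. ALL n>=N. (norm (S n))^2 <= B" using B by (auto simp: S_def norm_ecas_sum)
 qed
 thus ?thesis using that G cfG unfolding S_def by blast
qed

definition PN :: "nat => ('n::finite, 'b::euclidean_space) l2 => ('n, 'b) l2" where
 "PN N G = (SUM k:Kb N. ecas k (cf k G))"

lemma PN_tendsto: "(%N. PN N G) ----> G"
proof -
 have b: "(SUM k:Kb N. (norm (cf k G))^2) <= (norm G)^2" for N by (rule bessel) simp
 obtain G' where G': "(%N. PN N G) ----> G'" "!!k. cf k G' = cf k G"
  by (rule riesz_fischer[OF b]) (auto simp: PN_def)
 have "G' - G = 0" by (rule cf_unique) (simp add: cf_diff G')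
 thus ?thesis using G'(1) by simp
qed

lemma parseval: "(%N. SUM k:Kb N. (norm (cf k G))^2) ----> (norm G)^2"
proof -
 have "(%N. (norm (PN N G))^2) ----> (norm G)^2" by (intro tendsto_intros PN_tendsto)
 thus ?thesis by (simp add: PN_def norm_ecas_sum)
qed

section \<open>The periodic Sobolev space\<close>

text \<open>Trigonometric polynomials paired with their gradients. The closure \<open>W1\<close> of
  this graph is the Sobolev space H^1 of the torus, realised as a closed subspace of a product of L2
  spaces, the form required by \<open>parabolic\<close>.\<close>

definition W0 :: "(('n::finite, real) l2 \<times> ('n, real^'n) l2) set" where
 "W0 = span (range (%k. (ecas k 1, ecas (- k) (kv k))))"
definition W1 :: "(('n::finite, real) l2 \<times> ('n, real^'n) l2) set" where "W1 = closure W0"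

lemma W1_subspace: "subspace W1" unfolding W1_def W0_def by (intro subspace_closure subspace_span)
lemma W1_closed: "closed W1" unfolding W1_def by simp
lemma W0_sub: "W0 \<subseteq> W1" unfolding W1_def by (rule closure_subset)
lemma W0_basis: "(ecas k c, ecas (- k) (c *R kv k)) : W0"
proof -
 have "c *R (ecas k 1, ecas (- k) (kv k)) : W0" unfolding W0_def by (intro span_scale span_base rangeI)
 moreover have "ecas k c = c *R ecas k (1::real)" using linear_cmul[OF linear_ecas[of k], of c "1::real"] by simp
 moreover have "ecas (- k) (c *R kv k) = c *R ecas (- k) (kv k)" by (rule linear_cmul[OF linear_ecas])
 ultimately show ?thesis by simp
qed

text \<open>Testing a weak gradient with \<open>cas k\<close> yields its Fourier coefficients.
  Conversely a pair with such coefficients has Fourier truncations in \<open>W0\<close>, so weak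
  gradients in L2 and limits of smooth gradients are the same (\<open>W1_iff\<close>).\<close>

lemma weak_imp_cf:
 assumes "has_weak_grad (fn u) (fn G)" shows "cf k G = - (cf (- k) u *R kv k)"
proof -
 have "cf k G $ i = - (cf (- k) u * kv k $ i)" for i
 proof -
  have "tint (%x. fn u x * pgrad (cas k) x $ i) = - tint (%x. fn G x $ i * cas k x)"
   using assms cas_test[of k] unfolding has_weak_grad_def by blast
  moreover have "tint (%x. fn u x * pgrad (cas k) x $ i) = tint (%x. kv k $ i * (cas (- k) x * fn u x))"
   by (simp add: C1p_pgrad[OF cas_C1p] mult_ac)
  ultimately show ?thesis by (simp add: cf_component cf_real mult.commute)
 qed
 thus ?thesis by (simp add: vec_eq_iff)
qed

lemma cf_imp_W1:
 assumes "!!k. cf k G = - (cf (- k) u *R kv k)"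
 shows "(u, G) : W1" "(PN N u, PN N G) : W0"
proof -
 show W0: "(PN N u, PN N G) : W0" for N
 proof -
  have "PN N G = (SUM k:Kb N. ecas k (cf (- k) u *R kv (- k)))"
   unfolding PN_def assms by (simp add: kv_minus)
  also have "... = (SUM k:Kb N. ecas (- k) (cf k u *R kv k))"
   using Kb_reindex[of "%k. ecas (- k) (cf k u *R kv k)" N] by simp
  finally have "(PN N u, PN N G) = (SUM k:Kb N. (ecas k (cf k u), ecas (- k) (cf k u *R kv k)))"
   by (simp add: PN_def prod_eq_iff fst_sum snd_sum)
  moreover have "(SUM k:Kb N. (ecas k (cf k u), ecas (- k) (cf k u *R kv k))) : W0"
   unfolding W0_def by (intro span_sum) (use W0_basis in \<open>simp add: W0_def\<close>)
  ultimately show ?thesis by (simp only:)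
 qed
 show "(u, G) : W1" unfolding W1_def closure_sequential
  by (intro exI[of _ "%N. (PN N u, PN N G)"] conjI allI W0 tendsto_Pair PN_tendsto)
qed

lemma tintegrable_component: "tintegrable (%x. fn G x $ i)"
 using sqi_inner[OF sqi_fn[of G] sqi_const[of "axis i 1"]] by (simp add: inner_axis)

lemma test_fun_props:
 assumes "test_fun phi" shows "sqi phi" "sqi (%x. pgrad phi x $ i)" "sqi (%x. phi x *R v)" "sqi (pgrad phi)"
proof -
 have c: "continuous_on S phi" "continuous_on S (pgrad phi)" for S
  using test_fun_C1p[OF assms] C1p_cont[OF test_fun_C1p[OF assms]] continuous_on_subset unfolding C1p_def by blast+
 show "sqi phi" "sqi (%x. pgrad phi x $ i)" "sqi (%x. phi x *R v)" "sqi (pgrad phi)"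
  by (intro tintegrable_cont(2) continuous_intros c)+
qed

text \<open>For a fixed test function the integration by parts defect is a continuous linear
  functional of the pair; it vanishes on the generators and therefore on the closure of their
  span.\<close>

lemma W1_imp_weak: assumes "(u, G) : W1" shows "has_weak_grad (fn u) (fn G)"
 unfolding has_weak_grad_def
proof (intro conjI allI impI)
 show "tintegrable (fn u)" by (rule sqi_integrable) simp
 show "tintegrable (%x. fn G x $ i)" for i by (rule tintegrable_component)
 fix phi :: "real^'a => real" and i assume t: "test_fun phi"
 define L where "L z = fst z \<bullet> tol2 (%x. pgrad phi x $ i) + snd z \<bullet> tol2 (%x. phi x *R axis i (1::real))"
  for z :: "('a, real) l2 \<times> ('a, real^'a) l2"
 have L_eq: "L (u, G) = tint (%x. fn u x * pgrad phi x $ i) + tint (%x. fn G x $ i * phi x)" for u G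
  unfolding L_def fst_conv snd_conv inner_right[OF test_fun_props(2)[OF t]] inner_right[OF test_fun_props(3)[OF t]]
  by (simp add: inner_axis mult.commute)
 have lin: "linear L" unfolding L_def by (rule linearI) (auto simp: inner_add_left algebra_simps)
 have gen: "L (ecas k 1, ecas (- k) (kv k)) = 0" for k
 proof -
  have "ecas k 1 \<bullet> tol2 (%x. pgrad phi x $ i) = tint (%x. cas k x * pgrad phi x $ i)"
   "ecas (- k) (kv k) \<bullet> tol2 (%x. phi x *R axis i 1) = tint (%x. (cas (- k) x *R kv k) $ i * phi x)"
   unfolding ecas_def inner_tol2[OF sqi_ecas test_fun_props(2)[OF t]] inner_tol2[OF sqi_ecas test_fun_props(3)[OF t]]
   by (simp_all add: inner_axis mult_ac)
  thus ?thesis using C1p_weak_grad[OF cas_C1p[of k]] t unfolding L_def has_weak_grad_def by simp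
 qed
 have "L z = 0" if "z : W0" for z
  by (rule linear_eq_0_on_span[OF lin _ that[unfolded W0_def]]) (use gen in auto)
 moreover have cL: "continuous_on UNIV L" unfolding L_def by (intro continuous_intros)
 have "closed {z. L z = 0}" by (rule closed_Collect_eq[OF cL continuous_on_const])
 ultimately have "W1 \<subseteq> {z. L z = 0}" unfolding W1_def by (intro closure_minimal) auto
 thus "tint (%x. fn u x * pgrad phi x $ i) = - tint (%x. fn G x $ i * phi x)"
 proof -
  have "L (u, G) = 0" using assms \<open>W1 \<subseteq> _\<close> by blast
  thus ?thesis using L_eq[of u G] by linarith
 qed
qed

lemma W1_iff: "(u, G) : W1 \<longleftrightarrow> has_weak_grad (fn u) (fn G)"
 using W1_imp_weak cf_imp_W1(1) weak_imp_cf by metis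

lemma W1_cf: "(u, G) : W1 ==> cf k G = - (cf (- k) u *R kv k)"
 using W1_imp_weak weak_imp_cf by blast

section \<open>Representatives and uniqueness of weak gradients; truncated energies\<close>

lemma has_weak_grad_AE:
 assumes "has_weak_grad u g" "AE x in lc. u x = u' x" "AE x in lc. g x = g' x"
  "u' : bmc" "g' : bmc"
 shows "has_weak_grad u' g'"
proof -
 have gi': "(%x. g' x $ i) : bmc" for i
  using borel_measurable_inner[OF assms(5) borel_measurable_const[of "axis i 1"]] by (simp add: inner_axis)
 have u: "tintegrable u" and gi: "!!i. tintegrable (%x. g x $ i)"
  and eq: "!!phi i. test_fun phi ==> tint (%x. u x * pgrad phi x $ i) = - tint (%x. g x $ i * phi x)"
  using assms(1) by (auto simp: has_weak_grad_def)
 show ?thesis unfolding has_weak_grad_def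
 proof (intro conjI allI impI)
  show "tintegrable u'" using u assms(2,4) borel_measurable_integrable[OF u] by (subst integrable_cong_AE[where g=u]) auto
  show "tintegrable (%x. g' x $ i)" for i
   using gi[of i] assms(3) gi' borel_measurable_integrable[OF gi[of i]]
   by (subst integrable_cong_AE[where g="%x. g x $ i"]) auto
  fix phi :: "real^'a => real" and i assume t: "test_fun phi"
  note m = sqi_measurable[OF test_fun_props(1)[OF t]] sqi_measurable[OF test_fun_props(2)[OF t, of i]]
  have "tint (%x. u' x * pgrad phi x $ i) = tint (%x. u x * pgrad phi x $ i)"
   using assms(2,4) m borel_measurable_integrable[OF u] by (intro integral_cong_AE) auto
  also have "... = - tint (%x. g x $ i * phi x)" by (rule eq[OF t])
  also have "tint (%x. g x $ i * phi x) = tint (%x. g' x $ i * phi x)"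
   using assms(3) m gi'[of i] borel_measurable_integrable[OF gi[of i]] by (intro integral_cong_AE) auto
  finally show "tint (%x. u' x * pgrad phi x $ i) = - tint (%x. g' x $ i * phi x)" .
 qed
qed

text \<open>Gradients in \<open>has_weak_grad\<close> are only integrable, so uniqueness rests on
  \<open>L1_uniqueness\<close> applied to each component. It makes later statements independent of
  the choice made in \<open>wgrad\<close>.\<close>

lemma weak_grad_unique:
 assumes "has_weak_grad u g" "has_weak_grad u' g'" "AE x in lc. u x = u' x"
 shows "AE x in lc. g x = g' x"
proof -
 have i: "tintegrable u" "tintegrable u'" "!!i. tintegrable (%x. g x $ i)" "!!i. tintegrable (%x. g' x $ i)"
  using assms(1,2) by (auto simp: has_weak_grad_def)
 have bm: "tintegrable (%x. cas k x * f x)" if "tintegrable f" for k f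
 proof (rule integrable_dom)
  show "tintegrable (%y. 2 * f y)" using that by simp
  show "(%y. cas k y * f y) : bmc"
   using that tintegrable_cont(1)[OF cas_cont] by measurable
  show "AE y in lc. norm (cas k y * f y) <= norm (2 * f y)"
   using cas_bound by (intro AE_I2) (auto simp: abs_mult intro!: mult_right_mono)
 qed
 have "AE x in lc. g x $ j - g' x $ j = 0" for j
 proof (rule L1_uniqueness)
  show "tintegrable (%x. g x $ j - g' x $ j)" using i by simp
  fix k
  have "tint (%x. u x * pgrad (cas k) x $ j) = tint (%x. u' x * pgrad (cas k) x $ j)"
   using assms(3) sqi_measurable[OF test_fun_props(2)[OF cas_test, of k j]] i(1,2)
   by (intro integral_cong_AE borel_measurable_times) (auto dest!: borel_measurable_integrable)
  hence "tint (%x. g x $ j * cas k x) = tint (%x. g' x $ j * cas k x)"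
   using assms(1,2) cas_test[of k] unfolding has_weak_grad_def by simp
  thus "tint (%x. cas k x * (g x $ j - g' x $ j)) = 0"
   unfolding right_diff_distrib by (subst Bochner_Integration.integral_diff) (auto simp: bm i mult.commute)
 qed
 hence "AE x in lc. ALL j:UNIV. g x $ j - g' x $ j = 0" by (intro AE_finite_allI) auto
 thus ?thesis by eventually_elim (simp add: vec_eq_iff)
qed

lemma wgrad_weak: "EX g. has_weak_grad u g ==> has_weak_grad u (wgrad u)"
 unfolding wgrad_def by (erule someI_ex)

lemma W1_wgrad:
 assumes "(u, G) : W1" "AE x in lc. fn u x = f x" "f : bmc"
 shows "has_weak_grad f (fn G)" "has_weak_grad f (wgrad f)" "AE x in lc. wgrad f x = fn G x"
proof -
 show 1: "has_weak_grad f (fn G)"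
  by (rule has_weak_grad_AE[OF W1_imp_weak[OF assms(1)] assms(2)]) (use assms(3) in auto)
 show 2: "has_weak_grad f (wgrad f)" by (rule wgrad_weak) (use 1 in blast)
 show "AE x in lc. wgrad f x = fn G x" by (rule weak_grad_unique[OF 2 1]) simp
qed

lemma W1_unique: "(u, G) : W1 ==> (u, G') : W1 ==> G = G'"
 using weak_grad_unique[OF W1_imp_weak W1_imp_weak] l2_eqI by blast

text \<open>The Dirichlet energy restricted to finitely many frequencies. It is continuous in
  \<open>u\<close> for the L2 norm and makes sense without a gradient, so it passes to limits and is
  measurable along weakly continuous curves.\<close>

definition dir :: "nat => ('n::finite, real) l2 => real" where
 "dir N u = (SUM k:Kb N. (norm (kv k))^2 * (cf k u)^2)"

lemma dir_W1: "(u, G) : W1 ==> dir N u = (SUM k:Kb N. (norm (cf k G))^2)"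
proof -
 assume a: "(u, G) : W1"
 have "(SUM k:Kb N. (norm (cf k G))^2) = (SUM k:Kb N. (norm (kv (- k)))^2 * (cf (- k) u)^2)"
  by (intro sum.cong) (auto simp: W1_cf[OF a] power_mult_distrib kv_minus)
 also have "... = dir N u" unfolding dir_def by (rule Kb_reindex)
 finally show ?thesis by simp
qed

lemma dir_mono: "N <= M ==> dir N u <= dir M u"
 unfolding dir_def by (rule sum_mono2) (auto dest: Kb_mono)

lemma dir_bounded:
 assumes "!!N. dir N u <= B" obtains G where "(u, G) : W1" "(norm G)^2 <= B"
proof -
 have b: "(SUM k:Kb N. (norm (- (cf (- k) u *R kv k)))^2) <= B" for N
 proof -
  have "(SUM k:Kb N. (norm (- (cf (- k) u *R kv k)))^2) = (SUM k:Kb N. (norm (kv (- k)))^2 * (cf (- k) u)^2)"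
   by (intro sum.cong) (auto simp: power_mult_distrib kv_minus)
  also have "... = dir N u" unfolding dir_def by (rule Kb_reindex)
  finally show ?thesis using assms by simp
 qed
 obtain G where "!!k. cf k G = - (cf (- k) u *R kv k)" "(norm G)^2 <= B" by (rule riesz_fischer[OF b]) blast
 thus ?thesis using that cf_imp_W1(1) by blast
qed

text \<open>If a square integrable gradient exists this is Parseval's identity. Otherwise both sides
  are infinite, the right one by \<open>dir_bounded\<close>. The equality replaces a gradient chosen
  separately at each time by a supremum of continuous functions of time.\<close>

lemma dir_weak:
 assumes g: "has_weak_grad (fn u) g"
 shows "tnn (%x. (norm (g x))^2) = (SUP N. ennreal (dir N u))"
proof -
 have gi: "tintegrable (%x. g x $ i)" for i using g by (simp add: has_weak_grad_def)
 have gm: "g : bmc"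
  by (subst borel_measurable_euclidean_space) (auto simp: Basis_vec_def inner_axis borel_measurable_integrable[OF gi])
 have W: "tnn (%x. (norm (g x))^2) = (SUP N. ennreal (dir N u))" if a: "(u, G) : W1" for G
 proof -
  have "AE x in lc. g x = fn G x" by (rule weak_grad_unique[OF g W1_imp_weak[OF a]]) simp
  hence "tnn (%x. (norm (g x))^2) = tnn (%x. (norm (fn G x))^2)"
   by (intro nn_integral_cong_AE) (auto elim: AE_mp)
  also have "... = ennreal ((norm G)^2)" using nn_norm_sq[OF sqi_fn[of G]] by simp
  also have "... = (SUP N. ennreal (dir N u))"
  proof (rule LIMSEQ_unique[OF _ LIMSEQ_SUP])
   show "(%N. ennreal (dir N u)) ----> ennreal ((norm G)^2)"
    using parseval[of G] by (simp add: dir_W1[OF a] tendsto_ennrealI)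
   show "incseq (%N. ennreal (dir N u))" by (auto simp: incseq_def intro!: ennreal_leI dir_mono)
  qed
  finally show ?thesis .
 qed
 show ?thesis
 proof (cases "EX G. (u, G) : W1")
  case True thus ?thesis using W by blast
 next
  case False
  have "tnn (%x. (norm (g x))^2) = \<infinity>"
  proof (rule ccontr)
   assume "tnn (%x. (norm (g x))^2) ~= \<infinity>"
   hence "integrable lc (%x. (norm (g x))^2)"
    using gm by (intro integrableI_nonneg) (auto simp: top.not_eq_extremum)
   hence s: "sqi g" using gm by (simp add: sqi_def)
   have "has_weak_grad (fn u) (fn (tol2 g))"
    by (rule has_weak_grad_AE[OF g]) (use fn_tol2[OF s] in \<open>auto elim: AE_mp\<close>)
   thus False using False W1_iff by blast
  qed
  moreover have "(SUP N. ennreal (dir N u)) = \<infinity>"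
  proof (rule ccontr)
   assume "(SUP N. ennreal (dir N u)) ~= \<infinity>"
   then obtain B where B: "(SUP N. ennreal (dir N u)) = ennreal B" "0 <= B" by (cases "SUP N. ennreal (dir N u)") auto
   have "dir N u <= B" for N
    using SUP_upper[of N UNIV "%N. ennreal (dir N u)"] B by simp
   thus False using dir_bounded False by blast
  qed
  ultimately show ?thesis by (simp only:)
 qed
qed

section \<open>Rellich compactness and the Poincare inequality\<close>

lemma kv_outside: assumes "k \<notin> Kb N" shows "real (Suc N) <= norm (kv k)"
proof -
 obtain i where "\<bar>k $ i\<bar> > int N" using assms by (auto simp: Kb_def not_le)
 hence "real (Suc N) <= \<bar>of_int (k $ i)\<bar>" by linarith
 also have "... <= 2 * pi * \<bar>of_int (k $ i)\<bar>" using mult_right_mono[of 1 "2 * pi" "\<bar>real_of_int (k $ i)\<bar>"] pi_ge_two by simp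
 also have "... = \<bar>kv k $ i\<bar>" by (simp add: kv_def abs_mult)
 also have "... <= norm (kv k)" by (rule component_le_norm_cart)
 finally show ?thesis .
qed

text \<open>Frequencies outside \<open>Kb N\<close> have length at least N + 1, so the gradient pays
  for the tail. This is Rellich's theorem with a rate, and for N = 0 the Poincare
  inequality.\<close>

lemma rellich_tail: assumes a: "(u, G) : W1" shows "norm (u - PN N u) <= norm G / real (Suc N)"
proof (rule power2_le_imp_le)
 show "0 <= norm G / real (Suc N)" by simp
 have "(%M. (norm (PN M u - PN N u))^2) ----> (norm (u - PN N u))^2" by (intro tendsto_intros PN_tendsto)
 thus "(norm (u - PN N u))^2 <= (norm G / real (Suc N))^2"
 proof (rule LIMSEQ_le_const2, intro exI allI impI)
  fix M assume M: "N <= M"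
  have sub: "(Kb N :: (int^'a) set) \<subseteq> Kb M" using Kb_mono M .
  have "PN M u - PN N u = (SUM k:Kb M - Kb N. ecas k (cf k u))" unfolding PN_def by (simp add: sum_diff[OF _ sub])
  hence "(norm (PN M u - PN N u))^2 = (SUM k:Kb M - Kb N. (cf k u)^2)" by (simp add: norm_ecas_sum)
  also have "... <= (SUM k:Kb M - Kb N. (norm (kv k))^2 * (cf k u)^2 / (real (Suc N))^2)"
  proof (rule sum_mono)
   fix k :: "int^'a" assume "k : Kb M - Kb N"
   hence "(real (Suc N))^2 <= (norm (kv k))^2" by (intro power_mono kv_outside) auto
   hence "(real (Suc N))^2 * (cf k u)^2 <= (norm (kv k))^2 * (cf k u)^2" by (rule mult_right_mono) simp
   thus "(cf k u)^2 <= (norm (kv k))^2 * (cf k u)^2 / (real (Suc N))^2" by (simp add: field_simps del: of_nat_Suc)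
  qed
  also have "... <= (SUM k:Kb M. (norm (kv k))^2 * (cf k u)^2 / (real (Suc N))^2)"
   by (intro sum_mono2) auto
  also have "... = dir M u / (real (Suc N))^2" by (simp add: dir_def sum_divide_distrib)
  also have "... <= (norm G)^2 / (real (Suc N))^2"
   unfolding dir_W1[OF a] by (intro divide_right_mono bessel) auto
  finally show "(norm (PN M u - PN N u))^2 <= (norm G / real (Suc N))^2" by (simp add: power_divide)
 qed
qed

lemma W1_const: "(ecas 0 c, 0) : W1"
proof -
 have "(ecas 0 c, ecas (- 0) (c *R kv 0)) : W1" using W0_basis W0_sub by blast
 thus ?thesis by (simp add: linear_0[OF linear_ecas])
qed

text \<open>Potentials normalised to mean zero inherit the Cauchy property from their gradients by
  the Poincare inequality, that is, by \<open>rellich_tail\<close> for N = 0.\<close>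

lemma closed_grads: "closed (snd ` (W1 :: (('n::finite, real) l2 \<times> _) set))"
 unfolding closed_sequential_limits
proof (intro allI impI, elim conjE)
 fix X :: "nat => ('n, real^'n) l2" and G
 assume X: "ALL n. X n : snd ` W1" and lim: "X ----> G"
 have "EX v. (v, X n) : W1 & PN 0 v = 0" for n
 proof -
  obtain u where u: "(u, X n) : W1" using X by force
  have K0: "Kb 0 = {0 :: int^'n}" by (auto simp: Kb_def vec_eq_iff)
  have "(u - ecas 0 (cf 0 u), X n) : W1" using subspace_diff[OF W1_subspace u W1_const[of "cf 0 u"]] by simp
  moreover have "PN 0 (u - ecas 0 (cf 0 u)) = 0" by (simp add: PN_def K0 cf_diff cf_ecas linear_0[OF linear_ecas])
  ultimately show ?thesis by blast
 qed
 then obtain v where v: "!!n. (v n, X n) : W1" "!!n. PN 0 (v n) = 0" by metis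
 have le: "norm (v m - v n) <= norm (X m - X n)" for m n
 proof -
  have "(v m - v n, X m - X n) : W1" using subspace_diff[OF W1_subspace v(1) v(1)] by simp
  from rellich_tail[OF this, of 0] have "norm (v m - v n - PN 0 (v m - v n)) <= norm (X m - X n)" by simp
  moreover have "PN 0 (v m - v n) = 0"
   using v(2)[of m] v(2)[of n] by (simp add: PN_def cf_diff linear_diff[OF linear_ecas] sum_subtractf)
  ultimately show ?thesis by simp
 qed
 have "Cauchy v"
 proof (rule metric_CauchyI)
  fix e :: real assume "0 < e"
  then obtain M where "!!m n. m >= M ==> n >= M ==> dist (X m) (X n) < e"
   using metric_CauchyD[OF LIMSEQ_imp_Cauchy[OF lim]] by metis
  thus "EX M. ALL m>=M. ALL n>=M. dist (v m) (v n) < e"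
   using order.strict_trans1[OF le] unfolding dist_norm by blast
 qed
 then obtain u where u: "v ----> u" by (auto simp: Cauchy_convergent_iff convergent_def)
 have "(u, G) : W1" by (rule closed_sequentially[OF W1_closed v(1) tendsto_Pair[OF u lim]])
 thus "G : snd ` W1" by force
qed

section \<open>Averages of rapidly oscillating functions\<close>

definition sc :: "nat => int^'n => int^'n" where "sc N k = (\<chi> i. int N * k $ i)"

lemma cas_dilate: "cas k (real N *R x) = cas (sc N k) x"
proof -
 have "kv (sc N k) = real N *R kv k" by (simp add: kv_def sc_def vec_eq_iff)
 thus ?thesis by (simp add: cas_def)
qed

text \<open>The dilated indices are distinct, so Bessel's inequality makes the squares of these
  coefficients summable: a Riemann-Lebesgue lemma along dilations.\<close>

lemma cf_dilate_tendsto: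
 assumes "k ~= 0" shows "(%N. cf (sc (Suc N) k) u) ----> (0::real)"
proof -
 obtain i where i: "k $ i ~= 0" using assms by (auto simp: vec_eq_iff)
 have inj: "inj_on (%N. sc (Suc N) k) A" for A
 proof (rule inj_onI)
  fix M N assume "sc (Suc M) k = sc (Suc N) k"
  hence "int (Suc M) * k $ i = int (Suc N) * k $ i" by (auto simp: sc_def vec_eq_iff)
  thus "M = N" using i by simp
 qed
 have "(\<Sum>N<M. (cf (sc (Suc N) k) u)^2) <= (norm u)^2" for M
  using bessel[of "(%N. sc (Suc N) k) ` {..<M}" u] by (simp add: sum.reindex[OF inj] o_def)
 from this[of "Suc _"] have "(\<Sum>N\<le>M. (cf (sc (Suc N) k) u)^2) <= (norm u)^2" for M
  by (simp only: lessThan_Suc_atMost)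
 hence "summable (%N. (cf (sc (Suc N) k) u)^2)"
  by (intro bounded_imp_summable[where B="(norm u)^2"]) auto
 hence "(%N. (cf (sc (Suc N) k) u)^2) ----> 0" by (rule summable_LIMSEQ_zero)
 hence "(%N. sqrt ((cf (sc (Suc N) k) u)^2)) ----> sqrt 0" by (rule tendsto_real_sqrt)
 thus ?thesis by (simp add: tendsto_rabs_zero_iff)
qed

lemma tint_param_cont:
 fixes F :: "real^'n => real^'n => real"
 assumes c: "continuous_on (cell \<times> cell) (%z. F (fst z) (snd z))"
 shows "continuous_on cell (%x. tint (F x))"
 unfolding continuous_on_iff
proof (intro ballI allI impI)
 fix x :: "real^'n" and e :: real assume x: "x : cell" and e: "0 < e"
 have cy: "continuous_on cell (F x)" if "x : cell" for x
 proof -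
  have "continuous_on cell (%y. (x, y))" by (intro continuous_intros)
  from continuous_on_compose2[OF c this] that show ?thesis by auto
 qed
 have "uniformly_continuous_on (cell \<times> cell) (%z. F (fst z) (snd z))"
  by (intro compact_uniformly_continuous c compact_Times cell_compact)
 then obtain d where d: "0 < d" "!!z z'. z : cell \<times> cell ==> z' : cell \<times> cell ==> dist z' z < d ==>
   dist (F (fst z') (snd z')) (F (fst z) (snd z)) < e/2"
  using e unfolding uniformly_continuous_on_def by (metis half_gt_zero)
 show "EX d>0. ALL x':cell. dist x' x < d --> dist (tint (F x')) (tint (F x)) < e"
 proof (intro exI[of _ d] conjI ballI impI d)
  fix x' assume x': "x' : cell" "dist x' x < d"
  have i: "tintegrable (F x')" "tintegrable (F x)" using cy x x' by (auto intro: tintegrable_cont)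
  have "\<bar>tint (F x') - tint (F x)\<bar> = \<bar>tint (%y. F x' y - F x y)\<bar>" using i by simp
  also have "... <= tint (%y. \<bar>F x' y - F x y\<bar>)" by (rule integral_abs_bound)
  also have "... <= tint (%y::real^'n. e/2)"
  proof (rule integral_mono)
   show "tintegrable (%y. \<bar>F x' y - F x y\<bar>)" using i by simp
   fix y :: "real^'n" assume "y : space lc"
   thus "\<bar>F x' y - F x y\<bar> <= e/2"
    using d(2)[of "(x, y)" "(x', y)"] x x' by (simp add: dist_Pair_Pair dist_real_def)
  qed (use i in auto)
  also have "... = e/2" by (rule tint_const)
  finally show "dist (tint (F x')) (tint (F x)) < e" using e by (simp add: dist_real_def)
 qed
qed

lemma frac_cell: "(\<chi> i. frac (y $ i)) : cell" "EX n::int. y $ i = (\<chi> i. frac (y $ i)) $ i + of_int n"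
proof -
 show "(\<chi> i. frac (y $ i)) : cell" by (simp add: mem_cell less_imp_le[OF frac_lt_1])
 show "EX n::int. y $ i = (\<chi> i. frac (y $ i)) $ i + of_int n"
  by (rule exI[of _ "\<lfloor>y $ i\<rfloor>"]) (simp add: frac_def)
qed

lemma txp_props:
 assumes "txp G" shows "continuous_on UNIV (%z. G (fst z) (snd z))" "periodic (G x)"
proof -
 show "continuous_on UNIV (%z. G (fst z) (snd z))" using assms
  by induction (auto intro!: continuous_intros continuous_on_compose2[OF cas_cont[of UNIV]] intro: continuous_on_compose2[of UNIV _ _ fst])
 show "periodic (G x)" using assms
 proof induction
  case (base a k) thus ?case using cas_C1p[of k] by (simp add: C1p_def periodic_def)
 next
  case (add F G) thus ?case by (simp add: periodic_def)
 qed
qed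

lemma cont_slices:
 fixes F :: "real^'n => real^'n => real"
 assumes "continuous_on UNIV (%z. F (fst z) (snd z))"
 shows "continuous_on S (F x)" "continuous_on S (%x. F x (c *R x))" "continuous_on A (%z. F (fst z) (snd z))"
proof -
 show "continuous_on S (F x)"
 proof -
  have "continuous_on S (%y. (x, y))" by (intro continuous_intros)
  from continuous_on_compose2[OF assms this] show ?thesis by auto
 qed
 show "continuous_on S (%x. F x (c *R x))"
 proof -
  have "continuous_on S (%x. (x, c *R x))"
   by (rule continuous_on_Pair[OF continuous_on_id]) (rule continuous_on_scaleR[OF continuous_on_const continuous_on_id])
  from continuous_on_compose2[OF assms this subset_UNIV] show ?thesis by simp
 qed
 show "continuous_on A (%z. F (fst z) (snd z))" using assms continuous_on_subset by blast
qed

lemma sqi_mult_cont: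
 fixes w a :: "real^'n => real"
 assumes "sqi w" "continuous_on cell a" shows "sqi (%x. w x * a x)" "tintegrable (%x. w x * a x)"
proof -
 obtain K where K: "!!x. x : cell ==> norm (a x) <= K"
  using compact_imp_bounded[OF compact_continuous_image[OF assms(2) cell_compact]] by (auto simp: bounded_iff)
 have "bpw (%x v. a x *R v :: real) \<bar>K\<bar>"
  by (rule bpw_scalar) (use K tintegrable_cont(1)[OF assms(2)] in \<open>force+\<close>)
 from sqi_pw[OF this assms(1)] show s: "sqi (%x. w x * a x)" by (simp add: mult.commute)
 show "tintegrable (%x. w x * a x)" by (rule sqi_integrable[OF s])
qed

lemma osc_mean_txp:
 assumes "txp G" "sqi w"
 shows "(%N. tint (%x. w x * G x (real (Suc N) *R x))) ----> tint (%x. w x * tint (G x))"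
 using assms(1)
proof induction
 case (base a k)
 have s: "sqi (%x. w x * a x)" by (rule sqi_mult_cont(1)[OF assms(2) continuous_on_subset[OF base]]) simp
 have eq: "tint (%x. w x * (a x * cas k (real (Suc N) *R x))) = cf (sc (Suc N) k) (tol2 (%x. w x * a x))" for N
 proof -
  have "cf (sc (Suc N) k) (tol2 (%x. w x * a x)) = ecas (sc (Suc N) k) 1 \<bullet> tol2 (%x. w x * a x)" by (simp add: cf_inner)
  also have "... = tint (%x. cas (sc (Suc N) k) x * (w x * a x))"
   unfolding ecas_def inner_tol2[OF sqi_ecas s] by simp
  finally show ?thesis by (simp add: cas_dilate[symmetric] mult_ac del: of_nat_Suc)
 qed
 show ?case
 proof (cases "k = 0")
  case False
  thus ?thesis unfolding eq using cf_dilate_tendsto[OF False] by (simp add: tint_cas)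
 next
  case True
  thus ?thesis by (simp add: measure_cell measure_restrict_space)
 qed
next
 case (add F G)
 have c: "continuous_on cell (%x. F x (c *R x))" "continuous_on cell (%x. G x (c *R x))"
   "continuous_on cell (%x. tint (F x))" "continuous_on cell (%x. tint (G x))" for c
  by (rule cont_slices(2)[of F, OF txp_props(1)[OF add(1)]], rule cont_slices(2)[of G, OF txp_props(1)[OF add(2)]],
    rule tint_param_cont[of F, OF cont_slices(3)[of F, OF txp_props(1)[OF add(1)]]],
    rule tint_param_cont[of G, OF cont_slices(3)[of G, OF txp_props(1)[OF add(2)]]])
 have t: "tintegrable (F x)" "tintegrable (G x)" for x
  by (rule tintegrable_cont(3)[OF cont_slices(1)[of F, OF txp_props(1)[OF add(1)]]],
    rule tintegrable_cont(3)[OF cont_slices(1)[of G, OF txp_props(1)[OF add(2)]]])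
 have "tint (%x. w x * (F x (real (Suc N) *R x) + G x (real (Suc N) *R x)))
   = tint (%x. w x * F x (real (Suc N) *R x)) + tint (%x. w x * G x (real (Suc N) *R x))" for N
  unfolding distrib_left by (intro integral_plus sqi_mult_cont(2)[OF assms(2)] c)
 moreover have "tint (%x. w x * tint (%y. F x y + G x y)) = tint (%x. w x * tint (F x)) + tint (%x. w x * tint (G x))"
  unfolding integral_plus[OF t] distrib_left
  by (intro integral_plus sqi_mult_cont(2)[OF assms(2)] c)
 ultimately show ?case using tendsto_add[OF add.IH] by (simp only:)
qed

lemma osc_mean:
 fixes F :: "real^'n => real^'n => real"
 assumes c: "continuous_on UNIV (%z. F (fst z) (snd z))" and p: "!!x. periodic (F x)" and w: "sqi w"
 shows "(%N. tint (%x. w x * F x (real (Suc N) *R x))) ----> tint (%x. w x * tint (F x))"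
proof (rule LIMSEQ_I)
 fix e :: real assume e: "0 < e"
 define I where "I = tint (%x. \<bar>w x\<bar>)"
 have I: "0 <= I" unfolding I_def by (rule Bochner_Integration.integral_nonneg) auto
 define d where "d = e / (3 * (I + 1))"
 have d: "0 < d" "d * I < e / 3" using e I by (auto simp: d_def field_simps)
 have pc: "F x y = F x y'" if "x : cell" "y : cell" "y' : cell" "circ y = circ y'" for x y y'
  by (rule periodic_int[OF p circ_eqD[OF that(4)]])
 from torus_stone_weierstrass[of F, OF cont_slices(3)[of F, OF c] pc d(1)]
 obtain G where G: "txp G" "!!x y. x : cell ==> y : cell ==> \<bar>F x y - G x y\<bar> < d" by blast
 \<comment> \<open>The approximation is known on the cell; periodicity of both functions extends it
   to the dilated argument, which runs far outside.\<close>
 have G': "\<bar>F x y - G x y\<bar> < d" if "x : cell" for x y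
  using G(2)[OF that frac_cell(1)[of y]] periodic_int[OF p frac_cell(2), of x y] periodic_int[OF txp_props(2)[OF G(1)] frac_cell(2), of x y]
  by simp
 have ci: "tintegrable (%x. \<bar>w x\<bar>)" using sqi_integrable[OF w] by simp
 have est: "\<bar>tint (%x. w x * a x) - tint (%x. w x * b x)\<bar> <= d * I"
  if "continuous_on cell a" "continuous_on cell b" "!!x. x : cell ==> \<bar>a x - b x\<bar> <= d" for a b
 proof -
  have "\<bar>tint (%x. w x * a x) - tint (%x. w x * b x)\<bar> = \<bar>tint (%x. w x * a x - w x * b x)\<bar>"
   by (simp add: sqi_mult_cont[OF w] that)
  also have "... <= tint (%x. \<bar>w x * a x - w x * b x\<bar>)" by (rule integral_abs_bound)
  also have "... <= tint (%x. d * \<bar>w x\<bar>)"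
  proof (rule integral_mono)
   show "tintegrable (%x. \<bar>w x * a x - w x * b x\<bar>)"
    by (intro Bochner_Integration.integrable_abs Bochner_Integration.integrable_diff sqi_mult_cont[OF w] that)
   fix x :: "real^'n" assume "x : space lc"
   hence "\<bar>w x\<bar> * \<bar>a x - b x\<bar> <= \<bar>w x\<bar> * d" using that(3) by (intro mult_left_mono) auto
   thus "\<bar>w x * a x - w x * b x\<bar> <= d * \<bar>w x\<bar>"
    by (simp only: right_diff_distrib[symmetric] abs_mult mult.commute[of d])
  qed (use ci in simp)
  finally show ?thesis by (simp add: I_def)
 qed
 note cG = txp_props(1)[OF G(1)]
 have tF: "tintegrable (F x)" and tG: "tintegrable (G x)" for x
  by (rule tintegrable_cont(3)[OF cont_slices(1)[of F, OF c]], rule tintegrable_cont(3)[OF cont_slices(1)[of G, OF cG]])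
 have 1: "\<bar>tint (%x. w x * F x (real (Suc N) *R x)) - tint (%x. w x * G x (real (Suc N) *R x))\<bar> <= d * I" for N
  by (rule est) (rule cont_slices(2)[of F, OF c], rule cont_slices(2)[of G, OF cG], rule less_imp_le[OF G'])
 have 2: "\<bar>tint (%x. w x * tint (F x)) - tint (%x. w x * tint (G x))\<bar> <= d * I"
 proof (rule est)
  fix x :: "real^'n" assume x: "x : cell"
  have "\<bar>tint (F x) - tint (G x)\<bar> = \<bar>tint (%y. F x y - G x y)\<bar>" using tF tG by simp
  also have "... <= tint (%y. \<bar>F x y - G x y\<bar>)" by (rule integral_abs_bound)
  also have "... <= tint (%y::real^'n. d)"
   using tF[of x] tG[of x] less_imp_le[OF G'[OF x]] by (intro integral_mono) auto
  finally show "\<bar>tint (F x) - tint (G x)\<bar> <= d" by (simp only: tint_const)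
 qed (rule tint_param_cont[of F, OF cont_slices(3)[of F, OF c]], rule tint_param_cont[of G, OF cont_slices(3)[of G, OF cG]])
 obtain N0 where N0: "!!N. N >= N0 ==> norm (tint (%x. w x * G x (real (Suc N) *R x)) - tint (%x. w x * tint (G x))) < e/3"
  using LIMSEQ_D[OF osc_mean_txp[OF G(1) w], of "e/3"] e by auto
 show "EX no. ALL n>=no. norm (tint (%x. w x * F x (real (Suc n) *R x)) - tint (%x. w x * tint (F x))) < e"
 proof (intro exI[of _ N0] allI impI)
  fix n assume "N0 <= n"
  thus "norm (tint (%x. w x * F x (real (Suc n) *R x)) - tint (%x. w x * tint (F x))) < e"
   using N0[of n] 1[of n] 2 d(2) unfolding real_norm_def by linarith
 qed
qed

lemma pw_inner: "bpw A K ==> pw A u \<bullet> v = tint (%x. A x (fn u x) \<bullet> fn v x)"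
 unfolding pw_def by (rule inner_left[OF sqi_pw[OF _ sqi_fn]])

lemma pw_pw: assumes "bpw A K" "bpw B L" shows "pw A (pw B u) = pw (%x v. A x (B x v)) u"
 unfolding pw_def[of B] pw_tol2[OF assms(1) sqi_pw[OF assms(2) sqi_fn]] by (simp add: pw_def)

lemma pw_cong_id: assumes "!!x v. x : cell ==> A x v = v" "bpw A K" shows "pw A u = u"
proof (rule l2_eqI)
 show "AE x in lc. fn (pw A u) x = fn u x"
  using fn_pw[OF assms(2), of u] AE_space by eventually_elim (use assms(1) in auto)
qed

lemma norm_tol2_mono:
 assumes "sqi f" "sqi g" "AE x in lc. norm (f x) <= norm (g x)"
 shows "norm (tol2 f) <= norm (tol2 g)"
proof (rule power2_le_imp_le)
 have "tint (%x. (norm (f x))^2) <= tint (%x. (norm (g x))^2)"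
  by (rule integral_mono_AE) (use assms in \<open>auto simp: sqi_def elim: AE_mp intro!: AE_I2 power_mono\<close>)
 thus "(norm (tol2 f))^2 <= (norm (tol2 g))^2" using assms by (simp add: norm_tol2_sq)
qed simp

lemma sqi_dominated:
 fixes f :: "real^'n => 'b::euclidean_space" and g :: "real^'n => 'c::euclidean_space"
 assumes "f : bmc" "sqi g" "AE x in lc. norm (f x) <= norm (g x)"
 shows "sqi f"
 unfolding sqi_def
proof
 show "integrable lc (%x. (norm (f x))^2)"
 proof (rule integrable_dom)
  show "integrable lc (%x. (norm (g x))^2)" using assms by (simp add: sqi_def)
  show "AE x in lc. norm ((norm (f x))^2) <= norm ((norm (g x))^2)"
   using assms(3) by eventually_elim (auto intro: power_mono)
 qed (use assms in measurable)
qed (rule assms)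

lemma l2_dct:
 fixes F :: "nat => real^'n => 'b::euclidean_space"
 assumes m: "!!n. F n : bmc" and w: "sqi w" and f: "f : bmc"
  and lim: "AE x in lc. (%n. F n x) ----> f x"
  and bd: "!!n. AE x in lc. norm (F n x) <= (w x :: real)"
 shows "sqi f" "!!n. sqi (F n)" "(%n. tol2 (F n)) ----> tol2 f"
proof -
 have allbd: "AE x in lc. ALL n. norm (F n x) <= w x" using bd by (simp add: AE_all_countable)
 have fb: "AE x in lc. norm (f x) <= w x"
  using allbd lim
 proof eventually_elim
  case (elim x)
  show ?case by (rule LIMSEQ_le_const2[OF tendsto_norm[OF elim(2)]]) (use elim in auto)
 qed
 show sf: "sqi f" by (rule sqi_dominated[OF f w]) (use fb in \<open>auto elim: AE_mp\<close>)
 show sF: "sqi (F n)" for n by (rule sqi_dominated[OF m w]) (use bd[of n] in \<open>auto elim: AE_mp\<close>)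
 have "(%n. tint (%x. (norm (F n x - f x))^2)) ----> tint (%x::real^'n. 0)"
 proof (rule integral_dominated_convergence[where w="%x. (2 * w x)^2"])
  show "tintegrable (%x. (2 * w x)^2)" using sqi_scale[OF w, of 2] by (simp add: sqi_def)
  show "AE x in lc. (%n. (norm (F n x - f x))^2) ----> 0"
   using lim
  proof eventually_elim
   case (elim x)
   have "(%n. (norm (F n x - f x))^2) ----> (norm (f x - f x))^2" by (intro tendsto_intros elim)
   thus ?case by simp
  qed
  show "AE x in lc. norm ((norm (F n x - f x))^2) <= (2 * w x)^2" for n
   using allbd fb
  proof eventually_elim
   case (elim x)
   have "norm (F n x - f x) <= norm (F n x) + norm (f x)" by (rule norm_triangle_ineq4)
   also have "... <= 2 * w x" using elim by (smt (verit))
   finally have "(norm (F n x - f x))^2 <= (2 * w x)^2" by (rule power_mono) simp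
   thus ?case by simp
  qed
 qed (use m f in measurable)
 moreover have "tint (%x. (norm (F n x - f x))^2) = (norm (tol2 (F n) - tol2 f))^2" for n
  by (simp add: diff_tol2[OF sF sf] norm_tol2_sq[OF sqi_diff[OF sF sf]])
 ultimately have "(%n. (norm (tol2 (F n) - tol2 f))^2) ----> 0" by simp
 hence "(%n. sqrt ((norm (tol2 (F n) - tol2 f))^2)) ----> sqrt 0" by (rule tendsto_real_sqrt)
 thus "(%n. tol2 (F n)) ----> tol2 f" by (simp add: LIM_zero_iff tendsto_norm_zero_iff)
qed

section \<open>The chain rule in the Sobolev space\<close>

lemma W0_repr:
 assumes "z : W0" obtains phi g where "C1p phi g" "z = (tol2 phi, tol2 g)"
proof -
 have "EX phi g. C1p phi g & z = (tol2 phi, tol2 g)"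
  using assms unfolding W0_def
 proof (induction rule: span_induct_alt)
  case base
  have "C1p (%x. 0) (%x. 0 :: real^'a)" by (simp add: C1p_def periodic_def)
  thus ?case by (intro exI[of _ "%x. 0"]) (auto simp: zero_tol2[symmetric] zero_prod_def)
 next
  case (step c y z)
  then obtain k phi g where y: "y = (ecas k 1, ecas (- k) (kv k))" and phi: "C1p phi g" "z = (tol2 phi, tol2 g)" by auto
  have s: "sqi phi" "sqi g" using C1p_cont[OF phi(1)] phi(1) by (auto simp: C1p_def intro: tintegrable_cont(2) continuous_on_subset)
  have "C1p (%x. c * cas k x + phi x) (%x. c *R (cas (- k) x *R kv k) + g x)"
   using phi(1) cas_C1p[of k] unfolding C1p_def
   by (auto simp: periodic_def inner_add_left intro!: continuous_intros cas_cont derivative_eq_intros)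
  moreover have "c *R y + z = (tol2 (%x. c * cas k x + phi x), tol2 (%x. c *R (cas (- k) x *R kv k) + g x))"
   unfolding y phi(2) ecas_def using s add_tol2[OF sqi_scale[OF sqi_ecas[of k "1::real"], of c] s(1)]
    add_tol2[OF sqi_scale[OF sqi_ecas[of "- k" "kv k"], of c] s(2)]
   by (simp add: scaleR_tol2[OF sqi_ecas] del: scaleR_scaleR) (simp add: scaleR_tol2[OF sqi_ecas[of k "1::real", simplified]])
  ultimately show ?case by blast
 qed
 thus ?thesis using that by blast
qed

lemma C1p_in_W1: assumes "C1p phi g" shows "(tol2 phi, tol2 g) : W1"
proof -
 have s: "sqi phi" "sqi g" using C1p_cont[OF assms] assms by (auto simp: C1p_def intro: tintegrable_cont(2) continuous_on_subset)
 show ?thesis unfolding W1_iff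
  by (rule has_weak_grad_AE[OF C1p_weak_grad[OF assms]]) (use fn_tol2[OF s(1)] fn_tol2[OF s(2)] in \<open>auto elim: AE_mp\<close>)
qed

lemma C1p_compose:
 assumes "C1p phi g" "!!s. (\<Psi> has_real_derivative \<Psi>' s) (at s)" "continuous_on UNIV \<Psi>'"
 shows "C1p (%x. \<Psi> (phi x)) (%x. \<Psi>' (phi x) *R g x)"
proof -
 have "((%x. \<Psi> (phi x)) has_derivative (%v. \<Psi>' (phi x) * (g x \<bullet> v))) (at x)" for x
  using assms(1) by (intro has_derivative_compose[OF _ assms(2)[unfolded has_field_derivative_def]]) (auto simp: C1p_def)
 hence d: "((%x. \<Psi> (phi x)) has_derivative (%v. (\<Psi>' (phi x) *R g x) \<bullet> v)) (at x)" for x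
  by (rule has_derivative_eq_rhs) (rule ext, simp)
 have c: "continuous_on UNIV (%x. \<Psi>' (phi x))"
  using continuous_on_compose2[OF assms(3) C1p_cont[OF assms(1)]] by simp
 show ?thesis unfolding C1p_def
 proof (intro conjI allI d)
  show "periodic (%x. \<Psi> (phi x))" using assms(1) by (simp add: C1p_def periodic_def)
  show "continuous_on UNIV (%x. \<Psi>' (phi x) *R g x)" using assms(1) c by (auto simp: C1p_def intro: continuous_on_scaleR)
 qed
qed

text \<open>Smooth pairs approximate the given one. The composed functions converge by the Lipschitz
  bound. In the gradients the factor \<open>\<Psi>'\<close> converges only almost everywhere along a
  subsequence, so it is first paired with the fixed limit gradient and treated by dominated
  convergence (\<open>c2\<close>); the change of gradient is then estimated in norm
  (\<open>c3\<close>).\<close>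

lemma W1_chain:
 fixes u :: "('n::finite, real) l2"
 assumes uG: "(u, G) : W1" and der: "!!s. (\<Psi> has_real_derivative \<Psi>' s) (at s)"
  and cont: "continuous_on UNIV \<Psi>'" and K: "!!s. \<bar>\<Psi>' s\<bar> <= K"
 shows "sqi (%x. \<Psi> (fn u x))" "sqi (%x. \<Psi>' (fn u x) *R fn G x)"
  "(tol2 (%x. \<Psi> (fn u x)), tol2 (%x. \<Psi>' (fn u x) *R fn G x)) : W1"
proof -
 have K0: "0 <= K" using K[of 0] by linarith
 have lip: "\<bar>\<Psi> s - \<Psi> t\<bar> <= K * \<bar>s - t\<bar>" for s t
  using field_differentiable_bound[of UNIV \<Psi> \<Psi>' K s t] der K by (auto intro: has_field_derivative_at_within)
 have c\<Psi>: "continuous_on UNIV \<Psi>" by (intro continuous_at_imp_continuous_on ballI DERIV_isCont[OF der])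
 have m1: "(%x. \<Psi> (f x)) : bmc" "(%x. \<Psi>' (f x)) : bmc"
  if "f : bmc" for f :: "real^'n => real"
  using that borel_measurable_continuous_on[OF c\<Psi> that] borel_measurable_continuous_on[OF cont that] by auto
 show s1: "sqi (%x. \<Psi> (fn u x))"
 proof (rule sqi_dominated[OF m1(1)[OF fn_measurable]])
  have "sqi (%x. K * \<bar>fn u x\<bar> + \<bar>\<Psi> 0\<bar>)"
   using sqi_add[OF sqi_scale[of "%x. \<bar>fn u x\<bar>" K] sqi_const[of "\<bar>\<Psi> 0\<bar>"]] sqi_fn[of u] by (simp add: sqi_def)
  thus "sqi (%x. K * \<bar>fn u x\<bar> + \<bar>\<Psi> 0\<bar>)" .
  show "AE x in lc. norm (\<Psi> (fn u x)) <= norm (K * \<bar>fn u x\<bar> + \<bar>\<Psi> 0\<bar>)"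
  proof (rule AE_I2)
   fix x show "norm (\<Psi> (fn u x)) <= norm (K * \<bar>fn u x\<bar> + \<bar>\<Psi> 0\<bar>)" using lip[of "fn u x" 0] K0 by auto
  qed
 qed
 have bp: "bpw (%x v. \<Psi>' (f x) *R v :: real^'n) K" if "f : bmc" for f :: "real^'n => real"
  by (rule bpw_scalar[OF m1(2)[OF that]]) (use K K0 in auto)
 show s2: "sqi (%x. \<Psi>' (fn u x) *R fn G x)" by (rule sqi_pw[OF bp sqi_fn]) simp
 obtain Z where Z: "!!n. Z n : W0" "Z ----> (u, G)" using uG unfolding W1_def closure_sequential by blast
 have "EX phi g. C1p phi g & Z n = (tol2 phi, tol2 g)" for n using W0_repr[OF Z(1)[of n]] by blast
 then obtain phi g where phi: "!!n. C1p (phi n) (g n)" "!!n. Z n = (tol2 (phi n), tol2 (g n))" by metis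
 have s: "sqi (phi n)" "sqi (g n)" for n
  using C1p_cont[OF phi(1)] phi(1)[of n] by (auto simp: C1p_def intro: tintegrable_cont(2) continuous_on_subset)
 have lu: "(%n. tol2 (phi n)) ----> u" and lG: "(%n. tol2 (g n)) ----> G"
  using tendsto_fst[OF Z(2)] tendsto_snd[OF Z(2)] by (simp_all add: phi(2))
 obtain r where r: "strict_mono r" "AE x in lc. (%k. fn (tol2 (phi (r k))) x) ----> fn u x"
  using l2_tendsto_AE_subseq[OF lu] by blast
 have "AE x in lc. ALL k. fn (tol2 (phi (r k))) x = phi (r k) x"
  using fn_tol2[OF s(1)] by (simp add: AE_all_countable)
 with r(2) have ae: "AE x in lc. (%k. phi (r k) x) ----> fn u x" by eventually_elim simp
 have lur: "(%k. tol2 (phi (r k))) ----> u" and lGr: "(%k. tol2 (g (r k))) ----> G"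
  using LIMSEQ_subseq_LIMSEQ[OF lu r(1)] LIMSEQ_subseq_LIMSEQ[OF lG r(1)] by (simp_all add: o_def)
 have sP: "sqi (%x. \<Psi> (phi n x))" for n
  by (rule tintegrable_cont(2)[OF continuous_on_subset[OF C1p_cont[OF C1p_compose[OF phi(1) der cont]] subset_UNIV]])
 have sP': "sqi (%x. \<Psi>' (phi n x) *R h x)" if "sqi h" for n and h :: "real^'n => real^'n"
  by (rule sqi_pw[OF bp[OF sqi_measurable[OF s(1)]] that])
 have c1: "(%k. tol2 (%x. \<Psi> (phi (r k) x))) ----> tol2 (%x. \<Psi> (fn u x))"
 proof (rule Lim_transform2[OF tendsto_const], rule Lim_null_comparison)
  show "\<forall>\<^sub>F k in sequentially. norm (tol2 (%x. \<Psi> (fn u x)) - tol2 (%x. \<Psi> (phi (r k) x))) <= K * norm (u - tol2 (phi (r k)))"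
  proof (rule always_eventually, rule allI)
   fix k
   have "norm (tol2 (%x. \<Psi> (fn u x)) - tol2 (%x. \<Psi> (phi (r k) x))) <= norm (tol2 (%x. K *R (fn u x - phi (r k) x)))"
    unfolding diff_tol2[OF s1 sP] using lip K0
    by (intro norm_tol2_mono sqi_diff sqi_scale s1 sP s sqi_fn AE_I2) (auto simp: abs_mult)
   also have "... = K * norm (u - tol2 (phi (r k)))"
    using scaleR_tol2[OF sqi_diff[OF sqi_fn[of u] s(1)[of "r k"]], of K] diff_tol2[OF sqi_fn[of u] s(1)[of "r k"]] K0
    by (metis norm_scaleR abs_of_nonneg tol2_fn)
   finally show "norm (tol2 (%x. \<Psi> (fn u x)) - tol2 (%x. \<Psi> (phi (r k) x))) <= K * norm (u - tol2 (phi (r k)))" .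
  qed
  have "(%k. K * norm (u - tol2 (phi (r k)))) ----> K * norm (u - u)" by (intro tendsto_intros lur)
  thus "(%k. K * norm (u - tol2 (phi (r k)))) ----> 0" by simp
 qed
 have c2: "(%k. tol2 (%x. \<Psi>' (phi (r k) x) *R fn G x)) ----> tol2 (%x. \<Psi>' (fn u x) *R fn G x)"
 proof (rule l2_dct(3))
  show "(%x. \<Psi>' (phi (r n) x) *R fn G x) : bmc" for n by (rule sqi_measurable[OF sP'[OF sqi_fn]])
  show "sqi (%x. K * norm (fn G x))" using sqi_scale[of "%x. norm (fn G x)" K] sqi_fn[of G] by (simp add: sqi_def)
  show "(%x. \<Psi>' (fn u x) *R fn G x) : bmc" by (rule sqi_measurable[OF s2])
  show "AE x in lc. (%n. \<Psi>' (phi (r n) x) *R fn G x) ----> \<Psi>' (fn u x) *R fn G x"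
   using ae
  proof eventually_elim
   case (elim x)
   have "isCont \<Psi>' (fn u x)" using cont by (simp add: continuous_on_eq_continuous_at)
   from isCont_tendsto_compose[OF this elim] show ?case by (intro tendsto_intros)
  qed
  show "AE x in lc. norm (\<Psi>' (phi (r n) x) *R fn G x) <= K * norm (fn G x)" for n
   using K by (intro AE_I2) (auto intro: mult_right_mono)
 qed
 have c3: "(%k. tol2 (%x. \<Psi>' (phi (r k) x) *R g (r k) x)) ----> tol2 (%x. \<Psi>' (fn u x) *R fn G x)"
 proof (rule Lim_transform2[OF c2], rule Lim_null_comparison)
  show "\<forall>\<^sub>F k in sequentially. norm (tol2 (%x. \<Psi>' (phi (r k) x) *R fn G x) - tol2 (%x. \<Psi>' (phi (r k) x) *R g (r k) x)) <= K * norm (G - tol2 (g (r k)))"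
  proof (rule always_eventually, rule allI)
   fix k
   have "tol2 (%x. \<Psi>' (phi (r k) x) *R fn G x) - tol2 (%x. \<Psi>' (phi (r k) x) *R g (r k) x)
    = tol2 (%x. \<Psi>' (phi (r k) x) *R (fn G x - g (r k) x))"
    unfolding diff_tol2[OF sP'[OF sqi_fn] sP'[OF s(2)]] by (simp add: scaleR_diff_right)
   also have "... = pw (%x v. \<Psi>' (phi (r k) x) *R v) (tol2 (%x. fn G x - g (r k) x))"
    by (rule pw_tol2[OF bp[OF sqi_measurable[OF s(1)]] sqi_diff[OF sqi_fn s(2)], symmetric])
   also have "norm ... <= K * norm (tol2 (%x. fn G x - g (r k) x))" by (rule norm_pw[OF bp[OF sqi_measurable[OF s(1)]]])
   also have "tol2 (%x. fn G x - g (r k) x) = G - tol2 (g (r k))" using diff_tol2[OF sqi_fn[of G] s(2)[of "r k"]] by simp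
   finally show "norm (tol2 (%x. \<Psi>' (phi (r k) x) *R fn G x) - tol2 (%x. \<Psi>' (phi (r k) x) *R g (r k) x)) <= K * norm (G - tol2 (g (r k)))" .
  qed
  have "(%k. K * norm (G - tol2 (g (r k)))) ----> K * norm (G - G)" by (intro tendsto_intros lGr)
  thus "(%k. K * norm (G - tol2 (g (r k)))) ----> 0" by simp
 qed
 show "(tol2 (%x. \<Psi> (fn u x)), tol2 (%x. \<Psi>' (fn u x) *R fn G x)) : W1"
  by (rule closed_sequentially[OF W1_closed _ tendsto_Pair[OF c1 c3]]) (rule C1p_in_W1[OF C1p_compose[OF phi(1) der cont]])
qed

lemma DERIV_glue:
 fixes f g :: "real => real"
 assumes "(f has_real_derivative D) (at m)" "(g has_real_derivative D) (at m)" "f m = g m"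
 shows "((%s. if s <= m then f s else g s) has_real_derivative D) (at m)"
proof -
 have "((%h. if h <= 0 then (f (m + h) - f m) / h else (g (m + h) - g m) / h) \<longlongrightarrow> D) (at 0)"
  using assms(1,2) unfolding DERIV_def
  by (intro filterlim_If) (auto intro: tendsto_mono[OF inf_le1])
 moreover have "(%h. if h <= 0 then (f (m + h) - f m) / h else (g (m + h) - g m) / h)
   = (%h. ((if m + h <= m then f (m + h) else g (m + h)) - (if m <= m then f m else g m)) / h)"
  using assms(3) by auto
 ultimately show ?thesis unfolding DERIV_def by simp
qed

lemma DERIV_glue_all:
 fixes f g :: "real => real"
 assumes "!!s. s <= m ==> (f has_real_derivative f' s) (at s)" "!!s. m <= s ==> (g has_real_derivative g' s) (at s)"
  "f m = g m" "f' m = g' m"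
 shows "((%s. if s <= m then f s else g s) has_real_derivative (if s <= m then f' s else g' s)) (at s)"
proof -
 consider "s < m" | "s = m" | "m < s" by linarith
 thus ?thesis
 proof cases
  case 1
  thus ?thesis using has_field_derivative_transform_within_open[OF assms(1)[of s], of "{..<m}"] by auto
 next
  case 2
  have "(f has_real_derivative g' m) (at m)" using assms(1)[of m] assms(4) by simp
  from DERIV_glue[OF this assms(2)[OF order_refl] assms(3)] 2 assms(4) show ?thesis by simp
 next
  case 3
  thus ?thesis using has_field_derivative_transform_within_open[OF assms(2)[of s], of "{m<..}"] by auto
 qed
qed

section \<open>Maximum principle\<close>

text \<open>The logarithm continued below \<open>m\<close> by its tangent line. It is C^1 with
  bounded derivative on the whole line, as the chain rule demands, and coincides with
  \<open>ln\<close> on the range of the solutions.\<close>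

definition lnm :: "real => real => real" where "lnm m s = (if s <= m then ln m + (s - m) / m else ln s)"

lemma lnm_props: assumes "0 < m"
 shows "(lnm m has_real_derivative 1 / max s m) (at s)" "continuous_on UNIV (%s. 1 / max s m)" "\<bar>1 / max s m\<bar> <= 1 / m"
  "m <= s ==> lnm m s = ln s"
proof -
 have "((%s. if s <= m then ln m + (s - m) / m else ln s) has_real_derivative (if s <= m then 1 / m else 1 / s)) (at s)"
  by (rule DERIV_glue_all) (use assms in \<open>auto intro!: derivative_eq_intros\<close>)
 moreover have "(if s <= m then 1 / m else 1 / s) = 1 / max s m" by auto
 ultimately show "(lnm m has_real_derivative 1 / max s m) (at s)" unfolding lnm_def[abs_def] by simp
 show "continuous_on UNIV (%s. 1 / max s m)" by (intro continuous_intros) (use assms in auto)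
 show "\<bar>1 / max s m\<bar> <= 1 / m" using assms by (auto simp: field_simps max_def)
 show "m <= s ==> lnm m s = ln s" using assms by (auto simp: lnm_def)
qed

text \<open>A smooth substitute for the negative part of s - m, whose kink the C^1 chain rule does
  not admit: nonpositive, zero above \<open>m\<close>, strictly negative below. With y the positive
  part of m - s its derivative is y^2 / (1 + y^2); the arctangent is there to keep this below
  one.\<close>

definition cutm :: "real => real => real" where "cutm m s = (if s <= m then - ((m - s) - arctan (m - s)) else 0)"

lemma cutm_props:
 shows "(cutm m has_real_derivative (max 0 (m - s))^2 / (1 + (max 0 (m - s))^2)) (at s)"
  "continuous_on UNIV (%s. (max 0 (m - s))^2 / (1 + (max 0 (m - s))^2))"
  "\<bar>(max 0 (m - s))^2 / (1 + (max 0 (m - s))^2)\<bar> <= 1" "cutm m s <= 0" "s < m ==> cutm m s < 0" "m <= s ==> cutm m s = 0"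
proof -
 have pos: "1 + y^2 ~= 0" for y :: real using zero_le_power2[of y] by linarith
 have "((%s. if s <= m then - ((m - s) - arctan (m - s)) else 0) has_real_derivative
  (if s <= m then (m - s)^2 / (1 + (m - s)^2) else 0)) (at s)"
 proof (rule DERIV_glue_all)
  show "((%s. - ((m - s) - arctan (m - s))) has_real_derivative (m - s)^2 / (1 + (m - s)^2)) (at s)" for s
   using pos[of "m - s"] by (auto intro!: derivative_eq_intros simp: field_simps)
 qed auto
 moreover have "(if s <= m then (m - s)^2 / (1 + (m - s)^2) else 0) = (max 0 (m - s))^2 / (1 + (max 0 (m - s))^2)" by auto
 ultimately show "(cutm m has_real_derivative (max 0 (m - s))^2 / (1 + (max 0 (m - s))^2)) (at s)"
  unfolding cutm_def[abs_def] by simp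
 show "continuous_on UNIV (%s. (max 0 (m - s))^2 / (1 + (max 0 (m - s))^2))"
  by (intro continuous_intros) (use pos in auto)
 show "\<bar>(max 0 (m - s))^2 / (1 + (max 0 (m - s))^2)\<bar> <= 1"
  using zero_le_power2[of "max 0 (m - s)"] by (auto simp: divide_le_eq not_less)
 have at: "arctan y < y" if "0 < y" for y :: real
 proof -
  have "EX z. 0 < z & z < y & arctan y - arctan 0 = (y - 0) * inverse (1 + z^2)"
   by (rule MVT2[OF that]) (rule DERIV_arctan)
  then obtain z where z: "0 < z" "z < y" "arctan y = y * inverse (1 + z^2)" by auto
  have "inverse (1 + z^2) < 1" using z by (simp add: inverse_less_1_iff)
  thus ?thesis using z(3) that by (simp add: mult_less_cancel_left2)
 qed
 show l: "cutm m s < 0" if "s < m" using at[of "m - s"] that by (simp add: cutm_def)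
 show e: "cutm m s = 0" if "m <= s" using that by (auto simp: cutm_def)
 show "cutm m s <= 0" using l e by (cases "s < m") auto
qed

text \<open>The data of the equation p f' = div (D grad f): a weight and a symmetric elliptic matrix
  field. The locale is instantiated for the oscillating problem, for the cell problem at a frozen
  slow variable and for the homogenized problem.\<close>

locale coef =
 fixes p :: "real^'n => real" and D :: "real^'n => real^'n^'n" and p0 p1 d0 d1 :: real
 assumes p_cont: "continuous_on UNIV p" and p0: "0 < p0" and p_lo: "p0 <= p x" and p_hi: "p x <= p1"
  and D_cont: "continuous_on UNIV (%x. D x $ i $ j)" and D_sym: "transpose (D x) = D x"
  and d0: "0 < d0" and D_lo: "d0 * (norm \<xi>)^2 <= \<xi> \<bullet> (D x *v \<xi>)" and D_hi: "norm (D x *v \<xi>) <= d1 * norm \<xi>"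
begin

lemma p_pos: "0 < p x" using p0 p_lo[of x] by linarith
lemma p1_pos: "0 < p1" using p_pos[of 0] p_hi[of 0] by linarith
lemma d1_nonneg: "0 <= d1"
proof -
 have "0 <= d1 * norm (axis undefined 1 :: real^'n)" using D_hi[of 0 "axis undefined 1"] norm_ge_zero order_trans by blast
 thus ?thesis by simp
qed

text \<open>Multiplication by sqrt p maps L2 with weight \<open>p\<close> isometrically onto the
  unweighted space. In the variable u = sqrt p f the equation acquires the symmetric form required
  by \<open>parabolic\<close>; \<open>ip\<close> is the inverse of this map, \<open>pp\<close> its
  square, and \<open>Wp\<close> the gradient graph in the new variable.\<close>

definition "sp = (pw (%x v. sqrt (p x) *R v) :: ('n, real) l2 => _)"
definition "ip = (pw (%x v. (1 / sqrt (p x)) *R v) :: ('n, real) l2 => _)"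
definition "pp = (pw (%x v. p x *R v) :: ('n, real) l2 => _)"
definition "Dm = (pw (%x v. D x *v v) :: ('n, real^'n) l2 => _)"
definition "aD G H = Dm G \<bullet> H"

lemma b_sp: "bpw (%x v :: real. sqrt (p x) *R v) (sqrt p1)"
 by (rule bpw_scalar) (use p_hi p_pos p1_pos in \<open>auto intro!: tintegrable_cont(1) continuous_intros continuous_on_subset[OF p_cont] simp: less_imp_le\<close>)
lemma b_ip: "bpw (%x v :: real. (1 / sqrt (p x)) *R v) (1 / sqrt p0)"
proof (rule bpw_scalar)
 show "(%x. 1 / sqrt (p x)) : bmc"
  by (rule tintegrable_cont(1)) (use p_pos in \<open>auto intro!: continuous_intros continuous_on_subset[OF p_cont] simp: less_imp_neq[symmetric]\<close>)
 show "\<bar>1 / sqrt (p x)\<bar> <= 1 / sqrt p0" for x using p_lo[of x] p0 by (auto intro!: frac_le)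
qed (use p0 in auto)
lemma b_pp: "bpw (%x v :: real. p x *R v) p1"
 by (rule bpw_scalar) (use p_hi p_pos p1_pos in \<open>auto intro!: tintegrable_cont(1) continuous_on_subset[OF p_cont] simp: less_imp_le\<close>)
lemma b_D: "bpw (%x v. D x *v v) d1"
 by (rule bpw_matrix) (use D_hi d1_nonneg in \<open>auto intro!: tintegrable_cont(1) continuous_on_subset[OF D_cont]\<close>)

lemma sp_ip [simp]: "sp (ip u) = u" and ip_sp [simp]: "ip (sp u) = u" and ip_pp: "ip (pp u) = sp u" and sp_sp: "sp (sp u) = pp u"
proof -
 have b1: "bpw (%x v :: real. sqrt (p x) *R (1 / sqrt (p x)) *R v) 1" "bpw (%x v :: real. (1 / sqrt (p x)) *R sqrt (p x) *R v) 1"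
  using p_pos by (auto simp: bpw_def linear_id[unfolded id_def] less_imp_neq[symmetric])
 show "sp (ip u) = u" unfolding sp_def ip_def pw_pw[OF b_sp b_ip]
  by (rule pw_cong_id[OF _ b1(1)]) (use p_pos in \<open>simp add: less_imp_neq[symmetric]\<close>)
 show "ip (sp u) = u" unfolding sp_def ip_def pw_pw[OF b_ip b_sp]
  by (rule pw_cong_id[OF _ b1(2)]) (use p_pos in \<open>simp add: less_imp_neq[symmetric]\<close>)
 have "(1 / sqrt (p x)) * (p x * v) = sqrt (p x) * v" for x v
 proof -
  have "(1 / sqrt (p x)) * (p x * v) = (p x / sqrt (p x)) * v" by simp
  thus ?thesis using p_pos[of x] by (simp only: real_div_sqrt[OF less_imp_le])
 qed
 thus "ip (pp u) = sp u" unfolding sp_def ip_def pp_def pw_pw[OF b_ip b_pp] by (simp add: real_scaleR_def[abs_def])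
 have "(%x v :: real. sqrt (p x) *R sqrt (p x) *R v) = (%x v. p x *R v)"
  using p_pos by (intro ext) (simp add: mult.assoc[symmetric] less_imp_le)
 thus "sp (sp u) = pp u" unfolding sp_def pp_def pw_pw[OF b_sp b_sp] by (simp only:)
qed

lemma bl_sp: "bounded_linear sp" and bl_ip: "bounded_linear ip" and bl_pp: "bounded_linear pp" and bl_Dm: "bounded_linear Dm"
 unfolding sp_def ip_def pp_def Dm_def by (rule bounded_linear_pw[OF b_sp] bounded_linear_pw[OF b_ip] bounded_linear_pw[OF b_pp] bounded_linear_pw[OF b_D])+

lemma pp_inner: "pp u \<bullet> v = tint (%x. p x * fn u x * fn v x)" unfolding pp_def pw_inner[OF b_pp] by simp
lemma sp_inner: "sp u \<bullet> v = u \<bullet> sp v"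
proof -
 have "sp u \<bullet> v = tint (%x. sqrt (p x) * fn u x * fn v x)" unfolding sp_def pw_inner[OF b_sp] by simp
 also have "... = sp v \<bullet> u" unfolding sp_def pw_inner[OF b_sp] by (simp add: mult_ac)
 finally show ?thesis by (simp add: inner_commute)
qed
lemma pp_ip: "pp u \<bullet> ip w = sp u \<bullet> w"
 using sp_inner[of "sp u" "ip w"] by (simp add: sp_sp)

lemma aD_int: "aD G H = tint (%x. (D x *v fn G x) \<bullet> fn H x)"
 unfolding aD_def Dm_def by (rule pw_inner[OF b_D])

lemma aD_right: "sqi f ==> aD G (tol2 f) = tint (%x. (D x *v fn G x) \<bullet> f x)"
 unfolding aD_def Dm_def pw_def by (rule inner_tol2[OF sqi_pw[OF b_D sqi_fn]])

lemma D_inner: "(D x *v v) \<bullet> w = (D x *v w) \<bullet> v"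
 by (metis D_sym dot_lmul_matrix inner_commute vector_transpose_matrix)

lemma aD_sym: "aD G H = aD H G" unfolding aD_int using D_inner by simp

lemma aD_bb: "bounded_bilinear aD"
 unfolding aD_def by (rule bounded_bilinear.comp1[OF bounded_bilinear_inner bl_Dm])

lemma aD_coer: "d0 * (norm G)^2 <= aD G G"
proof -
 have "d0 * (norm G)^2 = tint (%x. d0 * (norm (fn G x))^2)" by (simp add: norm_l2_sq)
 also have "... <= tint (%x. (D x *v fn G x) \<bullet> fn G x)"
  using D_lo sqi_fn[of G] by (intro integral_mono sqi_inner sqi_pw[OF b_D]) (auto simp: sqi_def inner_commute)
 finally show ?thesis by (simp add: aD_int)
qed

lemma aD_le: "\<bar>aD G H\<bar> <= d1 * norm G * norm H"
proof -
 have n: "norm (Dm G) <= d1 * norm G" unfolding Dm_def by (rule norm_pw[OF b_D])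
 have "\<bar>aD G H\<bar> <= norm (Dm G) * norm H" unfolding aD_def by (rule Cauchy_Schwarz_ineq2)
 also have "... <= (d1 * norm G) * norm H" by (rule mult_right_mono[OF n norm_ge_zero])
 finally show ?thesis .
qed

definition "Wp = {z. (ip (fst z), snd z) : W1}"

lemma Wp_iff: "(u, G) : Wp \<longleftrightarrow> (ip u, G) : W1" by (simp add: Wp_def)

lemma PN_dom: "EX H. (PN N v, H) : W0"
proof -
 define S where "S = (SUM k:Kb N. (ecas k (cf k v), ecas (- k) (cf k v *R kv k)))"
 have "S : W0"
  unfolding W0_def S_def by (intro span_sum) (use W0_basis in \<open>simp add: W0_def\<close>)
 moreover have "fst S = PN N v" by (simp add: S_def fst_sum PN_def)
 hence "S = (PN N v, snd S)" by (simp add: prod_eq_iff)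
 ultimately have "(PN N v, snd S) : W0" by simp
 thus ?thesis by blast
qed

lemma parabolic_Wp: "parabolic Wp aD d0"
proof (rule parabolic.intro)
 interpret ip: bounded_linear ip by (rule bl_ip)
 show "subspace Wp"
 proof (rule subspaceI)
  show "0 : Wp" using subspace_0[OF W1_subspace] by (simp add: Wp_def ip.zero zero_prod_def)
  show "x + y : Wp" if "x : Wp" "y : Wp" for x y
   using subspace_add[OF W1_subspace, of "(ip (fst x), snd x)" "(ip (fst y), snd y)"] that by (simp add: Wp_def ip.add)
  show "c *R x : Wp" if "x : Wp" for c x
   using subspace_scale[OF W1_subspace, of "(ip (fst x), snd x)" c] that by (simp add: Wp_def ip.scaleR)
 qed
 have "continuous_on UNIV (%z. (ip (fst z), snd z))"
  by (intro continuous_on_Pair ip.continuous_on continuous_on_fst continuous_on_snd continuous_on_id)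
 hence "closed ((%z. (ip (fst z), snd z)) -` W1)" by (rule closed_vimage[OF W1_closed])
 thus "closed Wp" by (simp add: Wp_def vimage_def)
 show "closure (fst ` Wp) = UNIV"
 proof (intro set_eqI iffI UNIV_I)
  fix u :: "('n, real) l2"
  have "sp (PN N (ip u)) : fst ` Wp" for N
  proof -
   obtain H where "(PN N (ip u), H) : W0" using PN_dom by blast
   hence "(sp (PN N (ip u)), H) : Wp" using W0_sub by (auto simp: Wp_iff)
   thus ?thesis by force
  qed
  moreover have "(%N. sp (PN N (ip u))) ----> sp (ip u)" by (rule bounded_linear.tendsto[OF bl_sp PN_tendsto])
  ultimately show "u : closure (fst ` Wp)" unfolding closure_sequential by (auto intro!: exI[of _ "%N. sp (PN N (ip u))"])
 qed
qed (rule aD_bb, rule aD_sym, rule d0, rule aD_coer)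

sublocale par: parabolic Wp aD d0 by (rule parabolic_Wp)

text \<open>The pointwise bounds on f, rewritten for u = sqrt p f.\<close>

definition "Klo m = {u. AE x in lc. m * sqrt (p x) <= fn u x}"
definition "Khi m = {u. AE x in lc. fn u x <= m * sqrt (p x)}"

lemma closed_Klo: "closed (Klo m)"
 unfolding closed_sequential_limits
proof (intro allI impI, elim conjE)
 fix X u assume X: "ALL n. X n : Klo m" "X ----> u"
 obtain r where r: "strict_mono r" "AE x in lc. (%k. fn (X (r k)) x) ----> fn u x"
  using l2_tendsto_AE_subseq[OF X(2)] by blast
 have "AE x in lc. ALL n. m * sqrt (p x) <= fn (X (r n)) x"
  using X(1) by (simp add: AE_all_countable Klo_def)
 with r(2) have "AE x in lc. m * sqrt (p x) <= fn u x"
 proof eventually_elim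
  case (elim x)
  show ?case by (rule LIMSEQ_le_const[OF elim(1)]) (use elim(2) in auto)
 qed
 thus "u : Klo m" by (simp add: Klo_def)
qed

lemma fn_minus: "AE x in lc. fn (- u) x = - fn u x"
 using fn_scaleR[of "-1" u] by simp

lemma Khi_Klo: "u : Khi m \<longleftrightarrow> - u : Klo (- m)"
 unfolding Khi_def Klo_def mem_Collect_eq using fn_minus[of u] by (auto elim: AE_mp)

lemma closed_Khi: "closed (Khi m)"
proof -
 have "Khi m = uminus -` Klo (- m)" using Khi_Klo by auto
 thus ?thesis using closed_vimage[OF closed_Klo] continuous_on_minus[OF continuous_on_id] by metis
qed

text \<open>Weak maximum principle for one step: test with \<open>cutm m\<close> of the solution z.
  The form contributes a nonnegative amount, since the gradient of the test function is a
  nonnegative multiple of that of z. What remains is a nonpositive integral of the nonnegative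
  function p (z - m) \<open>cutm m\<close> z, which therefore vanishes and forces z to be at least
  \<open>m\<close>.\<close>

lemma resolvent_Klo: assumes \<mu>: "0 < \<mu>" and u: "u : Klo m" shows "par.R \<mu> u : Klo m"
proof -
 define z where "z = ip (par.R \<mu> u)"
 have zG: "(z, par.Gr \<mu> u) : W1" using par.R_in[OF \<mu>, of u] by (simp add: Wp_iff z_def)
 let ?G = "par.Gr \<mu> u"
 let ?psi = "%s. (max 0 (m - s))^2 / (1 + (max 0 (m - s))^2)"
 define w where "w = tol2 (%x. cutm m (fn z x))"
 define H where "H = tol2 (%x. ?psi (fn z x) *R fn ?G x)"
 note ch = W1_chain[OF zG cutm_props(1)[of m] cutm_props(2)[of m] cutm_props(3)[of m]]
 have wH: "(w, H) : W1" unfolding w_def H_def by (rule ch(3))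
 hence "(sp w, H) : Wp" by (simp add: Wp_iff)
 from par.R_eq[OF \<mu> this, of u] have eq: "par.R \<mu> u \<bullet> sp w + \<mu> * aD ?G H = u \<bullet> sp w" .
 have "0 <= aD ?G H"
 proof -
  have "aD ?G H = tint (%x. (D x *v fn ?G x) \<bullet> (?psi (fn z x) *R fn ?G x))"
   unfolding H_def by (rule aD_right[OF ch(2)])
  also have "0 <= ..."
  proof (rule Bochner_Integration.integral_nonneg_AE, rule AE_I2)
   fix x
   have "0 <= fn ?G x \<bullet> (D x *v fn ?G x)" using D_lo[of "fn ?G x" x] d0 by (smt (verit) mult_nonneg_nonneg zero_le_power2)
   thus "0 <= (D x *v fn ?G x) \<bullet> (?psi (fn z x) *R fn ?G x)" by (simp add: inner_commute)
  qed
  finally show ?thesis .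
 qed
 hence le: "(sp (par.R \<mu> u) - sp u) \<bullet> w <= 0" using eq \<mu> sp_inner[of "par.R \<mu> u" w] sp_inner[of u w]
  by (simp add: inner_diff_left) (smt (verit) mult_nonneg_nonneg)
 have spz: "sp (par.R \<mu> u) = pp z" by (simp add: z_def sp_sp[symmetric])
 define c where "c = tol2 (%x. p x * m)"
 have sc: "sqi (%x. p x * m)" by (rule tintegrable_cont(2)) (intro continuous_intros continuous_on_subset[OF p_cont] subset_UNIV)
 have int: "tintegrable (%x. p x * (fn z x - m) * cutm m (fn z x))"
 proof -
  have "sqi (%x. p x *R fn z x - p x * m)" by (intro sqi_diff sc sqi_pw[OF b_pp sqi_fn])
  from sqi_inner[OF this ch(1)] show ?thesis by (simp add: right_diff_distrib)
 qed
 have "tint (%x. p x * (fn z x - m) * cutm m (fn z x)) <= (pp z - sp u) \<bullet> w"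
 proof -
  have fpp: "AE x in lc. fn (pp z - sp u) x = p x * fn z x - sqrt (p x) * fn u x"
   using fn_diff[of "pp z" "sp u"] fn_pw[OF b_pp, of z] fn_pw[OF b_sp, of u]
   unfolding pp_def sp_def by eventually_elim simp
  have "(pp z - sp u) \<bullet> w = tint (%x. fn (pp z - sp u) x * cutm m (fn z x))"
   unfolding w_def using inner_right[OF ch(1), of "pp z - sp u"] by simp
  moreover have "tint (%x. p x * (fn z x - m) * cutm m (fn z x)) <= tint (%x. fn (pp z - sp u) x * cutm m (fn z x))"
  proof (rule integral_mono_AE[OF int])
   show "tintegrable (%x. fn (pp z - sp u) x * cutm m (fn z x))" using sqi_inner[OF sqi_fn[of "pp z - sp u"] ch(1)] by simp
   show "AE x in lc. p x * (fn z x - m) * cutm m (fn z x) <= fn (pp z - sp u) x * cutm m (fn z x)"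
    using fpp u[unfolded Klo_def mem_Collect_eq]
   proof eventually_elim
    case (elim x)
    have "sqrt (p x) * (m * sqrt (p x)) <= sqrt (p x) * fn u x" using elim(2) p_pos[of x] by (intro mult_left_mono) auto
    hence "p x * m <= sqrt (p x) * fn u x" using p_pos[of x] by (simp add: mult.left_commute less_imp_le mult.commute)
    hence "fn (pp z - sp u) x <= p x * (fn z x - m)" using elim(1) by (simp add: algebra_simps)
    thus ?case using cutm_props(4)[of m "fn z x"] by (rule mult_right_mono_neg)
   qed
  qed
  ultimately show ?thesis by simp
 qed
 hence le2: "tint (%x. p x * (fn z x - m) * cutm m (fn z x)) <= 0" using le by (simp add: spz)
 have nn: "AE x in lc. 0 <= p x * (fn z x - m) * cutm m (fn z x)"
 proof (rule AE_I2)
  fix x show "0 <= p x * (fn z x - m) * cutm m (fn z x)"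
   using cutm_props(4,6)[of m "fn z x"] p_pos[of x]
   by (cases "m <= fn z x") (auto simp: zero_le_mult_iff mult_le_0_iff)
 qed
 have "0 <= tint (%x. p x * (fn z x - m) * cutm m (fn z x))" by (rule Bochner_Integration.integral_nonneg_AE[OF nn])
 hence "tint (%x. p x * (fn z x - m) * cutm m (fn z x)) = 0" using le2 by simp
 hence ae0: "AE x in lc. p x * (fn z x - m) * cutm m (fn z x) = 0"
  using integral_nonneg_eq_0_iff_AE[OF int nn] by blast
 have "AE x in lc. fn (par.R \<mu> u) x = sqrt (p x) * fn z x"
  using fn_pw[OF b_sp, of z] unfolding z_def sp_def[symmetric] sp_ip by simp
 with ae0 have "AE x in lc. m * sqrt (p x) <= fn (par.R \<mu> u) x"
 proof eventually_elim
  case (elim x)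
  have "m <= fn z x" using elim(1) cutm_props(5)[of "fn z x" m] p_pos[of x] by (cases "m <= fn z x") auto
  thus ?case using elim(2) p_pos[of x] by (simp add: mult.commute mult_left_mono less_imp_le)
 qed
 thus ?thesis by (simp add: Klo_def)
qed

lemma resolvent_Khi: assumes \<mu>: "0 < \<mu>" and u: "u : Khi m" shows "par.R \<mu> u : Khi m"
 using resolvent_Klo[OF \<mu>, of "- u" "- m"] u par.R_scaleR[OF \<mu>, of "-1" u] by (simp add: Khi_Klo)

end

section \<open>From weak solutions to regular flows\<close>

lemma wgrad_measurable:
 fixes u :: "real^'n => real"
 assumes "EX g. has_weak_grad u g" shows "wgrad u : bmc"
proof -
 have "(%x. wgrad u x $ i) : bmc" for i
  using wgrad_weak[OF assms] by (simp add: has_weak_grad_def borel_measurable_integrable)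
 thus ?thesis by (subst borel_measurable_euclidean_space) (auto simp: Basis_vec_def inner_axis)
qed

text \<open>Extends an identity tested with the functions \<open>cas k\<close> to all pairs in
  \<open>W1\<close> by linearity and closure.\<close>

lemma W1_functional_zero:
 assumes L: "bounded_linear L" and gen: "!!k. L (ecas k 1, ecas (- k) (kv k)) = (0::real)" and z: "z : W1"
 shows "L z = 0"
proof -
 interpret L: bounded_linear L by fact
 have "L z = 0" if "z : W0" for z
  by (rule linear_eq_0_on_span[OF L.linear_axioms _ that[unfolded W0_def]]) (use gen in auto)
 moreover have "closed {z. L z = 0}"
  by (rule closed_Collect_eq[OF L.continuous_on[OF continuous_on_id] continuous_on_const])
 ultimately have "W1 \<subseteq> {z. L z = 0}" unfolding W1_def by (intro closure_minimal) auto
 thus ?thesis using z by blast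
qed

text \<open>For a bounded curve the pairing with \<open>psi\<close> is a uniform limit of pairings
  with Fourier truncations of \<open>psi\<close>, which are continuous by hypothesis.\<close>

lemma continuous_on_inner_from_cas:
 fixes g :: "real => ('n::finite, real) l2"
 assumes b: "!!t. t : S ==> norm (g t) <= C" and c: "!!k. continuous_on S (%t. g t \<bullet> ecas k 1)"
 shows "continuous_on S (%t. g t \<bullet> psi)"
proof (cases "S = {}")
 case False
 hence C: "0 <= C" using b norm_ge_zero order_trans by blast
 have PN: "PN N psi = (SUM k:Kb N. cf k psi *R ecas k 1)" for N
  unfolding PN_def by (intro sum.cong refl) (metis linear_cmul[OF linear_ecas] mult.right_neutral real_scaleR_def)
 have "uniform_limit S (%N t. g t \<bullet> PN N psi) (%t. g t \<bullet> psi) sequentially"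
 proof (rule uniform_limitI)
  fix e :: real assume e: "0 < e"
  have "\<forall>\<^sub>F N in sequentially. dist (PN N psi) psi < e / (C + 1)"
   using PN_tendsto[of psi] e C by (intro tendstoD) auto
  thus "\<forall>\<^sub>F N in sequentially. ALL t:S. dist (g t \<bullet> PN N psi) (g t \<bullet> psi) < e"
  proof (eventually_elim, intro ballI)
   fix N t assume N: "dist (PN N psi) psi < e / (C + 1)" and t: "t : S"
   have "dist (g t \<bullet> PN N psi) (g t \<bullet> psi) = \<bar>g t \<bullet> (PN N psi - psi)\<bar>" by (simp add: dist_real_def inner_diff_right)
   also have "... <= norm (g t) * norm (PN N psi - psi)" by (rule Cauchy_Schwarz_ineq2)
   also have "... <= C * (e / (C + 1))" using b[OF t] N C by (intro mult_mono) (auto simp: dist_norm)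
   also have "... < e" using e C by (simp add: field_simps)
   finally show "dist (g t \<bullet> PN N psi) (g t \<bullet> psi) < e" .
  qed
 qed
 thus ?thesis
  by (rule uniform_limit_theorem[rotated])
    (auto simp: PN inner_sum_right intro!: always_eventually continuous_intros c)
qed simp

context coef
begin

lemma norm_sp: "norm (sp u) <= sqrt p1 * norm u" unfolding sp_def by (rule norm_pw[OF b_sp])
lemma norm_ip: "norm (ip u) <= 1 / sqrt p0 * norm u" unfolding ip_def by (rule norm_pw[OF b_ip])
lemma norm_pp: "norm (pp u) <= p1 * norm u" unfolding pp_def by (rule norm_pw[OF b_pp])
lemma fn_sp: "AE x in lc. fn (sp u) x = sqrt (p x) * fn u x"
 using fn_pw[OF b_sp, of u] unfolding sp_def by eventually_elim (erule trans, rule real_scaleR_def)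

text \<open>The regularity that survives the limit when the constants are uniform. The clause on
  \<open>aD (G t) k\<close> bounds the flux by the L2 norm of the potential \<open>w\<close> instead
  of that of its gradient \<open>k\<close>, so it says that the divergence of the flux is bounded in
  L2; it holds at every time, as do the pointwise bounds, and the equation is stated in integrated
  form.\<close>

definition flow :: "real => real => real => real => (real => ('n, real) l2) => (real => ('n, real^'n) l2) => bool" where
 "flow T L m1 m2 f G \<longleftrightarrow> (ALL t:{0..T}. (f t, G t) : W1 & (ALL w k. (w, k) : W1 --> \<bar>aD (G t) k\<bar> <= L * norm w) \<and>
   (AE x in lc. m1 <= fn (f t) x & fn (f t) x <= m2) \<and>
   (ALL s:{0..T}. norm (f t - f s) <= L * \<bar>t - s\<bar>) \<and>
   (ALL z:W1. ((%s. aD (G s) (snd z)) has_integral (- ((pp (f t) - pp (f 0)) \<bullet> fst z))) {0..t}))"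

text \<open>In the variable u = sqrt p f the weak formulation becomes an \<open>evolution\<close>.
  The bounds on the data put u at time zero into the domain of the operator, with image of norm at
  most sqrt K; then \<open>lipschitz\<close>, \<open>slice_regularity\<close> and
  \<open>invariant_set\<close> provide the clauses of \<open>flow\<close>. The two conditions on
  \<open>L\<close> come from going back to f: sqrt p1 enters the flux bound, 1 / sqrt p0 the bound
  on time increments.\<close>

lemma FP_flow:
 assumes T: "0 < T" and DM: "!!x. D x = p x *R M x" and fp: "FP_solution M p T \<rho>"
  and init: "!!x. x : cell ==> a <= \<rho> 0 x & \<rho> 0 x <= b" and a: "0 < a"
  and h: "is_initial_dt M p (%x. \<rho> 0 x / p x) h"
  and K: "0 <= K" "tnn (%x. (h x)^2 * p x) <= ennreal K"
   "tnn (%x. wgrad (%y. \<rho> 0 y / p y) x \<bullet> (p x *R (M x *v wgrad (%y. \<rho> 0 y / p y) x))) <= ennreal K"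
  and L: "sqrt K * sqrt p1 <= L" "sqrt K / sqrt p0 <= L"
 shows "!!t. t : {0..T} ==> sqi (%x. \<rho> t x / p x)"
  "EX G. flow T L (a / p1) (b / p0) (%t. tol2 (%x. \<rho> t x / p x)) G"
proof -
 interpret sp: bounded_linear sp by (rule bl_sp)
 interpret ip: bounded_linear ip by (rule bl_ip)
 interpret pp: bounded_linear pp by (rule bl_pp)
 interpret aD: bounded_bilinear aD by (rule aD_bb)
 have dens: "!!t. t : {0..T} ==> is_density (\<rho> t)"
  and wg: "!!t. t : {0..T} ==> EX g. has_weak_grad (%x. \<rho> t x / p x) g"
  and en: "(\<integral>\<^sup>+t\<in>{0..T}. tnn (%x. (norm (wgrad (%x. \<rho> t x / p x) x))^2) \<partial>lborel) < \<infinity>"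
  and ti: "!!phi t. test_fun phi ==> t : {0..T} ==> tintegrable (%x. p x * ((M x *v wgrad (%x. \<rho> t x / p x) x) \<bullet> pgrad phi x))"
  and Li: "!!phi. test_fun phi ==> integrable (lebesgue_on {0..T}) (%t. tint (%x. p x * ((M x *v wgrad (%x. \<rho> t x / p x) x) \<bullet> pgrad phi x)))"
  and eq: "!!phi t. test_fun phi ==> t : {0..T} ==> tint (%x. \<rho> t x * phi x) - tint (%x. \<rho> 0 x * phi x) =
    - integral\<^sup>L (lebesgue_on {0..t}) (%s. tint (%x. p x * ((M x *v wgrad (%x. \<rho> s x / p x) x) \<bullet> pgrad phi x)))"
  using fp unfolding FP_solution_def by blast+
 obtain C' where C': "!!t. t : {0..T} ==> tnn (%x. (\<rho> t x / p x)^2 * p x) <= ennreal C'"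
  using fp unfolding FP_solution_def by blast
 define C where "C = sqrt (\<bar>C'\<bar> / p0)"
 define f where "f t = tol2 (%x. \<rho> t x / p x)" for t
 have pm [measurable]: "p : bmc" by (rule tintegrable_cont(1)[OF continuous_on_subset[OF p_cont subset_UNIV]])
 have fm [measurable]: "(%x. \<rho> t x / p x) : bmc" if "t : {0..T}" for t
 proof -
  have "tintegrable (\<rho> t)" using dens[OF that] by (simp add: is_density_def)
  from borel_measurable_divide[OF borel_measurable_integrable[OF this] pm] show ?thesis .
 qed
 have weight: "tnn (%x. (norm (q x))^2) <= ennreal ((sqrt (c / p0))^2)"
  if q: "q : bmc" and le: "tnn (%x. (q x)^2 * p x) <= ennreal c" and c: "0 <= c" for q :: "real^'n => real" and c
 proof -
  have "ennreal p0 * tnn (%x. (norm (q x))^2) = tnn (%x. p0 * (norm (q x))^2)"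
   using q p0 by (subst nn_integral_cmult[symmetric]) (auto simp: ennreal_mult less_imp_le)
  also have "... <= tnn (%x. (q x)^2 * p x)"
   using p_lo by (intro nn_integral_mono ennreal_leI) (auto simp: mult.commute[of _ "p _"] intro!: mult_right_mono)
  also have "... <= ennreal c" by fact
  finally have l: "ennreal p0 * tnn (%x. (norm (q x))^2) <= ennreal c" .
  have "tnn (%x. (norm (q x))^2) = ennreal (1 / p0) * (ennreal p0 * tnn (%x. (norm (q x))^2))"
   using p0 by (simp add: mult.assoc[symmetric] ennreal_mult[symmetric])
  also have "... <= ennreal (1 / p0) * ennreal c" by (rule mult_left_mono[OF l]) simp
  also have "... = ennreal ((sqrt (c / p0))^2)" using p0 c by (simp add: ennreal_mult[symmetric])
  finally show ?thesis .
 qed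
 have sq: "sqi (%x. \<rho> t x / p x)" and fb: "norm (f t) <= C" if t: "t : {0..T}" for t
 proof -
  have "tnn (%x. (\<rho> t x / p x)^2 * p x) <= ennreal \<bar>C'\<bar>"
   using C'[OF t] by (rule order_trans) (simp add: ennreal_leI)
  from weight[OF fm[OF t] this] nn_sqi[OF fm[OF t], of C]
  show "sqi (%x. \<rho> t x / p x)" "norm (f t) <= C" using p0 by (auto simp: C_def f_def)
 qed
 show "!!t. t : {0..T} ==> sqi (%x. \<rho> t x / p x)" by (rule sq)
 have ppf: "pp (f t) \<bullet> tol2 phi = tint (%x. \<rho> t x * phi x)" if t: "t : {0..T}" and s: "sqi phi" for t phi
 proof -
  have "pp (f t) = tol2 (%x. p x *R (\<rho> t x / p x))" unfolding pp_def f_def by (rule pw_tol2[OF b_pp sq[OF t]])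
  moreover have "sqi (%x. p x *R (\<rho> t x / p x))" by (rule sqi_pw[OF b_pp sq[OF t]])
  ultimately show ?thesis using inner_tol2[OF _ s, of "%x. p x *R (\<rho> t x / p x)"] p_pos by (simp add: less_imp_neq[symmetric])
 qed
 \<comment> \<open>Weak continuity in time: tested with \<open>cas k\<close>, the weighted solution
   is a constant minus an indefinite integral. Pairing with \<open>ip (ip psi)\<close> cancels the
   weight.\<close>
 have wc: "continuous_on {0..T} (%t. f t \<bullet> psi)" for psi
 proof -
  have "continuous_on {0..T} (%t. pp (f t) \<bullet> ip (ip psi))"
  proof (rule continuous_on_inner_from_cas)
   show "norm (pp (f t)) <= p1 * C" if "t : {0..T}" for t
    using order_trans[OF norm_pp mult_left_mono[OF fb[OF that]]] p1_pos by simp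
   fix k :: "int^'n"
   let ?X = "%s. tint (%x. p x * ((M x *v wgrad (%x. \<rho> s x / p x) x) \<bullet> pgrad (cas k) x))"
   have i: "?X integrable_on {0..T}" by (rule integrable_on_lebesgue_on[OF Li[OF cas_test]]) simp
   have eqn: "pp (f t) \<bullet> ecas k 1 = tint (%x. \<rho> 0 x * cas k x) - integral {0..t} ?X" if t: "t : {0..T}" for t
   proof -
    have "integral\<^sup>L (lebesgue_on {0..t}) ?X = integral {0..t} ?X"
    proof (rule lebesgue_integral_eq_integral)
    show "integrable (lebesgue_on {0..t}) ?X"
    by (rule integrable_subinterval[OF Li[OF cas_test]]) (use t in auto)
    qed simp
    moreover have "pp (f t) \<bullet> ecas k 1 = tint (%x. \<rho> t x * cas k x)"
    using ppf[OF t sqi_ecas[of k "1::real"]] by (simp add: ecas_def)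
    ultimately show ?thesis using eq[OF cas_test[of k] t] by simp
   qed
   have cont: "continuous_on {0..T} (%t. tint (%x. \<rho> 0 x * cas k x) - integral {0..t} ?X)"
    by (intro continuous_on_diff continuous_on_const indefinite_integral_continuous_1[OF i])
   show "continuous_on {0..T} (%t. pp (f t) \<bullet> ecas k 1)"
    by (rule continuous_on_eq[OF cont]) (rule eqn[symmetric])
  qed
  moreover have "pp (f t) \<bullet> ip (ip psi) = f t \<bullet> psi" for t
   by (simp add: pp_ip sp_inner)
  ultimately show ?thesis by simp
 qed
 \<comment> \<open>The spatial energy as a supremum of functions continuous in time. This gives
   measurability in time, about which the choice of \<open>wgrad\<close> at each separate time says
   nothing.\<close>
 define N where "N t = (SUP n. ennreal (dir n (f t)))" for t
 have fwg: "has_weak_grad (fn (f t)) (wgrad (%x. \<rho> t x / p x))" if t: "t : {0..T}" for t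
 proof (rule has_weak_grad_AE[OF wgrad_weak[OF wg[OF t]]])
  show "AE x in lc. \<rho> t x / p x = fn (f t) x" using fn_tol2[OF sq[OF t]] by (auto simp: f_def elim: AE_mp)
  show "wgrad (%x. \<rho> t x / p x) : bmc" by (rule wgrad_measurable[OF wg[OF t]])
 qed auto
 have N_eq: "N t = tnn (%x. (norm (wgrad (%x. \<rho> t x / p x) x))^2)" if t: "t : {0..T}" for t
  unfolding N_def by (rule dir_weak[OF fwg[OF t], symmetric])
 have Nm: "(%t. N t * indicator {0..T} t) : borel_measurable lborel"
 proof -
  have c: "continuous_on {0..T} (%t. dir n (f t))" for n
  proof -
   have "cf k u = u \<bullet> ecas k 1" for k and u :: "('n, real) l2" using cf_inner[of k 1 u] by (simp add: inner_commute)
   thus ?thesis unfolding dir_def by (auto intro!: continuous_intros wc)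
  qed
  have "(%t. ennreal (indicator {0..T} t *R dir n (f t))) : borel_measurable borel" for n
   using borel_measurable_continuous_on_indicator[OF _ c[of n]] by measurable
  hence "(%t. SUP n. ennreal (indicator {0..T} t *R dir n (f t))) : borel_measurable borel" by (intro borel_measurable_SUP) auto
  moreover have "(%t. SUP n. ennreal (indicator {0..T} t *R dir n (f t))) = (%t. N t * indicator {0..T} t)"
   by (rule ext) (auto simp: N_def indicator_def)
  ultimately show ?thesis by simp
 qed
 have Nfin: "(\<integral>\<^sup>+t. N t * indicator {0..T} t \<partial>lborel) < \<infinity>"
 proof -
  have "(\<integral>\<^sup>+t. N t * indicator {0..T} t \<partial>lborel) = (\<integral>\<^sup>+t\<in>{0..T}. tnn (%x. (norm (wgrad (%x. \<rho> t x / p x) x))^2) \<partial>lborel)"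
   by (intro nn_integral_cong) (auto simp: N_eq indicator_def)
  thus ?thesis using en by simp
 qed
 \<comment> \<open>The times at which the gradient is not square integrable. Finiteness of the
   time-integrated energy makes this set negligible, so the value 0 given to \<open>Gs\<close> there
   does not affect time integrals.\<close>
 define bad where "bad = {t : {0..T}. N t = \<infinity>}"
 have neg: "negligible bad"
 proof -
  have "AE t in lborel. N t * indicator {0..T} t ~= \<infinity>" using Nfin Nm by (intro nn_integral_PInf_AE) auto
  hence "AE t in lborel. t \<notin> bad" by eventually_elim (auto simp: bad_def)
  hence "AE t in lebesgue. t \<notin> bad" by (rule AE_completion)
  then obtain N' where "N' : null_sets lebesgue" "bad \<subseteq> N'" by (auto simp: eventually_ae_filter)
  thus ?thesis using negligible_iff_null_sets negligible_subset by blast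
 qed
 have e2r: "ennreal (enn2real x) <= x" for x by (cases x) auto
 define Nr where "Nr t = enn2real (N t * indicator {0..T} t)" for t
 have Nr_int: "Nr integrable_on {0..T}"
 proof -
  have "integrable lborel Nr"
  proof (rule integrableI_nonneg)
   show "Nr : borel_measurable lborel" unfolding Nr_def using Nm by measurable
   have "(\<integral>\<^sup>+ x. ennreal (Nr x) \<partial>lborel) <= (\<integral>\<^sup>+t. N t * indicator {0..T} t \<partial>lborel)"
    unfolding Nr_def by (intro nn_integral_mono e2r)
   thus "(\<integral>\<^sup>+ x. ennreal (Nr x) \<partial>lborel) < \<infinity>" using Nfin by (rule le_less_trans)
  qed (auto simp: Nr_def)
  hence "Nr integrable_on UNIV" by (rule integrable_on_lborel)
  from integrable_on_subcbox[OF this, of 0 T] show ?thesis by simp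
 qed
 define Gs where "Gs t = (if t : {0..T} - bad then (SOME G. (f t, G) : W1) else 0)" for t
 have Gs: "(f t, Gs t) : W1" "norm (Gs t) <= 1 + Nr t" if t: "t : {0..T} - bad" for t
 proof -
  have fin: "N t < \<infinity>" using t by (auto simp: bad_def top.not_eq_extremum)
  then obtain r where r: "N t = ennreal r" "0 <= r" by (cases "N t") auto
  have Nr: "Nr t = r" using t r by (simp add: Nr_def)
  have "ennreal (dir n (f t)) <= N t" for n unfolding N_def by (rule SUP_upper) simp
  hence "dir n (f t) <= Nr t" for n unfolding Nr r(1) using r(2) by simp
  from dir_bounded[OF this] obtain G where G: "(f t, G) : W1" "(norm G)^2 <= Nr t" by blast
  thus W: "(f t, Gs t) : W1" using t someI[of "%G. (f t, G) : W1" G] by (auto simp: Gs_def)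
  hence "Gs t = G" using G W1_unique by blast
  moreover have "0 <= (norm G - 1)^2 + 1 + (norm G)^2" by simp
  hence "norm G <= 1 + (norm G)^2" by (simp add: power2_eq_square algebra_simps)
  ultimately show "norm (Gs t) <= 1 + Nr t" using G by simp
 qed
 have Nr0: "0 <= Nr t" for t by (simp add: Nr_def)
 have Gsb: "norm (Gs t) <= 1 + Nr t" for t using Gs(2)[of t] Nr0[of t] by (cases "t : {0..T} - bad") (auto simp: Gs_def)
 \<comment> \<open>The test pairs for which the integrated equation holds at all times: a subspace
   that contains the generators of \<open>W1\<close>. Its closedness follows by dominated
   convergence, with a multiple of \<open>1 + Nr\<close> as the bound.\<close>
 define E where "E = {z. ALL t:{0..T}. ((%s. aD (Gs s) (snd z)) has_integral (- ((pp (f t) - pp (f 0)) \<bullet> fst z))) {0..t}}"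
 have gen: "(ecas k 1, ecas (- k) (kv k)) : E" for k
  unfolding E_def mem_Collect_eq fst_conv snd_conv
 proof
  fix t assume t: "t : {0..T}"
  let ?X = "%s. tint (%x. p x * ((M x *v wgrad (%x. \<rho> s x / p x) x) \<bullet> pgrad (cas k) x))"
  have i: "integrable (lebesgue_on {0..t}) ?X"
   by (rule integrable_subinterval[OF Li[OF cas_test]]) (use t in auto)
  have "(?X has_integral (integral\<^sup>L (lebesgue_on {0..t}) ?X)) {0..t}"
   by (rule has_integral_integral_lebesgue_on[OF i]) simp
  moreover have "integral\<^sup>L (lebesgue_on {0..t}) ?X = - ((pp (f t) - pp (f 0)) \<bullet> ecas k 1)"
   using eq[OF cas_test[of k] t] ppf[OF t sqi_ecas[of k "1::real"]] ppf[of 0, OF _ sqi_ecas[of k "1::real"]] T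
   by (simp add: ecas_def inner_diff_left)
  ultimately have I: "(?X has_integral (- ((pp (f t) - pp (f 0)) \<bullet> ecas k 1))) {0..t}" by simp
  show "((%s. aD (Gs s) (ecas (- k) (kv k))) has_integral - ((pp (f t) - pp (f 0)) \<bullet> ecas k 1)) {0..t}"
  proof (rule has_integral_spike[OF neg _ I])
   fix s assume s: "s : {0..t} - bad"
   hence s': "s : {0..T}" "s : {0..T} - bad" using t by auto
   have pg: "pgrad (cas k) = (%x. cas (- k) x *R kv k)" by (rule C1p_pgrad[OF cas_C1p])
   have ae: "AE x in lc. wgrad (%x. \<rho> s x / p x) x = fn (Gs s) x"
    by (rule weak_grad_unique[OF fwg[OF s'(1)] W1_imp_weak[OF Gs(1)[OF s'(2)]]]) simp
   have "aD (Gs s) (ecas (- k) (kv k)) = tint (%x. (D x *v fn (Gs s) x) \<bullet> (cas (- k) x *R kv k))"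
    unfolding ecas_def by (rule aD_right[OF sqi_ecas])
   also have "... = ?X s"
   proof (rule integral_cong_AE)
    show "(%x. (D x *v fn (Gs s) x) \<bullet> (cas (- k) x *R kv k)) : bmc"
    by (rule borel_measurable_integrable[OF sqi_inner[OF sqi_pw[OF b_D sqi_fn] sqi_ecas]])
    show "(%x. p x * ((M x *v wgrad (%x. \<rho> s x / p x) x) \<bullet> pgrad (cas k) x)) : bmc"
    by (rule borel_measurable_integrable[OF ti[OF cas_test s'(1)]])
    show "AE x in lc. (D x *v fn (Gs s) x) \<bullet> (cas (- k) x *R kv k) = p x * ((M x *v wgrad (%x. \<rho> s x / p x) x) \<bullet> pgrad (cas k) x)"
    using ae by eventually_elim (simp add: DM pg scaleR_matrix_vector_assoc[symmetric])
   qed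
   finally show "aD (Gs s) (ecas (- k) (kv k)) = ?X s" .
  qed
 qed
 have sub: "subspace E"
 proof (rule subspaceI)
  show "0 : E" by (simp add: E_def aD.zero_right)
  show "x + y : E" if "x : E" "y : E" for x y
   unfolding E_def mem_Collect_eq
  proof
   fix t assume t: "t : {0..T}"
   from has_integral_add[of "%s. aD (Gs s) (snd x)" _ "{0..t}" "%s. aD (Gs s) (snd y)"] that t
   show "((%s. aD (Gs s) (snd (x + y))) has_integral - ((pp (f t) - pp (f 0)) \<bullet> fst (x + y))) {0..t}"
    unfolding E_def by (fastforce simp: aD.add_right inner_add_right)
  qed
  show "c *R x : E" if "x : E" for c x
   unfolding E_def mem_Collect_eq
  proof
   fix t assume t: "t : {0..T}"
   from has_integral_cmul[of "%s. aD (Gs s) (snd x)" _ "{0..t}" c] that t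
   show "((%s. aD (Gs s) (snd (c *R x))) has_integral - ((pp (f t) - pp (f 0)) \<bullet> fst (c *R x))) {0..t}"
    unfolding E_def by (fastforce simp: aD.scaleR_right)
  qed
 qed
 have clE: "closed E"
  unfolding closed_sequential_limits
 proof (intro allI impI, elim conjE)
  fix Z z assume Z: "ALL n. Z n : E" "Z ----> z"
  have lf: "(%n. fst (Z n)) ----> fst z" and ls: "(%n. snd (Z n)) ----> snd z"
   using Z(2) by (auto intro: tendsto_fst tendsto_snd)
  obtain B where B: "!!n. norm (snd (Z n)) <= B" using convergent_imp_Bseq[OF convergentI[OF ls]] by (auto simp: Bseq_def)
  have B0: "0 <= B" using B[of 0] norm_ge_zero order_trans by blast
  show "z : E" unfolding E_def mem_Collect_eq
  proof
   fix t assume t: "t : {0..T}"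
   have Nrt: "(%s. d1 * (1 + Nr s) * B) integrable_on {0..t}"
   proof -
    have "Nr integrable_on {0..t}" using integrable_subinterval_real[OF Nr_int, of 0 t] t by auto
    from integrable_on_cmult_left[OF integrable_add[OF integrable_const_ivl[of 1 0 t] this], of "d1 * B"]
    show ?thesis by (simp add: mult_ac)
   qed
   have hi: "!!n. ((%s. aD (Gs s) (snd (Z n))) has_integral (- ((pp (f t) - pp (f 0)) \<bullet> fst (Z n)))) {0..t}"
    using Z(1) t unfolding E_def by blast
   have h1: "(%s. aD (Gs s) (snd (Z n))) integrable_on {0..t}" for n using hi by blast
   have h3: "norm (aD (Gs s) (snd (Z n))) <= d1 * (1 + Nr s) * B" for n s
    proof -
    have "norm (aD (Gs s) (snd (Z n))) <= d1 * norm (Gs s) * norm (snd (Z n))" using aD_le by simp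
    also have "... <= d1 * (1 + Nr s) * B"
    using Gsb[of s] B[of n] d1_nonneg Nr0[of s] by (intro mult_mono mult_left_mono mult_nonneg_nonneg) auto
    finally show ?thesis .
    qed
   have h4: "(%n. aD (Gs s) (snd (Z n))) ----> aD (Gs s) (snd z)" for s by (intro aD.tendsto tendsto_const ls)
   note dc = dominated_convergence[OF h1 Nrt h3 h4]
   have "(%n. - ((pp (f t) - pp (f 0)) \<bullet> fst (Z n))) ----> - ((pp (f t) - pp (f 0)) \<bullet> fst z)" by (intro tendsto_intros lf)
   hence "integral {0..t} (%s. aD (Gs s) (snd z)) = - ((pp (f t) - pp (f 0)) \<bullet> fst z)"
    using dc(2) LIMSEQ_unique unfolding integral_unique[OF hi] by blast
   thus "((%s. aD (Gs s) (snd z)) has_integral - ((pp (f t) - pp (f 0)) \<bullet> fst z)) {0..t}"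
    using dc(1) integrable_integral by fastforce
  qed
 qed
 have WE: "W1 \<subseteq> E"
  unfolding W1_def W0_def by (intro closure_minimal span_minimal sub clE) (use gen in auto)
 define u where "u t = sp (f t)" for t
 have goodW: "(u r, Gs r) : Wp" if "r : {0..T} - bad" for r using Gs(1)[OF that] by (simp add: Wp_iff u_def)
 have evo: "evolution Wp aD d0 u T (sqrt p1 * C)"
 proof
  show "norm (u t) <= sqrt p1 * C" if "t : {0..T}" for t
   using order_trans[OF norm_sp mult_left_mono[OF fb[OF that]]] p1_pos unfolding u_def by simp
  fix eta :: real and phi t assume eta: "0 < eta" and t: "t : {0..T}"
  let ?z = "(ip (par.R eta phi), par.Gr eta phi)"
  have "?z : E" using par.R_in[OF eta, of phi] WE by (auto simp: Wp_iff)
  hence I: "((%s. aD (Gs s) (par.Gr eta phi)) has_integral (- ((pp (f t) - pp (f 0)) \<bullet> ip (par.R eta phi)))) {0..t}"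
   using t by (simp add: E_def)
  have "(pp (f t) - pp (f 0)) \<bullet> ip (par.R eta phi) = (u t - u 0) \<bullet> par.R eta phi"
   by (simp add: inner_diff_left pp_ip u_def)
  with I have I: "((%s. aD (Gs s) (par.Gr eta phi)) has_integral (- ((u t - u 0) \<bullet> par.R eta phi))) {0..t}" by simp
  show "((%r. u r \<bullet> par.Yo eta phi) has_integral - ((u t - u 0) \<bullet> par.R eta phi)) {0..t}"
  proof (rule has_integral_spike[OF neg _ I])
   fix r assume "r : {0..t} - bad"
   hence "(u r, Gs r) : Wp" using goodW t by auto
   from par.Yo_eq[OF eta this, of phi] show "u r \<bullet> par.Yo eta phi = aD (Gs r) (par.Gr eta phi)"
    by (simp add: inner_commute aD_sym)
  qed
 qed
 interpret ev: evolution Wp aD d0 u T "sqrt p1 * C" by (rule evo)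
 have z0: "0 : {0..T}" using T by simp
 have hp: "tintegrable (%x. h x * p x)" and hw: "!!phi. test_fun phi ==>
   tint (%x. h x * p x * phi x) = - tint (%x. p x * ((M x *v wgrad (%x. \<rho> 0 x / p x) x) \<bullet> pgrad phi x))"
  using h by (auto simp: is_initial_dt_def)
 have hm: "h : bmc"
 proof -
  have "(%x. (h x * p x) / p x) : bmc" using hp by measurable
  thus ?thesis using p_pos by (simp add: less_imp_neq[symmetric])
 qed
 have hs: "sqi h" using nn_sqi[OF hm weight[OF hm K(2,1)]] p0 K(1) by simp
 define hh where "hh = sp (tol2 h)"
 have nhh: "norm hh <= sqrt K"
 proof (rule power2_le_imp_le)
  have e: "hh = tol2 (%x. sqrt (p x) *R h x)" unfolding hh_def sp_def by (rule pw_tol2[OF b_sp hs])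
  have s: "sqi (%x. sqrt (p x) *R h x)" by (rule sqi_pw[OF b_sp hs])
  have "ennreal ((norm hh)^2) = tnn (%x. (norm (sqrt (p x) *R h x))^2)" unfolding e by (rule nn_norm_sq[OF s, symmetric])
  also have "... = tnn (%x. (h x)^2 * p x)" using p_pos by (intro nn_integral_cong) (simp add: power_mult_distrib less_imp_le mult.commute)
  also have "... <= ennreal K" by (rule K(2))
  finally show "(norm hh)^2 <= (sqrt K)^2" using K(1) by simp
 qed (use K in simp)
 \<comment> \<open>A statement for almost every time says nothing about time zero; here the assumed
   bound on the initial energy shows that 0 is not a bad time.\<close>
 obtain g0 where g0: "(f 0, g0) : W1"
 proof -
  let ?g = "wgrad (%y. \<rho> 0 y / p y)"
  have "(%x. ?g x $ i) : bmc" for i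
   using fwg[OF z0] by (simp add: has_weak_grad_def borel_measurable_integrable)
  hence gm [measurable]: "?g : bmc"
   by (subst borel_measurable_euclidean_space) (auto simp: Basis_vec_def inner_axis)
  have "ennreal d0 * tnn (%x. (norm (?g x))^2) = tnn (%x. d0 * (norm (?g x))^2)"
   using d0 by (subst nn_integral_cmult[symmetric]) (auto simp: ennreal_mult less_imp_le)
  also have "... <= tnn (%x. ?g x \<bullet> (p x *R (M x *v ?g x)))"
  proof (intro nn_integral_mono ennreal_leI)
   fix x show "d0 * (norm (?g x))^2 <= ?g x \<bullet> (p x *R (M x *v ?g x))"
    using D_lo[of "?g x" x] by (simp add: DM scaleR_matrix_vector_assoc[symmetric])
  qed
  also have "... <= ennreal K" by (rule K(3))
  finally have "ennreal d0 * tnn (%x. (norm (?g x))^2) < \<infinity>" by (rule le_less_trans) simp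
  hence "tnn (%x. (norm (?g x))^2) < \<infinity>" using d0 by (auto simp: ennreal_mult_less_top)
  hence "N 0 < \<infinity>" using N_eq[OF z0] by simp
  hence "0 \<notin> bad" by (auto simp: bad_def)
  hence "(f 0, Gs 0) : W1" using Gs(1)[of 0] z0 by simp
  thus ?thesis by (rule that)
 qed
 \<comment> \<open>The weak definition of the initial time derivative, extended from basis functions
   to all test pairs: the initial value lies in the domain of the operator and its image is
   \<open>- hh\<close>.\<close>
 have g0h: "aD g0 k = - (hh \<bullet> w)" if wk: "(w, k) : Wp" for w k
 proof -
  have wk': "(ip w, k) : W1" using wk by (simp add: Wp_iff)
  have bl: "bounded_linear (%z. aD g0 (snd z) + pp (tol2 h) \<bullet> fst z)"
   by (intro bounded_linear_add bounded_linear_compose[OF aD.bounded_linear_right bounded_linear_snd]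
    bounded_linear_compose[OF bounded_linear_inner_right bounded_linear_fst])
  have "aD g0 (snd (ip w, k)) + pp (tol2 h) \<bullet> fst (ip w, k) = 0"
  proof (rule W1_functional_zero[OF bl _ wk'], unfold fst_conv snd_conv)
   fix k :: "int^'n"
   have pg: "pgrad (cas k) = (%x. cas (- k) x *R kv k)" by (rule C1p_pgrad[OF cas_C1p])
   have ae: "AE x in lc. wgrad (%x. \<rho> 0 x / p x) x = fn g0 x"
    by (rule weak_grad_unique[OF fwg[OF z0] W1_imp_weak[OF g0]]) simp
   have "aD g0 (ecas (- k) (kv k)) = tint (%x. (D x *v fn g0 x) \<bullet> (cas (- k) x *R kv k))"
    unfolding ecas_def by (rule aD_right[OF sqi_ecas])
   also have "... = tint (%x. p x * ((M x *v wgrad (%x. \<rho> 0 x / p x) x) \<bullet> pgrad (cas k) x))"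
   proof (rule integral_cong_AE)
    show "(%x. (D x *v fn g0 x) \<bullet> (cas (- k) x *R kv k)) : bmc"
    by (rule borel_measurable_integrable[OF sqi_inner[OF sqi_pw[OF b_D sqi_fn] sqi_ecas]])
    show "(%x. p x * ((M x *v wgrad (%x. \<rho> 0 x / p x) x) \<bullet> pgrad (cas k) x)) : bmc"
    by (rule borel_measurable_integrable[OF ti[OF cas_test z0]])
    show "AE x in lc. (D x *v fn g0 x) \<bullet> (cas (- k) x *R kv k) = p x * ((M x *v wgrad (%x. \<rho> 0 x / p x) x) \<bullet> pgrad (cas k) x)"
    using ae by eventually_elim (simp add: DM pg scaleR_matrix_vector_assoc[symmetric])
   qed
   also have "... = - tint (%x. h x * p x * cas k x)" using hw[OF cas_test[of k]] by simp
   also have "tint (%x. h x * p x * cas k x) = pp (tol2 h) \<bullet> ecas k 1"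
   proof -
    have "pp (tol2 h) = tol2 (%x. p x *R h x)" unfolding pp_def by (rule pw_tol2[OF b_pp hs])
    thus ?thesis unfolding ecas_def using inner_tol2[OF sqi_pw[OF b_pp hs] sqi_ecas[of k "1::real"]] by (simp add: mult.commute)
   qed
   finally show "aD g0 (ecas (- k) (kv k)) + pp (tol2 h) \<bullet> ecas k 1 = 0" by simp
  qed
  thus ?thesis by (simp add: pp_ip hh_def)
 qed
 have u0: "(u 0, g0) : Wp" using g0 by (simp add: Wp_iff u_def)
 have lip: "norm (u t - u s) <= sqrt K * \<bar>t - s\<bar>" if "s : {0..T}" "t : {0..T}" for s t
  using order_trans[OF ev.lipschitz[OF u0 g0h that] mult_right_mono[OF nhh]] by simp
 have fsp: "AE x in lc. fn (u t) x = sqrt (p x) * fn (f t) x" for t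
  unfolding u_def by (rule fn_sp)
 have f0: "AE x in lc. a / p1 <= fn (f 0) x & fn (f 0) x <= b / p0"
  using fn_tol2[OF sq[OF z0]] AE_space
 proof eventually_elim
  case (elim x)
  hence i: "a <= \<rho> 0 x" "\<rho> 0 x <= b" using init by auto
  have "a / p1 <= \<rho> 0 x / p x" using i a p_hi[of x] p_pos[of x] by (intro frac_le) auto
  moreover have "\<rho> 0 x / p x <= b / p0" using i a p_lo[of x] p0 by (intro frac_le) auto
  ultimately show ?case using elim(1) by (simp add: f_def)
 qed
 have uK: "u t : Klo (a / p1)" "u t : Khi (b / p0)" if t: "t : {0..T}" for t
 proof -
  have sq0: "0 <= sqrt (p x)" for x using p_pos[of x] by simp
  have "AE x in lc. a / p1 * sqrt (p x) <= fn (u 0) x & fn (u 0) x <= b / p0 * sqrt (p x)"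
   using f0 fsp[of 0]
  proof eventually_elim
   case (elim x)
   thus ?case using mult_right_mono[OF _ sq0[of x]] by (metis mult.commute)
  qed
  hence 0: "u 0 : Klo (a / p1)" "u 0 : Khi (b / p0)"
   unfolding Klo_def Khi_def mem_Collect_eq by (auto elim: AE_mp)
  show "u t : Klo (a / p1)" by (rule ev.invariant_set[OF closed_Klo resolvent_Klo 0(1) t])
  show "u t : Khi (b / p0)" by (rule ev.invariant_set[OF closed_Khi resolvent_Khi 0(2) t])
 qed
 have bounds: "AE x in lc. a / p1 <= fn (f t) x & fn (f t) x <= b / p0" if t: "t : {0..T}" for t
  using uK[OF t, unfolded Klo_def Khi_def mem_Collect_eq] fsp[of t]
 proof eventually_elim
  case (elim x)
  have "0 < sqrt (p x)" using p_pos by simp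
  moreover have "a / p1 * sqrt (p x) <= fn (f t) x * sqrt (p x)" "fn (f t) x * sqrt (p x) <= b / p0 * sqrt (p x)"
   using elim unfolding elim(3) mult.commute[of "sqrt (p x)"] by blast+
  ultimately show ?case by (meson mult_right_le_imp_le)
 qed
 have "EX G. (u t, G) : Wp & (ALL w k. (w, k) : Wp --> \<bar>aD G k\<bar> <= sqrt K * norm w)" if t: "t : {0..T}" for t
  using ev.slice_regularity[OF lip T t] by metis
 then obtain G where G: "!!t. t : {0..T} ==> (u t, G t) : Wp"
   "!!t w k. t : {0..T} ==> (w, k) : Wp ==> \<bar>aD (G t) k\<bar> <= sqrt K * norm w" by metis
 have fG: "(f t, G t) : W1" if "t : {0..T}" for t using G(1)[OF that] by (simp add: Wp_iff u_def)
 have L0: "0 <= L" using L(1) K(1) p1_pos by (meson mult_nonneg_nonneg order_trans real_sqrt_ge_zero less_imp_le)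
 have "flow T L (a / p1) (b / p0) f G"
  unfolding flow_def
 proof (intro ballI conjI allI impI bounds)
  fix t assume t: "t : {0..T}"
  show "(f t, G t) : W1" by (rule fG[OF t])
  fix w :: "('n, real) l2" and k assume wk: "(w, k) : W1"
  hence "(sp w, k) : Wp" by (simp add: Wp_iff)
  from G(2)[OF t this] have "\<bar>aD (G t) k\<bar> <= sqrt K * norm (sp w)" .
  also have "... <= sqrt K * (sqrt p1 * norm w)" by (intro mult_left_mono norm_sp) (use K in simp)
  also have "... = sqrt K * sqrt p1 * norm w" by simp
  also have "... <= L * norm w" by (rule mult_right_mono[OF L(1)]) simp
  finally show "\<bar>aD (G t) k\<bar> <= L * norm w" .
 next
  fix t s assume t: "t : {0..T}" and s: "s : {0..T}"
  have "f t - f s = ip (u t - u s)" by (simp add: u_def ip.diff)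
  hence "norm (f t - f s) <= 1 / sqrt p0 * norm (u t - u s)" using norm_ip by simp
  also have "... <= 1 / sqrt p0 * (sqrt K * \<bar>t - s\<bar>)" by (intro mult_left_mono lip s t) (use p0 in simp)
  also have "... = sqrt K / sqrt p0 * \<bar>t - s\<bar>" by simp
  also have "... <= L * \<bar>t - s\<bar>" by (rule mult_right_mono[OF L(2)]) simp
  finally show "norm (f t - f s) <= L * \<bar>t - s\<bar>" .
 next
  fix t and z :: "('n, real) l2 \<times> ('n, real^'n) l2" assume t: "t : {0..T}" and z: "z : W1"
  have I: "((%s. aD (Gs s) (snd z)) has_integral - ((pp (f t) - pp (f 0)) \<bullet> fst z)) {0..t}"
   using WE z t by (auto simp: E_def)
  show "((%s. aD (G s) (snd z)) has_integral - ((pp (f t) - pp (f 0)) \<bullet> fst z)) {0..t}"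
  proof (rule has_integral_spike[OF neg _ I])
   fix s assume s: "s : {0..t} - bad"
   hence s: "s : {0..T} - bad" "s : {0..T}" using t by auto
   have "G s = Gs s" by (rule W1_unique[OF fG[OF s(2)] Gs(1)[OF s(1)]])
   thus "aD (G s) (snd z) = aD (Gs s) (snd z)" by simp
  qed
 qed
 thus "EX G. flow T L (a / p1) (b / p0) (%t. tol2 (%x. \<rho> t x / p x)) G" unfolding f_def by blast
qed

end

section \<open>Cell problems and homogenization\<close>

lemma smooth_continuous: "smooth_fun f ==> continuous_on UNIV f"
proof -
 assume "smooth_fun f"
 hence "iter_pd [] f differentiable (at x)" for x unfolding smooth_fun_def by blast
 thus ?thesis by (auto intro!: continuous_at_imp_continuous_on differentiable_imp_continuous_within)
qed

lemma continuous_on_matrix_vector: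
 fixes A :: "'a::topological_space => real^'m^'k"
 assumes "!!i j. continuous_on S (%x. A x $ i $ j)" "continuous_on S v"
 shows "continuous_on S (%x. A x *v v x)"
 unfolding matrix_vector_mult_def by (intro continuous_on_vec_lambda continuous_intros assms)

lemma matrix_inv_mult:
 assumes "invertible (A :: real^'n^'m)" shows "A ** matrix_inv A = mat 1" "matrix_inv A ** A = mat 1"
proof -
 have "A ** matrix_inv A = mat 1 & matrix_inv A ** A = mat 1"
  unfolding matrix_inv_def by (rule someI_ex) (use assms in \<open>simp add: invertible_def\<close>)
 thus "A ** matrix_inv A = mat 1" "matrix_inv A ** A = mat 1" by auto
qed

lemma cancel_square: "a * n^2 <= b * n ==> 0 <= n ==> 0 <= b ==> a * n <= (b :: real)"
 by (cases "n = 0") (auto simp: power2_eq_square mult.assoc[symmetric])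

text \<open>With eta the image of \<xi> under the inverse, the upper bound comes from the form at
  eta. The lower bound is nonnegativity of the form at eta - \<xi> / C2, the shift for which the
  remaining terms collapse to a single multiple of |\<xi>|^2.\<close>

lemma matrix_inv_bounds:
 fixes B :: "real^'n^'n"
 assumes sym: "transpose B = B" and C: "0 < C1" "0 < C2"
  and b: "!!\<xi>. C1 * (\<xi> \<bullet> \<xi>) <= \<xi> \<bullet> (B *v \<xi>) & \<xi> \<bullet> (B *v \<xi>) <= C2 * (\<xi> \<bullet> \<xi>)"
 shows "invertible B" "B *v (matrix_inv B *v \<xi>) = \<xi>" "transpose (matrix_inv B) = matrix_inv B"
  "norm (matrix_inv B *v \<xi>) <= 1 / C1 * norm \<xi>" "1 / C2 * (norm \<xi>)^2 <= \<xi> \<bullet> (matrix_inv B *v \<xi>)"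
proof -
 have "x = 0" if "B *v x = 0" for x
 proof -
  have "C1 * (x \<bullet> x) <= 0" using b[of x] that by simp
  hence "x \<bullet> x <= 0" using C by (simp add: mult_le_0_iff)
  hence "x \<bullet> x = 0" using inner_ge_zero[of x] by linarith
  thus ?thesis by simp
 qed
 hence "EX A. A ** B = mat 1" using matrix_left_invertible_ker by blast
 thus inv: "invertible B" by (simp add: invertible_left_inverse)
 have r: "B ** matrix_inv B = mat 1" and l: "matrix_inv B ** B = mat 1" using matrix_inv_mult[OF inv] by auto
 show eq: "B *v (matrix_inv B *v \<xi>) = \<xi>" for \<xi> by (simp add: matrix_vector_mul_assoc r)
 have "transpose (matrix_inv B) ** B = mat 1"
  using arg_cong[OF r, of transpose] sym by (simp add: matrix_transpose_mul)
 hence "transpose (matrix_inv B) ** (B ** matrix_inv B) = matrix_inv B" by (simp add: matrix_mul_assoc)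
 thus "transpose (matrix_inv B) = matrix_inv B" by (simp add: r)
 define eta where "eta = matrix_inv B *v \<xi>"
 have Beta: "B *v eta = \<xi>" using eq by (simp add: eta_def)
 have "C1 * (norm eta)^2 <= eta \<bullet> \<xi>" using b[of eta] by (simp add: Beta power2_norm_eq_inner)
 also have "... <= norm eta * norm \<xi>" by (rule norm_cauchy_schwarz)
 finally have "C1 * norm eta <= norm \<xi>" by (cases "eta = 0") (auto simp: power2_eq_square)
 thus "norm (matrix_inv B *v \<xi>) <= 1 / C1 * norm \<xi>" using C by (simp add: eta_def field_simps)
 define \<zeta> where "\<zeta> = eta - (1 / C2) *R \<xi>"
 have sy: "x \<bullet> (B *v y) = (B *v x) \<bullet> y" for x y
  by (metis sym dot_lmul_matrix vector_transpose_matrix)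
 have "0 <= \<zeta> \<bullet> (B *v \<zeta>)" using b[of \<zeta>] C by (smt (verit) inner_ge_zero mult_nonneg_nonneg)
 also have "\<zeta> \<bullet> (B *v \<zeta>) = eta \<bullet> \<xi> - 2 / C2 * (\<xi> \<bullet> \<xi>) + (1 / C2)^2 * (\<xi> \<bullet> (B *v \<xi>))"
  using sy[of eta \<xi>] C by (simp add: \<zeta>_def matrix_vector_mult_diff_distrib matrix_vector_mult_scaleR Beta inner_diff_left inner_diff_right power2_eq_square inner_commute field_simps)
 also have "... <= eta \<bullet> \<xi> - 2 / C2 * (\<xi> \<bullet> \<xi>) + (1 / C2)^2 * (C2 * (\<xi> \<bullet> \<xi>))" using b[of \<xi>] by (intro add_left_mono mult_left_mono) auto
 also have "... = eta \<bullet> \<xi> - 1 / C2 * (\<xi> \<bullet> \<xi>)" using C by (simp add: power2_eq_square field_simps)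
 finally show "1 / C2 * (norm \<xi>)^2 <= \<xi> \<bullet> (matrix_inv B *v \<xi>)"
  by (simp add: eta_def power2_norm_eq_inner inner_commute)
qed

text \<open>Admits C^1 periodic test functions, in particular products of dilated Hartley functions,
  in place of smooth ones.\<close>

lemma W1_by_parts:
 assumes uG: "(u, G) : W1" and phi: "C1p phi g"
 shows "G \<bullet> tol2 (%x. phi x *R c) = - (u \<bullet> tol2 (%x. g x \<bullet> c))"
proof -
 have cf: "continuous_on S phi" and cg: "continuous_on S g" for S
  using C1p_cont[OF phi] phi continuous_on_subset unfolding C1p_def by blast+
 have s: "sqi (%x. phi x *R c)" "sqi (%x. g x \<bullet> c)" by (intro tintegrable_cont(2) continuous_intros cf cg)+
 have "snd (u, G) \<bullet> tol2 (%x. phi x *R c) + fst (u, G) \<bullet> tol2 (%x. g x \<bullet> c) = 0"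
 proof (rule W1_functional_zero[OF _ _ uG])
  show "bounded_linear (%z. snd z \<bullet> tol2 (%x. phi x *R c) + fst z \<bullet> tol2 (%x. g x \<bullet> c))"
   by (intro bounded_linear_add bounded_linear_compose[OF bounded_linear_inner_left bounded_linear_snd]
    bounded_linear_compose[OF bounded_linear_inner_left bounded_linear_fst])
  fix k :: "int^'a"
  note m = C1p_mult[OF phi cas_C1p[of k]]
  have ci: "tintegrable (%x. (phi x *R cas (- k) x *R kv k + cas k x *R g x) $ i * c $ i)" for i
   by (intro tintegrable_cont(3) continuous_intros cf cg cas_cont)
  have "tint (%x. (phi x *R cas (- k) x *R kv k + cas k x *R g x) \<bullet> c)
    = (SUM i:UNIV. tint (%x. (phi x *R cas (- k) x *R kv k + cas k x *R g x) $ i * c $ i))"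
   unfolding inner_vec_def inner_real_def by (rule Bochner_Integration.integral_sum) (rule ci)
  also have "... = 0" using C1p_integral_zero[OF m] by simp
  finally have z: "tint (%x. (phi x *R cas (- k) x *R kv k + cas k x *R g x) \<bullet> c) = 0" .
  have "ecas (- k) (kv k) \<bullet> tol2 (%x. phi x *R c) + ecas k 1 \<bullet> tol2 (%x. g x \<bullet> c)
    = tint (%x. (cas (- k) x *R kv k) \<bullet> (phi x *R c)) + tint (%x. (cas k x *R 1) \<bullet> (g x \<bullet> c))"
   unfolding ecas_def inner_tol2[OF sqi_ecas s(1)] inner_tol2[OF sqi_ecas s(2)] ..
  also have "... = tint (%x. (cas (- k) x *R kv k) \<bullet> (phi x *R c) + (cas k x *R 1) \<bullet> (g x \<bullet> c))"
   by (rule integral_plus[symmetric]) (intro sqi_inner sqi_ecas s)+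
  also have "... = 0" using z by (simp add: inner_add_left mult_ac)
  finally show "snd (ecas k 1, ecas (- k) (kv k)) \<bullet> tol2 (%x. phi x *R c) + fst (ecas k 1, ecas (- k) (kv k)) \<bullet> tol2 (%x. g x \<bullet> c) = 0" by simp
 qed
 thus ?thesis by simp
qed

lemma grad_mean_zero: assumes "(u, G) : W1" shows "G \<bullet> tol2 (%x. c) = 0"
proof -
 have "G \<bullet> ecas 0 c = 0" using cf_inner[of 0 c G] W1_cf[OF assms, of 0] by (simp add: inner_commute)
 thus ?thesis by (simp add: ecas_def)
qed

locale hom =
 fixes B :: "real^'n => real^'n^'n" and \<pi> :: "real^'n => real^'n => real" and C1 C2 c0 c1 :: real
 assumes B_smooth: "!!j k. smooth_fun (%y. B y $ j $ k)"
  and B_periodic: "periodic B"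
  and B_sym: "!!y. transpose (B y) = B y"
  and B_bounds: "0 < C1" "C1 <= C2"
   "!!y \<xi>. C1 * (\<xi> \<bullet> \<xi>) <= \<xi> \<bullet> (B y *v \<xi>) & \<xi> \<bullet> (B y *v \<xi>) <= C2 * (\<xi> \<bullet> \<xi>)"
  and pi_smooth: "smooth_fun (%z. \<pi> (fst z) (snd z))"
  and pi_periodic: "!!x. periodic (\<pi> x)"
  and c0: "0 < c0" and pi_bounds: "!!x y. c0 <= \<pi> x y & \<pi> x y <= c1"
begin

lemma C2_pos: "0 < C2" using B_bounds by linarith
lemma Binv: "invertible (B y)" "B y *v (matrix_inv (B y) *v \<xi>) = \<xi>" "transpose (matrix_inv (B y)) = matrix_inv (B y)"
  "norm (matrix_inv (B y) *v \<xi>) <= 1 / C1 * norm \<xi>" "1 / C2 * (norm \<xi>)^2 <= \<xi> \<bullet> (matrix_inv (B y) *v \<xi>)"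
 by (rule matrix_inv_bounds[OF B_sym B_bounds(1) C2_pos B_bounds(3)])+

lemma B_cont: "continuous_on UNIV (%y. B y $ j $ k)" by (rule smooth_continuous[OF B_smooth])
lemma pi_cont: "continuous_on UNIV (%z. \<pi> (fst z) (snd z))" by (rule smooth_continuous[OF pi_smooth])
lemma c1_pos: "0 < c1" using c0 pi_bounds[of 0 0] by linarith

text \<open>The difference of two inverses applied to e_k is the inverse at \<open>y\<close> applied
  to e_k - \<open>B y *v v z\<close>; the inverses are uniformly bounded and this vector tends to
  zero.\<close>

lemma Binv_cont: "continuous_on UNIV (%y. matrix_inv (B y) $ j $ k)"
proof -
 define v where "v y = matrix_inv (B y) *v axis k 1" for y
 have "isCont v z" for z
 proof -
  have "((%y. v y - v z) \<longlongrightarrow> 0) (at z)"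
  proof (rule Lim_null_comparison)
   show "\<forall>\<^sub>F y in at z. norm (v y - v z) <= 1 / C1 * norm (axis k 1 - B y *v v z)"
   proof (rule always_eventually, rule allI)
    fix y
    have "matrix_inv (B y) *v (axis k 1 - B y *v v z) = v y - v z"
    using matrix_inv_mult[OF Binv(1)[of y]] by (simp add: matrix_vector_mult_diff_distrib matrix_vector_mul_assoc v_def[of y])
    thus "norm (v y - v z) <= 1 / C1 * norm (axis k 1 - B y *v v z)" using Binv(4)[of y "axis k 1 - B y *v v z"] by simp
   qed
   have "continuous_on UNIV (%y. 1 / C1 * norm (axis k 1 - B y *v v z))"
    by (intro continuous_intros continuous_on_matrix_vector B_cont)
   hence "((%y. 1 / C1 * norm (axis k 1 - B y *v v z)) \<longlongrightarrow> 1 / C1 * norm (axis k 1 - B z *v v z)) (at z)"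
    by (simp add: continuous_on_eq_continuous_at isCont_def)
   thus "((%y. 1 / C1 * norm (axis k 1 - B y *v v z)) \<longlongrightarrow> 0) (at z)" by (simp add: v_def Binv(2))
  qed
  thus ?thesis by (simp add: isCont_def LIM_zero_iff)
 qed
 hence "continuous_on UNIV (%y. v y $ j)" by (intro continuous_intros continuous_at_imp_continuous_on) auto
 moreover have "v y $ j = matrix_inv (B y) $ j $ k" for y
  by (simp add: v_def matrix_vector_mult_basis column_def)
 ultimately show ?thesis by simp
qed

abbreviation "Dxy \<equiv> Dmat B \<pi>"
abbreviation "pN N \<equiv> pi_eps \<pi> (1 / real (Suc N))"
abbreviation "MN N \<equiv> (%x. matrix_inv (B_eps B (1 / real (Suc N)) x))"
definition "DN N x = Dxy x (real (Suc N) *R x)"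

lemma pN_eq: "pN N x = \<pi> x (real (Suc N) *R x)" by (simp add: pi_eps_def)
lemma DN_eq: "DN N x = pN N x *R MN N x" by (simp add: DN_def Dmat_def pi_eps_def B_eps_def)

lemma Dxy_cont: "continuous_on UNIV (%z. Dxy (fst z) (snd z) $ i $ j)"
 unfolding Dmat_def vector_scaleR_component
 by (intro continuous_intros pi_cont continuous_on_compose2[OF Binv_cont[of i j]]) auto

lemma Dxy_sym: "transpose (Dxy x y) = Dxy x y"
 using Binv(3)[of y] by (simp add: Dmat_def transpose_def vec_eq_iff)

lemma Dxy_lo: "c0 / C2 * (norm \<xi>)^2 <= \<xi> \<bullet> (Dxy x y *v \<xi>)"
proof -
 have "c0 * (1 / C2 * (norm \<xi>)^2) <= \<pi> x y * (\<xi> \<bullet> (matrix_inv (B y) *v \<xi>))"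
  using Binv(5)[of \<xi> y] pi_bounds[of x y] c0 C2_pos by (intro mult_mono) auto
 thus ?thesis by (simp add: Dmat_def scaleR_matrix_vector_assoc[symmetric])
qed

lemma Dxy_hi: "norm (Dxy x y *v \<xi>) <= c1 / C1 * norm \<xi>"
proof -
 have "\<pi> x y * norm (matrix_inv (B y) *v \<xi>) <= c1 * (1 / C1 * norm \<xi>)"
  using Binv(4)[of y \<xi>] pi_bounds[of x y] c0 B_bounds(1) by (intro mult_mono) auto
 thus ?thesis using pi_bounds[of x y] c0 by (simp add: Dmat_def scaleR_matrix_vector_assoc[symmetric])
qed

lemma Dxy_periodic: "periodic (Dxy x)"
 using pi_periodic[of x] B_periodic by (simp add: periodic_def Dmat_def)

lemma cont_diag:
 fixes F :: "real^'n => real^'n => 'c::topological_space"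
 assumes "continuous_on UNIV (%z. F (fst z) (snd z))"
 shows "continuous_on S (%x. F x (c *R x))" "continuous_on S (F x)"
proof -
 have c1: "continuous_on S (%x. (x, c *R x))" by (rule continuous_on_Pair[OF continuous_on_id]) (rule continuous_on_scaleR[OF continuous_on_const continuous_on_id])
 have c2: "continuous_on S (%y. (x, y))" by (intro continuous_intros)
 show "continuous_on S (%x. F x (c *R x))" using continuous_on_compose2[OF assms c1] by simp
 show "continuous_on S (F x)" using continuous_on_compose2[OF assms c2] by simp
qed

lemma d0_pos: "0 < c0 / C2" using c0 C2_pos by simp

lemma coef_N: "coef (pN N) (DN N) c0 c1 (c0 / C2) (c1 / C1)"
proof
 show "continuous_on UNIV (pN N)" unfolding pN_eq[abs_def] by (rule cont_diag(1)[where F=\<pi>, OF pi_cont])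
 show "continuous_on UNIV (%x. DN N x $ i $ j)" for i j
  unfolding DN_def by (rule cont_diag(1)[where F="%x y. Dxy x y $ i $ j", OF Dxy_cont])
qed (unfold DN_def pN_eq, (rule c0 d0_pos Dxy_sym Dxy_lo Dxy_hi conjunct1[OF pi_bounds] conjunct2[OF pi_bounds])+)

lemma coef_x: "coef (\<pi> x) (Dxy x) c0 c1 (c0 / C2) (c1 / C1)"
proof
 show "continuous_on UNIV (\<pi> x)" by (rule cont_diag(2)[where F=\<pi>, OF pi_cont])
 show "continuous_on UNIV (%y. Dxy x y $ i $ j)" for i j
  by (rule cont_diag(2)[where F="%x y. Dxy x y $ i $ j", OF Dxy_cont])
qed (rule c0 d0_pos Dxy_sym Dxy_lo Dxy_hi conjunct1[OF pi_bounds] conjunct2[OF pi_bounds])+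

sublocale N: coef "pN N" "DN N" c0 c1 "c0 / C2" "c1 / C1" for N by (rule coef_N)
sublocale X: coef "\<pi> x" "Dxy x" c0 c1 "c0 / C2" "c1 / C1" for x by (rule coef_x)

definition "ei i = (tol2 (%y. axis i 1) :: ('n, real^'n) l2)"

text \<open>The corrector is sought through its gradient: the space of gradients is closed and the
  form is coercive on it, so the additive constant in the corrector never appears.\<close>

lemma cell_exists: "EX w g. (w, g) : W1 & (ALL v k. (v, k) : W1 --> X.aD x (ei i + g) k = 0)"
proof -
 interpret a: bounded_bilinear "X.aD x" by (rule X.aD_bb)
 have sub: "subspace (snd ` (W1 :: (('n, real) l2 \<times> _) set))" by (rule linear_subspace_image[OF linear_snd W1_subspace])
 obtain g where g: "g : snd ` (W1 :: (('n, real) l2 \<times> _) set)" "!!k. k : snd ` (W1 :: (('n, real) l2 \<times> _) set) ==> X.aD x g k = - X.aD x (ei i) k"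
  by (rule lax_milgram[OF sub closed_grads X.aD_bb X.aD_sym d0_pos X.aD_coer bounded_linear_minus[OF a.bounded_linear_right[of "ei i"]]]) blast
 obtain w where "(w, g) : W1" using g(1) by force
 moreover have "X.aD x (ei i + g) k = 0" if "(v, k) : W1" for v k
  using g(2)[of k] that by (force simp: a.add_left)
 ultimately show ?thesis by blast
qed

lemma test_in_W1: "test_fun phi ==> (tol2 phi, tol2 (pgrad phi)) : W1"
 by (rule C1p_in_W1[OF test_fun_C1p])

text \<open>Justifies the choice in \<open>cell_w\<close>: the Hilbert space solution is translated
  back into a function whose \<open>wgrad\<close> satisfies the cell problem.\<close>

lemma cell_w_props: "cell_sol B \<pi> x i (cell_w B \<pi> x i)"
proof -
 obtain w g where wg: "(w, g) : W1" and eq: "!!v k. (v, k) : W1 ==> X.aD x (ei i + g) k = 0"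
  using cell_exists[of x i] by blast
 have W: "has_weak_grad (fn w) (fn g)" "has_weak_grad (fn w) (wgrad (fn w))" "AE y in lc. wgrad (fn w) y = fn g y"
  by (rule W1_wgrad[OF wg], simp, rule fn_measurable)+
 have gm: "wgrad (fn w) : bmc" by (rule wgrad_measurable) (use W(1) in blast)
 have sg: "sqi (wgrad (fn w))" by (rule sqi_dominated[OF gm sqi_fn[of g]]) (use W(3) in \<open>auto elim: AE_mp\<close>)
 have tg: "tol2 (wgrad (fn w)) = g" using tol2_eqI[OF sg sqi_fn W(3)] by simp
 have "cell_sol B \<pi> x i (fn w)"
  unfolding cell_sol_def
 proof (intro conjI allI impI)
  show "EX g. has_weak_grad (fn w) g" using W(1) by blast
  show "tintegrable (%y. (fn w y)^2)" using sqi_fn[of w] by (simp add: sqi_def)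
  show "tintegrable (%y. (norm (wgrad (fn w) y))^2)" using sg by (simp add: sqi_def)
  fix phi :: "real^'n => real" assume t: "test_fun phi"
  have s: "sqi (%y. axis i 1 + wgrad (fn w) y)" by (intro sqi_add sg sqi_const)
  have "ei i + g = tol2 (%y. axis i 1 + wgrad (fn w) y)" unfolding ei_def tg[symmetric] by (rule add_tol2[OF sqi_const sg])
  hence "X.aD x (ei i + g) (tol2 (pgrad phi)) = tint (%y. (Dxy x y *v (axis i 1 + wgrad (fn w) y)) \<bullet> pgrad phi y)"
   using pw_tol2[OF X.b_D s] inner_tol2[OF sqi_pw[OF X.b_D s] test_fun_props(4)[OF t]] by (simp add: X.aD_def X.Dm_def)
  thus "tint (%y. (Dxy x y *v (wgrad (fn w) y + axis i 1)) \<bullet> pgrad phi y) = 0"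
   using eq[OF test_in_W1[OF t]] by (simp add: add.commute)
 qed
 thus ?thesis unfolding cell_w_def by (rule someI[of "cell_sol B \<pi> x i"])
qed

text \<open>The corrected unit field e_i + grad w_i. The matrix \<open>dh\<close> defined next is
  the effective matrix before division by the averaged density.\<close>

definition "Ec x i = tol2 (%y. axis i 1 + wgrad (cell_w B \<pi> x i) y)"
definition "dh x = Dbar B \<pi> x + Gbar B \<pi> x"

lemma cell_grad:
 shows sqi_cell: "sqi (wgrad (cell_w B \<pi> x i))"
  and Ec_diff: "EX w. (w, Ec x i - ei i) : W1"
  and Ec_orth: "(v, k) : W1 ==> X.aD x (Ec x i) k = 0"
proof -
 let ?w = "cell_w B \<pi> x i"
 have w: "EX g. has_weak_grad ?w g" "tintegrable (%y. (?w y)^2)" "tintegrable (%y. (norm (wgrad ?w y))^2)"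
  and e: "!!phi. test_fun phi ==> tint (%y. (Dmat B \<pi> x y *v (wgrad ?w y + axis i 1)) \<bullet> pgrad phi y) = 0"
  using cell_w_props[of x i] unfolding cell_sol_def by blast+
 have wg: "has_weak_grad ?w (wgrad ?w)" by (rule wgrad_weak[OF w(1)])
 note gm = wgrad_measurable[OF w(1)]
 show sg: "sqi (wgrad ?w)" using gm w(3) by (simp add: sqi_def)
 have sw: "sqi ?w" using w(2) wg by (simp add: sqi_def has_weak_grad_def borel_measurable_integrable)
 have W: "(tol2 ?w, tol2 (wgrad ?w)) : W1" unfolding W1_iff
  by (rule has_weak_grad_AE[OF wg]) (use fn_tol2[OF sw] fn_tol2[OF sg] in \<open>auto elim: AE_mp\<close>)
 have E: "Ec x i = ei i + tol2 (wgrad ?w)" unfolding Ec_def ei_def by (rule add_tol2[OF sqi_const sg, symmetric])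
 thus "EX w. (w, Ec x i - ei i) : W1" using W by auto
 interpret a: bounded_bilinear "X.aD x" by (rule X.aD_bb)
 assume vk: "(v, k) : W1"
 have "X.aD x (Ec x i) (snd (v, k)) = 0"
 proof (rule W1_functional_zero[OF _ _ vk])
  show "bounded_linear (%z. X.aD x (Ec x i) (snd z))" by (intro bounded_linear_compose[OF a.bounded_linear_right bounded_linear_snd])
  fix l :: "int^'n"
  have s: "sqi (%y. axis i 1 + wgrad ?w y)" by (intro sqi_add sg sqi_const)
  have pg: "pgrad (cas l) = (%x. cas (- l) x *R kv l)" by (rule C1p_pgrad[OF cas_C1p])
  have "X.aD x (Ec x i) (tol2 (pgrad (cas l))) = tint (%y. (Dxy x y *v (axis i 1 + wgrad ?w y)) \<bullet> pgrad (cas l) y)"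
   using pw_tol2[OF X.b_D s] inner_tol2[OF sqi_pw[OF X.b_D s] test_fun_props(4)[OF cas_test[of l]]]
   by (simp add: X.aD_def X.Dm_def Ec_def)
  thus "X.aD x (Ec x i) (snd (ecas l 1, ecas (- l) (kv l))) = 0"
   using e[OF cas_test[of l]] unfolding ecas_def snd_conv pg by (simp add: add.commute)
 qed
 thus "X.aD x (Ec x i) k = 0" by simp
qed

lemma dh_entry: "dh x $ j $ i = X.aD x (Ec x i) (ei j)"
proof -
 let ?w = "cell_w B \<pi> x i"
 have s: "sqi (%y. axis i 1 + wgrad ?w y)" by (intro sqi_add sqi_cell sqi_const)
 have "X.aD x (Ec x i) (ei j) = tint (%y. (Dxy x y *v (axis i 1 + wgrad ?w y)) \<bullet> axis j 1)"
  using pw_tol2[OF X.b_D s] inner_tol2[OF sqi_pw[OF X.b_D s] sqi_const[of "axis j 1"]] by (simp add: X.aD_def X.Dm_def Ec_def ei_def)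
 also have "... = tint (%y. (Dxy x y *v axis i 1) \<bullet> axis j 1 + (Dxy x y *v wgrad ?w y) \<bullet> axis j 1)"
  by (simp add: matrix_vector_right_distrib inner_add_left)
 also have "... = tint (%y. (Dxy x y *v axis i 1) \<bullet> axis j 1) + tint (%y. (Dxy x y *v wgrad ?w y) \<bullet> axis j 1)"
  by (rule integral_plus) (intro sqi_inner sqi_pw[OF X.b_D] sqi_cell sqi_const)+
 also have "... = dh x $ j $ i"
  by (simp add: dh_def Dbar_def Gbar_def inner_axis matrix_vector_mult_basis column_def)
 finally show ?thesis by simp
qed

text \<open>The cell equation makes the flux of \<open>Ec x i\<close> orthogonal to gradients, so
  e_j may be replaced by \<open>Ec x j\<close> in \<open>dh_entry\<close>. In this form symmetry and
  coercivity of the effective matrix are visible.\<close>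

lemma dh_form: "dh x $ j $ i = X.aD x (Ec x i) (Ec x j)"
proof -
 interpret a: bounded_bilinear "X.aD x" by (rule X.aD_bb)
 obtain w where "(w, Ec x j - ei j) : W1" using Ec_diff by blast
 from Ec_orth[OF this, of x i] show ?thesis by (simp add: dh_entry a.diff_right)
qed

lemma dh_sym: "transpose (dh x) = dh x"
 unfolding transpose_def vec_eq_iff by (auto simp: dh_form) (rule X.aD_sym)

text \<open>The energy of the corrected field equals its pairing with the unit field e_i, so one
  power of the norm cancels against coercivity.\<close>

lemma Ec_bound: "norm (Ec x i) <= c1 / C1 / (c0 / C2)"
proof -
 interpret a: bounded_bilinear "X.aD x" by (rule X.aD_bb)
 have n1: "norm (ei i) = 1"
 proof -
  have "(norm (ei i))^2 = 1" unfolding ei_def norm_tol2_sq[OF sqi_const] by (simp add: measure_cell measure_restrict_space)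
  thus ?thesis by (simp add: power2_eq_1_iff) (smt (verit) norm_ge_zero)
 qed
 have "c0 / C2 * (norm (Ec x i))^2 <= X.aD x (Ec x i) (Ec x i)" by (rule X.aD_coer)
 also have "... = X.aD x (Ec x i) (ei i)" by (metis dh_entry dh_form)
 also have "... <= c1 / C1 * norm (Ec x i) * norm (ei i)" using X.aD_le[of x "Ec x i" "ei i"] by simp
 finally have le: "c0 / C2 * (norm (Ec x i))^2 <= c1 / C1 * norm (Ec x i)" unfolding n1 by simp
 have "c0 / C2 * norm (Ec x i) <= c1 / C1" by (rule cancel_square[OF le]) (use c1_pos B_bounds(1) in auto)
 thus ?thesis by (subst pos_le_divide_eq[OF d0_pos]) (simp only: mult.commute)
qed

text \<open>The combination \<open>E\<close> of corrected fields has mean \<xi>, since gradients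
  have mean zero; hence its norm is at least that of \<xi>, and its energy is the quadratic
  form.\<close>

lemma dh_coercive: "c0 / C2 * (norm \<xi>)^2 <= \<xi> \<bullet> (dh x *v \<xi>)"
proof -
 interpret a: bounded_bilinear "X.aD x" by (rule X.aD_bb)
 define E where "E = (SUM i:UNIV. \<xi> $ i *R Ec x i)"
 have "X.aD x E E = (SUM i:UNIV. \<xi> $ i * (SUM j:UNIV. \<xi> $ j * dh x $ i $ j))"
  by (simp add: E_def a.sum_left a.sum_right a.scaleR_left a.scaleR_right dh_form sum_distrib_left)
 also have "... = \<xi> \<bullet> (dh x *v \<xi>)" by (simp add: inner_vec_def matrix_vector_mult_def mult.commute)
 finally have "\<xi> \<bullet> (dh x *v \<xi>) = X.aD x E E" ..
 moreover have "norm \<xi> <= norm E"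
 proof -
  have inn: "Ec x i \<bullet> tol2 (%y. \<xi>) = \<xi> $ i" for i
  proof -
   obtain w where "(w, Ec x i - ei i) : W1" using Ec_diff by blast
   from grad_mean_zero[OF this, of \<xi>] have "Ec x i \<bullet> tol2 (%y. \<xi>) = ei i \<bullet> tol2 (%y. \<xi>)" by (simp add: inner_diff_left)
   also have "... = \<xi> $ i" unfolding ei_def inner_tol2[OF sqi_const sqi_const] by (simp add: inner_axis' measure_cell measure_restrict_space)
   finally show ?thesis .
  qed
  have n: "norm (tol2 (%y::real^'n. \<xi>)) = norm \<xi>"
  proof -
   have "(norm (tol2 (%y::real^'n. \<xi>)))^2 = (norm \<xi>)^2" unfolding norm_tol2_sq[OF sqi_const] by (rule tint_const)
   thus ?thesis by (rule power2_eq_imp_eq) auto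
  qed
  have "(norm \<xi>)^2 = E \<bullet> tol2 (%y. \<xi>)"
   by (simp add: E_def inner_sum_left inn power2_norm_eq_inner inner_vec_def)
  also have "... <= norm E * norm \<xi>" using norm_cauchy_schwarz[of E "tol2 (%y. \<xi>)"] n by simp
  finally show ?thesis by (cases "\<xi> = 0") (auto simp: power2_eq_square)
 qed
 hence "c0 / C2 * (norm \<xi>)^2 <= c0 / C2 * (norm E)^2" using d0_pos by (intro mult_left_mono power_mono) auto
 ultimately show ?thesis using X.aD_coer[of E x] by simp
qed

text \<open>The difference of two corrected fields is a gradient; both cell equations are tested
  with it. The resulting Lipschitz dependence on the coefficients is what permits freezing the slow
  variable.\<close>

lemma Ec_perturb:
 assumes d: "!!y v. y : cell ==> norm ((Dxy x y - Dxy x' y) *v v) <= \<delta> * norm v" and \<delta>: "0 <= \<delta>"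
 shows "norm (X.Dm x u - X.Dm x' u) <= \<delta> * norm u"
  "norm (Ec x i - Ec x' i) <= \<delta> * (c1 / C1 / (c0 / C2)) / (c0 / C2)"
proof -
 interpret a: bounded_bilinear "X.aD x" by (rule X.aD_bb)
 show D: "norm (X.Dm x u - X.Dm x' u) <= \<delta> * norm u" for u
 proof -
  have s: "sqi (%y. Dxy x y *v fn u y)" "sqi (%y. Dxy x' y *v fn u y)" by (rule sqi_pw[OF X.b_D sqi_fn])+
  have "X.Dm x u - X.Dm x' u = tol2 (%y. Dxy x y *v fn u y - Dxy x' y *v fn u y)"
   unfolding X.Dm_def pw_def by (rule diff_tol2[OF s])
  also have "norm ... <= norm (tol2 (%y. \<delta> *R fn u y))"
   using d \<delta> by (intro norm_tol2_mono sqi_diff s sqi_scale sqi_fn AE_I2) (auto simp: matrix_vector_mult_diff_rdistrib[symmetric])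
  also have "... = \<delta> * norm u" using scaleR_tol2[OF sqi_fn[of u], of \<delta>] \<delta> by (metis abs_of_nonneg norm_scaleR tol2_fn)
  finally show ?thesis .
 qed
 obtain w where w: "(w, Ec x i - ei i) : W1" using Ec_diff by blast
 obtain w' where w': "(w', Ec x' i - ei i) : W1" using Ec_diff by blast
 let ?d = "Ec x i - Ec x' i"
 have W: "(w - w', ?d) : W1" using subspace_diff[OF W1_subspace w w'] by simp
 have "c0 / C2 * (norm ?d)^2 <= X.aD x ?d ?d" by (rule X.aD_coer)
 also have "... = - X.aD x (Ec x' i) ?d" using Ec_orth[OF W, of x i] by (simp add: a.diff_left)
 also have "... = (X.Dm x' (Ec x' i) - X.Dm x (Ec x' i)) \<bullet> ?d" using Ec_orth[OF W, of x' i] by (simp add: X.aD_def inner_diff_left)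
 also have "... <= norm (X.Dm x' (Ec x' i) - X.Dm x (Ec x' i)) * norm ?d" by (rule norm_cauchy_schwarz)
 also have "... <= (\<delta> * (c1 / C1 / (c0 / C2))) * norm ?d"
  using order_trans[OF D[of "Ec x' i"] mult_left_mono[OF Ec_bound \<delta>]] by (intro mult_right_mono) (auto simp: norm_minus_commute)
 finally have le: "c0 / C2 * (norm ?d)^2 <= \<delta> * (c1 / C1 / (c0 / C2)) * norm ?d" .
 have "c0 / C2 * norm ?d <= \<delta> * (c1 / C1 / (c0 / C2))"
  by (rule cancel_square[OF le]) (use \<delta> c1_pos B_bounds(1) c0 C2_pos in auto)
 thus "norm ?d <= \<delta> * (c1 / C1 / (c0 / C2)) / (c0 / C2)" by (subst pos_le_divide_eq[OF d0_pos]) (subst mult.commute, assumption)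
qed

end

text \<open>Trigonometric polynomials are dense, and \<open>C + norm Y + 1\<close> bounds the price
  of replacing \<open>psi\<close> by a truncation.\<close>

lemma weak_limit_from_cas:
 fixes X :: "nat => ('n::finite, 'b::euclidean_space) l2"
 assumes b: "!!k. norm (X k) <= C" and c: "!!l b. b : Basis ==> (%k. X k \<bullet> ecas l b) ----> Y \<bullet> ecas l b"
 shows "(%k. X k \<bullet> psi) ----> Y \<bullet> psi"
proof (rule tendstoI)
 fix e :: real assume e: "0 < e"
 have C: "0 <= C" using b[of 0] norm_ge_zero order_trans by blast
 have ec: "ecas l v = (SUM b:Basis. (v \<bullet> b) *R ecas l b)" for l :: "int^'n" and v :: 'b
 proof -
  have "ecas l (SUM b:Basis. (v \<bullet> b) *R b) = (SUM b:Basis. (v \<bullet> b) *R ecas l b)"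
   by (simp add: linear_sum[OF linear_ecas] linear_cmul[OF linear_ecas])
  thus ?thesis by (simp add: euclidean_representation)
 qed
 have P: "(%k. X k \<bullet> PN M psi) ----> Y \<bullet> PN M psi" for M
 proof -
  have "Z \<bullet> PN M psi = (SUM l:Kb M. SUM b:Basis. (cf l psi \<bullet> b) * (Z \<bullet> ecas l b))" for Z
   unfolding PN_def by (subst ec) (simp add: inner_sum_right)
  thus ?thesis by (simp only:) (intro tendsto_sum tendsto_mult_left c)
 qed
 define K where "K = C + norm Y + 1"
 have K: "0 < K" using C by (simp add: K_def add_nonneg_pos)
 have "0 < e / (2 * K)" using e K by simp
 then obtain M where M: "dist (PN M psi) psi < e / (2 * K)"
  using PN_tendsto[of psi] unfolding LIMSEQ_def by blast
 have "\<forall>\<^sub>F k in sequentially. dist (X k \<bullet> PN M psi) (Y \<bullet> PN M psi) < e / 2"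
  using P[of M] e by (intro tendstoD) auto
 thus "\<forall>\<^sub>F k in sequentially. dist (X k \<bullet> psi) (Y \<bullet> psi) < e"
 proof eventually_elim
  case (elim k)
  have "\<bar>(X k - Y) \<bullet> (psi - PN M psi)\<bar> <= norm (X k - Y) * norm (psi - PN M psi)" by (rule Cauchy_Schwarz_ineq2)
  also have "... <= K * (e / (2 * K))"
   using M norm_triangle_ineq4[of "X k" Y] b[of k] K_def K by (intro mult_mono) (auto simp: dist_norm norm_minus_commute)
  also have "... = e / 2" using K by simp
  also have "(X k - Y) \<bullet> (psi - PN M psi) = (X k \<bullet> psi - Y \<bullet> psi) - (X k \<bullet> PN M psi - Y \<bullet> PN M psi)"
   by (simp add: inner_diff_left inner_diff_right)
  finally have "\<bar>(X k \<bullet> psi - Y \<bullet> psi) - (X k \<bullet> PN M psi - Y \<bullet> PN M psi)\<bar> <= e / 2" .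
  thus ?case using elim unfolding dist_real_def by linarith
 qed
qed

section \<open>Bounded multipliers, dilations and partitions of the cell\<close>

lemma sqi_inner_bdd:
 fixes F h :: "real^'n => 'b::euclidean_space"
 assumes F: "sqi F" and h: "h : bmc" "!!x. x : cell ==> norm (h x) <= K"
 shows "sqi (%x. F x \<bullet> h x)" "norm (tol2 (%x. F x \<bullet> h x)) <= K * norm (tol2 F)"
proof -
 have K: "0 <= K" using order_trans[OF norm_ge_zero h(2)[of 0]] by (simp add: mem_cell)
 have m: "(%x. F x \<bullet> h x) : bmc" using sqi_measurable[OF F] h(1) by (rule borel_measurable_inner)
 have ae: "AE x in lc. norm (F x \<bullet> h x) <= norm (K *R F x)"
 proof (rule AE_I2)
  fix x assume "x : space (lebesgue_on (cell :: (real^'n) set))"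
  hence "norm (F x) * norm (h x) <= norm (F x) * K" using h(2)[of x] by (intro mult_left_mono) auto
  thus "norm (F x \<bullet> h x) <= norm (K *R F x)" using Cauchy_Schwarz_ineq2[of "F x" "h x"] K by (simp add: mult.commute)
 qed
 show s: "sqi (%x. F x \<bullet> h x)" by (rule sqi_dominated[OF m sqi_scale[OF F] ae])
 have "norm (tol2 (%x. F x \<bullet> h x)) <= norm (tol2 (%x. K *R F x))" by (rule norm_tol2_mono[OF s sqi_scale[OF F] ae])
 also have "... = K * norm (tol2 F)" using scaleR_tol2[OF F, of K] K by (metis abs_of_nonneg norm_scaleR)
 finally show "norm (tol2 (%x. F x \<bullet> h x)) <= K * norm (tol2 F)" .
qed

lemma norm_tol2_bdd:
 fixes F :: "real^'n => 'b::euclidean_space"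
 assumes "sqi F" "!!x. x : cell ==> norm (F x) <= K" shows "norm (tol2 F) <= K"
proof -
 have K: "0 <= K" using order_trans[OF norm_ge_zero assms(2)[of 0]] by (simp add: mem_cell)
 have "norm (tol2 F) <= norm (tol2 (%x::real^'n. K))" by (rule norm_tol2_mono[OF assms(1) sqi_const]) (use assms(2) K in auto)
 also have "... = K"
 proof -
  have "(norm (tol2 (%x::real^'n. K)))^2 = K^2" unfolding norm_tol2_sq[OF sqi_const] real_norm_def power2_abs by (rule tint_const)
  thus ?thesis using K by (simp add: power2_eq_imp_eq)
 qed
 finally show ?thesis .
qed

lemma tintegrable_bdd_mult:
 assumes "psi : bmc" "!!x. x : cell ==> \<bar>psi x\<bar> <= K" "tintegrable u"
 shows "tintegrable (%x. psi x * u x)"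
proof (rule integrable_dom)
 show "tintegrable (%x. K * u x)" using assms(3) by simp
 show "(%x. psi x * u x) : bmc" using assms(1) borel_measurable_integrable[OF assms(3)] by simp
 show "AE x in lc. norm (psi x * u x) <= norm (K * u x)"
 proof (rule AE_I2)
  fix x assume "x : space (lebesgue_on (cell :: (real^'a) set))"
  hence "\<bar>psi x\<bar> <= \<bar>K\<bar>" using assms(2)[of x] by simp
  thus "norm (psi x * u x) <= norm (K * u x)" by (simp add: abs_mult mult_right_mono)
 qed
qed

lemma C1p_dilate: assumes C: "C1p phi g" shows "C1p (%x. phi (real N *R x)) (%x. real N *R g (real N *R x))"
 unfolding C1p_def
proof (intro conjI allI)
 have p: "periodic phi" and d: "!!x. (phi has_derivative (%v. g x \<bullet> v)) (at x)" and c: "continuous_on UNIV g"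
  using C unfolding C1p_def by blast+
 show "periodic (%x. phi (real N *R x))" unfolding periodic_def
  using periodic_int_axis[OF p, of _ "int N"] by (simp add: scaleR_add_right)
 have "((%x. phi (real N *R x)) has_derivative (%v. g (real N *R x) \<bullet> (real N *R v))) (at x)" for x
  by (rule has_derivative_compose[OF _ d]) (auto intro!: derivative_eq_intros)
 thus "((%x. phi (real N *R x)) has_derivative (%v. (real N *R g (real N *R x)) \<bullet> v)) (at x)" for x by simp
 show "continuous_on UNIV (%x. real N *R g (real N *R x))"
  by (intro continuous_intros continuous_on_compose2[OF c]) auto
qed

lemma C1p_grad_periodic: assumes C: "C1p phi g" shows "periodic g"
 unfolding periodic_def
proof (intro allI)
 fix x :: "real^'a" and i
 have p: "!!x i. phi (x + axis i 1) = phi x" and d: "!!x. (phi has_derivative (%v. g x \<bullet> v)) (at x)"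
  using C unfolding C1p_def periodic_def by blast+
 have "((%x. phi (x + axis i 1)) has_derivative (%v. g (x + axis i 1) \<bullet> v)) (at x)"
  by (rule has_derivative_compose[OF _ d]) (auto intro!: derivative_eq_intros)
 hence "(%v. g (x + axis i 1) \<bullet> v) = (%v. g x \<bullet> v)" unfolding p by (rule has_derivative_unique[OF _ d])
 hence "g (x + axis i 1) \<bullet> v = g x \<bullet> v" for v by (rule fun_cong)
 thus "g (x + axis i 1) = g x" using vector_eq_rdot by blast
qed

lemma kv_sc: "kv (sc N k) = real N *R kv k" by (simp add: kv_def sc_def vec_eq_iff)

lemma sum_tol2:
 assumes "finite I" "!!i. i : I ==> sqi (F i)" shows "sqi (%x. SUM i:I. F i x) & (SUM i:I. tol2 (F i)) = tol2 (%x. SUM i:I. F i x)"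
 using assms by (induction I rule: finite_induct) (auto simp: zero_tol2[symmetric] add_tol2 sqi_add)

text \<open>Covering and disjointness are stated together as uniqueness of the index, the form used
  to split integrals.\<close>

definition partition :: "real => nat set => (nat => (real^'n) set) => bool" where
 "partition d I A \<longleftrightarrow> finite I & (ALL j:I. A j : sets borel & A j \<subseteq> cell & (ALL x:A j. ALL y:A j. dist x y < d)) \<and>
   (ALL x:cell. EX! j. j : I & x : A j)"

lemma partitionD:
 assumes "partition d I A"
 shows "finite I" "ALL j:I. A j : sets borel & A j \<subseteq> cell & (ALL x:A j. ALL y:A j. dist x y < d)"
  "ALL x:cell. EX! j. j : I & x : A j"
 using assms unfolding partition_def by - (elim conjE, assumption)+

lemma cell_partition:
 fixes d :: real
 assumes d: "0 < d"
 shows "EX I (A :: nat => (real^'n) set). partition d I A"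
proof -
 have "cell \<subseteq> (\<Union>p\<in>(cell :: (real^'n) set). ball p (d/2))" using d by auto
 then obtain P where P: "P \<subseteq> (cell :: (real^'n) set)" "finite P" "cell \<subseteq> (\<Union>p\<in>P. ball p (d/2))"
  by (rule compactE_image[OF cell_compact, rotated]) auto
 obtain ps where ps: "set ps = P" using finite_list[OF P(2)] by blast
 define U where "U j = ball (ps ! j) (d/2)" for j
 define A where "A j = (cell :: (real^'n) set) \<inter> disjointed U j" for j
 show ?thesis unfolding partition_def
 proof (rule exI[of _ "{..<length ps}"], rule exI[of _ A], intro conjI ballI)
  show "A j : sets borel" for j
  proof -
   have "range (disjointed U) \<subseteq> sets borel" by (rule sets.range_disjointed_sets) (auto simp: U_def)
   thus ?thesis by (auto simp: A_def cell_def intro!: sets.Int)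
  qed
  show "dist x y < d" if "x : A j" "y : A j" for j x y
  proof -
   have "dist (ps ! j) x < d/2" "dist (ps ! j) y < d/2" using that disjointed_subset[of U j] by (auto simp: A_def U_def)
   thus ?thesis using dist_triangle_half_r by blast
  qed
  show "EX! j. j : {..<length ps} & x : A j" if x: "x : cell" for x
  proof -
   obtain j where j: "j < length ps" "x : U j" using P(3) x ps unfolding U_def in_set_conv_nth[symmetric] by (fastforce simp: in_set_conv_nth)
   define m where "m = (LEAST m. x : U m)"
   have m: "x : U m" "m <= j" unfolding m_def using j by (auto intro: LeastI Least_le)
   have "x \<notin> U i" if "i < m" for i using not_less_Least that unfolding m_def by blast
   hence xA: "x : A m" using m x by (auto simp: A_def disjointed_def)
   have "i = m" if "x : A i" for i
    by (rule ccontr) (use that xA disjoint_family_onD[OF disjoint_family_disjointed[of U], of i m] in \<open>auto simp: A_def\<close>)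
   note uniq = this
   have "m : {..<length ps}" using order.strict_trans1[OF m(2) j(1)] by simp
   thus ?thesis using xA uniq by (rule_tac ex1I[of _ m]) blast+
  qed
 qed (auto simp: A_def)
qed

lemma borel_indicator: "A : sets borel ==> (indicator A :: real^'n => real) : bmc"
 by (intro borel_measurable_indicator') (auto simp: sets_restrict_space)

lemma tintegrable_indicator: "A : sets borel ==> tintegrable u ==> tintegrable (%x. indicator A x * u x)"
 by (rule tintegrable_bdd_mult[OF borel_indicator, of _ 1]) (auto simp: indicator_def)

lemma partition_indicator:
 fixes A :: "nat => 'a set"
 assumes "finite I" "EX! j. j : I & x : A j" shows "(SUM j:I. indicator (A j) x * c j) = (c (THE j. j : I & x : A j) :: real)"
proof -
 let ?j = "THE j. j : I & x : A j"
 have j: "?j : I & x : A ?j" by (rule theI'[OF assms(2)])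
 have "indicator (A j) x * c j = (if j = ?j then c j else 0)" if "j : I" for j
  using j that assms(2) by (cases "x : A j") auto
 hence "(SUM j:I. indicator (A j) x * c j) = (SUM j:I. if j = ?j then c j else 0)" by (rule sum.cong[OF refl])
 also have "... = c ?j" using j assms(1) by (simp add: sum.delta)
 finally show ?thesis .
qed

lemma tint_partition:
 fixes u :: "real^'n => real" and A :: "nat => (real^'n) set"
 assumes "finite I" "!!j. j : I ==> A j : sets borel" "!!x. x : cell ==> EX! j. j : I & x : A j" "tintegrable u"
 shows "tint u = (SUM j:I. tint (%x. indicator (A j) x * u x))"
proof -
 have "tint u = tint (%x. SUM j:I. indicator (A j) x * u x)"
 proof (rule Bochner_Integration.integral_cong[OF refl])
  fix x assume "x : space (lebesgue_on (cell :: (real^'n) set))"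
  thus "u x = (SUM j:I. indicator (A j) x * u x)"
   using partition_indicator[OF assms(1), of x A "%_. u x"] assms(3)[of x] by simp
 qed
 also have "... = (SUM j:I. tint (%x. indicator (A j) x * u x))"
  by (rule Bochner_Integration.integral_sum) (rule tintegrable_indicator[OF assms(2) assms(4)])
 finally show ?thesis .
qed

context hom begin

text \<open>Uniform continuity of the entries on a compact set; the number \<open>c\<close> of
  entries of the matrix is the price of passing to the operator norm.\<close>

lemma Dxy_unif:
 assumes \<omega>: "0 < \<omega>" and S: "compact S"
 obtains d where "0 < d" "!!x x' y v. x : S ==> x' : S ==> y : cell ==> dist x x' < d ==> norm ((Dxy x y - Dxy x' y) *v v) <= \<omega> * norm v"
proof -
 define c where "c = real CARD('n) * real CARD('n)"
 have c: "0 < c" by (simp add: c_def)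
 have "EX d>0. ALL x:S. ALL x':S. ALL y:cell. dist x x' < d --> \<bar>Dxy x y $ i $ j - Dxy x' y $ i $ j\<bar> < \<omega> / c" for i j
 proof -
  have "uniformly_continuous_on (S \<times> cell) (%z. Dxy (fst z) (snd z) $ i $ j)"
   by (intro compact_uniformly_continuous compact_Times S cell_compact continuous_on_subset[OF Dxy_cont]) auto
  moreover have "0 < \<omega> / c" using \<omega> c by simp
  ultimately obtain d where d: "0 < d" "!!z z'. z : S \<times> cell ==> z' : S \<times> cell ==> dist z' z < d ==>
    dist (Dxy (fst z') (snd z') $ i $ j) (Dxy (fst z) (snd z) $ i $ j) < \<omega> / c"
   unfolding uniformly_continuous_on_def by meson
  have "\<bar>Dxy x y $ i $ j - Dxy x' y $ i $ j\<bar> < \<omega> / c" if "x : S" "x' : S" "y : cell" "dist x x' < d" for x x' y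
   using d(2)[of "(x', y)" "(x, y)"] that by (simp add: dist_Pair_Pair dist_real_def)
  thus ?thesis using d(1) by blast
 qed
 hence ex: "EX d. 0 < d & (ALL x:S. ALL x':S. ALL y:cell. dist x x' < d --> \<bar>Dxy x y $ i $ j - Dxy x' y $ i $ j\<bar> < \<omega> / c)" for i j .
 define dd where "dd i j = (SOME d. 0 < d & (ALL x:S. ALL x':S. ALL y:cell. dist x x' < d --> \<bar>Dxy x y $ i $ j - Dxy x' y $ i $ j\<bar> < \<omega> / c))" for i j
 have dd: "!!i j. 0 < dd i j" "!!i j x x' y. x : S ==> x' : S ==> y : cell ==> dist x x' < dd i j ==> \<bar>Dxy x y $ i $ j - Dxy x' y $ i $ j\<bar> < \<omega> / c"
  using someI_ex[OF ex] unfolding dd_def by blast+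
 define d where "d = Min (range (%(i, j). dd i j))"
 show ?thesis
 proof (rule that[of d])
  show "0 < d" using dd(1) by (auto simp: d_def)
  fix x x' y v :: "real^'n" assume *: "x : S" "x' : S" "y : cell" "dist x x' < d"
  have "d <= dd i j" for i j unfolding d_def by (rule Min_le) auto
  hence "dist x x' < dd i j" for i j using *(4) less_le_trans by blast
  hence "\<bar>(Dxy x y - Dxy x' y) $ i $ j\<bar> <= \<omega> / c" for i j using dd(2)[OF *(1-3), of i j] by (simp add: less_imp_le)
  hence "onorm ((*v) (Dxy x y - Dxy x' y)) <= c * (\<omega> / c)" unfolding c_def by (rule onorm_le_matrix_component)
  hence "onorm ((*v) (Dxy x y - Dxy x' y)) * norm v <= \<omega> * norm v" using c by (intro mult_right_mono) auto
  thus "norm ((Dxy x y - Dxy x' y) *v v) <= \<omega> * norm v"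
   using onorm[OF matrix_vector_mul_bounded_linear[of "Dxy x y - Dxy x' y"], of v] by linarith
 qed
qed

section \<open>Bounds and continuity of the effective matrix\<close>

abbreviation "d0 \<equiv> c0 / C2"
abbreviation "d1 \<equiv> c1 / C1"
abbreviation "KE \<equiv> c1 / C1 / (c0 / C2)"

lemma d1_pos: "0 < d1" and KE_pos: "0 < KE" by (rule divide_pos_pos[OF c1_pos B_bounds(1)], rule divide_pos_pos[OF divide_pos_pos[OF c1_pos B_bounds(1)] d0_pos])

text \<open>The mean flux of the i-th cell solution, a column of \<open>dh\<close>. It is written as
  the zeroth Fourier coefficient because that is the only mode of the flux that survives in
  \<open>grad_osc\<close>.\<close>

definition "dcol x i = cf 0 (X.Dm x (Ec x i))"

lemma dcol_nth: "dcol x i $ j = dh x $ j $ i"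
proof -
 have "dcol x i $ j = ecas 0 (axis j 1) \<bullet> X.Dm x (Ec x i)" by (simp add: dcol_def cf_inner inner_axis')
 also have "... = dh x $ j $ i" by (simp add: dh_entry X.aD_def ei_def ecas_def inner_commute)
 finally show ?thesis .
qed

lemma dh_dcol: "(dh x *v v) $ i = v \<bullet> dcol x i"
proof -
 have "dh x $ i $ j = dh x $ j $ i" for j using dh_sym[of x] unfolding transpose_def vec_eq_iff by simp
 thus ?thesis by (simp add: matrix_vector_mult_def inner_vec_def dcol_nth mult.commute)
qed

lemma norm_cf: "norm (cf k G) <= norm G"
proof -
 have "(norm (cf k G))^2 <= (norm G)^2" using bessel[of "{k}" G] by simp
 thus ?thesis by (rule power2_le_imp_le) simp
qed

lemma dcol_bound: "norm (dcol x i) <= d1 * KE"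
proof -
 have "norm (X.Dm x (Ec x i)) <= d1 * norm (Ec x i)" unfolding X.Dm_def by (rule norm_pw[OF X.b_D])
 also have "... <= d1 * KE" using Ec_bound d1_pos by (intro mult_left_mono) auto
 finally show ?thesis using norm_cf[of 0 "X.Dm x (Ec x i)"] by (simp add: dcol_def)
qed

text \<open>The two summands of the constant account for the change of the coefficients at a fixed
  field and for the change of the corrected field.\<close>

lemma dcol_perturb:
 assumes d: "!!y v. y : cell ==> norm ((Dxy x y - Dxy x' y) *v v) <= \<delta> * norm v" and \<delta>: "0 <= \<delta>"
 shows "norm (dcol x i - dcol x' i) <= \<delta> * (KE + d1 * (KE / d0))"
proof -
 note p = Ec_perturb[OF d \<delta>]
 have eq: "X.Dm x (Ec x i) - X.Dm x' (Ec x' i) = (X.Dm x (Ec x i) - X.Dm x' (Ec x i)) + X.Dm x' (Ec x i - Ec x' i)"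
  using linear_diff[OF bounded_linear.linear[OF X.bl_Dm]] by simp
 have "norm (X.Dm x (Ec x i) - X.Dm x' (Ec x i)) <= \<delta> * KE"
  by (rule order_trans[OF p(1) mult_left_mono[OF Ec_bound \<delta>]])
 moreover have "norm (X.Dm x' (Ec x i - Ec x' i)) <= d1 * (\<delta> * KE / d0)"
  unfolding X.Dm_def by (rule order_trans[OF norm_pw[OF X.b_D] mult_left_mono[OF p(2)]]) (use d1_pos in auto)
 ultimately have "norm (X.Dm x (Ec x i) - X.Dm x' (Ec x' i)) <= \<delta> * KE + d1 * (\<delta> * KE / d0)"
  unfolding eq using norm_triangle_ineq order_trans add_mono by meson
 also have "... = \<delta> * (KE + d1 * (KE / d0))" by (simp add: distrib_left)
 finally show ?thesis using norm_cf[of 0 "X.Dm x (Ec x i) - X.Dm x' (Ec x' i)"] unfolding dcol_def cf_diff by linarith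
qed

lemma dcol_cont_compact:
 assumes S: "compact S" shows "continuous_on S (%x. dcol x i)"
 unfolding continuous_on_iff
proof (intro ballI allI impI)
 fix x :: "real^'n" and e :: real assume x: "x : S" and e: "0 < e"
 define K where "K = KE + d1 * (KE / d0)"
 have K: "0 < K" unfolding K_def by (rule add_pos_pos[OF KE_pos mult_pos_pos[OF d1_pos divide_pos_pos[OF KE_pos d0_pos]]])
 have "0 < e / (2 * K)" using e K by simp
 then obtain d where d: "0 < d" "!!x x' y v. x : S ==> x' : S ==> y : cell ==> dist x x' < d ==> norm ((Dxy x y - Dxy x' y) *v v) <= e / (2 * K) * norm v"
  by (rule Dxy_unif[OF _ S]) blast
 have "dist (dcol x' i) (dcol x i) < e" if "x' : S" "dist x' x < d" for x'
 proof -
  have "norm (dcol x' i - dcol x i) <= e / (2 * K) * K"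
   using dcol_perturb[of x' x "e / (2 * K)" i] d(2)[OF that(1) x _ that(2)] e K by (simp add: K_def)
  also have "... < e" using e K by simp
  finally show ?thesis by (simp add: dist_norm)
 qed
 thus "EX d>0. ALL x':S. dist x' x < d --> dist (dcol x' i) (dcol x i) < e" using d(1) by blast
qed

lemma dcol_cont: "continuous_on S (%x. dcol x i)"
proof (rule continuous_at_imp_continuous_on, rule ballI)
 fix x :: "real^'n"
 have "x : interior (cball x 1)" by simp
 thus "isCont (%x. dcol x i) x" by (rule continuous_on_interior[OF dcol_cont_compact[OF compact_cball]])
qed

lemma dh_cont: "continuous_on S (%x. dh x $ j $ i)"
 using dcol_cont unfolding dcol_nth[symmetric] by (rule continuous_on_component)

lemma dh_bound: "norm (dh x *v v) <= real CARD('n) * (d1 * KE) * norm v"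
proof -
 have "norm (dh x *v v) <= (SUM i:UNIV. \<bar>(dh x *v v) $ i\<bar>)" by (rule norm_le_l1_cart)
 also have "... <= (SUM i:(UNIV::'n set). norm v * (d1 * KE))"
 proof (rule sum_mono)
  fix i show "\<bar>(dh x *v v) $ i\<bar> <= norm v * (d1 * KE)"
   unfolding dh_dcol by (rule order_trans[OF Cauchy_Schwarz_ineq2 mult_left_mono[OF dcol_bound norm_ge_zero]])
 qed
 finally show ?thesis by (simp add: mult_ac)
qed

lemma b_dh: "bpw (%x v. dh x *v v) (real CARD('n) * (d1 * KE))"
 by (rule bpw_matrix[OF tintegrable_cont(1)[OF dh_cont] dh_bound]) (intro mult_nonneg_nonneg less_imp_le[OF d1_pos] less_imp_le[OF KE_pos] of_nat_0_le_iff)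

definition "Dh = pw (%x v. dh x *v v)"

end

text \<open>One time slice along a subsequence: bounded gradients, potentials converging strongly in
  L2, and in \<open>eq\<close> fluxes whose divergence is bounded in L2. The last two are the
  compactness behind a div-curl argument.\<close>

locale homseq = hom B \<pi> C1 C2 c0 c1
 for B :: "real^'n => real^'n^'n" and \<pi> :: "real^'n => real^'n => real" and C1 C2 c0 c1 :: real +
 fixes \<sigma> :: "nat => nat" and f :: "nat => ('n, real) l2" and G :: "nat => ('n, real^'n) l2"
  and fl :: "('n, real) l2" and Gl :: "('n, real^'n) l2" and \<Lambda> L :: real
 assumes \<sigma>: "strict_mono \<sigma>" and W: "!!k. (f k, G k) : W1" and Gb: "!!k. norm (G k) <= \<Lambda>"
  and eq: "!!k w q. (w, q) : W1 ==> \<bar>N.aD (\<sigma> k) (G k) q\<bar> <= L * norm w"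
  and lim: "f ----> fl" and Wl: "(fl, Gl) : W1"
begin

abbreviation "Nk k \<equiv> real (Suc (\<sigma> k))"
definition "J k x = DN (\<sigma> k) x *v fn (G k) x"

lemma \<Lambda>_nonneg: "0 <= \<Lambda>" using Gb[of 0] norm_ge_zero order_trans by blast

lemma sqi_J: "sqi (J k)" unfolding J_def by (rule sqi_pw[OF N.b_D sqi_fn])
lemma J_tol2: "N.Dm (\<sigma> k) (G k) = tol2 (J k)" by (simp add: N.Dm_def pw_def J_def[abs_def])
lemma norm_J: "norm (tol2 (J k)) <= d1 * \<Lambda>"
 unfolding J_tol2[symmetric] N.Dm_def by (rule order_trans[OF norm_pw[OF N.b_D] mult_left_mono[OF Gb]]) (use d1_pos in auto)

lemma inv_Nk: "(%k. C / Nk k) ----> 0"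
 using LIMSEQ_subseq_LIMSEQ[OF lim_const_over_n[of C, THEN LIMSEQ_Suc] \<sigma>] by (simp add: o_def)

lemma dilate_cont:
 fixes h :: "real^'n => 'b::topological_space"
 assumes "continuous_on UNIV h" shows "continuous_on S (%x. h (c *R x))"
proof -
 have "continuous_on S (%x. c *R x)" by (rule continuous_on_scaleR[OF continuous_on_const continuous_on_id])
 from continuous_on_compose2[OF assms this] show ?thesis by simp
qed

lemma dilate_bdd:
 fixes h :: "real^'n => 'b::euclidean_space"
 assumes "continuous_on UNIV h" "periodic h" obtains K where "0 <= K" "!!x. norm (h x) <= K"
proof -
 obtain K where K: "0 <= K" "!!x. x : cell ==> norm (h x) <= K" by (rule bounded_cell[OF assms(1)]) blast
 have "norm (h x) <= K" for x
 proof -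
  have "h x = h (\<chi> i. frac (x $ i))" by (rule periodic_int[OF assms(2) frac_cell(2)])
  thus ?thesis using K(2)[OF frac_cell(1)] by simp
 qed
 thus ?thesis using K(1) that by blast
qed

text \<open>At the dilated variable \<open>g\<close> is 1 / \<open>Nk k\<close> times the gradient
  of a bounded function. Testing the equation with that function times \<open>cas l\<close> leaves
  terms bounded uniformly in k, because the flux sees only the L2 norm of the potential; dividing by
  \<open>Nk k\<close> gives the limit zero. Boundedness then extends it from \<open>cas l\<close> to
  any square integrable weight.\<close>

lemma flux_osc:
 assumes C: "C1p phi g" and psi: "sqi psi"
 shows "(%k. tint (%x. psi x * (J k x \<bullet> g (Nk k *R x)))) ----> 0"
proof -
 have cg: "continuous_on UNIV g" using C unfolding C1p_def by blast
 obtain Kg where Kg: "0 <= Kg" "!!x. norm (g x) <= Kg" by (rule dilate_bdd[OF cg C1p_grad_periodic[OF C]]) blast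
 have cphi: "continuous_on UNIV phi" by (rule C1p_cont[OF C])
 obtain Kp where Kp: "0 <= Kp" "!!x. norm (phi x) <= Kp"
  by (rule dilate_bdd[OF cphi]) (use C in \<open>auto simp: C1p_def\<close>)
 define X where "X k = tol2 (%x. J k x \<bullet> g (Nk k *R x))" for k
 have gm: "(%x. g (Nk k *R x)) : bmc" for k
  by (rule tintegrable_cont(1)[OF dilate_cont[OF cg]])
 note s = sqi_inner_bdd[OF sqi_J gm Kg(2)]
 have nX: "norm (X k) <= Kg * (d1 * \<Lambda>)" for k
  unfolding X_def by (rule order_trans[OF s(2) mult_left_mono[OF norm_J Kg(1)]])
 have "(%k. X k \<bullet> ecas l 1) ----> 0" for l :: "int^'n"
 proof (rule Lim_null_comparison[OF always_eventually inv_Nk], rule allI)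
  fix k
  interpret a: bounded_bilinear "N.aD (\<sigma> k)" by (rule N.aD_bb)
  let ?N = "Nk k"
  define w where "w x = cas l x * phi (?N *R x)" for x
  define a where "a x = cas l x *R g (?N *R x)" for x
  define q where "q x = phi (?N *R x) *R cas (- l) x *R kv l" for x
  have sw: "sqi w" and sa: "sqi a" and sq: "sqi q" unfolding w_def a_def q_def
   by (intro tintegrable_cont(2) continuous_intros cas_cont dilate_cont[OF cg] dilate_cont[OF cphi])+
  have "C1p w (%x. ?N *R a x + q x)"
   using C1p_mult[OF cas_C1p[of l] C1p_dilate[OF C, of "Suc (\<sigma> k)"]] unfolding w_def a_def q_def
   by (simp only: scaleR_left_commute[of "cas l _" "real (Suc (\<sigma> k))"])
  hence "(tol2 w, tol2 (%x. ?N *R a x + q x)) : W1" by (rule C1p_in_W1)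
  also have "tol2 (%x. ?N *R a x + q x) = ?N *R tol2 a + tol2 q"
   by (simp only: scaleR_tol2[OF sa] add_tol2[OF sqi_scale[OF sa] sq])
  finally have "\<bar>N.aD (\<sigma> k) (G k) (?N *R tol2 a + tol2 q)\<bar> <= L * norm (tol2 w)" by (rule eq)
  hence "\<bar>?N * N.aD (\<sigma> k) (G k) (tol2 a) + N.aD (\<sigma> k) (G k) (tol2 q)\<bar> <= L * norm (tol2 w)"
   by (simp only: a.add_right a.scaleR_right real_scaleR_def)
  moreover have "norm (tol2 w) <= 2 * Kp"
   by (rule norm_tol2_bdd[OF sw]) (use cas_bound Kp in \<open>auto simp: w_def abs_mult intro!: mult_mono\<close>)
  moreover have "\<bar>N.aD (\<sigma> k) (G k) (tol2 q)\<bar> <= d1 * \<Lambda> * (Kp * (2 * norm (kv l)))"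
  proof -
   have "norm (tol2 q) <= Kp * (2 * norm (kv l))"
    by (rule norm_tol2_bdd[OF sq], unfold q_def norm_scaleR)
    (intro mult_mono Kp(2)[unfolded real_norm_def] cas_bound order_refl mult_nonneg_nonneg abs_ge_zero norm_ge_zero Kp(1), simp)
   thus ?thesis
    by (intro order_trans[OF N.aD_le] mult_mono mult_left_mono Gb norm_ge_zero mult_nonneg_nonneg less_imp_le[OF d1_pos] \<Lambda>_nonneg)
  qed
  ultimately have b: "?N * \<bar>N.aD (\<sigma> k) (G k) (tol2 a)\<bar> <= \<bar>L\<bar> * (2 * Kp) + d1 * \<Lambda> * (Kp * (2 * norm (kv l)))"
  proof -
   assume 1: "\<bar>?N * N.aD (\<sigma> k) (G k) (tol2 a) + N.aD (\<sigma> k) (G k) (tol2 q)\<bar> <= L * norm (tol2 w)"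
    and 2: "norm (tol2 w) <= 2 * Kp" and 3: "\<bar>N.aD (\<sigma> k) (G k) (tol2 q)\<bar> <= d1 * \<Lambda> * (Kp * (2 * norm (kv l)))"
   have "L * norm (tol2 w) <= \<bar>L\<bar> * (2 * Kp)" using 2 by (intro mult_mono) auto
   moreover have "?N * \<bar>N.aD (\<sigma> k) (G k) (tol2 a)\<bar> = \<bar>?N * N.aD (\<sigma> k) (G k) (tol2 a)\<bar>" by (simp add: abs_mult)
   ultimately show ?thesis using 1 3 by linarith
  qed
  have "X k \<bullet> ecas l 1 = tint (%x. (J k x \<bullet> g (?N *R x)) \<bullet> (cas l x *R 1))"
   unfolding X_def ecas_def by (rule inner_tol2[OF s(1) sqi_ecas])
  also have "... = N.aD (\<sigma> k) (G k) (tol2 a)"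
   unfolding N.aD_right[OF sa] by (rule Bochner_Integration.integral_cong) (auto simp: J_def a_def)
  finally have "X k \<bullet> ecas l 1 = N.aD (\<sigma> k) (G k) (tol2 a)" .
  moreover have "0 < ?N" by simp
  ultimately show "norm (X k \<bullet> ecas l 1) <= (\<bar>L\<bar> * (2 * Kp) + d1 * \<Lambda> * (Kp * (2 * norm (kv l)))) / ?N"
   using b by (simp only: real_norm_def pos_le_divide_eq mult.commute)
 qed
 hence "(%k. X k \<bullet> tol2 psi) ----> 0 \<bullet> tol2 psi" using weak_limit_from_cas[of X _ 0, OF nX] by simp
 thus ?thesis unfolding X_def inner_tol2[OF s(1) psi] by (simp add: mult.commute)
qed

text \<open>The counterpart for gradients against divergence-free oscillations. In the integration
  by parts the large term, carrying the factor \<open>Nk k\<close>, drops out because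
  \<open>c\<close> is orthogonal to \<open>kv m\<close>. What remains pairs strongly converging
  potentials with an oscillating function whose weak limit is zero unless
  \<open>m = 0\<close>.\<close>

lemma grad_osc:
 assumes c: "kv m \<bullet> c = 0" and psi: "sqi psi"
 shows "(%k. tint (%x. psi x * (fn (G k) x \<bullet> (cas m (Nk k *R x) *R c)))) ----> (if m = 0 then tint (%x. psi x * (fn Gl x \<bullet> c)) else 0)"
proof -
 let ?m = "%k. sc (Suc (\<sigma> k)) m"
 define X where "X k = tol2 (%x. fn (G k) x \<bullet> (cas (?m k) x *R c))" for k
 define Y where "Y = (if m = 0 then tol2 (%x. fn Gl x \<bullet> c) else 0)"
 have hm: "(%x. cas (?m k) x *R c) : bmc" for k by (rule sqi_measurable[OF sqi_ecas])
 have hb: "norm (cas (?m k) x *R c) <= 2 * norm c" for k x using mult_right_mono[OF cas_bound norm_ge_zero] by simp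
 note s = sqi_inner_bdd[OF sqi_fn hm hb]
 have s0: "sqi (%x. fn Gl x \<bullet> c)" by (rule sqi_inner_bdd(1)[OF sqi_fn borel_measurable_const order_refl])
 have nX: "norm (X k) <= 2 * norm c * \<Lambda>" for k
  unfolding X_def using s(2)[of "G k" k] Gb[of k] by (simp add: mult_left_mono order_trans)
 have "(%k. X k \<bullet> ecas l 1) ----> Y \<bullet> ecas l 1" for l :: "int^'n"
 proof -
  define q where "q k = tol2 (%x. cas (?m k) x * (cas (- l) x * (kv l \<bullet> c)))" for k
  define u where "u = tol2 (%x. fn fl x * (cas (- l) x * (kv l \<bullet> c)))"
  have sq: "sqi (%x. cas (?m k) x * (cas (- l) x * (kv l \<bullet> c)))" for k by (intro tintegrable_cont(2) continuous_intros cas_cont)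
  have su: "sqi (%x. fn fl x * (cas (- l) x * (kv l \<bullet> c)))" by (intro sqi_mult_cont(1) sqi_fn continuous_intros cas_cont)
  have nq: "norm (q k) <= 2 * (2 * \<bar>kv l \<bullet> c\<bar>)" for k unfolding q_def
   by (rule norm_tol2_bdd[OF sq], unfold real_norm_def abs_mult) (intro mult_mono cas_bound mult_nonneg_nonneg abs_ge_zero order_refl, auto)
  have x: "X k \<bullet> ecas l 1 = - (f k \<bullet> q k)" for k
  proof -
   have "X k \<bullet> ecas l 1 = tint (%x. (fn (G k) x \<bullet> (cas (?m k) x *R c)) \<bullet> (cas l x *R 1))"
    unfolding X_def ecas_def by (rule inner_tol2[OF s(1) sqi_ecas])
   also have "... = tint (%x. fn (G k) x \<bullet> ((cas l x * cas (?m k) x) *R c))" by (simp add: mult_ac)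
   also have "... = G k \<bullet> tol2 (%x. (cas l x * cas (?m k) x) *R c)"
    by (rule inner_right[symmetric]) (intro tintegrable_cont(2) continuous_intros cas_cont)
   also have "... = - (f k \<bullet> q k)"
    unfolding W1_by_parts[OF W C1p_mult[OF cas_C1p[of l] cas_C1p[of "?m k"]]] q_def
    by (simp add: inner_add_left kv_sc c mult.assoc)
   finally show ?thesis .
  qed
  have flq: "fl \<bullet> q k = cf (?m k) u" for k
  proof -
   have "cf (?m k) u = u \<bullet> tol2 (%x. cas (?m k) x)"
    unfolding cf_real inner_right[OF tintegrable_cont(2)[OF cas_cont]] by (simp add: mult.commute)
   also have "... = tint (%x. (fn fl x * (cas (- l) x * (kv l \<bullet> c))) \<bullet> cas (?m k) x)"
    unfolding u_def by (rule inner_tol2[OF su tintegrable_cont(2)[OF cas_cont]])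
   also have "... = fl \<bullet> q k" unfolding q_def inner_right[OF sq] by (simp add: mult_ac)
   finally show ?thesis ..
  qed
  have d0: "(%k. (f k - fl) \<bullet> q k) ----> 0"
  proof (rule Lim_null_comparison[OF always_eventually], rule allI)
   show "norm ((f k - fl) \<bullet> q k) <= norm (f k - fl) * (2 * (2 * \<bar>kv l \<bullet> c\<bar>))" for k
    unfolding real_norm_def by (rule order_trans[OF Cauchy_Schwarz_ineq2 mult_left_mono[OF nq]]) simp
   show "(%k. norm (f k - fl) * (2 * (2 * \<bar>kv l \<bullet> c\<bar>))) ----> 0"
    by (rule tendsto_mult_left_zero[OF tendsto_norm_zero[OF LIM_zero[OF lim]]])
  qed
  have "(%k. fl \<bullet> q k) ----> - (Y \<bullet> ecas l 1)"
  proof (cases "m = 0")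
   case True
   have z: "?m k = 0" for k using True by (simp add: sc_def vec_eq_iff)
   have "fl \<bullet> q k = - (Gl \<bullet> tol2 (%x. cas l x *R c))" for k
    unfolding W1_by_parts[OF Wl cas_C1p[of l]] q_def z by (simp add: mult.commute)
   moreover have "Gl \<bullet> tol2 (%x. cas l x *R c) = Y \<bullet> ecas l 1"
   proof -
    have "Y \<bullet> ecas l 1 = tint (%x. (fn Gl x \<bullet> c) \<bullet> (cas l x *R 1))"
    using True inner_tol2[OF s0 sqi_ecas] by (simp only: Y_def ecas_def if_True simp_thms)
    thus ?thesis unfolding inner_right[OF sqi_ecas] by (simp add: mult.commute)
   qed
   ultimately show ?thesis by simp
  next
   case False
   thus ?thesis unfolding flq Y_def
    using LIMSEQ_subseq_LIMSEQ[OF cf_dilate_tendsto[OF False, of u] \<sigma>] by (simp add: o_def)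
  qed
  from tendsto_minus[OF tendsto_add[OF d0 this]] show ?thesis unfolding x by (simp add: inner_diff_left)
 qed
 hence "(%k. X k \<bullet> tol2 psi) ----> Y \<bullet> tol2 psi" using weak_limit_from_cas[of X _ Y, OF nX] by simp
 hence 1: "(%k. tint (%x. fn (G k) x \<bullet> (cas m (Nk k *R x) *R c) * psi x)) ----> Y \<bullet> tol2 psi"
  unfolding X_def inner_tol2[OF s(1) psi] inner_real_def unfolding cas_dilate[symmetric] .
 have "Y \<bullet> tol2 psi = (if m = 0 then tint (%x. psi x * (fn Gl x \<bullet> c)) else 0)"
  by (simp add: Y_def inner_tol2[OF s0 psi] mult.commute)
 with 1 show ?thesis by (simp only: mult.commute)
qed

lemma homogenization_local:
 assumes A: "A : sets borel" "A \<subseteq> cell" and \<omega>: "0 < \<omega>" and eta: "0 < eta"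
  and D: "!!x y v. x : A ==> y : cell ==> norm ((Dxy x y - Dxy x0 y) *v v) <= \<omega> * norm v"
 shows "\<forall>\<^sub>F k in sequentially. \<bar>tint (%x. indicator A x * (cas l x * ((J k x - dh x *v fn Gl x) $ i)))\<bar>
   <= eta + \<omega> * tint (%x. indicator A x * ((norm (fn (G k) x))^2 + 2 * (2 + KE)^2 + 2 * (KE + d1 * (KE / d0)) * norm (fn Gl x)))"
proof -
 define F where "F = X.Dm x0 (Ec x0 i)"
 have KE: "0 <= KE" and d1: "0 <= d1" by (rule less_imp_le[OF KE_pos], rule less_imp_le[OF d1_pos])
 obtain w where w: "(w, Ec x0 i - ei i) : W1" using Ec_diff by blast
 have "0 < \<omega> / (d1 + 1)" by (rule divide_pos_pos[OF \<omega>]) (use d1 in linarith)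
 \<comment> \<open>The corrector gradient is only an L2 function of the fast variable and cannot be
   evaluated at a dilated point. It is replaced by a continuous gradient; the tolerance is chosen so
   that the flux changes by at most \<omega>.\<close>
 then obtain z where z: "z : W0" "dist z (w, Ec x0 i - ei i) < \<omega> / (d1 + 1)"
  using w unfolding W1_def closure_approachable by blast
 obtain phi g where phi: "C1p phi g" "z = (tol2 phi, tol2 g)" by (rule W0_repr[OF z(1)])
 have cg: "continuous_on UNIV g" using phi(1) unfolding C1p_def by blast
 have sg: "sqi g" by (rule tintegrable_cont(2)[OF continuous_on_subset[OF cg]]) simp
 have g: "d1 * norm (ei i + tol2 g - Ec x0 i) <= \<omega>"
 proof -
  have "norm (ei i + tol2 g - Ec x0 i) <= dist z (w, Ec x0 i - ei i)"
   using norm_snd_le[of "tol2 g - (Ec x0 i - ei i)" "tol2 phi - w"] unfolding phi(2) dist_norm by (simp add: algebra_simps)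
  hence "d1 * norm (ei i + tol2 g - Ec x0 i) <= d1 * (\<omega> / (d1 + 1))" using z(2) d1 by (intro mult_left_mono) auto
  also have "... <= (d1 + 1) * (\<omega> / (d1 + 1))" using d1 \<omega> by (intro mult_right_mono divide_nonneg_nonneg) auto
  also have "... = \<omega>" using d1 by simp
  finally show ?thesis .
 qed
 obtain M where "dist (PN M F) F < \<omega>" using PN_tendsto[of F] \<omega> unfolding LIMSEQ_def by blast
 hence M: "norm (F - PN M F) <= \<omega>" by (simp add: dist_norm norm_minus_commute)
 define s where "s y = (SUM m:Kb M. cas m y *R cf m F)" for y
 have cs: "continuous_on S s" for S unfolding s_def by (intro continuous_intros cas_cont)
 have PF: "PN M F = tol2 s" using sum_tol2[of "Kb M" "%m x. cas m x *R cf m F"] by (simp add: PN_def ecas_def s_def[abs_def])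
 have div: "kv m \<bullet> cf m F = 0" for m
 proof -
  have "(ecas (- m) 1, ecas (- (- m)) (kv (- m))) : W1" using W0_basis[of "- m" 1] W0_sub by auto
  from Ec_orth[OF this] have "ecas m (kv (- m)) \<bullet> F = 0" by (simp add: X.aD_def F_def inner_commute)
  thus ?thesis by (simp add: cf_inner kv_minus)
 qed
 define r where "r x y = Dxy x y *v (axis i 1 + g y) - s y" for x y
 have cr: "continuous_on UNIV (%z. r (fst z) (snd z))" unfolding r_def
  by (intro continuous_intros continuous_on_matrix_vector Dxy_cont continuous_on_compose2[OF cg] continuous_on_compose2[OF cs[of UNIV]]) auto
 have pr: "periodic (r x)" for x
 proof -
  have "cas m (y + axis j 1) = cas m y" for m :: "int^'n" and y j using cas_test[of m] unfolding test_fun_def periodic_def by blast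
  thus ?thesis using Dxy_periodic[of x] C1p_grad_periodic[OF phi(1)] unfolding periodic_def r_def s_def by simp
 qed
 have rb: "norm (tol2 (r x)) <= \<omega> * (2 + KE)" if x: "x : A" for x
 proof -
  have se: "sqi (%y. axis i 1 + g y)" by (intro sqi_add sg sqi_const)
  have "tol2 (r x) = X.Dm x (ei i + tol2 g) - PN M F"
   unfolding PF X.Dm_def ei_def add_tol2[OF sqi_const sg] pw_tol2[OF X.b_D se] r_def[abs_def]
   by (rule diff_tol2[symmetric]) (intro sqi_pw[OF X.b_D se], rule tintegrable_cont(2)[OF cs])
  also have "... = X.Dm x (ei i + tol2 g - Ec x0 i) + (X.Dm x (Ec x0 i) - X.Dm x0 (Ec x0 i)) + (F - PN M F)"
   using linear_diff[OF bounded_linear.linear[OF X.bl_Dm], of x "ei i + tol2 g" "Ec x0 i"] by (simp add: F_def)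
  finally have e: "tol2 (r x) = ..." .
  have "norm (X.Dm x (ei i + tol2 g - Ec x0 i)) <= \<omega>" unfolding X.Dm_def by (rule order_trans[OF norm_pw[OF X.b_D] g])
  moreover have "norm (X.Dm x (Ec x0 i) - X.Dm x0 (Ec x0 i)) <= \<omega> * KE"
   by (rule order_trans[OF Ec_perturb(1)[OF D[OF x] less_imp_le[OF \<omega>]] mult_left_mono[OF Ec_bound less_imp_le[OF \<omega>]]])
  ultimately have "norm (tol2 (r x)) <= \<omega> + \<omega> * KE + \<omega>" unfolding e
   by (intro order_trans[OF norm_triangle_ineq] add_mono M)
  also have "... = \<omega> * (2 + KE)" by (simp only: distrib_left)
  finally show ?thesis .
 qed
 \<comment> \<open>The residual is small in mean square over one period. Its square is continuous
   and periodic in the fast variable, so \<open>osc_mean\<close> turns this into smallness along the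
   dilation.\<close>
 define R where "R x y = (norm (r x y))^2" for x y
 have cR: "continuous_on UNIV (%z. R (fst z) (snd z))" unfolding R_def by (intro continuous_intros cr)
 have pR: "periodic (R x)" for x using pr[of x] by (simp add: periodic_def R_def)
 have mR: "tint (R x) <= (\<omega> * (2 + KE))^2" if "x : A" for x
 proof -
  have "tint (R x) = (norm (tol2 (r x)))^2" unfolding R_def[abs_def]
   by (rule norm_tol2_sq[symmetric], rule tintegrable_cont(2)[OF cont_diag(2)[where F=r, OF cr]])
  thus ?thesis using rb[OF that] by (simp add: power_mono)
 qed
 note mA = borel_indicator[OF A(1)]
 define psi where "psi x = indicator A x * cas l x" for x
 have mpsi: "psi : bmc" unfolding psi_def
  by (intro borel_measurable_times mA tintegrable_cont(1)[OF cas_cont])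
 have bpsi: "\<bar>psi x\<bar> <= 2" for x using cas_bound by (auto simp: psi_def indicator_def)
 have spsi: "sqi psi" by (rule sqi_bounded[OF mpsi, of 2]) (use bpsi in auto)
 have spsi2: "sqi (%x. (psi x)^2)"
  by (rule sqi_bounded[of _ 4]) (use mpsi power_mono[OF bpsi abs_ge_zero, of _ 2] in \<open>auto simp: power2_abs\<close>)
 note mult = tintegrable_bdd_mult[OF mpsi bpsi]
 note multA = tintegrable_indicator[OF A(1)]
 have iJ: "tintegrable (%x. J k x \<bullet> h (Nk k *R x))" if "continuous_on UNIV h" for k h
  by (intro sqi_inner sqi_J tintegrable_cont(2) dilate_cont that)
 have iG: "tintegrable (%x. fn (G k) x \<bullet> h x)" if "continuous_on cell h" for k h
  by (intro sqi_inner sqi_fn tintegrable_cont(2) that)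
 have il: "tintegrable (%x. fn Gl x \<bullet> h x)" if "continuous_on cell h" for h
  by (intro sqi_inner sqi_fn tintegrable_cont(2) that)
 have crk: "continuous_on cell (%x. r x (Nk k *R x))" for k by (rule cont_diag(1)[where F=r, OF cr])
 \<comment> \<open>Three parts: the residual, a combination whose integral tends to zero, and the
   error of freezing the effective matrix.\<close>
 have id1: "(J k x - dh x *v fn Gl x) $ i = fn (G k) x \<bullet> r x (Nk k *R x) +
   ((SUM m:Kb M. fn (G k) x \<bullet> (cas m (Nk k *R x) *R cf m F)) - J k x \<bullet> g (Nk k *R x) - fn Gl x \<bullet> dcol x0 i) - fn Gl x \<bullet> (dcol x i - dcol x0 i)" for k x
 proof -
  have "J k x \<bullet> (axis i 1 + g (Nk k *R x)) = fn (G k) x \<bullet> (DN (\<sigma> k) x *v (axis i 1 + g (Nk k *R x)))"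
   unfolding J_def by (subst N.D_inner) (rule inner_commute)
  also have "... = fn (G k) x \<bullet> r x (Nk k *R x) + fn (G k) x \<bullet> s (Nk k *R x)"
   by (simp add: r_def DN_def inner_diff_right)
  finally have "J k x $ i = fn (G k) x \<bullet> r x (Nk k *R x) + fn (G k) x \<bullet> s (Nk k *R x) - J k x \<bullet> g (Nk k *R x)"
   by (simp add: inner_add_right inner_axis)
  thus ?thesis by (simp add: dh_dcol s_def inner_sum_right inner_diff_right)
 qed
 define Z where "Z k = (SUM m:Kb M. tint (%x. psi x * (fn (G k) x \<bullet> (cas m (Nk k *R x) *R cf m F))))
   - tint (%x. psi x * (J k x \<bullet> g (Nk k *R x))) - tint (%x. psi x * (fn Gl x \<bullet> dcol x0 i))" for k
 have Z: "Z ----> 0"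
 proof -
  have "(SUM m:Kb M. if m = 0 then tint (%x. psi x * (fn Gl x \<bullet> cf m F)) else 0) = tint (%x. psi x * (fn Gl x \<bullet> dcol x0 i))"
  proof -
   have "(0 :: int^'n) : Kb M" by (rule Kb_0)
   thus ?thesis by (simp add: sum.delta dcol_def F_def)
  qed
  moreover have "(%k. SUM m:Kb M. tint (%x. psi x * (fn (G k) x \<bullet> (cas m (Nk k *R x) *R cf m F)))) ---->
    (SUM m:Kb M. if m = 0 then tint (%x. psi x * (fn Gl x \<bullet> cf m F)) else 0)"
   by (rule tendsto_sum) (rule grad_osc[OF div spsi])
  ultimately have "Z ----> tint (%x. psi x * (fn Gl x \<bullet> dcol x0 i)) - 0 - tint (%x. psi x * (fn Gl x \<bullet> dcol x0 i))"
   unfolding Z_def by (intro tendsto_diff flux_osc[OF phi(1) spsi] tendsto_const) (simp only:)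
  thus ?thesis by simp
 qed
 define Q where "Q k = tint (%x. (psi x)^2 * R x (Nk k *R x))" for k
 define q where "q = tint (%x. (psi x)^2 * tint (R x))"
 have Q: "Q ----> q"
  using LIMSEQ_subseq_LIMSEQ[OF osc_mean[OF cR pR spsi2] \<sigma>] unfolding Q_def q_def by (simp add: o_def)
 have iA: "tintegrable (%x. indicator A x * c)" for c :: real by (rule multA) simp
 have q: "q <= tint (%x. indicator A x * (4 * (\<omega> * (2 + KE))^2))" unfolding q_def
 proof (rule integral_mono)
  show "tintegrable (%x. (psi x)^2 * tint (R x))"
   by (rule sqi_mult_cont(2)[OF spsi2 tint_param_cont[OF continuous_on_subset[OF cR]]]) simp
  fix x
  have "(cas l x)^2 * tint (R x) <= 4 * (\<omega> * (2 + KE))^2" if "x : A"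
   using mR[OF that] power_mono[OF cas_bound[of l x] abs_ge_zero, of 2] by (intro mult_mono) (auto simp: power2_abs R_def)
  thus "(psi x)^2 * tint (R x) <= indicator A x * (4 * (\<omega> * (2 + KE))^2)" by (auto simp: psi_def indicator_def)
 qed (rule iA)
 have "\<forall>\<^sub>F k in sequentially. dist (Z k) 0 < eta / 2" by (rule tendstoD[OF Z]) (use eta in simp)
 moreover have "\<forall>\<^sub>F k in sequentially. Q k < q + \<omega> * eta" by (rule order_tendstoD(2)[OF Q]) (use \<omega> eta in simp)
 ultimately show ?thesis
 proof eventually_elim
  case (elim k)
  let ?K' = "KE + d1 * (KE / d0)"
  have crk2: "continuous_on cell (%x. R x (Nk k *R x))" by (rule cont_diag(1)[where F=R, OF cR])
  have iQ: "tintegrable (%x. (psi x)^2 * R x (Nk k *R x))" by (rule sqi_mult_cont(2)[OF spsi2 crk2])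
  have ig2: "tintegrable (%x. (norm (fn (G k) x))^2)" using sqi_fn[of "G k"] by (simp add: sqi_def)
  have ign: "tintegrable (%x. norm (fn Gl x))" using sqi_integrable[OF sqi_fn] by (rule integrable_norm)
  define a where "a = tint (%x. psi x * (fn (G k) x \<bullet> r x (Nk k *R x)))"
  define b where "b = tint (%x. psi x * (fn Gl x \<bullet> (dcol x i - dcol x0 i)))"
  have cc: "continuous_on UNIV (%y. cas m y *R cf m F)" for m by (intro continuous_intros cas_cont)
  have cb: "continuous_on cell (%x. dcol x i - dcol x0 i)" by (intro continuous_intros dcol_cont)
  have split: "tint (%x. indicator A x * (cas l x * ((J k x - dh x *v fn Gl x) $ i))) = a + Z k - b"
  proof -
   note ints = iG[OF crk] iJ[OF cg] il[OF continuous_on_const] il[OF cb] iG[OF dilate_cont[OF cc]]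
   have "tint (%x. indicator A x * (cas l x * ((J k x - dh x *v fn Gl x) $ i))) =
    tint (%x. psi x * (fn (G k) x \<bullet> r x (Nk k *R x)) + ((SUM m:Kb M. psi x * (fn (G k) x \<bullet> (cas m (Nk k *R x) *R cf m F)))
    - psi x * (J k x \<bullet> g (Nk k *R x)) - psi x * (fn Gl x \<bullet> dcol x0 i)) - psi x * (fn Gl x \<bullet> (dcol x i - dcol x0 i)))"
    unfolding id1 by (simp only: psi_def mult.assoc[symmetric] distrib_left right_diff_distrib sum_distrib_left)
   also have "... = a + Z k - b" unfolding a_def b_def Z_def
    using mult[OF ints(1)] mult[OF ints(2)] mult[OF ints(3)] mult[OF ints(4)] mult[OF ints(5)]
    by (simp add: Bochner_Integration.integral_sum del: inner_scaleR_right)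
   finally show ?thesis .
  qed
  \<comment> \<open>Young's inequality with weight \<omega>. The limit of \<open>Q k\<close> is of
    order \<omega>^2, so the factor 1 / (2 \<omega>) still leaves order \<omega>, while the gradient
    is merely bounded in L2.\<close>
  have aa: "\<bar>a\<bar> <= tint (%x. \<omega> / 2 * (indicator A x * (norm (fn (G k) x))^2) + 1 / (2 * \<omega>) * ((psi x)^2 * R x (Nk k *R x)))"
   unfolding a_def
  proof (rule order_trans[OF integral_abs_bound integral_mono])
   show "tintegrable (%x. \<bar>psi x * (fn (G k) x \<bullet> r x (Nk k *R x))\<bar>)" using mult[OF iG[OF crk]] by (rule integrable_abs)
   show "tintegrable (%x. \<omega> / 2 * (indicator A x * (norm (fn (G k) x))^2) + 1 / (2 * \<omega>) * ((psi x)^2 * R x (Nk k *R x)))"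
    by (intro integrable_plus integrable_mult_right multA ig2 iQ)
   fix x
   define u where "u = norm (fn (G k) x)"
   define v where "v = \<bar>psi x\<bar> * norm (r x (Nk k *R x))"
   have "\<bar>psi x * (fn (G k) x \<bullet> r x (Nk k *R x))\<bar> <= \<bar>psi x\<bar> * (u * norm (r x (Nk k *R x)))"
    unfolding abs_mult u_def by (intro mult_left_mono Cauchy_Schwarz_ineq2) simp
   also have "... = indicator A x * (u * v)" by (auto simp: v_def psi_def indicator_def)
   also have "u * v <= \<omega> / 2 * u^2 + 1 / (2 * \<omega>) * v^2"
   proof -
    have "0 <= (\<omega> * u - v)^2 / (2 * \<omega>)" using \<omega> by simp
    also have "... = \<omega> / 2 * u^2 + 1 / (2 * \<omega>) * v^2 - u * v" using \<omega> by (simp add: power2_eq_square field_simps)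
    finally show ?thesis by simp
   qed
   hence "indicator A x * (u * v) <= indicator A x * (\<omega> / 2 * u^2 + 1 / (2 * \<omega>) * v^2)" by (intro mult_left_mono) auto
   also have "... = \<omega> / 2 * (indicator A x * u^2) + 1 / (2 * \<omega>) * ((psi x)^2 * R x (Nk k *R x))"
    by (auto simp: v_def psi_def R_def power_mult_distrib indicator_def power2_abs)
   finally show "\<bar>psi x * (fn (G k) x \<bullet> r x (Nk k *R x))\<bar> <= \<omega> / 2 * (indicator A x * (norm (fn (G k) x))^2) + 1 / (2 * \<omega>) * ((psi x)^2 * R x (Nk k *R x))"
    by (simp add: u_def)
  qed
  also have "... = \<omega> / 2 * tint (%x. indicator A x * (norm (fn (G k) x))^2) + 1 / (2 * \<omega>) * Q k"
   unfolding Q_def by (subst integral_plus[OF integrable_mult_right[OF multA[OF ig2]] integrable_mult_right[OF iQ]]) (simp only: integral_mult_right_zero)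
  also have "1 / (2 * \<omega>) * Q k <= 1 / (2 * \<omega>) * (tint (%x. indicator A x * (4 * (\<omega> * (2 + KE))^2)) + \<omega> * eta)"
   using elim(2) q \<omega> by (intro mult_left_mono) auto
  also have "... = \<omega> * tint (%x. indicator A x * (2 * (2 + KE)^2)) + eta / 2"
  proof -
   have "tint (%x. indicator A x * (4 * (\<omega> * (2 + KE))^2)) = 2 * \<omega>^2 * tint (%x. indicator A x * (2 * (2 + KE)^2))"
    by (simp add: power_mult_distrib)
   thus ?thesis using \<omega> by (simp only:) (simp add: power2_eq_square field_simps)
  qed
  finally have A1: "\<bar>a\<bar> <= \<omega> / 2 * tint (%x. indicator A x * (norm (fn (G k) x))^2) + (\<omega> * tint (%x. indicator A x * (2 * (2 + KE)^2)) + eta / 2)" by simp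
  have A2: "\<bar>b\<bar> <= tint (%x. \<omega> * (indicator A x * (2 * ?K' * norm (fn Gl x))))"
   unfolding b_def
  proof (rule order_trans[OF integral_abs_bound integral_mono])
   show "tintegrable (%x. \<bar>psi x * (fn Gl x \<bullet> (dcol x i - dcol x0 i))\<bar>)" using mult[OF il[OF cb]] by (rule integrable_abs)
   show "tintegrable (%x. \<omega> * (indicator A x * (2 * ?K' * norm (fn Gl x))))"
    by (intro integrable_mult_right multA ign)
   fix x
   show "\<bar>psi x * (fn Gl x \<bullet> (dcol x i - dcol x0 i))\<bar> <= \<omega> * (indicator A x * (2 * ?K' * norm (fn Gl x)))"
   proof (cases "x : A")
    case True
    have "\<bar>fn Gl x \<bullet> (dcol x i - dcol x0 i)\<bar> <= norm (fn Gl x) * (\<omega> * ?K')"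
    by (rule order_trans[OF Cauchy_Schwarz_ineq2 mult_left_mono[OF dcol_perturb[OF D[OF True] less_imp_le[OF \<omega>]] norm_ge_zero]])
    hence "\<bar>psi x\<bar> * \<bar>fn Gl x \<bullet> (dcol x i - dcol x0 i)\<bar> <= 2 * (norm (fn Gl x) * (\<omega> * ?K'))"
    using bpsi[of x] by (intro mult_mono) auto
    also have "... = \<omega> * (1 * (2 * ?K' * norm (fn Gl x)))" by (simp only: mult_ac mult_1)
    finally show ?thesis using True by (simp only: abs_mult indicator_simps)
   qed (simp add: psi_def)
  qed
  have e1: "tint (%x. indicator A x * ((norm (fn (G k) x))^2 + 2 * (2 + KE)^2 + 2 * ?K' * norm (fn Gl x)))
   = tint (%x. indicator A x * (norm (fn (G k) x))^2) + tint (%x. indicator A x * (2 * (2 + KE)^2)) + tint (%x. indicator A x * (2 * ?K' * norm (fn Gl x)))"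
   unfolding distrib_left[of "indicator A _"]
   by (subst integral_plus[OF integrable_plus[OF multA[OF ig2] iA] multA[OF integrable_mult_right[OF ign]]],
    subst integral_plus[OF multA[OF ig2] iA]) (rule refl)
  have arith: "\<bar>a + z - b\<bar> <= eta + \<omega> * (t1 + t2 + t3)"
   if "\<bar>a\<bar> <= \<omega> / 2 * t1 + (\<omega> * t2 + eta / 2)" "\<bar>b\<bar> <= \<omega> * t3" "\<bar>z\<bar> <= eta / 2" "0 <= t1" for z t1 t2 t3 :: real
  proof -
   have "\<omega> / 2 * t1 = (\<omega> * t1) / 2" and "0 <= \<omega> * t1" using that(4) \<omega> by auto
   thus ?thesis using that(1-3) unfolding distrib_left by linarith
  qed
  show ?case unfolding split e1
   by (rule arith[OF A1 A2[unfolded integral_mult_right_zero]]) (use elim(1) in \<open>simp_all add: dist_real_def\<close>)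
 qed
qed

text \<open>Local estimates are summed over a partition on which the coefficients vary by at most
  \<omega>. Their errors are kept as integrals over the pieces, so they add up to \<omega> times a
  bound that does not depend on the partition.\<close>

theorem homogenization: "(%k. N.aD (\<sigma> k) (G k) K) ----> Dh Gl \<bullet> K"
proof -
 have "(%k. tol2 (J k) \<bullet> ecas l b) ----> Dh Gl \<bullet> ecas l b" if b: "b : Basis" for l :: "int^'n" and b
 proof -
  obtain i where i: "b = axis i 1" using b by (auto simp: Basis_vec_def)
  define K' where "K' = KE + d1 * (KE / d0)"
  have K': "0 <= K'" unfolding K'_def using less_imp_le[OF add_pos_pos[OF KE_pos mult_pos_pos[OF d1_pos divide_pos_pos[OF KE_pos d0_pos]]]] .
  define U where "U k x = cas l x * ((J k x - dh x *v fn Gl x) $ i)" for k x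
  define V where "V k x = (norm (fn (G k) x))^2 + 2 * (2 + KE)^2 + 2 * K' * norm (fn Gl x)" for k x
  have sd: "sqi (%x. dh x *v fn Gl x)" by (rule sqi_pw[OF b_dh sqi_fn])
  have ig2: "tintegrable (%x. (norm (fn (G k) x))^2)" for k using sqi_fn[of "G k"] by (simp add: sqi_def)
  have ign: "tintegrable (%x. norm (fn Gl x))" using sqi_integrable[OF sqi_fn] by (rule integrable_norm)
  have iV: "tintegrable (V k)" for k unfolding V_def[abs_def]
   by (intro integrable_plus ig2 integrable_mult_right ign tintegrable_const)
  have U: "tol2 (J k) \<bullet> ecas l b - Dh Gl \<bullet> ecas l b = tint (U k)" and iU: "tintegrable (U k)" for k
  proof -
   have eq: "U k = (%x. (J k x - dh x *v fn Gl x) \<bullet> (cas l x *R b))" by (simp add: U_def i inner_axis fun_eq_iff)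
   show "tintegrable (U k)" unfolding eq by (intro sqi_inner sqi_diff sqi_J sd sqi_ecas)
   have "tol2 (J k) \<bullet> ecas l b - Dh Gl \<bullet> ecas l b = tol2 (%x. J k x - dh x *v fn Gl x) \<bullet> ecas l b"
    unfolding Dh_def pw_def diff_tol2[OF sqi_J sd, symmetric] by (rule inner_diff_left[symmetric])
   also have "... = tint (U k)" unfolding eq ecas_def by (rule inner_tol2[OF sqi_diff[OF sqi_J sd] sqi_ecas])
   finally show "tol2 (J k) \<bullet> ecas l b - Dh Gl \<bullet> ecas l b = tint (U k)" .
  qed
  define C where "C = \<Lambda>^2 + 2 * (2 + KE)^2 + 2 * K' * tint (%x. norm (fn Gl x))"
  have C: "0 <= C" unfolding C_def using K' by (intro add_nonneg_nonneg mult_nonneg_nonneg integral_nonneg_AE) auto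
  have V: "tint (V k) <= C" for k
  proof -
   have "tint (V k) = (norm (G k))^2 + 2 * (2 + KE)^2 + 2 * K' * tint (%x. norm (fn Gl x))"
    unfolding V_def[abs_def] norm_l2_sq
    by (subst integral_plus[OF integrable_plus[OF ig2 tintegrable_const] integrable_mult_right[OF ign]],
    subst integral_plus[OF ig2 tintegrable_const]) (simp only: tint_const integral_mult_right_zero)
   thus ?thesis using power_mono[OF Gb norm_ge_zero, of k 2] by (simp add: C_def)
  qed
  have "(%k. tint (U k)) ----> 0"
  proof (rule tendstoI)
   fix e :: real assume e: "0 < e"
   \<comment> \<open>Half of \<open>e\<close> is reserved for the errors of order \<omega>, the
     other half is shared by the finitely many local limits through \<open>eta\<close>.\<close>
   define \<omega> where "\<omega> = e / (2 * (C + 1))"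
   have \<omega>: "0 < \<omega>" using e C by (simp add: \<omega>_def)
   obtain d where d: "0 < d" "!!x x' y v. x : cell ==> x' : cell ==> y : cell ==> dist x x' < d ==> norm ((Dxy x y - Dxy x' y) *v v) <= \<omega> * norm v"
    by (rule Dxy_unif[OF \<omega> cell_compact]) blast
   have "EX I (A :: nat => (real^'n) set). partition d I A" by (rule cell_partition[OF d(1)])
   then obtain I where "EX A :: nat => (real^'n) set. partition d I A" ..
   then obtain A where "partition d I (A :: nat => (real^'n) set)" ..
   note I = partitionD(1)[OF this] and A0 = partitionD(2,3)[OF this]
   have A: "A j : sets borel" "A j \<subseteq> cell" "x : A j ==> y : A j ==> dist x y < d" if "j : I" for j x y
    using bspec[OF A0(1) that] by blast+
   note ex1 = bspec[OF A0(2)]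
   define eta where "eta = e / (2 * (real (card I) + 1))"
   have eta: "0 < eta" unfolding eta_def by (rule divide_pos_pos[OF e]) simp
   have "\<forall>\<^sub>F k in sequentially. ALL j:I. \<bar>tint (%x. indicator (A j) x * U k x)\<bar> <= eta + \<omega> * tint (%x. indicator (A j) x * V k x)"
    unfolding U_def V_def K'_def
   proof (rule eventually_ball_finite[OF I], rule ballI)
    fix j assume j: "j : I"
    show "\<forall>\<^sub>F k in sequentially. \<bar>tint (%x. indicator (A j) x * (cas l x * ((J k x - dh x *v fn Gl x) $ i)))\<bar>
    <= eta + \<omega> * tint (%x. indicator (A j) x * ((norm (fn (G k) x))^2 + 2 * (2 + KE)^2 + 2 * (KE + d1 * (KE / d0)) * norm (fn Gl x)))"
    proof (rule homogenization_local[OF A(1,2)[OF j] \<omega> eta, of "SOME x. x : A j"])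
    fix x y v :: "real^'n" assume x: "x : A j" and y: "y : cell"
    have "(SOME x. x : A j) : A j" using x by (rule someI)
    thus "norm ((Dxy x y - Dxy (SOME x. x : A j) y) *v v) <= \<omega> * norm v"
    using d(2)[OF _ _ y A(3)[OF j x]] A(2)[OF j] x by blast
    qed
   qed
   thus "\<forall>\<^sub>F k in sequentially. dist (tint (U k)) 0 < e"
   proof eventually_elim
    case (elim k)
    have pU: "tint (U k) = (SUM j:I. tint (%x. indicator (A j) x * U k x))"
    by (rule tint_partition[OF I _ _ iU]) (rule A(1), assumption, rule ex1, assumption)
    have pV: "tint (V k) = (SUM j:I. tint (%x. indicator (A j) x * V k x))"
    by (rule tint_partition[OF I _ _ iV]) (rule A(1), assumption, rule ex1, assumption)
    have "\<bar>tint (U k)\<bar> <= (SUM j:I. eta + \<omega> * tint (%x. indicator (A j) x * V k x))"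
    unfolding pU by (rule order_trans[OF sum_abs sum_mono]) (use elim in auto)
    also have "... = real (card I) * eta + \<omega> * tint (V k)"
    unfolding pV by (simp add: sum.distrib sum_distrib_left)
    also have "... <= real (card I) * eta + \<omega> * C" using V \<omega> by (intro add_left_mono mult_left_mono) auto
    also have "... < (real (card I) + 1) * eta + \<omega> * (C + 1)" using eta \<omega> by (simp add: distrib_left distrib_right)
    also have "... = e / 2 + e / 2"
    proof -
    have "(real (card I) + 1) * eta = e / 2" unfolding eta_def by (simp add: field_simps)
    moreover have "\<omega> * (C + 1) = e / 2" using C unfolding \<omega>_def by (simp add: field_simps)
    ultimately show ?thesis by simp
    qed
    finally show ?case by (simp add: dist_real_def)
   qed
  qed
  thus ?thesis unfolding U[symmetric] by (rule LIM_zero_cancel)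
 qed
 from weak_limit_from_cas[of "%k. tol2 (J k)" _ "Dh Gl" K, OF norm_J this] show ?thesis unfolding N.aD_def J_tol2 .
qed

end

section \<open>Dissipation and action along a flow\<close>

lemma lnm_lip: assumes "0 < m" shows "\<bar>lnm m s - lnm m t\<bar> <= \<bar>s - t\<bar> / m"
proof -
 have "norm (lnm m s - lnm m t) <= 1 / m * norm (s - t)"
  by (rule field_differentiable_bound[of UNIV "lnm m" "%s. 1 / max s m"])
   (use lnm_props(1,3)[OF assms] in auto)
 thus ?thesis by simp
qed

text \<open>The logarithm and its gradient as elements of L2; the tangent continuation makes both
  total, and they are the true ones where \<open>u\<close> is at least \<open>m\<close>.\<close>

definition "lg m u = tol2 (%x. lnm m (fn u x))"
definition "gg m u G = tol2 (%x. (1 / max (fn u x) m) *R fn G x)"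

lemma ln_W1:
 assumes "(u, G) : W1" "0 < m"
 shows "sqi (%x. lnm m (fn u x))" "sqi (%x. (1 / max (fn u x) m) *R fn G x)" "(lg m u, gg m u G) : W1"
 unfolding lg_def gg_def
 by (rule W1_chain(1)[OF assms(1) lnm_props(1-3)[OF assms(2)]], rule W1_chain(2)[OF assms(1) lnm_props(1-3)[OF assms(2)]],
   rule W1_chain(3)[OF assms(1) lnm_props(1-3)[OF assms(2)]])

lemma lg_lip:
 assumes u: "(u, G) : W1" and v: "(v, H) : W1" and m: "0 < m"
 shows "norm (lg m u - lg m v) <= norm (u - v) / m"
proof -
 note s = ln_W1(1)[OF u m] ln_W1(1)[OF v m]
 have "lg m u - lg m v = tol2 (%x. lnm m (fn u x) - lnm m (fn v x))" unfolding lg_def by (rule diff_tol2[OF s])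
 also have "norm ... <= norm (tol2 (%x. (1 / m) *R fn (u - v) x))"
 proof (rule norm_tol2_mono[OF sqi_diff[OF s] sqi_scale[OF sqi_fn]])
  show "AE x in lc. norm (lnm m (fn u x) - lnm m (fn v x)) <= norm ((1 / m) *R fn (u - v) x)"
   using fn_diff[of u v] by eventually_elim (use lnm_lip[OF m] m in \<open>simp add: abs_mult\<close>)
 qed
 also have "... = norm (u - v) / m" using scaleR_tol2[OF sqi_fn[of "u - v"], of "1 / m"] m by (metis abs_of_pos divide_inverse_commute inverse_eq_divide norm_scaleR tol2_fn zero_less_divide_1_iff)
 finally show ?thesis .
qed

text \<open>For a Borel version of the integrand, the positive and the negative part are densities
  of finite measures that agree on all half-lines and hence everywhere; so the two parts coincide
  almost everywhere.\<close>

lemma AE_zero_of_integrals: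
 fixes g :: "real => real"
 assumes t: "0 <= t" and g: "integrable (lebesgue_on {0..t}) g" and z: "!!s. s : {0..t} ==> integral\<^sup>L (lebesgue_on {0..s}) g = 0"
 shows "AE x in lborel. x : {0..t} --> g x = 0"
proof -
 define h where "h x = indicator {0..t} x * g x" for x
 have h: "integrable lebesgue h" using g unfolding h_def
  by (subst (asm) integrable_restrict_space) auto
 obtain h' where h': "h' : borel_measurable lborel" "AE x in lborel. h x = h' x"
  using completion_ex_borel_measurable_real[of h lborel] borel_measurable_integrable[OF h] by blast
 have i': "integrable lborel h'"
 proof -
  have "integrable lebesgue h'"
   by (rule integrable_cong_AE_imp[OF h]) (use h' in \<open>auto intro: AE_completion measurable_completion elim: AE_mp\<close>)
  thus ?thesis using h'(1) integrable_completion by blast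
 qed
 have zero: "integral\<^sup>L lborel (%y. indicator {x<..} y * h' y) = 0" for x
 proof -
  have S: "integral\<^sup>L lebesgue (%y. indicator {0..s} y * g y) = 0" "integrable lebesgue (%y. indicator {0..s} y * g y)" if s: "s : {0..t}" for s
  proof -
   show "integral\<^sup>L lebesgue (%y. indicator {0..s} y * g y) = 0" using z[OF s] by (subst (asm) integral_restrict_space) auto
   have "integrable (lebesgue_on {0..s}) g" by (rule integrable_subinterval[OF g]) (use s in auto)
   thus "integrable lebesgue (%y. indicator {0..s} y * g y)" by (subst (asm) integrable_restrict_space) auto
  qed
  have "integral\<^sup>L lborel (%y. indicator {x<..} y * h' y) = integral\<^sup>L lebesgue (%y. indicator {x<..} y * h' y)"
   by (rule integral_completion[symmetric]) (use h'(1) in measurable)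
  also have "... = integral\<^sup>L lebesgue (%y. indicator {x<..} y * h y)"
  proof (rule integral_cong_AE)
   show "(%y. indicator {x<..} y * h' y) : borel_measurable lebesgue" by (rule measurable_completion) (use h'(1) in measurable)
   show "(%y. indicator {x<..} y * h y) : borel_measurable lebesgue"
    by (intro borel_measurable_times borel_measurable_indicator borel_measurable_integrable[OF h]) auto
   have "AE y in lebesgue. h y = h' y" using h'(2) by (rule AE_completion)
   thus "AE y in lebesgue. indicator {x<..} y * h' y = indicator {x<..} y * h y" by eventually_elim simp
  qed
  also have "... = 0"
  proof -
   consider "x < 0" | "x : {0..t}" | "t < x" by fastforce
   thus ?thesis
   proof cases
    case 1
    hence "(%y. indicator {x<..} y * h y) = (%y. indicator {0..t} y * g y)" by (auto simp: fun_eq_iff h_def indicator_def)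
    thus ?thesis using S(1)[of t] t by simp
   next
    case 2
    hence "(%y. indicator {x<..} y * h y) = (%y. indicator {0..t} y * g y - indicator {0..x} y * g y)" by (auto simp: fun_eq_iff h_def indicator_def)
    thus ?thesis using S[of t] S[OF 2] t by simp
   next
    case 3
    hence "(%y. indicator {x<..} y * h y) = (%y. 0)" by (auto simp: fun_eq_iff h_def indicator_def)
    thus ?thesis by simp
   qed
  qed
  finally show ?thesis .
 qed
 define P where "P y = max 0 (h' y)" for y
 define Q where "Q y = max 0 (- h' y)" for y
 have iP: "integrable lborel P" "integrable lborel Q" unfolding P_def Q_def using i' by auto
 have em: "emeasure (density lborel (%y. ennreal (w y))) {x<..} = ennreal (integral\<^sup>L lborel (%y. indicator {x<..} y * w y))"
  if w: "integrable lborel w" "!!y. 0 <= w y" for w :: "real => real" and x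
 proof -
  have "emeasure (density lborel (%y. ennreal (w y))) {x<..} = (\<integral>\<^sup>+y. ennreal (w y) * indicator {x<..} y \<partial>lborel)"
   using w(1) by (subst emeasure_density) auto
  also have "... = (\<integral>\<^sup>+y. ennreal (indicator {x<..} y * w y) \<partial>lborel)" by (rule nn_integral_cong) (auto simp: indicator_def)
  also have "... = ennreal (integral\<^sup>L lborel (%y. indicator {x<..} y * w y))"
   by (rule nn_integral_eq_integral) (use w integrable_real_mult_indicator[of "{x<..}" lborel w] in \<open>auto simp: mult.commute\<close>)
  finally show ?thesis .
 qed
 have "density lborel (%y. ennreal (P y)) = density lborel (%y. ennreal (Q y))"
 proof (rule measure_eqI_lessThan)
  fix x
  have ii: "integrable lborel (%y. indicator {x<..} y * P y)" "integrable lborel (%y. indicator {x<..} y * Q y)"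
   using integrable_real_mult_indicator[of "{x<..}" lborel, OF _ iP(1)] integrable_real_mult_indicator[of "{x<..}" lborel, OF _ iP(2)] by (auto simp: mult.commute)
  have "(%y. indicator {x<..} y * h' y) = (%y. indicator {x<..} y * P y - indicator {x<..} y * Q y)"
   by (auto simp: fun_eq_iff P_def Q_def indicator_def)
  hence "integral\<^sup>L lborel (%y. indicator {x<..} y * P y) = integral\<^sup>L lborel (%y. indicator {x<..} y * Q y)"
   using zero[of x] ii by simp
  moreover have "emeasure (density lborel (%y. ennreal (P y))) {x<..} = ennreal (integral\<^sup>L lborel (%y. indicator {x<..} y * P y))"
   by (rule em[OF iP(1)]) (simp add: P_def)
  moreover have "emeasure (density lborel (%y. ennreal (Q y))) {x<..} = ennreal (integral\<^sup>L lborel (%y. indicator {x<..} y * Q y))"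
   by (rule em[OF iP(2)]) (simp add: Q_def)
  ultimately show "emeasure (density lborel (%y. ennreal (P y))) {x<..} = emeasure (density lborel (%y. ennreal (Q y))) {x<..}"
   "emeasure (density lborel (%y. ennreal (P y))) {x<..} < \<infinity>" by simp_all
 qed simp_all
 hence "AE y in lborel. ennreal (P y) = ennreal (Q y)"
  using h'(1) by (subst (asm) sigma_finite_measure.density_unique_iff[OF lborel.sigma_finite_measure_axioms]) (auto simp: P_def Q_def)
 thus ?thesis using h'(2)
 proof eventually_elim
  case (elim y)
  have "P y = Q y" using elim(1) by (simp add: P_def Q_def)
  hence "h' y = 0" by (auto simp: P_def Q_def max_def split: if_splits)
  thus ?case using elim(2) by (auto simp: h_def)
 qed
qed

context coef begin

section \<open>Time continuity of fluxes and of the dissipation\<close>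

lemma p_measurable: "p : bmc"
 by (rule tintegrable_cont(1)[OF continuous_on_subset[OF p_cont subset_UNIV]])

lemma M_measurable:
 assumes DM: "!!x. D x = p x *R M x" and v: "v : bmc"
 shows "(%x. M x *v v x) : bmc"
proof -
 have "(%x. D x *v v x) : bmc" using b_D v unfolding bpw_def by blast
 hence "(%x. (1 / p x) *R (D x *v v x)) : bmc" using p_measurable by measurable
 moreover have "(1 / p x) *R (D x *v v x) = M x *v v x" for x
  unfolding DM using p_pos[of x] by (simp add: scaleR_matrix_vector_assoc[symmetric])
 ultimately show ?thesis by simp
qed

lemma flowD:
 assumes "flow T L m1 m2 f G" "t : {0..T}"
 shows "(f t, G t) : W1" "(w, k) : W1 ==> \<bar>aD (G t) k\<bar> <= L * norm w" "AE x in lc. m1 <= fn (f t) x & fn (f t) x <= m2"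
  "s : {0..T} ==> norm (f t - f s) <= L * \<bar>t - s\<bar>"
  "z : W1 ==> ((%s. aD (G s) (snd z)) has_integral (- ((pp (f t) - pp (f 0)) \<bullet> fst z))) {0..t}"
 using assms unfolding flow_def by blast+

lemma flow_norm:
 assumes "flow T L m1 m2 f G" "t : {0..T}" "0 < m1"
 shows "norm (f t) <= \<bar>m2\<bar>" "d0 * (norm (G t))^2 <= \<bar>L\<bar> * \<bar>m2\<bar>"
proof -
 have "norm (tol2 (fn (f t))) <= norm (tol2 (%x::real^'n. m2))"
  by (rule norm_tol2_mono[OF sqi_fn sqi_const]) (use flowD(3)[OF assms(1,2)] assms(3) in \<open>auto elim: AE_mp\<close>)
 also have "... <= \<bar>m2\<bar>" by (rule norm_tol2_bdd[OF sqi_const]) simp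
 finally show n: "norm (f t) <= \<bar>m2\<bar>" by simp
 have "d0 * (norm (G t))^2 <= \<bar>aD (G t) (G t)\<bar>" using aD_coer[of "G t"] by linarith
 also have "... <= L * norm (f t)" by (rule flowD(2)[OF assms(1,2) flowD(1)[OF assms(1,2)]])
 also have "... <= \<bar>L\<bar> * \<bar>m2\<bar>" using n by (intro mult_mono) auto
 finally show "d0 * (norm (G t))^2 <= \<bar>L\<bar> * \<bar>m2\<bar>" .
qed

text \<open>Coercivity bounds the squared increment of the gradient by the flux increment tested
  with it. The flux sees only the L2 norm of the potential, which is Lipschitz in time, so the
  gradient is Holder continuous of exponent one half.\<close>

lemma flow_G_cont: assumes fl: "flow T L m1 m2 f G" shows "continuous_on {0..T} G"
 unfolding continuous_on_def
proof
 fix s assume s: "s : {0..T}"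
 interpret aD: bounded_bilinear aD by (rule aD_bb)
 have le: "norm (G t - G s) <= sqrt (2 * \<bar>L\<bar> * (\<bar>L\<bar> * \<bar>t - s\<bar>) / d0)" if t: "t : {0..T}" for t
 proof -
  have W: "(f t - f s, G t - G s) : W1" using subspace_diff[OF W1_subspace flowD(1)[OF fl t] flowD(1)[OF fl s]] by simp
  have "d0 * (norm (G t - G s))^2 <= aD (G t) (G t - G s) - aD (G s) (G t - G s)" using aD_coer[of "G t - G s"] by (simp add: aD.diff_left)
  also have "... <= 2 * (L * norm (f t - f s))" using flowD(2)[OF fl t W] flowD(2)[OF fl s W] by linarith
  also have "... <= 2 * (\<bar>L\<bar> * (\<bar>L\<bar> * \<bar>t - s\<bar>))"
  proof (intro mult_left_mono mult_mono)
   show "norm (f t - f s) <= \<bar>L\<bar> * \<bar>t - s\<bar>" by (rule order_trans[OF flowD(4)[OF fl t s]]) (simp add: mult_right_mono)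
  qed auto
  finally have "(norm (G t - G s))^2 <= 2 * \<bar>L\<bar> * (\<bar>L\<bar> * \<bar>t - s\<bar>) / d0" using d0 by (simp add: pos_le_divide_eq mult_ac)
  thus ?thesis by (rule real_le_rsqrt)
 qed
 have "((%t. G t - G s) \<longlongrightarrow> 0) (at s within {0..T})"
 proof (rule Lim_null_comparison)
  show "\<forall>\<^sub>F t in at s within {0..T}. norm (G t - G s) <= sqrt (2 * \<bar>L\<bar> * (\<bar>L\<bar> * \<bar>t - s\<bar>) / d0)"
   using le by (auto simp: eventually_at_filter)
  have "((%t. sqrt (2 * \<bar>L\<bar> * (\<bar>L\<bar> * \<bar>t - s\<bar>) / d0)) \<longlongrightarrow> sqrt (2 * \<bar>L\<bar> * (\<bar>L\<bar> * \<bar>s - s\<bar>) / d0)) (at s within {0..T})"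
   using d0 by (intro tendsto_intros) auto
  thus "((%t. sqrt (2 * \<bar>L\<bar> * (\<bar>L\<bar> * \<bar>t - s\<bar>) / d0)) \<longlongrightarrow> 0) (at s within {0..T})" by simp
 qed
 thus "(G \<longlongrightarrow> G s) (at s within {0..T})" by (rule LIM_zero_cancel)
qed

lemma flow_aD_cont: assumes fl: "flow T L m1 m2 f G" shows "continuous_on {0..T} (%t. aD (G t) k)"
proof -
 interpret aD: bounded_bilinear aD by (rule aD_bb)
 show ?thesis by (rule bounded_linear.continuous_on[OF aD.bounded_linear_left flow_G_cont[OF fl]])
qed

text \<open>The entropy dissipation, the integral of <D H, H> / u, that is the flux paired with the
  gradient of log u. By \<open>ln_pressure\<close> the functional \<open>psi_star\<close> at the
  chemical potential is half of it.\<close>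

definition "ent m u H = aD H (gg m u H)"

text \<open>The change of the logarithm is paired with the flux and estimated in L2; the change of
  the flux is paired with a fixed field. Continuity supplies the measurability in time needed for
  Fatou's lemma.\<close>

lemma ent_cont: assumes fl: "flow T L m1 m2 f G" and m: "0 < m1" shows "continuous_on {0..T} (%t. ent m1 (f t) (G t))"
 unfolding continuous_on_def
proof
 fix s assume s: "s : {0..T}"
 interpret aD: bounded_bilinear aD by (rule aD_bb)
 let ?g = "%t. gg m1 (f t) (G t)"
 have "((%t. aD (G t) (?g t) - aD (G s) (?g s)) \<longlongrightarrow> 0) (at s within {0..T})"
 proof (rule Lim_null_comparison)
  show "\<forall>\<^sub>F t in at s within {0..T}. norm (aD (G t) (?g t) - aD (G s) (?g s)) <= \<bar>L\<bar> * (\<bar>L\<bar> * \<bar>t - s\<bar> / m1) + \<bar>aD (G t) (?g s) - aD (G s) (?g s)\<bar>"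
   unfolding eventually_at_filter
  proof (rule always_eventually, intro allI impI)
   fix t assume t: "t : {0..T}"
   have W: "(lg m1 (f t) - lg m1 (f s), ?g t - ?g s) : W1"
    using subspace_diff[OF W1_subspace ln_W1(3)[OF flowD(1)[OF fl t] m] ln_W1(3)[OF flowD(1)[OF fl s] m]] by simp
   have "\<bar>aD (G t) (?g t - ?g s)\<bar> <= L * norm (lg m1 (f t) - lg m1 (f s))" by (rule flowD(2)[OF fl t W])
   also have "... <= \<bar>L\<bar> * (\<bar>L\<bar> * \<bar>t - s\<bar> / m1)"
   proof (intro mult_mono)
    have "norm (f t - f s) <= \<bar>L\<bar> * \<bar>t - s\<bar>" by (rule order_trans[OF flowD(4)[OF fl t s]]) (simp add: mult_right_mono)
    thus "norm (lg m1 (f t) - lg m1 (f s)) <= \<bar>L\<bar> * \<bar>t - s\<bar> / m1"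
    using lg_lip[OF flowD(1)[OF fl t] flowD(1)[OF fl s] m] m divide_right_mono[of "norm (f t - f s)" "\<bar>L\<bar> * \<bar>t - s\<bar>" m1] by linarith
   qed auto
   finally show "norm (aD (G t) (?g t) - aD (G s) (?g s)) <= \<bar>L\<bar> * (\<bar>L\<bar> * \<bar>t - s\<bar> / m1) + \<bar>aD (G t) (?g s) - aD (G s) (?g s)\<bar>"
    by (simp add: aD.diff_right)
  qed
  have "((%t. aD (G t) (?g s)) \<longlongrightarrow> aD (G s) (?g s)) (at s within {0..T})" using flow_aD_cont[OF fl] s unfolding continuous_on_def by blast
  hence "((%t. \<bar>L\<bar> * (\<bar>L\<bar> * \<bar>t - s\<bar> / m1) + \<bar>aD (G t) (?g s) - aD (G s) (?g s)\<bar>) \<longlongrightarrow> \<bar>L\<bar> * (\<bar>L\<bar> * \<bar>s - s\<bar> / m1) + \<bar>aD (G s) (?g s) - aD (G s) (?g s)\<bar>) (at s within {0..T})"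
   using m by (intro tendsto_intros) auto
  thus "((%t. \<bar>L\<bar> * (\<bar>L\<bar> * \<bar>t - s\<bar> / m1) + \<bar>aD (G t) (?g s) - aD (G s) (?g s)\<bar>) \<longlongrightarrow> 0) (at s within {0..T})" by simp
 qed
 thus "((%t. ent m1 (f t) (G t)) \<longlongrightarrow> ent m1 (f s) (G s)) (at s within {0..T})" unfolding ent_def by (rule LIM_zero_cancel)
qed

lemma fp_mult: assumes "!!x. D x = p x *R M x" shows "p x * c * (w \<bullet> (M x *v v)) = c * ((D x *v v) \<bullet> w)"
 unfolding assms by (simp add: scaleR_matrix_vector_assoc[symmetric] inner_commute)

text \<open>The gradient of - (log f + 1) is - H / u, so the density cancels in r M grad \<xi> = - D
  H: this potential drives exactly the flux of the equation. The bounds on \<open>u\<close> let the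
  true logarithm be replaced by \<open>lnm\<close>.\<close>

lemma ln_pressure:
 assumes uG: "(u, H) : W1" and b: "AE x in lc. m <= fn u x & fn u x <= m2" and m: "0 < m"
  and DM: "!!x. D x = p x *R M x"
  and r: "r : bmc" "AE x in lc. r x = p x * fn u x"
 defines "\<xi> \<equiv> %x. - (ln (r x / p x) + 1)"
 shows "EX g. has_weak_grad \<xi> g" "tnn (%x. (1/2) * (wgrad \<xi> x \<bullet> (M x *v wgrad \<xi> x)) * r x) = ennreal (1/2 * ent m u H)"
  "AE x in lc. r x * ((M x *v wgrad \<xi> x) \<bullet> w x) = - ((D x *v fn H x) \<bullet> w x)" "0 <= ent m u H"
proof -
 have pm: "p : bmc" by (rule tintegrable_cont(1)[OF continuous_on_subset[OF p_cont subset_UNIV]])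
 have m\<xi>: "\<xi> : bmc" unfolding \<xi>_def using r(1) pm by measurable
 define U where "U = - lg m u - ecas 0 1"
 have W: "(U, - gg m u H) : W1"
  using subspace_diff[OF W1_subspace subspace_neg[OF W1_subspace ln_W1(3)[OF uG m]] W1_const[of 1]] by (simp add: U_def)
 note s = ln_W1(1,2)[OF uG m]
 have fU: "AE x in lc. fn U x = \<xi> x"
 proof -
  have "U = tol2 (%x. - lnm m (fn u x) - cas 0 x *R 1)"
  proof -
   have "- lg m u = tol2 (%x. - lnm m (fn u x))" unfolding lg_def using scaleR_tol2[OF s(1), of "-1"] by simp
   thus ?thesis unfolding U_def ecas_def by (simp only: diff_tol2[OF sqi_minus[OF s(1)] sqi_ecas])
  qed
  hence "AE x in lc. fn U x = - lnm m (fn u x) - cas 0 x *R 1"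
   using fn_tol2[OF sqi_diff[OF sqi_minus[OF s(1)] sqi_ecas[of 0 1]]] by simp
  thus ?thesis using b r(2)
  proof eventually_elim
   case (elim x)
   thus ?case using p_pos[of x] lnm_props(4)[OF m, of "fn u x"] by (simp add: \<xi>_def)
  qed
 qed
 note wg = W1_wgrad[OF W fU m\<xi>]
 show ex: "EX g. has_weak_grad \<xi> g" using wg(1) by blast
 have fg: "AE x in lc. r x = p x * fn u x & wgrad \<xi> x = - ((1 / fn u x) *R fn H x) & fn (gg m u H) x = (1 / fn u x) *R fn H x & 0 < fn u x"
 proof -
  have "- gg m u H = tol2 (%x. - ((1 / max (fn u x) m) *R fn H x))" unfolding gg_def using scaleR_tol2[OF s(2), of "-1"] by simp
  hence "AE x in lc. fn (- gg m u H) x = - ((1 / max (fn u x) m) *R fn H x)" using fn_tol2[OF sqi_minus[OF s(2)]] by simp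
  moreover have "AE x in lc. fn (gg m u H) x = (1 / max (fn u x) m) *R fn H x" unfolding gg_def by (rule fn_tol2[OF s(2)])
  ultimately show ?thesis using wg(3) b r(2) by eventually_elim (use m in \<open>auto simp: max_def\<close>)
 qed
 show "AE x in lc. r x * ((M x *v wgrad \<xi> x) \<bullet> w x) = - ((D x *v fn H x) \<bullet> w x)"
  using fg
 proof eventually_elim
  case (elim x)
  have "r x * ((M x *v wgrad \<xi> x) \<bullet> w x) = p x * fn u x * (w x \<bullet> (M x *v wgrad \<xi> x))" using elim by (simp add: inner_commute)
  also have "... = fn u x * ((D x *v wgrad \<xi> x) \<bullet> w x)" by (rule fp_mult[OF DM])
  also have "D x *v wgrad \<xi> x = (- 1 / fn u x) *R (D x *v fn H x)"
   using elim matrix_vector_mult_scaleR[of "D x" "- 1 / fn u x" "fn H x"] by simp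
  finally show ?case using elim by simp
 qed
 have i: "tintegrable (%x. (D x *v fn H x) \<bullet> fn (gg m u H) x)" by (intro sqi_inner sqi_pw[OF b_D] sqi_fn)
 have eq: "AE x in lc. (1/2) * (wgrad \<xi> x \<bullet> (M x *v wgrad \<xi> x)) * r x = 1/2 * ((D x *v fn H x) \<bullet> fn (gg m u H) x) & 0 <= (D x *v fn H x) \<bullet> fn (gg m u H) x"
  using fg
 proof eventually_elim
  case (elim x)
  have "(wgrad \<xi> x \<bullet> (M x *v wgrad \<xi> x)) * r x = fn u x * ((D x *v wgrad \<xi> x) \<bullet> wgrad \<xi> x)"
   using elim fp_mult[OF DM, of x "fn u x" "wgrad \<xi> x" "wgrad \<xi> x"] by (simp add: mult_ac)
  moreover have "D x *v wgrad \<xi> x = (- 1 / fn u x) *R (D x *v fn H x)"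
   using elim matrix_vector_mult_scaleR[of "D x" "- 1 / fn u x" "fn H x"] by simp
  ultimately have 1: "(wgrad \<xi> x \<bullet> (M x *v wgrad \<xi> x)) * r x = (D x *v fn H x) \<bullet> fn (gg m u H) x" using elim by simp
  have "0 <= d0 * (norm (fn H x))^2" using d0 by simp
  hence "0 <= (D x *v fn H x) \<bullet> fn H x" using D_lo[of "fn H x" x] by (simp add: inner_commute)
  hence "0 <= (D x *v fn H x) \<bullet> fn (gg m u H) x" using elim by simp
  thus ?case using 1 by simp
 qed
 show "0 <= ent m u H" unfolding ent_def aD_int by (rule integral_nonneg_AE) (use eq in \<open>auto elim: AE_mp\<close>)
 have "tnn (%x. (1/2) * (wgrad \<xi> x \<bullet> (M x *v wgrad \<xi> x)) * r x) = tnn (%x. 1/2 * ((D x *v fn H x) \<bullet> fn (gg m u H) x))"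
  by (rule nn_integral_cong_AE) (use eq in eventually_elim, simp)
 also have "... = ennreal (tint (%x. 1/2 * ((D x *v fn H x) \<bullet> fn (gg m u H) x)))"
  by (rule nn_integral_eq_integral[OF integrable_mult_right[OF i]]) (use eq in eventually_elim, simp)
 finally show "tnn (%x. (1/2) * (wgrad \<xi> x \<bullet> (M x *v wgrad \<xi> x)) * r x) = ennreal (1/2 * ent m u H)"
  by (simp only: ent_def aD_int integral_mult_right_zero)
qed

text \<open>Links the densities of the theorem, which are functions, with the L2 classes of f = rho
  / p.\<close>

definition track :: "real => (real => real^'n => real) => (real => ('n, real) l2) => bool" where
 "track T \<rho> f \<longleftrightarrow> (ALL t:{0..T}. \<rho> t : bmc & (AE x in lc. \<rho> t x = p x * fn (f t) x))"

lemma trackD: assumes "track T \<rho> f" "t : {0..T}"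
 shows "\<rho> t : bmc" "AE x in lc. \<rho> t x = p x * fn (f t) x"
 using assms unfolding track_def by blast+

lemma track_inner: assumes "track T \<rho> f" "t : {0..T}" "sqi phi" shows "tint (%x. \<rho> t x * phi x) = pp (f t) \<bullet> tol2 phi"
proof -
 note tr = trackD[OF assms(1,2)]
 have m: "(%x. p x * fn (f t) x * fn (tol2 phi) x) : bmc"
  by (intro borel_measurable_times fn_measurable tintegrable_cont(1)[OF continuous_on_subset[OF p_cont subset_UNIV]])
 have "AE x in lc. \<rho> t x * phi x = p x * fn (f t) x * fn (tol2 phi) x"
  using tr(2) fn_tol2[OF assms(3)] by eventually_elim simp
 thus ?thesis unfolding pp_inner
  by (intro integral_cong_AE borel_measurable_times tr(1) sqi_measurable[OF assms(3)] m)
qed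

lemma psi_star_flow:
 assumes fl: "flow T L m1 m2 f G" and m: "0 < m1" and tr: "track T \<rho> f" and DM: "!!x. D x = p x *R M x" and t: "t : {0..T}"
 shows "psi_star M (\<rho> t) (%x. - (ln (\<rho> t x / p x) + 1)) = ennreal (1/2 * ent m1 (f t) (G t))" "0 <= ent m1 (f t) (G t)"
 using ln_pressure[OF flowD(1)[OF fl t] flowD(3)[OF fl t] m DM trackD[OF tr t]] unfolding psi_star_def by simp_all

text \<open>The pressure - (log f + 1) is an admissible potential, because by
  \<open>ln_pressure\<close> its flux is that of the flow and the integrated equation is the
  required continuity equation.\<close>

lemma action_le:
 assumes fl: "flow T L m1 m2 f G" and m: "0 < m1" and tr: "track T \<rho> f" and DM: "!!x. D x = p x *R M x" and t: "t : {0..T}"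
 shows "action M \<rho> t <= (\<integral>\<^sup>+tau\<in>{0..t}. ennreal (1/2 * ent m1 (f tau) (G tau)) \<partial>lborel)"
proof -
 define u where "u tau = (%x. - (ln (\<rho> tau x / p x) + 1))" for tau
 have sub: "tau : {0..T}" if "tau : {0..t}" for tau using that t by auto
 note lp = ln_pressure[OF flowD(1)[OF fl sub] flowD(3)[OF fl sub] m DM trackD[OF tr sub], folded u_def]
 have X: "tintegrable (%x. \<rho> tau x * ((M x *v wgrad (u tau) x) \<bullet> pgrad phi x))"
  "tint (%x. \<rho> tau x * ((M x *v wgrad (u tau) x) \<bullet> pgrad phi x)) = - aD (G tau) (tol2 (pgrad phi))"
  if tau: "tau : {0..t}" and phi: "test_fun phi" for tau phi
 proof -
  have sg: "sqi (pgrad phi)" by (rule test_fun_props(4)[OF phi])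
  have i: "tintegrable (%x. - ((D x *v fn (G tau) x) \<bullet> pgrad phi x))" by (intro Bochner_Integration.integrable_minus sqi_inner sqi_pw[OF b_D] sqi_fn sg)
  have ae: "AE x in lc. \<rho> tau x * ((M x *v wgrad (u tau) x) \<bullet> pgrad phi x) = - ((D x *v fn (G tau) x) \<bullet> pgrad phi x)"
   by (rule lp(3)[OF tau tau tau tau])
  have meas: "(%x. \<rho> tau x * ((M x *v wgrad (u tau) x) \<bullet> pgrad phi x)) : bmc"
   by (intro borel_measurable_times borel_measurable_inner trackD(1)[OF tr sub[OF tau]] sqi_measurable[OF sg]
    M_measurable[OF DM] wgrad_measurable lp(1)[OF tau tau tau tau])
  show "tintegrable (%x. \<rho> tau x * ((M x *v wgrad (u tau) x) \<bullet> pgrad phi x))"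
   by (rule integrable_cong_AE_imp[OF i meas]) (use ae in eventually_elim, simp)
  show "tint (%x. \<rho> tau x * ((M x *v wgrad (u tau) x) \<bullet> pgrad phi x)) = - aD (G tau) (tol2 (pgrad phi))"
   unfolding aD_right[OF sg] integral_minus[symmetric] by (rule integral_cong_AE[OF meas borel_measurable_integrable[OF i] ae])
 qed
 have rep: "represents M \<rho> t u"
  unfolding represents_def
 proof (intro conjI ballI allI impI)
  show "EX g. has_weak_grad (u tau) g" if "tau : {0..t}" for tau by (rule lp(1)[OF that that that that])
  fix phi :: "real^'n => real" assume phi: "test_fun phi"
  show "tintegrable (%x. \<rho> tau x * ((M x *v wgrad (u tau) x) \<bullet> pgrad phi x))" if "tau : {0..t}" for tau by (rule X(1)[OF that phi])
  let ?a = "%tau. - aD (G tau) (tol2 (pgrad phi))"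
  let ?b = "%tau. tint (%x. \<rho> tau x * ((M x *v wgrad (u tau) x) \<bullet> pgrad phi x))"
  have ca: "continuous_on {0..T} ?a" by (intro continuous_on_minus flow_aD_cont[OF fl])
  have ia: "integrable (lebesgue_on {0..s}) ?a" if "s : {0..t}" for s
   by (rule continuous_imp_integrable_real[OF continuous_on_subset[OF ca]]) (use that t in auto)
  show "integrable (lebesgue_on {0..t}) ?b"
   by (subst Bochner_Integration.integrable_cong[OF refl, of _ _ ?a]) (use X(2)[OF _ phi] ia[of t] t in auto)
  fix s assume s: "s : {0..t}"
  have "integral\<^sup>L (lebesgue_on {0..s}) ?b = integral\<^sup>L (lebesgue_on {0..s}) ?a"
   by (rule Bochner_Integration.integral_cong[OF refl]) (use X(2)[OF _ phi] s in auto)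
  also have "... = integral {0..s} ?a" by (rule lebesgue_integral_eq_integral[OF ia[OF s]]) simp
  also have "... = (pp (f s) - pp (f 0)) \<bullet> tol2 phi"
   by (rule integral_unique) (use has_integral_neg[OF flowD(5)[OF fl sub[OF s] C1p_in_W1[OF test_fun_C1p[OF phi]]]] in simp)
  also have "... = tint (%x. \<rho> s x * phi x) - tint (%x. \<rho> 0 x * phi x)"
   using track_inner[OF tr sub[OF s] test_fun_props(1)[OF phi]] track_inner[OF tr _ test_fun_props(1)[OF phi], of 0] t by (simp add: inner_diff_left)
  finally show "tint (%x. \<rho> s x * phi x) - tint (%x. \<rho> 0 x * phi x) = integral\<^sup>L (lebesgue_on {0..s}) ?b" ..
 qed
 hence "action M \<rho> t <= (\<integral>\<^sup>+tau\<in>{0..t}. tnn (%x. (1/2) * (wgrad (u tau) x \<bullet> (M x *v wgrad (u tau) x)) * \<rho> tau x) \<partial>lborel)"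
  unfolding action_def by (intro INF_lower) simp
 also have "... = (\<integral>\<^sup>+tau\<in>{0..t}. ennreal (1/2 * ent m1 (f tau) (G tau)) \<partial>lborel)"
 proof (rule nn_integral_cong)
  fix tau show "tnn (%x. (1/2) * (wgrad (u tau) x \<bullet> (M x *v wgrad (u tau) x)) * \<rho> tau x) * indicator {0..t} tau = ennreal (1/2 * ent m1 (f tau) (G tau)) * indicator {0..t} tau"
  proof (cases "tau : {0..t}")
   case True
   show ?thesis by (simp only: lp(2)[OF True True True True])
  qed simp
 qed
 finally show ?thesis .
qed

text \<open>Consider the form \<open>Y\<close> with matrix u D at \<open>V + g\<close>, where
  \<open>g\<close> is the gradient of log u. Equality of the divergences gives
  \<open>Y V \<bullet> g = - ent m u H\<close>, the definition of \<open>g\<close> gives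
  \<open>Y g \<bullet> g = ent m u H\<close>, and nonnegativity leaves
  \<open>ent m u H <= Y V \<bullet> V\<close>. The equation for \<open>v\<close> is known only
  against \<open>cas k\<close>; its extension to \<open>g\<close> relies on square integrability of
  \<open>v\<close>.\<close>

lemma young_pressure:
 assumes uG: "(u, H) : W1" and b: "AE x in lc. m <= fn u x & fn u x <= m2" and m: "0 < m" "m <= m2"
  and DM: "!!x. D x = p x *R M x"
  and r: "r : bmc" "AE x in lc. r x = p x * fn u x"
  and v: "v : bmc"
  and eq: "!!k. tint (%x. r x * ((M x *v v x) \<bullet> pgrad (cas k) x)) = - aD H (ecas (- k) (kv k))"
 shows "ennreal (1/2 * ent m u H) <= tnn (%x. (1/2) * (v x \<bullet> (M x *v v x)) * r x)"
proof (cases "tnn (%x. (1/2) * (v x \<bullet> (M x *v v x)) * r x)")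
 case top thus ?thesis by simp
next
 case (real c)
 \<comment> \<open>A copy of \<open>u\<close> clipped to its range, so that the bounds hold at every
   point as \<open>bpw\<close> requires.\<close>
 define e where "e x = min (max (fn u x) m) m2" for x
 have e: "m <= e x" "e x <= m2" for x using m by (auto simp: e_def)
 have em: "e : bmc" unfolding e_def by measurable
 have ae: "AE x in lc. r x = p x * e x & fn u x = e x" using b r(2) by eventually_elim (auto simp: e_def)
 have bY: "bpw (%x v. (e x *R D x) *v v) (m2 * d1)"
 proof (rule bpw_matrix)
  show "(%x. (e x *R D x) $ i $ j) : bmc" for i j
   using borel_measurable_times[OF em tintegrable_cont(1)[OF continuous_on_subset[OF D_cont subset_UNIV], of i j]] by simp
  have "\<bar>e x\<bar> * norm (D x *v v) <= m2 * (d1 * norm v)" for x v using e[of x] m D_hi by (intro mult_mono) auto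
  thus "norm ((e x *R D x) *v v) <= m2 * d1 * norm v" for x v by (simp add: scaleR_matrix_vector_assoc[symmetric] mult.assoc)
 qed (use m d1_nonneg in auto)
 define Y where "Y = pw (%x v. (e x *R D x) *v v)"
 interpret Y: bounded_linear Y unfolding Y_def by (rule bounded_linear_pw[OF bY])
 have Yi: "Y U \<bullet> W = tint (%x. e x * ((D x *v fn U x) \<bullet> fn W x))" for U W
  unfolding Y_def pw_inner[OF bY] by (simp add: scaleR_matrix_vector_assoc[symmetric])
 have Ysym: "Y U \<bullet> W = Y W \<bullet> U" for U W unfolding Yi by (subst D_inner) (rule refl)
 have Ynn: "0 <= Y U \<bullet> U" for U
 proof -
  have "0 <= (D x *v w) \<bullet> w" for x w using D_lo[of w x] d0 by (smt (verit) inner_commute mult_nonneg_nonneg zero_le_power2)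
  thus ?thesis unfolding Yi using e m by (intro integral_nonneg_AE AE_I2 mult_nonneg_nonneg) (auto intro: order_trans[of 0 m])
 qed
 have form: "AE x in lc. (1/2) * (v x \<bullet> (M x *v v x)) * r x = 1/2 * (e x * ((D x *v v x) \<bullet> v x))"
  using ae
 proof eventually_elim
  case (elim x)
  show ?case using fp_mult[OF DM, of x "e x" "v x" "v x"] elim by (simp add: mult_ac)
 qed
 \<comment> \<open>The competitor is not assumed to be in L2; finiteness of its action together with
   the lower bounds on density and matrix puts it there.\<close>
 have sv: "sqi v"
 proof (rule nn_sqi(1)[OF v, of "sqrt (c / (m * d0 / 2))"])
  have "ennreal (m * d0 / 2) * tnn (%x. (norm (v x))^2) = tnn (%x. (m * d0 / 2) * (norm (v x))^2)"
  proof -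
   have "ennreal (m * d0 / 2) * tnn (%x. (norm (v x))^2) = (\<integral>\<^sup>+x. ennreal (m * d0 / 2) * ennreal ((norm (v x))^2) \<partial>lc)"
    by (rule nn_integral_cmult[symmetric]) (use v in measurable)
   also have "... = tnn (%x. (m * d0 / 2) * (norm (v x))^2)"
    by (rule nn_integral_cong) (use m d0 in \<open>simp add: ennreal_mult[symmetric]\<close>)
   finally show ?thesis .
  qed
  also have "... <= tnn (%x. (1/2) * (v x \<bullet> (M x *v v x)) * r x)"
  proof (rule nn_integral_mono_AE)
   show "AE x in lc. ennreal ((m * d0 / 2) * (norm (v x))^2) <= ennreal ((1/2) * (v x \<bullet> (M x *v v x)) * r x)"
    using form
   proof eventually_elim
    case (elim x)
    have "m * (d0 * (norm (v x))^2) <= e x * ((D x *v v x) \<bullet> v x)" using e[of x] m d0 D_lo[of "v x" x] by (intro mult_mono) (auto simp: inner_commute)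
    thus ?case unfolding elim by (intro ennreal_leI) simp
   qed
  qed
  finally have le: "ennreal (m * d0 / 2) * tnn (%x. (norm (v x))^2) <= ennreal c" using real by simp
  have pos: "0 < m * d0 / 2" using m d0 by simp
  have "tnn (%x. (norm (v x))^2) = ennreal (1 / (m * d0 / 2)) * (ennreal (m * d0 / 2) * tnn (%x. (norm (v x))^2))"
  proof -
   have "ennreal (1 / z) * ennreal z = 1" if "0 < z" for z using that by (simp add: ennreal_mult[symmetric])
   thus ?thesis by (simp only: mult.assoc[symmetric] pos mult_1)
  qed
  also have "... <= ennreal (1 / (m * d0 / 2)) * ennreal c" by (rule mult_left_mono[OF le]) simp
  also have "... = ennreal ((sqrt (c / (m * d0 / 2)))^2)" using pos real by (simp add: ennreal_mult[symmetric])
  finally show "tnn (%x. (norm (v x))^2) <= ennreal ((sqrt (c / (m * d0 / 2)))^2)" .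
  show "0 <= sqrt (c / (m * d0 / 2))" using m d0 real by simp
 qed
 define V where "V = tol2 v"
 have fV: "AE x in lc. fn V x = v x" unfolding V_def by (rule fn_tol2[OF sv])
 have Yw: "Y V \<bullet> tol2 w = tint (%x. e x * ((D x *v v x) \<bullet> w x))" if w: "sqi w" for w
 proof -
  have "Y V \<bullet> tol2 w = tol2 (%x. (e x *R D x) *v v x) \<bullet> tol2 w" unfolding Y_def V_def pw_tol2[OF bY sv] ..
  also have "... = tint (%x. ((e x *R D x) *v v x) \<bullet> w x)" by (rule inner_tol2[OF sqi_pw[OF bY sv] w])
  finally show ?thesis by (simp add: scaleR_matrix_vector_assoc[symmetric])
 qed
 have iw: "tintegrable (%x. e x * ((D x *v v x) \<bullet> w x))" if w: "sqi w" for w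
  using sqi_inner[OF sqi_pw[OF bY sv] w] by (simp add: scaleR_matrix_vector_assoc[symmetric])
 have Yk: "Y V \<bullet> k = - aD H k" if "(w, k) : W1" for w k
 proof -
  have "Y V \<bullet> snd (w, k) + aD H (snd (w, k)) = 0"
  proof (rule W1_functional_zero[OF _ _ that])
   interpret aD: bounded_bilinear aD by (rule aD_bb)
   show "bounded_linear (%z. Y V \<bullet> snd z + aD H (snd z))"
    by (intro bounded_linear_add bounded_linear_compose[OF bounded_linear_inner_right bounded_linear_snd] bounded_linear_compose[OF aD.bounded_linear_right bounded_linear_snd])
   fix k :: "int^'n"
   have pg: "pgrad (cas k) = (%x. cas (- k) x *R kv k)" by (rule C1p_pgrad[OF cas_C1p])
   have "- aD H (ecas (- k) (kv k)) = tint (%x. r x * ((M x *v v x) \<bullet> pgrad (cas k) x))" by (rule eq[symmetric])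
   also have "... = tint (%x. e x * ((D x *v v x) \<bullet> pgrad (cas k) x))"
   proof (rule integral_cong_AE)
    have sp: "sqi (pgrad (cas k))" unfolding pg by (rule sqi_ecas)
    show m2: "(%x. e x * ((D x *v v x) \<bullet> pgrad (cas k) x)) : bmc"
    using iw[OF sp] by (rule borel_measurable_integrable)
    show ae2: "AE x in lc. r x * ((M x *v v x) \<bullet> pgrad (cas k) x) = e x * ((D x *v v x) \<bullet> pgrad (cas k) x)"
    using ae
    proof eventually_elim
    case (elim x)
    show ?case using fp_mult[OF DM, of x "e x" "pgrad (cas k) x" "v x"] elim by (simp add: inner_commute)
    qed
    show "(%x. r x * ((M x *v v x) \<bullet> pgrad (cas k) x)) : bmc"
    by (intro borel_measurable_times borel_measurable_inner r(1) sqi_measurable[OF sp] M_measurable[OF DM] v)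
   qed
   also have "... = Y V \<bullet> ecas (- k) (kv k)" unfolding pg ecas_def by (rule Yw[OF sqi_ecas, symmetric])
   finally show "Y V \<bullet> snd (ecas k 1, ecas (- k) (kv k)) + aD H (snd (ecas k (1::real), ecas (- k) (kv k))) = 0" by simp
  qed
  thus ?thesis by simp
 qed
 define g where "g = gg m u H"
 have gW: "(lg m u, g) : W1" unfolding g_def by (rule ln_W1(3)[OF uG m(1)])
 have Yg: "Y W \<bullet> g = aD W H" for W
  unfolding Yi aD_int
 proof (rule integral_cong_AE)
  have "AE x in lc. fn g x = (1 / max (fn u x) m) *R fn H x" unfolding g_def gg_def by (rule fn_tol2[OF ln_W1(2)[OF uG m(1)]])
  thus "AE x in lc. e x * ((D x *v fn W x) \<bullet> fn g x) = (D x *v fn W x) \<bullet> fn H x"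
   using b ae by eventually_elim (use m in \<open>auto simp: max_def\<close>)
  show "(%x. e x * ((D x *v fn W x) \<bullet> fn g x)) : bmc"
   by (intro borel_measurable_times em borel_measurable_integrable sqi_inner sqi_pw[OF b_D] sqi_fn)
  show "(%x. (D x *v fn W x) \<bullet> fn H x) : bmc"
   by (intro borel_measurable_integrable sqi_inner sqi_pw[OF b_D] sqi_fn)
 qed
 have E: "Y g \<bullet> g = ent m u H" "Y V \<bullet> g = - ent m u H" unfolding ent_def g_def[symmetric]
  using Yg[of g] Yk[OF gW] aD_sym[of g H] by simp_all
 have "0 <= Y (V + g) \<bullet> (V + g)" by (rule Ynn)
 hence le: "ent m u H <= Y V \<bullet> V" using E Ysym[of g V] by (simp add: Y.add inner_add_left inner_add_right)
 have "ennreal (1/2 * ent m u H) <= ennreal (tint (%x. 1/2 * (e x * ((D x *v v x) \<bullet> v x))))"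
  unfolding integral_mult_right_zero Yw[OF sv, folded V_def, symmetric] using le by (intro ennreal_leI) simp
 also have "... = tnn (%x. 1/2 * (e x * ((D x *v v x) \<bullet> v x)))"
 proof (rule nn_integral_eq_integral[symmetric, OF integrable_mult_right[OF iw[OF sv]]])
  have "0 <= e x * ((D x *v w) \<bullet> w)" for x w using e[of x] m D_lo[of w x] d0 by (smt (verit) inner_commute mult_nonneg_nonneg zero_le_power2)
  thus "AE x in lc. 0 <= 1/2 * (e x * ((D x *v v x) \<bullet> v x))" by (intro AE_I2) simp
 qed
 also have "... = tnn (%x. (1/2) * (v x \<bullet> (M x *v v x)) * r x)"
  by (rule nn_integral_cong_AE) (use form in eventually_elim, simp)
 finally show ?thesis .
qed

text \<open>Two integrated equations for the same densities give, for each frequency, equal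
  integrands at almost every time. Countably many frequencies share one null set, off which
  \<open>young_pressure\<close> applies time by time.\<close>

lemma action_ge:
 assumes fl: "flow T L m1 m2 f G" and m: "0 < m1" "m1 <= m2" and tr: "track T \<rho> f" and DM: "!!x. D x = p x *R M x" and t: "t : {0..T}"
 shows "(\<integral>\<^sup>+tau\<in>{0..t}. ennreal (1/2 * ent m1 (f tau) (G tau)) \<partial>lborel) <= action M \<rho> t"
 unfolding action_def
proof (rule INF_greatest)
 fix u assume "u : {u. represents M \<rho> t u}"
 hence wg: "!!tau. tau : {0..t} ==> EX g. has_weak_grad (u tau) g"
  and I: "!!phi. test_fun phi ==> integrable (lebesgue_on {0..t}) (%tau. tint (%x. \<rho> tau x * ((M x *v wgrad (u tau) x) \<bullet> pgrad phi x)))"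
  and eq: "!!phi s. test_fun phi ==> s : {0..t} ==> tint (%x. \<rho> s x * phi x) - tint (%x. \<rho> 0 x * phi x) =
    integral\<^sup>L (lebesgue_on {0..s}) (%tau. tint (%x. \<rho> tau x * ((M x *v wgrad (u tau) x) \<bullet> pgrad phi x)))"
  unfolding represents_def by blast+
 have sub: "tau : {0..T}" if "tau : {0..t}" for tau using that t by auto
 have "AE tau in lborel. tau : {0..t} --> tint (%x. \<rho> tau x * ((M x *v wgrad (u tau) x) \<bullet> pgrad (cas k) x)) + aD (G tau) (ecas (- k) (kv k)) = 0" for k
 proof (rule AE_zero_of_integrals)
  let ?X = "%tau. tint (%x. \<rho> tau x * ((M x *v wgrad (u tau) x) \<bullet> pgrad (cas k) x))"
  let ?A = "%tau. aD (G tau) (ecas (- k) (kv k))"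
  have iA: "integrable (lebesgue_on {0..s}) ?A" if "s : {0..t}" for s
   by (rule continuous_imp_integrable_real[OF continuous_on_subset[OF flow_aD_cont[OF fl]]]) (use that t in auto)
  show "0 <= t" using t by simp
  thus "integrable (lebesgue_on {0..t}) (%tau. ?X tau + ?A tau)" using I[OF cas_test] iA[of t] by auto
  fix s assume s: "s : {0..t}"
  have iX: "integrable (lebesgue_on {0..s}) ?X" by (rule integrable_subinterval[OF I[OF cas_test]]) (use s in auto)
  have "integral\<^sup>L (lebesgue_on {0..s}) ?A = integral {0..s} ?A" by (rule lebesgue_integral_eq_integral[OF iA[OF s]]) simp
  also have "... = - ((pp (f s) - pp (f 0)) \<bullet> ecas k 1)"
   using flowD(5)[OF fl sub[OF s] subsetD[OF W0_sub W0_basis[of k 1]]] by (simp add: integral_unique)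
  also have "... = - (tint (%x. \<rho> s x * cas k x) - tint (%x. \<rho> 0 x * cas k x))"
   using track_inner[OF tr sub[OF s] sqi_ecas[of k "1::real"]] track_inner[OF tr _ sqi_ecas[of k "1::real"], of 0] t by (simp add: inner_diff_left ecas_def)
  finally show "integral\<^sup>L (lebesgue_on {0..s}) (%tau. ?X tau + ?A tau) = 0"
   using eq[OF cas_test[of k] s] integral_plus[OF iX iA[OF s]] by simp
 qed
 hence "AE tau in lborel. ALL k. tau : {0..t} --> tint (%x. \<rho> tau x * ((M x *v wgrad (u tau) x) \<bullet> pgrad (cas k) x)) + aD (G tau) (ecas (- k) (kv k)) = 0"
  unfolding AE_all_countable by blast
 thus "(\<integral>\<^sup>+tau\<in>{0..t}. ennreal (1/2 * ent m1 (f tau) (G tau)) \<partial>lborel) <= (\<integral>\<^sup>+tau\<in>{0..t}. tnn (%x. (1/2) * (wgrad (u tau) x \<bullet> (M x *v wgrad (u tau) x)) * \<rho> tau x) \<partial>lborel)"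
 proof (intro nn_integral_mono_AE, eventually_elim)
  case (elim tau)
  show ?case
  proof (cases "tau : {0..t}")
   case True
   note v = wgrad_measurable[OF wg[OF True]]
   have "tint (%x. \<rho> tau x * ((M x *v wgrad (u tau) x) \<bullet> pgrad (cas k) x)) = - aD (G tau) (ecas (- k) (kv k))" for k
    using elim True by (auto simp: eq_neg_iff_add_eq_0)
   from young_pressure[OF flowD(1)[OF fl sub[OF True]] flowD(3)[OF fl sub[OF True]] m DM trackD[OF tr sub[OF True]] v this]
   show ?thesis by (rule mult_right_mono) simp
  qed simp
 qed
qed

end

section \<open>Wasserstein distance\<close>

lemma tdist_sq_le:
 assumes "x : cell" "y : (cell :: (real^'n) set)"
 shows "(tdist x y)^2 <= (dist x y)^2" "(tdist x y)^2 <= real CARD('n)"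
proof -
 let ?S = "{norm (x - y - k) | k. ALL i. k $ i : \<int>}"
 have "norm (x - y - 0) : ?S" by (rule CollectI, rule exI[of _ 0]) simp
 moreover have bd: "bdd_below ?S" by (rule bdd_belowI[of _ 0]) auto
 ultimately have 1: "tdist x y <= norm (x - y - 0)" unfolding tdist_def by (intro cInf_lower)
 have 0: "0 <= tdist x y" unfolding tdist_def
  by (rule cInf_greatest) (use \<open>norm (x - y - 0) : ?S\<close> in blast, auto)
 show le: "(tdist x y)^2 <= (dist x y)^2" using 1 0 by (intro power_mono) (auto simp: dist_norm)
 have "(dist x y)^2 = (SUM i:UNIV. (x $ i - y $ i)^2)" by (simp add: dist_norm norm_vec_def L2_set_def sum_nonneg)
 also have "... <= (SUM i:(UNIV::'n set). 1)"
 proof (rule sum_mono)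
  fix i
  have "\<bar>x $ i - y $ i\<bar> <= 1" using assms unfolding mem_cell by (smt (verit))
  thus "(x $ i - y $ i)^2 <= 1" by (simp add: abs_square_le_1)
 qed
 finally show "(tdist x y)^2 <= real CARD('n)" using le by simp
qed

text \<open>Couplings are Borel measures while densities are only Lebesgue measurable. The function
  \<open>p'\<close> is a Borel version, nonnegative and zero off the cell, with the same
  masses.\<close>

lemma nn_lebesgue_cell:
 fixes p :: "real^'n => real"
 assumes "tintegrable p" "!!x. x : cell ==> 0 <= p x" "A : sets borel"
 obtains p' where "p' : borel_measurable borel" "!!x. 0 <= p' x" "!!x. x \<notin> cell ==> p' x = 0" "AE x in lborel. indicator cell x * p x = p' x"
  "!!A. A : sets borel ==> (\<integral>\<^sup>+x\<in>A \<inter> cell. ennreal (p x) \<partial>lborel) = (\<integral>\<^sup>+x\<in>A. ennreal (p' x) \<partial>lborel)"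
  "!!A. A : sets borel ==> (\<integral>\<^sup>+x\<in>A. ennreal (p' x) \<partial>lborel) = ennreal (tint (%x. indicator A x * p x))"
proof -
 have il: "integrable lebesgue (%x. indicator cell x * p x)" using assms(1) by (subst (asm) integrable_restrict_space) auto
 obtain q where q: "q : borel_measurable lborel" "AE x in lborel. indicator cell x * p x = q x"
  using completion_ex_borel_measurable_real[OF borel_measurable_integrable[OF il]] by blast
 define p' where "p' x = indicator cell x * max 0 (q x)" for x
 have cb: "(cell :: (real^'n) set) : sets borel" by (simp add: cell_def)
 have m: "p' : borel_measurable borel" unfolding p'_def using q(1) cb by measurable
 have ae: "AE x in lborel. indicator cell x * p x = p' x"
  using q(2)
 proof eventually_elim
  case (elim x)
  show ?case using elim assms(2)[of x] by (cases "x : cell") (auto simp: p'_def)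
 qed
 show ?thesis
 proof (rule that[OF m _ _ ae])
  fix A :: "(real^'n) set" assume A: "A : sets borel"
  show e: "(\<integral>\<^sup>+x\<in>A \<inter> cell. ennreal (p x) \<partial>lborel) = (\<integral>\<^sup>+x\<in>A. ennreal (p' x) \<partial>lborel)"
   by (rule nn_integral_cong_AE) (use ae in eventually_elim, auto simp: indicator_def split: if_splits)
  have "ennreal (tint (%x. indicator A x * p x)) = (\<integral>\<^sup>+x. ennreal (indicator A x * p x) \<partial>lc)"
   by (rule nn_integral_eq_integral[symmetric, OF tintegrable_indicator[OF A assms(1)]])
    (use assms(2) in \<open>auto intro!: AE_I2\<close>)
  also have "... = (\<integral>\<^sup>+x. ennreal (indicator A x * p x) * indicator cell x \<partial>lebesgue)"
   by (rule nn_integral_restrict_space) simp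
  also have "... = (\<integral>\<^sup>+x. ennreal (indicator A x * p x) * indicator cell x \<partial>lborel)" by (rule nn_integral_completion)
  also have "... = (\<integral>\<^sup>+x\<in>A. ennreal (p' x) \<partial>lborel)"
   by (rule nn_integral_cong_AE) (use ae in eventually_elim, auto simp: indicator_def split: if_splits)
  finally show "(\<integral>\<^sup>+x\<in>A. ennreal (p' x) \<partial>lborel) = ennreal (tint (%x. indicator A x * p x))" ..
 qed (auto simp: p'_def)
qed

text \<open>The diagonal part of the discrete coupling keeps the common mass of each cell of the partition; the
 excess masses are coupled independently. When \<open>m = 0\<close> there is no excess, so the junk value of the quotient is harmless.\<close>

lemma discrete_coupling:
 fixes a b :: "nat => real"
 assumes I: "finite I" and a: "!!i. i : I ==> 0 <= a i" "sum a I = 1" and b: "!!i. i : I ==> 0 <= b i" "sum b I = 1"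
 shows "EX e :: nat => nat => real. (ALL i j. 0 <= e i j) & (ALL i:I. min (a i) (b i) + (SUM j:I. e i j) = a i) \<and>
  (ALL j:I. min (a j) (b j) + (SUM i:I. e i j) = b j) & (SUM i:I. SUM j:I. e i j) <= (SUM i:I. \<bar>a i - b i\<bar>)"
proof -
 define c where "c i = min (a i) (b i)" for i
 define m where "m = (SUM i:I. a i - c i)"
 define e where "e i j = (a i - c i) * (b j - c j) / m" for i j
 have m': "m = (SUM i:I. b i - c i)" using a(2) b(2) by (simp add: m_def sum_subtractf)
 have m0: "0 <= m" unfolding m_def by (rule sum_nonneg) (simp add: c_def)
 have z: "a i = c i & b i = c i" if "m = 0" "i : I" for i
  using sum_nonneg_eq_0_iff[OF I, of "%i. a i - c i"] sum_nonneg_eq_0_iff[OF I, of "%i. b i - c i"] that m_def m' by (auto simp: c_def)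
 have r: "(SUM j:I. e i j) = a i - c i" if "i : I" for i
 proof (cases "m = 0")
  case False
  have "(SUM j:I. e i j) = (a i - c i) / m * (SUM j:I. b j - c j)" unfolding e_def sum_distrib_left by (rule sum.cong) auto
  thus ?thesis using False m' by simp
 qed (use z[OF _ that] in \<open>simp add: e_def\<close>)
 have l: "(SUM i:I. e i j) = b j - c j" if "j : I" for j
 proof (cases "m = 0")
  case False
  have "(SUM i:I. e i j) = (b j - c j) / m * (SUM i:I. a i - c i)" unfolding e_def sum_distrib_left by (rule sum.cong) auto
  thus ?thesis using False m_def by simp
 qed (use z[OF _ that] in \<open>simp add: e_def\<close>)
 show ?thesis
 proof (rule exI[of _ e], intro conjI allI)
  show "0 <= e i j" for i j using m0 by (simp add: e_def c_def)
  show "(SUM i:I. SUM j:I. e i j) <= (SUM i:I. \<bar>a i - b i\<bar>)"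
   by (rule sum_mono) (use r in \<open>auto simp: c_def\<close>)
 qed (use r l in \<open>auto simp: c_def\<close>)
qed

text \<open>The coupling places mass \<open>w i j\<close> from \<open>discrete_coupling\<close> on
  \<open>A i \<times> A j\<close> as the product of the normalised restrictions. Mass that stays in
  its piece costs at most \<open>d^2\<close>, the rest at most the dimension, which bounds squared
  distances in the cell. Convergence of finitely many masses thus controls the Wasserstein
  distance.\<close>

lemma W2sq_partition:
 fixes p q :: "real^'n => real"
 assumes P: "partition d I A" and d: "0 < d" and p: "is_density p" and q: "is_density q"
 shows "W2sq p q <= ennreal (d^2 + real CARD('n) * (SUM j:I. \<bar>tint (%x. indicator (A j) x * p x) - tint (%x. indicator (A j) x * q x)\<bar>))"
proof -
 note I = partitionD(1)[OF P]
 have Ab: "A j : sets borel" "A j \<subseteq> cell" "x : A j ==> y : A j ==> dist x y < d" if "j : I" for j x y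
  using bspec[OF partitionD(2)[OF P] that] by blast+
 note ex1 = bspec[OF partitionD(3)[OF P]]
 have p0: "tintegrable p" "!!x. x : cell ==> 0 <= p x" "tint p = 1" and q0: "tintegrable q" "!!x. x : cell ==> 0 <= q x" "tint q = 1"
  using p q unfolding is_density_def by blast+
 obtain p' where p': "p' : borel_measurable borel" "!!x. 0 <= p' x" "!!x. x \<notin> cell ==> p' x = 0" "AE x in lborel. indicator cell x * p x = p' x"
  "!!A. A : sets borel ==> (\<integral>\<^sup>+x\<in>A \<inter> cell. ennreal (p x) \<partial>lborel) = (\<integral>\<^sup>+x\<in>A. ennreal (p' x) \<partial>lborel)"
  "!!A. A : sets borel ==> (\<integral>\<^sup>+x\<in>A. ennreal (p' x) \<partial>lborel) = ennreal (tint (%x. indicator A x * p x))"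
  by (rule nn_lebesgue_cell[OF p0(1,2), of "{}"]) auto
 obtain q' where q': "q' : borel_measurable borel" "!!x. 0 <= q' x" "!!x. x \<notin> cell ==> q' x = 0" "AE x in lborel. indicator cell x * q x = q' x"
  "!!A. A : sets borel ==> (\<integral>\<^sup>+x\<in>A \<inter> cell. ennreal (q x) \<partial>lborel) = (\<integral>\<^sup>+x\<in>A. ennreal (q' x) \<partial>lborel)"
  "!!A. A : sets borel ==> (\<integral>\<^sup>+x\<in>A. ennreal (q' x) \<partial>lborel) = ennreal (tint (%x. indicator A x * q x))"
  by (rule nn_lebesgue_cell[OF q0(1,2), of "{}"]) auto
 define a where "a j = tint (%x. indicator (A j) x * p x)" for j
 define b where "b j = tint (%x. indicator (A j) x * q x)" for j
 have a: "0 <= a j" "0 <= b j" for j unfolding a_def b_def using p0(2) q0(2) by (auto intro!: integral_nonneg_AE AE_I2)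
 have sa: "sum a I = 1" "sum b I = 1" unfolding a_def b_def
  using tint_partition[OF I Ab(1) ex1 p0(1)] tint_partition[OF I Ab(1) ex1 q0(1)] p0(3) q0(3) by simp_all
 have "EX e :: nat => nat => real. (ALL i j. 0 <= e i j) & (ALL i:I. min (a i) (b i) + (SUM j:I. e i j) = a i) \<and>
  (ALL j:I. min (a j) (b j) + (SUM i:I. e i j) = b j) & (SUM i:I. SUM j:I. e i j) <= (SUM i:I. \<bar>a i - b i\<bar>)"
  by (rule discrete_coupling[OF I a(1) sa(1) a(2) sa(2)])
 then obtain e where e0: "(ALL i j. 0 <= e i j) & (ALL i:I. min (a i) (b i) + (SUM j:I. e i j) = a i) \<and>
  (ALL j:I. min (a j) (b j) + (SUM i:I. e i j) = b j) & (SUM i:I. SUM j:I. e i j) <= (SUM i:I. \<bar>a i - b i\<bar>)" ..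
 have e: "0 <= e i j" "i : I ==> min (a i) (b i) + (SUM j:I. e i j) = a i"
  "j : I ==> min (a j) (b j) + (SUM i:I. e i j) = b j" "(SUM i:I. SUM j:I. e i j) <= (SUM i:I. \<bar>a i - b i\<bar>)" for i j
  using e0 by simp_all
 define w where "w i j = (if i = j then min (a i) (b i) else 0) + e i j" for i j
 have w0: "0 <= w i j" if "i : I" "j : I" for i j using e(1)[of i j] a by (auto simp: w_def)
 have wr: "(SUM j:I. w i j) = a i" "(SUM j:I. w j i) = b i" if "i : I" for i
  using that e(2,3)[OF that] I by (simp_all add: w_def sum.distrib sum.delta sum.delta')
 \<comment> \<open>For a piece without mass the quotient is zero; the weights attached to that piece
   vanish too (\<open>f1\<close>), so no mass is lost.\<close>
 define f where "f i x = ennreal (indicator (A i) x * p' x / a i)" for i x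
 define g where "g j y = ennreal (indicator (A j) y * q' y / b j)" for j y
 have fm: "f i : borel_measurable borel" "g i : borel_measurable borel" if "i : I" for i
  unfolding f_def g_def using p'(1) q'(1) Ab(1)[OF that] by measurable
 have fS: "(\<integral>\<^sup>+x. f i x * indicator S x \<partial>lborel) = ennreal (1 / a i) * (\<integral>\<^sup>+x\<in>A i \<inter> S. ennreal (p' x) \<partial>lborel)"
  and gS: "(\<integral>\<^sup>+x. g i x * indicator S x \<partial>lborel) = ennreal (1 / b i) * (\<integral>\<^sup>+x\<in>A i \<inter> S. ennreal (q' x) \<partial>lborel)"
  if "i : I" "S : sets borel" for i S
  using that Ab(1)[OF that(1)] p'(1,2) q'(1,2) a
  by (subst nn_integral_cmult[symmetric], measurable, intro nn_integral_cong, auto simp: f_def g_def indicator_def ennreal_mult'[symmetric])+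
 have inA: "(\<integral>\<^sup>+x\<in>A i. ennreal (p' x) \<partial>lborel) = ennreal (a i)" "(\<integral>\<^sup>+x\<in>A i. ennreal (q' x) \<partial>lborel) = ennreal (b i)" if "i : I" for i
  using p'(6)[OF Ab(1)[OF that]] q'(6)[OF Ab(1)[OF that]] by (simp_all add: a_def b_def)
 have f1: "ennreal (w i j) * (\<integral>\<^sup>+x. g j x \<partial>lborel) = ennreal (w i j)" "ennreal (w i j) * (\<integral>\<^sup>+x. f i x \<partial>lborel) = ennreal (w i j)" if i: "i : I" and j: "j : I" for i j
 proof -
  have wz: "w i j = 0" if "b j = 0 | a i = 0"
   using that
  proof
   assume "b j = 0"
   thus ?thesis using sum_nonneg_eq_0_iff[OF I, of "%i. w i j"] wr(2)[OF j] w0[OF _ j] i by simp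
  next
   assume "a i = 0"
   thus ?thesis using sum_nonneg_eq_0_iff[OF I, of "%j. w i j"] wr(1)[OF i] w0[OF i] j by simp
  qed
  have "(\<integral>\<^sup>+x. g j x \<partial>lborel) = 1" if "b j ~= 0"
   using gS[OF j, of UNIV] inA(2)[OF j] that a(2)[of j] by (simp add: ennreal_mult[symmetric])
  thus "ennreal (w i j) * (\<integral>\<^sup>+x. g j x \<partial>lborel) = ennreal (w i j)" using wz by (cases "b j = 0") auto
  have "(\<integral>\<^sup>+x. f i x \<partial>lborel) = 1" if "a i ~= 0"
   using fS[OF i, of UNIV] inA(1)[OF i] that a(1)[of i] by (simp add: ennreal_mult[symmetric])
  thus "ennreal (w i j) * (\<integral>\<^sup>+x. f i x \<partial>lborel) = ennreal (w i j)" using wz by (cases "a i = 0") auto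
 qed
 define kk where "kk w z = (SUM i:I. SUM j:I. ennreal (w i j) * (f i (fst z) * g j (snd z)))" for w and z :: "(real^'n) \<times> (real^'n)"
 have mkk: "kk w : borel_measurable (lborel \<Otimes>\<^sub>M lborel)" for w
 proof -
  have "(%z. f i (fst z) * g j (snd z)) : borel_measurable (lborel \<Otimes>\<^sub>M lborel)" if "i : I" "j : I" for i j
   using fm(1)[OF that(1)] fm(2)[OF that(2)] by measurable
  thus ?thesis unfolding kk_def
   by (rule_tac borel_measurable_sum, rule_tac borel_measurable_sum, rule_tac borel_measurable_times_ennreal[OF borel_measurable_const]) blast
 qed
 have int: "(\<integral>\<^sup>+z. kk w z * (s (fst z) * t (snd z)) \<partial>(lborel \<Otimes>\<^sub>M lborel)) =
   (SUM i:I. SUM j:I. ennreal (w i j) * ((\<integral>\<^sup>+x. f i x * s x \<partial>lborel) * (\<integral>\<^sup>+y. g j y * t y \<partial>lborel)))"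
  if s: "s : borel_measurable borel" and t: "t : borel_measurable borel" for w and s t :: "real^'n => ennreal"
 proof -
  have m2: "(%z. f i (fst z) * s (fst z) * (g j (snd z) * t (snd z))) : borel_measurable (lborel \<Otimes>\<^sub>M lborel)" if "i : I" "j : I" for i j
   using fm(1)[OF that(1)] fm(2)[OF that(2)] s t by measurable
  have "(\<integral>\<^sup>+z. kk w z * (s (fst z) * t (snd z)) \<partial>(lborel \<Otimes>\<^sub>M lborel)) =
   (\<integral>\<^sup>+z. (SUM i:I. SUM j:I. ennreal (w i j) * (f i (fst z) * s (fst z) * (g j (snd z) * t (snd z)))) \<partial>(lborel \<Otimes>\<^sub>M lborel))"
   by (rule nn_integral_cong) (unfold kk_def sum_distrib_right, intro sum.cong refl, simp only: mult_ac)
  also have "... = (SUM i:I. SUM j:I. ennreal (w i j) * (\<integral>\<^sup>+z. f i (fst z) * s (fst z) * (g j (snd z) * t (snd z)) \<partial>(lborel \<Otimes>\<^sub>M lborel)))"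
   using m2 by (simp add: nn_integral_sum nn_integral_cmult)
  also have "... = (SUM i:I. SUM j:I. ennreal (w i j) * ((\<integral>\<^sup>+x. f i x * s x \<partial>lborel) * (\<integral>\<^sup>+y. g j y * t y \<partial>lborel)))"
  proof (intro sum.cong refl arg_cong2[where f="(*)"])
   fix i j assume ij: "i : I" "j : I"
   have mf: "(%x. f i x * s x) : borel_measurable lborel" and mg: "(%y. g j y * t y) : borel_measurable lborel"
    using fm(1)[OF ij(1)] fm(2)[OF ij(2)] s t by measurable
   have "(\<integral>\<^sup>+z. f i (fst z) * s (fst z) * (g j (snd z) * t (snd z)) \<partial>(lborel \<Otimes>\<^sub>M lborel))
    = (\<integral>\<^sup>+x. \<integral>\<^sup>+y. f i x * s x * (g j y * t y) \<partial>lborel \<partial>lborel)"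
    using lborel.nn_integral_fst[OF m2[OF ij]] by simp
   also have "... = (\<integral>\<^sup>+x. f i x * s x * (\<integral>\<^sup>+y. g j y * t y \<partial>lborel) \<partial>lborel)" by (intro nn_integral_cong nn_integral_cmult mg)
   also have "... = (\<integral>\<^sup>+x. f i x * s x \<partial>lborel) * (\<integral>\<^sup>+y. g j y * t y \<partial>lborel)" by (rule nn_integral_multc[OF mf])
   finally show "(\<integral>\<^sup>+z. f i (fst z) * s (fst z) * (g j (snd z) * t (snd z)) \<partial>(lborel \<Otimes>\<^sub>M lborel)) = (\<integral>\<^sup>+x. f i x * s x \<partial>lborel) * (\<integral>\<^sup>+y. g j y * t y \<partial>lborel)" .
  qed
  finally show ?thesis .
 qed
 define k where "k = kk w"
 define \<gamma> where "\<gamma> = density (lborel \<Otimes>\<^sub>M lborel) k"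
 have mk: "k : borel_measurable (lborel \<Otimes>\<^sub>M lborel)" unfolding k_def by (rule mkk)
 have cb: "(cell :: (real^'n) set) : sets borel" by (simp add: cell_def)
 have ps: "sets (lborel \<Otimes>\<^sub>M lborel) = sets (borel :: ((real^'n) \<times> (real^'n)) measure)" unfolding borel_prod[symmetric] by (simp cong: sets_pair_measure_cong)
 have part: "(SUM i:I. (\<integral>\<^sup>+x\<in>A i \<inter> S. r x \<partial>lborel)) = (\<integral>\<^sup>+x\<in>S. r x \<partial>lborel)"
  if S: "S : sets borel" and r: "r : borel_measurable borel" "!!x. x \<notin> cell ==> r x = 0" for S and r :: "real^'n => ennreal"
 proof -
  have "(SUM i:I. (\<integral>\<^sup>+x\<in>A i \<inter> S. r x \<partial>lborel)) = (\<integral>\<^sup>+x. (SUM i:I. r x * indicator (A i \<inter> S) x) \<partial>lborel)"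
   by (rule nn_integral_sum[symmetric]) (use S r(1) Ab(1) in measurable)
  also have "... = (\<integral>\<^sup>+x\<in>S. r x \<partial>lborel)"
  proof (rule nn_integral_cong)
   fix x show "(SUM i:I. r x * indicator (A i \<inter> S) x) = r x * indicator S x"
   proof (cases "x : cell")
    case True
    define i0 where "i0 = (THE i. i : I & x : A i)"
    have "i0 : I & x : A i0" unfolding i0_def by (rule theI'[OF ex1[OF True]])
    moreover have "i = i0" if "i : I" "x : A i" for i
    unfolding i0_def by (rule the1_equality[OF ex1[OF True], symmetric]) (use that in blast)
    ultimately have i0: "i0 : I" "x : A i0" "!!i. i : I ==> x : A i ==> i = i0" by auto
    have "(SUM i:I. r x * indicator (A i \<inter> S) x) = (SUM i:I. if i = i0 then r x * indicator S x else 0)"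
    proof (rule sum.cong[OF refl])
    fix i assume i: "i : I"
    show "r x * indicator (A i \<inter> S) x = (if i = i0 then r x * indicator S x else 0)"
    proof (cases "i = i0")
    case False
    hence "x \<notin> A i" using i0(3)[OF i] by blast
    thus ?thesis using False by simp
    qed (simp add: i0(2) indicator_def)
    qed
    thus ?thesis using I i0(1) by simp
   qed (simp add: r(2))
  qed
  finally show ?thesis .
 qed
 have az: "ennreal (a i) * (ennreal (1 / a i) * (\<integral>\<^sup>+x\<in>A i \<inter> S. ennreal (p' x) \<partial>lborel)) = (\<integral>\<^sup>+x\<in>A i \<inter> S. ennreal (p' x) \<partial>lborel)"
  and bz: "ennreal (b i) * (ennreal (1 / b i) * (\<integral>\<^sup>+x\<in>A i \<inter> S. ennreal (q' x) \<partial>lborel)) = (\<integral>\<^sup>+x\<in>A i \<inter> S. ennreal (q' x) \<partial>lborel)"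
  if i: "i : I" for i S
 proof -
  have 1: "(\<integral>\<^sup>+x\<in>A i \<inter> S. ennreal (p' x) \<partial>lborel) <= ennreal (a i)" "(\<integral>\<^sup>+x\<in>A i \<inter> S. ennreal (q' x) \<partial>lborel) <= ennreal (b i)"
   unfolding inA[OF i, symmetric] by (intro nn_integral_mono, auto simp: indicator_def)+
  show "ennreal (a i) * (ennreal (1 / a i) * (\<integral>\<^sup>+x\<in>A i \<inter> S. ennreal (p' x) \<partial>lborel)) = (\<integral>\<^sup>+x\<in>A i \<inter> S. ennreal (p' x) \<partial>lborel)"
   using 1(1) a(1)[of i] by (cases "a i = 0") (auto simp: mult.assoc[symmetric] ennreal_mult[symmetric])
  show "ennreal (b i) * (ennreal (1 / b i) * (\<integral>\<^sup>+x\<in>A i \<inter> S. ennreal (q' x) \<partial>lborel)) = (\<integral>\<^sup>+x\<in>A i \<inter> S. ennreal (q' x) \<partial>lborel)"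
   using 1(2) a(2)[of i] by (cases "b i = 0") (auto simp: mult.assoc[symmetric] ennreal_mult[symmetric])
 qed
 have sw: "(SUM j:I. ennreal (w i j)) = ennreal (a i)" "(SUM j:I. ennreal (w j i)) = ennreal (b i)" if "i : I" for i
  using wr[OF that] w0 that by (simp_all add: sum_ennreal)
 have marg1: "emeasure \<gamma> (S \<times> UNIV) = (\<integral>\<^sup>+x\<in>S \<inter> cell. ennreal (p x) \<partial>lborel)" if S: "S : sets borel" for S
 proof -
  have "emeasure \<gamma> (S \<times> UNIV) = (\<integral>\<^sup>+z. k z * indicator (S \<times> UNIV) z \<partial>(lborel \<Otimes>\<^sub>M lborel))"
   unfolding \<gamma>_def by (rule emeasure_density[OF mk]) (use S in simp)
  also have "... = (\<integral>\<^sup>+z. k z * (indicator S (fst z) * indicator UNIV (snd z)) \<partial>(lborel \<Otimes>\<^sub>M lborel))"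
   by (rule nn_integral_cong) (auto simp: indicator_def)
  also have "... = (SUM i:I. SUM j:I. ennreal (w i j) * ((\<integral>\<^sup>+x. f i x * indicator S x \<partial>lborel) * (\<integral>\<^sup>+y. g j y * indicator UNIV y \<partial>lborel)))"
   unfolding k_def by (rule int) (use S in auto)
  also have "... = (SUM i:I. SUM j:I. ennreal (w i j) * (\<integral>\<^sup>+x. f i x * indicator S x \<partial>lborel))"
  proof (intro sum.cong refl)
   fix i j assume "i : I" "j : I"
   from f1(1)[OF this] show "ennreal (w i j) * ((\<integral>\<^sup>+x. f i x * indicator S x \<partial>lborel) * (\<integral>\<^sup>+y. g j y * indicator UNIV y \<partial>lborel)) = ennreal (w i j) * (\<integral>\<^sup>+x. f i x * indicator S x \<partial>lborel)"
    by (simp add: mult.left_commute[of "ennreal (w i j)"]) (simp add: mult.commute)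
  qed
  also have "... = (SUM i:I. (\<integral>\<^sup>+x\<in>A i \<inter> S. ennreal (p' x) \<partial>lborel))"
   by (intro sum.cong refl) (simp only: sum_distrib_right[symmetric] sw fS[OF _ S] az)
  also have "... = (\<integral>\<^sup>+x\<in>S. ennreal (p' x) \<partial>lborel)" by (rule part[OF S]) (use p'(1,3) in auto)
  finally show ?thesis using p'(5)[OF S] by simp
 qed
 have marg2: "emeasure \<gamma> (UNIV \<times> S) = (\<integral>\<^sup>+x\<in>S \<inter> cell. ennreal (q x) \<partial>lborel)" if S: "S : sets borel" for S
 proof -
  have "emeasure \<gamma> (UNIV \<times> S) = (\<integral>\<^sup>+z. k z * indicator (UNIV \<times> S) z \<partial>(lborel \<Otimes>\<^sub>M lborel))"
   unfolding \<gamma>_def by (rule emeasure_density[OF mk]) (use S in simp)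
  also have "... = (\<integral>\<^sup>+z. k z * (indicator UNIV (fst z) * indicator S (snd z)) \<partial>(lborel \<Otimes>\<^sub>M lborel))"
   by (rule nn_integral_cong) (auto simp: indicator_def)
  also have "... = (SUM i:I. SUM j:I. ennreal (w i j) * ((\<integral>\<^sup>+x. f i x * indicator UNIV x \<partial>lborel) * (\<integral>\<^sup>+y. g j y * indicator S y \<partial>lborel)))"
   unfolding k_def by (rule int) (use S in auto)
  also have "... = (SUM i:I. SUM j:I. ennreal (w i j) * (\<integral>\<^sup>+x. g j x * indicator S x \<partial>lborel))"
  proof (intro sum.cong refl)
   fix i j assume "i : I" "j : I"
   from f1(2)[OF this] show "ennreal (w i j) * ((\<integral>\<^sup>+x. f i x * indicator UNIV x \<partial>lborel) * (\<integral>\<^sup>+y. g j y * indicator S y \<partial>lborel)) = ennreal (w i j) * (\<integral>\<^sup>+x. g j x * indicator S x \<partial>lborel)"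
    by (simp add: mult.assoc[symmetric])
  qed
  also have "... = (SUM j:I. SUM i:I. ennreal (w i j) * (\<integral>\<^sup>+x. g j x * indicator S x \<partial>lborel))" by (rule sum.swap)
  also have "... = (SUM i:I. (\<integral>\<^sup>+x\<in>A i \<inter> S. ennreal (q' x) \<partial>lborel))"
   by (intro sum.cong refl) (simp only: sum_distrib_right[symmetric] sw gS[OF _ S] bz)
  also have "... = (\<integral>\<^sup>+x\<in>S. ennreal (q' x) \<partial>lborel)" by (rule part[OF S]) (use q'(1,3) in auto)
  finally show ?thesis using q'(5)[OF S] by simp
 qed
 have outside: "UNIV - (cell :: (real^'n) set) \<times> (cell :: (real^'n) set) : sets (lborel \<Otimes>\<^sub>M (lborel :: (real^'n) measure))"
 proof -
  have "closed ((cell :: (real^'n) set) \<times> (cell :: (real^'n) set))" unfolding cell_def by (intro closed_Times closed_cbox)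
  hence "open (UNIV - (cell :: (real^'n) set) \<times> (cell :: (real^'n) set))" by (simp add: Compl_eq_Diff_UNIV[symmetric] open_Compl)
  thus ?thesis unfolding ps by (rule borel_open)
 qed
 have supp: "emeasure \<gamma> (UNIV - cell \<times> cell) = 0"
 proof -
  have "emeasure \<gamma> (UNIV - cell \<times> cell) = (\<integral>\<^sup>+z. k z * indicator (UNIV - cell \<times> cell) z \<partial>(lborel \<Otimes>\<^sub>M lborel))"
   unfolding \<gamma>_def by (rule emeasure_density[OF mk outside])
  also have "... = (\<integral>\<^sup>+z. 0 \<partial>((lborel :: (real^'n) measure) \<Otimes>\<^sub>M (lborel :: (real^'n) measure)))"
  proof (rule nn_integral_cong)
   fix z :: "(real^'n) \<times> (real^'n)"
   have "f i (fst z) * g j (snd z) = 0" if "z \<notin> cell \<times> cell" for i j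
    using that p'(3)[of "fst z"] q'(3)[of "snd z"] by (cases z) (auto simp: f_def g_def)
   hence "k z = 0" if "z \<notin> cell \<times> cell"
    unfolding k_def kk_def using that by (intro sum.neutral ballI) (simp only: mult_zero_right not_False_eq_True simp_thms)
   thus "k z * indicator (UNIV - cell \<times> cell) z = 0" by (auto simp: indicator_def)
  qed
  finally show ?thesis by simp
 qed
 have cpl: "\<gamma> : couplings p q" unfolding couplings_def
  using supp marg1 marg2 ps by (auto simp: \<gamma>_def)
 have "(\<integral>\<^sup>+z. ennreal ((tdist (fst z) (snd z))^2) \<partial>\<gamma>) <= ennreal (d^2 + real CARD('n) * (SUM j:I. \<bar>a j - b j\<bar>))"
 proof -
  define c where "c i j = (if i = j then d^2 else real CARD('n))" for i j :: nat
  have c: "(tdist x y)^2 <= c i j" "(tdist x y)^2 <= real CARD('n)" if "i : I" "j : I" "x : A i" "y : A j" for i j x y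
  proof -
   have xy: "x : cell" "y : cell" using Ab(2) that by blast+
   show n: "(tdist x y)^2 <= real CARD('n)" by (rule tdist_sq_le(2)[OF xy])
   have "(tdist x y)^2 <= d^2" if "i = j"
    using tdist_sq_le(1)[OF xy] power_mono[of "dist x y" d 2] Ab(3)[OF \<open>i : I\<close>, of x y] \<open>x : A i\<close> \<open>y : A j\<close> that by (simp add: less_imp_le)
   thus "(tdist x y)^2 <= c i j" using n by (simp add: c_def)
  qed
  \<comment> \<open>A bound for the cost that is constant on products of pieces; only this function
    has to be measurable, not \<open>tdist\<close>.\<close>
  define C where "C z = ennreal (SUM i:I. indicator (A i) (fst z) * (SUM j:I. indicator (A j) (snd z) * c i j))" for z
  have C: "C z = ennreal (c i j)" if ij: "i : I" "j : I" "fst z : A i" "snd z : A j" for i j z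
  proof -
   have u: "(THE l. l : I & y : A l) = l" "EX! l. l : I & y : A l" if "l : I" "y : A l" for l y
   proof -
    show ex: "EX! l. l : I & y : A l" using ex1[of y] Ab(2)[OF that(1)] that(2) by blast
    show "(THE l. l : I & y : A l) = l" using the1_equality[OF ex] that by blast
   qed
   show ?thesis unfolding C_def
    by (simp only: partition_indicator[OF I u(2)[OF ij(1,3)]] u(1)[OF ij(1,3)] partition_indicator[OF I u(2)[OF ij(2,4)]] u(1)[OF ij(2,4)])
  qed
  have mC: "C : borel_measurable (lborel \<Otimes>\<^sub>M lborel)" unfolding C_def using Ab(1) by measurable
  have "AE z in \<gamma>. z : cell \<times> cell"
  proof (rule AE_I[OF _ supp])
   show "UNIV - cell \<times> cell : sets \<gamma>" unfolding \<gamma>_def using outside by simp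
  qed auto
  hence "AE z in \<gamma>. ennreal ((tdist (fst z) (snd z))^2) <= C z"
  proof eventually_elim
   case (elim z)
   hence "fst z : cell" "snd z : cell" by auto
   then obtain i j where ij: "i : I" "j : I" "fst z : A i" "snd z : A j" using ex1[of "fst z"] ex1[of "snd z"] by blast
   thus ?case unfolding C[OF ij] by (intro ennreal_leI c(1))
  qed
  hence "(\<integral>\<^sup>+z. ennreal ((tdist (fst z) (snd z))^2) \<partial>\<gamma>) <= (\<integral>\<^sup>+z. C z \<partial>\<gamma>)" by (rule nn_integral_mono_AE)
  also have "... = (\<integral>\<^sup>+z. k z * C z \<partial>(lborel \<Otimes>\<^sub>M lborel))" unfolding \<gamma>_def by (rule nn_integral_density[OF mk mC])
  also have "... = (\<integral>\<^sup>+z. kk (%i j. w i j * c i j) z * (indicator UNIV (fst z) * indicator UNIV (snd z)) \<partial>(lborel \<Otimes>\<^sub>M lborel))"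
  proof (rule nn_integral_cong)
   fix z :: "(real^'n) \<times> (real^'n)"
   have "ennreal (w i j) * (f i (fst z) * g j (snd z)) * C z = ennreal (w i j * c i j) * (f i (fst z) * g j (snd z))" if ij: "i : I" "j : I" for i j
   proof (cases "fst z : A i & snd z : A j")
    case True
    have "0 <= c i j" by (simp add: c_def)
    thus ?thesis using C[OF ij] True w0[OF ij] by (simp add: ennreal_mult mult_ac)
   qed (auto simp: f_def g_def)
   hence "k z * C z = kk (%i j. w i j * c i j) z" unfolding k_def kk_def sum_distrib_right by (intro sum.cong refl)
   thus "k z * C z = kk (%i j. w i j * c i j) z * (indicator UNIV (fst z) * indicator UNIV (snd z))" by simp
  qed
  also have "... = (SUM i:I. SUM j:I. ennreal (w i j * c i j) * ((\<integral>\<^sup>+x. f i x * indicator UNIV x \<partial>lborel) * (\<integral>\<^sup>+y. g j y * indicator UNIV y \<partial>lborel)))"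
   by (rule int) auto
  also have "... = (SUM i:I. SUM j:I. ennreal (w i j * c i j))"
  proof (intro sum.cong refl)
   fix i j assume ij: "i : I" "j : I"
   have "ennreal (w i j * c i j) = ennreal (c i j) * ennreal (w i j)" using w0[OF ij] by (simp add: ennreal_mult c_def mult.commute)
   moreover have "ennreal (w i j) * ((\<integral>\<^sup>+x. f i x \<partial>lborel) * (\<integral>\<^sup>+y. g j y \<partial>lborel)) = ennreal (w i j)"
    unfolding mult.assoc[symmetric] f1(2)[OF ij] by (rule f1(1)[OF ij])
   ultimately show "ennreal (w i j * c i j) * ((\<integral>\<^sup>+x. f i x * indicator UNIV x \<partial>lborel) * (\<integral>\<^sup>+y. g j y * indicator UNIV y \<partial>lborel)) = ennreal (w i j * c i j)"
    by (simp add: mult.assoc)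
  qed
  also have "... = ennreal (SUM i:I. SUM j:I. w i j * c i j)"
   using w0 by (simp add: sum_ennreal sum_nonneg c_def)
  also have "... <= ennreal (d^2 + real CARD('n) * (SUM j:I. \<bar>a j - b j\<bar>))"
  proof (rule ennreal_leI)
   have "(SUM i:I. SUM j:I. w i j * c i j) <= (SUM i:I. SUM j:I. (if i = j then a i * d^2 else 0) + e i j * real CARD('n))"
   proof (intro sum_mono)
    fix i j assume ij: "i : I" "j : I"
    have "w i i <= a i" using member_le_sum[of i I "w i"] w0[OF ij(1)] I ij(1) wr(1)[OF ij(1)] by auto
    hence "w i i * d^2 <= a i * d^2" by (rule mult_right_mono) simp
    moreover have "0 <= e i j * real CARD('n)" using e(1)[of i j] by simp
    ultimately show "w i j * c i j <= (if i = j then a i * d^2 else 0) + e i j * real CARD('n)" by (auto simp: c_def w_def)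
   qed
   also have "... = (SUM i:I. a i) * d^2 + (SUM i:I. SUM j:I. e i j) * real CARD('n)"
    using I by (simp add: sum.distrib sum.delta' sum.delta sum_distrib_right)
   also have "... <= d^2 + (SUM j:I. \<bar>a j - b j\<bar>) * real CARD('n)" using e(4) sa(1) by (simp add: mult_right_mono)
   finally show "(SUM i:I. SUM j:I. w i j * c i j) <= d^2 + real CARD('n) * (SUM j:I. \<bar>a j - b j\<bar>)" by (simp add: mult.commute)
  qed
  finally show ?thesis .
 qed
 thus ?thesis unfolding W2sq_def a_def b_def using cpl by (intro INF_lower2)
qed

section \<open>Passage to the limit\<close>

text \<open>Convergence at the points of a finite net in time suffices; the mesh \<open>d\<close>
  makes the Lipschitz error on either side at most e / 3.\<close>

lemma uniform_of_equilipschitz: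
 fixes h :: "nat => real => 'a::metric_space"
 assumes h: "!!n s t. s : {0..T} ==> t : {0..T} ==> dist (h n s) (h n t) <= C * \<bar>s - t\<bar>"
  and l: "!!s t. s : {0..T} ==> t : {0..T} ==> dist (l s) (l t) <= C * \<bar>s - t\<bar>"
  and lim: "!!t. t : {0..T} ==> (%n. h n t) ----> l t" and C: "0 <= C" and e: "0 < e"
 shows "\<forall>\<^sub>F n in sequentially. ALL t:{0..T}. dist (h n t) (l t) < e"
proof -
 define d where "d = e / (3 * (C + 1))"
 have d: "0 < d" "C * d <= e / 3" using e C by (auto simp: d_def field_simps)
 have "{0..T} \<subseteq> (\<Union>s\<in>{0..T}. ball s d)" using d by auto
 then obtain P where P: "P \<subseteq> {0..T}" "finite P" "{0..T} \<subseteq> (\<Union>s\<in>P. ball s d)"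
  by (rule compactE_image[OF compact_Icc, rotated]) auto
 have "\<forall>\<^sub>F n in sequentially. ALL s:P. dist (h n s) (l s) < e / 3"
  by (rule eventually_ball_finite[OF P(2)]) (rule ballI, rule tendstoD[OF lim], use P(1) e in auto)
 thus ?thesis
 proof eventually_elim
  case (elim n)
  show ?case
  proof
   fix t assume t: "t : {0..T}"
   then obtain s where s: "s : P" "dist s t < d" using P(3) by auto
   have s': "s : {0..T}" using s(1) P(1) by blast
   have "C * \<bar>s - t\<bar> <= C * d" using s(2) C by (intro mult_left_mono) (auto simp: dist_real_def)
   hence "dist (h n s) (h n t) <= e / 3" "dist (l s) (l t) <= e / 3" using h[OF s' t, of n] l[OF s' t] d(2) by linarith+
   moreover have "dist (h n s) (l s) < e / 3" using elim s(1) by blast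
   ultimately show "dist (h n t) (l t) < e"
    using dist_triangle[of "h n t" "l t" "h n s"] dist_triangle[of "h n s" "l t" "l s"] by (simp add: dist_commute)
  qed
 qed
qed

section \<open>The entropy as an L2 pairing\<close>

lemma sqi_mult_bdd:
 fixes a b :: "('n::finite, real) l2"
 assumes "AE x in lc. \<bar>fn a x\<bar> <= K" shows "sqi (%x. fn a x * fn b x)"
proof (rule sqi_dominated[OF _ sqi_scale[OF sqi_fn[of b], of K]])
 show "AE x in lc. norm (fn a x * fn b x) <= norm (K *R fn b x)"
  using assms by eventually_elim (auto simp: abs_mult intro!: mult_right_mono)
qed (intro borel_measurable_times fn_measurable)

definition "nl m u = tol2 (%x. fn u x * lnm m (fn u x))"

lemma sqi_nl:
 assumes "(u, G) : W1" "0 < m" "AE x in lc. m <= fn u x & fn u x <= m2"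
 shows "sqi (%x. fn u x * lnm m (fn u x))"
proof (rule sqi_dominated[OF _ sqi_scale[OF ln_W1(1)[OF assms(1,2)], of m2]])
 show "(%x. fn u x * lnm m (fn u x)) : bmc"
  by (intro borel_measurable_times fn_measurable sqi_measurable[OF ln_W1(1)[OF assms(1,2)]])
 show "AE x in lc. norm (fn u x * lnm m (fn u x)) <= norm (m2 *R lnm m (fn u x))"
  using assms(3) by eventually_elim (use assms(2) in \<open>auto simp: abs_mult intro!: mult_right_mono\<close>)
qed

text \<open>The difference is split as (s - t) log s + t (log s - log t): the constant adds a bound
  for the logarithm between \<open>m\<close> and \<open>m2\<close> to \<open>m2\<close> times the
  Lipschitz constant \<open>1 / m\<close>.\<close>

lemma nl_lip:
 assumes u: "(u, G) : W1" "AE x in lc. m <= fn u x & fn u x <= m2"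
  and v: "(v, H) : W1" "AE x in lc. m <= fn v x & fn v x <= m2" and m: "0 < m" "m <= m2"
 shows "norm (nl m u - nl m v) <= (\<bar>ln m\<bar> + \<bar>ln m2\<bar> + m2 / m) * norm (u - v)"
proof -
 let ?C = "\<bar>ln m\<bar> + \<bar>ln m2\<bar> + m2 / m"
 note s = sqi_nl[OF u(1) m(1) u(2)] sqi_nl[OF v(1) m(1) v(2)]
 have C: "0 <= ?C" using m by simp
 have "nl m u - nl m v = tol2 (%x. fn u x * lnm m (fn u x) - fn v x * lnm m (fn v x))" unfolding nl_def by (rule diff_tol2[OF s])
 also have "norm ... <= norm (tol2 (%x. ?C *R fn (u - v) x))"
 proof (rule norm_tol2_mono[OF sqi_diff[OF s] sqi_scale[OF sqi_fn]])
  show "AE x in lc. norm (fn u x * lnm m (fn u x) - fn v x * lnm m (fn v x)) <= norm (?C *R fn (u - v) x)"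
   using fn_diff[of u v] u(2) v(2)
  proof eventually_elim
   case (elim x)
   let ?s = "fn u x" and ?t = "fn v x"
   have ln: "\<bar>lnm m ?s\<bar> <= \<bar>ln m\<bar> + \<bar>ln m2\<bar>"
   proof -
    have "ln m <= ln ?s" "ln ?s <= ln m2" using elim m by auto
    thus ?thesis using lnm_props(4)[OF m(1), of ?s] elim by auto
   qed
   have "?s * lnm m ?s - ?t * lnm m ?t = (?s - ?t) * lnm m ?s + ?t * (lnm m ?s - lnm m ?t)" by (simp add: algebra_simps)
   also have "\<bar>...\<bar> <= \<bar>?s - ?t\<bar> * (\<bar>ln m\<bar> + \<bar>ln m2\<bar>) + m2 * (\<bar>?s - ?t\<bar> / m)"
   proof (rule order_trans[OF abs_triangle_ineq add_mono])
    show "\<bar>(?s - ?t) * lnm m ?s\<bar> <= \<bar>?s - ?t\<bar> * (\<bar>ln m\<bar> + \<bar>ln m2\<bar>)"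
    unfolding abs_mult by (rule mult_left_mono[OF ln abs_ge_zero])
    show "\<bar>?t * (lnm m ?s - lnm m ?t)\<bar> <= m2 * (\<bar>?s - ?t\<bar> / m)"
    unfolding abs_mult by (rule mult_mono[OF _ lnm_lip[OF m(1)]]) (use elim m in auto)
   qed
   also have "... = ?C * \<bar>?s - ?t\<bar>" by (simp add: algebra_simps)
   finally show ?case using elim C by (simp add: abs_mult)
  qed
 qed
 also have "... = ?C * norm (u - v)" using scaleR_tol2[OF sqi_fn[of "u - v"], of ?C] C by (metis abs_of_nonneg norm_scaleR tol2_fn)
 finally show ?thesis .
qed

lemma (in coef) rel_entropy_eq:
 assumes u: "(u, G) : W1" "AE x in lc. m <= fn u x & fn u x <= m2" and m: "0 < m"
  and r: "r : bmc" "AE x in lc. r x = p x * fn u x"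
 shows "rel_entropy p r = ereal (pp (nl m u) \<bullet> tol2 (%x. 1))"
proof -
 note s = sqi_nl[OF u(1) m u(2)]
 have s2: "sqi (%x. p x *R (fn u x * lnm m (fn u x)))" by (rule sqi_pw[OF b_pp s])
 have ae: "AE x in lc. p x *R (fn u x * lnm m (fn u x)) \<bullet> 1 = r x * ln (r x / p x)"
  using u(2) r(2)
 proof eventually_elim
  case (elim x)
  thus ?case using lnm_props(4)[OF m, of "fn u x"] p_pos[of x] by simp
 qed
 have i: "tintegrable (%x. p x *R (fn u x * lnm m (fn u x)) \<bullet> 1)" by (rule sqi_inner[OF s2 sqi_const])
 have m2: "(%x. r x * ln (r x / p x)) : bmc" using r(1) p_measurable by measurable
 have "pp (nl m u) \<bullet> tol2 (%x. 1) = tint (%x. p x *R (fn u x * lnm m (fn u x)) \<bullet> 1)"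
  unfolding pp_def nl_def pw_tol2[OF b_pp s] by (rule inner_tol2[OF s2 sqi_const])
 also have "... = tint (%x. r x * ln (r x / p x))" by (rule integral_cong_AE[OF borel_measurable_integrable[OF i] m2 ae])
 finally show ?thesis using integrable_cong_AE_imp[OF i m2] ae by (simp add: rel_entropy_def)
qed

context hom begin

text \<open>\<open>tint_param_cont\<close> gives continuity on the cell; a translation by
  \<open>a\<close> moves the given point to its centre.\<close>

lemma pibar_cont: "continuous_on UNIV (pi_bar \<pi>)"
proof (rule continuous_at_imp_continuous_on, rule ballI)
 fix x0 :: "real^'n"
 define c :: "real^'n" where "c = (\<chi> i. 1/2)"
 define a where "a = x0 - c"
 have "continuous_on cell (%z. tint ((%z. \<pi> (z + a)) z))"
  by (rule tint_param_cont) (intro continuous_on_compose2[OF pi_cont, of _ "%z. (fst z + a, snd z)", simplified] continuous_intros)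
 moreover have "c : interior cell" unfolding cell_def interior_cbox mem_box_cart One_nth by (simp add: c_def)
 ultimately have "isCont (%z. pi_bar \<pi> (z + a)) c" unfolding pi_bar_def by (rule continuous_on_interior)
 hence "isCont (%z. pi_bar \<pi> (z + a)) (x0 - a)" by (simp add: a_def)
 hence "isCont (%x. pi_bar \<pi> ((x - a) + a)) x0" by (rule isCont_o2[rotated]) (intro continuous_intros)
 thus "isCont (pi_bar \<pi>) x0" by simp
qed

lemma pibar_bounds: "c0 <= pi_bar \<pi> x" "pi_bar \<pi> x <= c1"
proof -
 have i: "tintegrable (\<pi> x)" by (rule tintegrable_cont(3)[OF cont_diag(2)[where F=\<pi>, OF pi_cont]])
 have "tint (%y::real^'n. c0) <= tint (\<pi> x)" by (rule integral_mono[OF tintegrable_const i]) (use pi_bounds in auto)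
 thus "c0 <= pi_bar \<pi> x" unfolding pi_bar_def by (subst (asm) tint_const)
 have "tint (\<pi> x) <= tint (%y::real^'n. c1)" by (rule integral_mono[OF i tintegrable_const]) (use pi_bounds in auto)
 thus "pi_bar \<pi> x <= c1" unfolding pi_bar_def by (subst (asm) tint_const)
qed

text \<open>The homogenized problem is again of the general type, so everything proved about flows,
  dissipation and action applies to the limit.\<close>

lemma coef_Lim: "coef (pi_bar \<pi>) dh c0 c1 d0 (real CARD('n) * (d1 * KE))"
 by (unfold_locales) (rule pibar_cont c0 pibar_bounds dh_cont dh_sym d0_pos dh_coercive dh_bound)+

sublocale Lim: coef "pi_bar \<pi>" dh c0 c1 d0 "real CARD('n) * (d1 * KE)" by (rule coef_Lim)

lemma Lim_aD: "Lim.aD G H = Dh G \<bullet> H" unfolding Lim.aD_def Lim.Dm_def Dh_def ..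

text \<open>The oscillating weight converges weakly to its average, the functions strongly. The
  assumption \<open>s\<close> makes the fixed factor an admissible weight for
  \<open>osc_mean\<close>.\<close>

lemma pp_tendsto:
 assumes \<sigma>: "strict_mono \<sigma>" and h: "h ----> hl" and s: "sqi (%x. fn hl x * fn v x)"
 shows "(%k. N.pp (\<sigma> k) (h k) \<bullet> v) ----> Lim.pp hl \<bullet> v"
proof -
 have "(%k. N.pp (\<sigma> k) hl \<bullet> v) ----> Lim.pp hl \<bullet> v"
  using LIMSEQ_subseq_LIMSEQ[OF osc_mean[OF pi_cont pi_periodic s] \<sigma>]
  unfolding N.pp_inner Lim.pp_inner pN_eq pi_bar_def by (simp add: o_def mult_ac)
 moreover have "(%k. N.pp (\<sigma> k) (h k - hl) \<bullet> v) ----> 0"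
 proof (rule Lim_null_comparison[OF always_eventually], rule allI)
  show "norm (N.pp (\<sigma> k) (h k - hl) \<bullet> v) <= c1 * norm (h k - hl) * norm v" for k
   unfolding real_norm_def by (rule order_trans[OF Cauchy_Schwarz_ineq2 mult_right_mono[OF N.norm_pp]]) simp
  show "(%k. c1 * norm (h k - hl) * norm v) ----> 0"
   by (rule tendsto_mult_left_zero[OF tendsto_mult_right_zero[OF tendsto_norm_zero[OF LIM_zero[OF h]]]])
 qed
 ultimately have "(%k. N.pp (\<sigma> k) hl \<bullet> v + N.pp (\<sigma> k) (h k - hl) \<bullet> v) ----> Lim.pp hl \<bullet> v + 0" by (rule tendsto_add)
 moreover have "N.pp (\<sigma> k) hl \<bullet> v + N.pp (\<sigma> k) (h k - hl) \<bullet> v = N.pp (\<sigma> k) (h k) \<bullet> v" for k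
  using linear_diff[OF bounded_linear.linear[OF N.bl_pp]] by (simp add: inner_diff_left)
 ultimately show ?thesis by simp
qed

end

locale seqflow = hom B \<pi> C1 C2 c0 c1
 for B :: "real^'n => real^'n^'n" and \<pi> :: "real^'n => real^'n => real" and C1 C2 c0 c1 :: real +
 fixes T L m1 m2 :: real and F :: "nat => real => ('n, real) l2" and Gs :: "nat => real => ('n, real^'n) l2"
 assumes T: "0 < T" and L: "0 <= L" and m: "0 < m1" "m1 <= m2" and flow: "!!N. N.flow N T L m1 m2 (F N) (Gs N)"
begin

definition "\<Lambda> = sqrt (L * m2 / d0)"

lemma G_bound: assumes "t : {0..T}" shows "norm (Gs N t) <= \<Lambda>"
proof -
 have "d0 * (norm (Gs N t))^2 <= L * m2" using N.flow_norm(2)[OF flow assms m(1)] L m by simp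
 hence "(norm (Gs N t))^2 <= L * m2 / d0" by (subst pos_le_divide_eq[OF d0_pos]) (simp only: mult.commute)
 thus ?thesis unfolding \<Lambda>_def by (rule real_le_rsqrt)
qed

lemma F_lip: assumes "s : {0..T}" "t : {0..T}" shows "norm (F N s - F N t) <= L * \<bar>s - t\<bar>"
 by (rule N.flowD(4)[OF flow assms])

text \<open>A diagonal subsequence makes all Fourier coefficients converge at rational times. The
  uniform gradient bound controls high frequencies through \<open>rellich_tail\<close>, and the
  Lipschitz bound passes to every time, so one subsequence converges strongly at all times. Limit
  gradients exist because the truncated energies stay bounded.\<close>

lemma limit_exists:
 "EX \<sigma> fl Gl. strict_mono \<sigma> & (ALL t:{0..T}. (%k. F (\<sigma> k) t) ----> fl t & (fl t, Gl t) : W1)"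
proof -
 define S where "S = (UNIV :: (int^'n) set) \<times> ({0..T} \<inter> \<rat>)"
 have cS: "countable S" unfolding S_def by (intro countable_SIGMA countable_Int2 countable_rat) auto
 have bS: "norm (cf (fst x) (F n (snd x))) <= m2" if "x : S" for n x
  using N.flow_norm(1)[OF flow _ m(1), of "snd x" n] norm_cf[of "fst x" "F n (snd x)"] that m by (auto simp: S_def)
 obtain \<sigma> where \<sigma>: "strict_mono \<sigma>" "!!x. x : S ==> EX l. (%n. cf (fst x) (F (\<sigma> n) (snd x))) ----> l"
  using function_convergent_subsequence[of S "%n x. cf (fst x) (F n (snd x))" m2, OF cS bS] by blast
 have conv: "convergent (%n. F (\<sigma> n) t)" if t: "t : {0..T}" for t
 proof (rule Cauchy_convergent, rule metric_CauchyI)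
  fix e :: real assume e: "0 < e"
  \<comment> \<open>Budget: e / 8 for moving to a rational time and e / 8 for the Fourier tail,
    twice, plus less than e / 4 between the truncations.\<close>
  define d where "d = e / (8 * (L + 1))"
  have d: "0 < d" "L * d <= e / 8" using e L by (auto simp: d_def field_simps)
  have "max 0 (t - d) < min T (t + d)" using t d(1) T by auto
  then obtain q where q: "q : \<rat>" "max 0 (t - d) < q" "q < min T (t + d)" using Rats_dense_in_real by blast
  have qT: "q : {0..T}" and tq: "\<bar>t - q\<bar> <= d" using q by auto
  obtain M :: nat where M: "8 * \<Lambda> / e < real M" using reals_Archimedean2 by blast
  have M': "\<Lambda> / real (Suc M) <= e / 8"
  proof -
   have "8 * \<Lambda> < real M * e" using M e by (simp add: pos_divide_less_eq)
   hence "\<Lambda> <= e / 8 * real (Suc M)" using e by (simp add: algebra_simps)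
   thus ?thesis by (simp add: pos_divide_le_eq del: of_nat_Suc)
  qed
  have "EX l. (%n. cf k (F (\<sigma> n) q)) ----> l" for k using \<sigma>(2)[of "(k, q)"] qT q(1) by (simp add: S_def)
  then obtain l where l: "!!k. (%n. cf k (F (\<sigma> n) q)) ----> l k" by metis
  have "(%n. PN M (F (\<sigma> n) q)) ----> (SUM k:Kb M. l k *R ecas k 1)"
  proof -
   have "PN M u = (SUM k:Kb M. cf k u *R ecas k 1)" for u :: "('n, real) l2"
   proof -
    have "(ecas k c :: ('n, real) l2) = c *R ecas k 1" for k and c :: real using linear_cmul[OF linear_ecas, of k c "1::real"] by simp
    thus ?thesis unfolding PN_def by (intro sum.cong refl)
   qed
   thus ?thesis by (simp only:) (intro tendsto_sum tendsto_scaleR l tendsto_const)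
  qed
  from metric_CauchyD[OF LIMSEQ_imp_Cauchy[OF this], of "e / 4"] e
  obtain n0 where n0: "!!i j. i >= n0 ==> j >= n0 ==> dist (PN M (F (\<sigma> i) q)) (PN M (F (\<sigma> j) q)) < e / 4" by auto
  have b: "dist (F (\<sigma> i) t) (PN M (F (\<sigma> i) q)) <= e / 4" for i
  proof -
   have "norm (F (\<sigma> i) t - F (\<sigma> i) q) <= e / 8"
    using F_lip[OF t qT, of "\<sigma> i"] mult_left_mono[OF tq L] d(2) by linarith
   moreover have "norm (F (\<sigma> i) q - PN M (F (\<sigma> i) q)) <= \<Lambda> / real (Suc M)"
    by (rule order_trans[OF rellich_tail[OF N.flowD(1)[OF flow qT]] divide_right_mono[OF G_bound[OF qT]]]) simp
   ultimately show ?thesis using M' dist_triangle[of "F (\<sigma> i) t" "PN M (F (\<sigma> i) q)" "F (\<sigma> i) q"] unfolding dist_norm by linarith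
  qed
  show "EX n0. ALL i>=n0. ALL j>=n0. dist (F (\<sigma> i) t) (F (\<sigma> j) t) < e"
  proof (rule exI[of _ n0], intro allI impI)
   fix i j assume "n0 <= i" "n0 <= j"
   from n0[OF this] show "dist (F (\<sigma> i) t) (F (\<sigma> j) t) < e"
    using b[of i] b[of j] e dist_triangle[of "F (\<sigma> i) t" "F (\<sigma> j) t" "PN M (F (\<sigma> i) q)"]
    dist_triangle[of "PN M (F (\<sigma> i) q)" "F (\<sigma> j) t" "PN M (F (\<sigma> j) q)"] dist_commute[of "F (\<sigma> j) t" "PN M (F (\<sigma> j) q)"] by linarith
  qed
 qed
 define fl where "fl t = lim (%n. F (\<sigma> n) t)" for t
 have lim: "(%n. F (\<sigma> n) t) ----> fl t" if "t : {0..T}" for t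
  using conv[OF that] unfolding fl_def by (simp add: convergent_LIMSEQ_iff)
 have "EX G. (fl t, G) : W1" if t: "t : {0..T}" for t
 proof -
  have "dir N (fl t) <= \<Lambda>^2" for N
  proof (rule LIMSEQ_le_const2)
   show "(%n. dir N (F (\<sigma> n) t)) ----> dir N (fl t)" unfolding dir_def by (intro tendsto_intros cf_tendsto lim[OF t])
   have "dir N (F (\<sigma> n) t) <= \<Lambda>^2" for n
    unfolding dir_W1[OF N.flowD(1)[OF flow t]]
    by (rule order_trans[OF bessel[OF finite_Kb] power_mono[OF G_bound[OF t] norm_ge_zero]])
   thus "EX n0. ALL n>=n0. dir N (F (\<sigma> n) t) <= \<Lambda>^2" by blast
  qed
  thus ?thesis using dir_bounded[of "fl t" "\<Lambda>^2"] by blast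
 qed
 hence "(fl t, SOME G. (fl t, G) : W1) : W1" if "t : {0..T}" for t using someI_ex that by metis
 thus ?thesis using \<sigma>(1) lim by (intro exI[of _ \<sigma>] exI[of _ fl] exI[of _ "%t. SOME G. (fl t, G) : W1"]) blast
qed

end

locale seqlim = seqflow B \<pi> C1 C2 c0 c1 T L m1 m2 F Gs
 for B :: "real^'n => real^'n^'n" and \<pi> :: "real^'n => real^'n => real" and C1 C2 c0 c1 T L m1 m2 F Gs +
 fixes \<sigma> :: "nat => nat" and fl :: "real => ('n, real) l2" and Gl :: "real => ('n, real^'n) l2"
 assumes \<sigma>: "strict_mono \<sigma>" and lim: "!!t. t : {0..T} ==> (%k. F (\<sigma> k) t) ----> fl t"
  and Wl: "!!t. t : {0..T} ==> (fl t, Gl t) : W1"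
begin

text \<open>The bounds in \<open>flow\<close> hold at every time, so each slice satisfies
  \<open>homseq\<close> along the same subsequence and none is extracted depending on the
  time.\<close>

lemma hom_t: assumes t: "t : {0..T}" shows "(%k. N.aD (\<sigma> k) (Gs (\<sigma> k) t) K) ----> Lim.aD (Gl t) K"
proof -
 interpret homseq B \<pi> C1 C2 c0 c1 \<sigma> "%k. F (\<sigma> k) t" "%k. Gs (\<sigma> k) t" "fl t" "Gl t" \<Lambda> L
  by unfold_locales (rule \<sigma> N.flowD(1)[OF flow t] G_bound[OF t] N.flowD(2)[OF flow t] lim[OF t] Wl[OF t], assumption?)+
 show ?thesis unfolding Lim_aD by (rule homogenization)
qed

lemma fl_AE: assumes t: "t : {0..T}" shows "AE x in lc. m1 <= fn (fl t) x & fn (fl t) x <= m2"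
proof -
 obtain r where r: "strict_mono r" "AE x in lc. (%k. fn (F (\<sigma> (r k)) t) x) ----> fn (fl t) x"
  by (rule l2_tendsto_AE_subseq[OF lim[OF t]])
 have "AE x in lc. ALL k. m1 <= fn (F (\<sigma> (r k)) t) x & fn (F (\<sigma> (r k)) t) x <= m2"
  unfolding AE_all_countable using N.flowD(3)[OF flow t] by blast
 thus ?thesis using r(2)
  by eventually_elim (auto intro: LIMSEQ_le_const LIMSEQ_le_const2)
qed

lemma fl_bdd: assumes t: "t : {0..T}" shows "AE x in lc. \<bar>fn (fl t) x\<bar> <= m2"
 using fl_AE[OF t] by eventually_elim (use m in auto)

lemma fl_lip: assumes "s : {0..T}" "t : {0..T}" shows "norm (fl s - fl t) <= L * \<bar>s - t\<bar>"
 by (rule LIMSEQ_le_const2[OF tendsto_norm[OF tendsto_diff[OF lim[OF assms(1)] lim[OF assms(2)]]]]) (use F_lip[OF assms] in blast)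

lemma pp_lim: assumes "t : {0..T}" shows "(%k. N.pp (\<sigma> k) (F (\<sigma> k) t) \<bullet> v) ----> Lim.pp (fl t) \<bullet> v"
 by (rule pp_tendsto[OF \<sigma> lim[OF assms] sqi_mult_bdd[OF fl_bdd[OF assms]]])

text \<open>Every clause passes to the limit at a fixed time. For the integrated equation the flux
  bound supplies the constant majorant \<open>L * norm (fst z)\<close> in time.\<close>

lemma limit_flow: "Lim.flow T L m1 m2 fl Gl"
 unfolding Lim.flow_def
proof (intro ballI conjI allI impI)
 fix t assume t: "t : {0..T}"
 show "(fl t, Gl t) : W1" by (rule Wl[OF t])
 show "AE x in lc. m1 <= fn (fl t) x & fn (fl t) x <= m2" by (rule fl_AE[OF t])
 show "norm (fl t - fl s) <= L * \<bar>t - s\<bar>" if "s : {0..T}" for s by (rule fl_lip[OF t that])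
 show "\<bar>Lim.aD (Gl t) k\<bar> <= L * norm w" if "(w, k) : W1" for w k
  by (rule LIMSEQ_le_const2[OF tendsto_rabs[OF hom_t[OF t]]]) (use N.flowD(2)[OF flow t that] in blast)
 fix z :: "('n, real) l2 \<times> ('n, real^'n) l2" assume z: "z : W1"
 have sub: "s : {0..T}" if "s : {0..t}" for s using that t by auto
 have h0: "(0::real) : {0..T}" using T by simp
 let ?f = "%k s. N.aD (\<sigma> k) (Gs (\<sigma> k) s) (snd z)"
 note hi = N.flowD(5)[OF flow t z]
 have dc: "(%s. Lim.aD (Gl s) (snd z)) integrable_on {0..t}" "(%k. integral {0..t} (?f k)) ----> integral {0..t} (%s. Lim.aD (Gl s) (snd z))"
 proof -
  have 1: "?f k integrable_on {0..t}" for k using hi by blast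
  have 2: "(%s. L * norm (fst z)) integrable_on {0..t}" by (rule integrable_const_ivl)
  have 3: "norm (?f k s) <= L * norm (fst z)" if "s : {0..t}" for k s
   using N.flowD(2)[OF flow sub[OF that], of "fst z" "snd z"] z by simp
  have 4: "(%k. ?f k s) ----> Lim.aD (Gl s) (snd z)" if "s : {0..t}" for s by (rule hom_t[OF sub[OF that]])
  show "(%s. Lim.aD (Gl s) (snd z)) integrable_on {0..t}" "(%k. integral {0..t} (?f k)) ----> integral {0..t} (%s. Lim.aD (Gl s) (snd z))"
   by (rule dominated_convergence(1)[OF 1 2 3 4], assumption+, rule dominated_convergence(2)[OF 1 2 3 4], assumption+)
 qed
 have "integral {0..t} (?f k) = - ((N.pp (\<sigma> k) (F (\<sigma> k) t) - N.pp (\<sigma> k) (F (\<sigma> k) 0)) \<bullet> fst z)" for k by (rule integral_unique[OF hi])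
 hence "(%k. integral {0..t} (?f k)) ----> - ((Lim.pp (fl t) - Lim.pp (fl 0)) \<bullet> fst z)"
  unfolding inner_diff_left by (simp only:) (intro tendsto_minus tendsto_diff pp_lim t h0)
 from LIMSEQ_unique[OF dc(2) this] show "((%s. Lim.aD (Gl s) (snd z)) has_integral - ((Lim.pp (fl t) - Lim.pp (fl 0)) \<bullet> fst z)) {0..t}"
  using integrable_integral[OF dc(1)] by simp
qed

text \<open>Flux and logarithmic gradient both converge only weakly. The gradient of the difference
  of the logarithms is split off: against it the flux is bounded by the L2 norm of that difference,
  which tends to zero. The rest is a weakly converging flux against a fixed field.\<close>

lemma ent_lim:
 assumes t: "t : {0..T}"
 shows "(%k. N.ent (\<sigma> k) m1 (F (\<sigma> k) t) (Gs (\<sigma> k) t)) ----> Lim.ent m1 (fl t) (Gl t)"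
proof -
 let ?g = "gg m1 (fl t) (Gl t)"
 let ?gk = "%k. gg m1 (F (\<sigma> k) t) (Gs (\<sigma> k) t)"
 have "(%k. N.aD (\<sigma> k) (Gs (\<sigma> k) t) (?gk k - ?g)) ----> 0"
 proof (rule Lim_null_comparison[OF always_eventually], rule allI)
  fix k
  have W: "(lg m1 (F (\<sigma> k) t) - lg m1 (fl t), ?gk k - ?g) : W1"
   using subspace_diff[OF W1_subspace ln_W1(3)[OF N.flowD(1)[OF flow t] m(1)] ln_W1(3)[OF Wl[OF t] m(1)]] by simp
  show "norm (N.aD (\<sigma> k) (Gs (\<sigma> k) t) (?gk k - ?g)) <= L * (norm (F (\<sigma> k) t - fl t) / m1)"
   unfolding real_norm_def
   by (rule order_trans[OF N.flowD(2)[OF flow t W] mult_left_mono[OF lg_lip[OF N.flowD(1)[OF flow t] Wl[OF t] m(1)] L]])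
 next
  show "(%k. L * (norm (F (\<sigma> k) t - fl t) / m1)) ----> 0"
   using tendsto_mult_right_zero[OF tendsto_mult_left_zero[OF tendsto_norm_zero[OF LIM_zero[OF lim[OF t]]]], of L "1 / m1"] by simp
 qed
 from tendsto_add[OF this hom_t[OF t, of ?g]] show ?thesis
  unfolding N.ent_def Lim.ent_def using bounded_bilinear.diff_right[OF N.aD_bb] by simp
qed

lemma fatou:
 assumes t: "t : {0..T}"
 shows "(\<integral>\<^sup>+tau\<in>{0..t}. ennreal (1/2 * Lim.ent m1 (fl tau) (Gl tau)) \<partial>lborel)
  <= liminf (%k. \<integral>\<^sup>+tau\<in>{0..t}. ennreal (1/2 * N.ent (\<sigma> k) m1 (F (\<sigma> k) tau) (Gs (\<sigma> k) tau)) \<partial>lborel)"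
proof -
 let ?u = "%k tau. ennreal (1/2 * N.ent (\<sigma> k) m1 (F (\<sigma> k) tau) (Gs (\<sigma> k) tau)) * indicator {0..t} tau"
 have "(\<integral>\<^sup>+tau\<in>{0..t}. ennreal (1/2 * Lim.ent m1 (fl tau) (Gl tau)) \<partial>lborel) = (\<integral>\<^sup>+tau. liminf (%k. ?u k tau) \<partial>lborel)"
 proof (rule nn_integral_cong)
  fix tau
  have "(%k. ?u k tau) ----> ennreal (1/2 * Lim.ent m1 (fl tau) (Gl tau)) * indicator {0..t} tau"
  proof (cases "tau : {0..t}")
   case True
   hence "tau : {0..T}" using t by auto
   from tendsto_ennrealI[OF tendsto_mult_left[OF ent_lim[OF this], of "1/2"]] show ?thesis using True by simp
  qed simp
  from lim_imp_Liminf[OF _ this] show "ennreal (1/2 * Lim.ent m1 (fl tau) (Gl tau)) * indicator {0..t} tau = liminf (%k. ?u k tau)" by simp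
 qed
 also have "... <= liminf (%k. \<integral>\<^sup>+tau. ?u k tau \<partial>lborel)"
 proof (rule nn_integral_liminf)
  fix k
  have "continuous_on {0..t} (%tau. 1/2 * N.ent (\<sigma> k) m1 (F (\<sigma> k) tau) (Gs (\<sigma> k) tau))"
   by (intro continuous_intros continuous_on_subset[OF N.ent_cont[OF flow m(1)]]) (use t in auto)
  hence "(%tau. indicator {0..t} tau *R (1/2 * N.ent (\<sigma> k) m1 (F (\<sigma> k) tau) (Gs (\<sigma> k) tau))) : borel_measurable borel"
   by (rule borel_measurable_continuous_on_indicator[rotated]) simp
  hence "(%tau. ennreal (indicator {0..t} tau *R (1/2 * N.ent (\<sigma> k) m1 (F (\<sigma> k) tau) (Gs (\<sigma> k) tau)))) : borel_measurable borel" by measurable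
  moreover have "(%tau. ennreal (indicator {0..t} tau *R (1/2 * N.ent (\<sigma> k) m1 (F (\<sigma> k) tau) (Gs (\<sigma> k) tau)))) = ?u k"
   by (auto simp: fun_eq_iff indicator_def)
  ultimately show "?u k : borel_measurable lborel" by simp
 qed
 finally show ?thesis .
qed

text \<open>On the common range the map from f to f log f is Lipschitz, so these functions converge
  strongly and may be paired with the oscillating weight.\<close>

lemma entropy_lim:
 assumes t: "t : {0..T}"
 shows "(%k. N.pp (\<sigma> k) (nl m1 (F (\<sigma> k) t)) \<bullet> tol2 (%x. 1)) ----> Lim.pp (nl m1 (fl t)) \<bullet> tol2 (%x. 1)"
proof (rule pp_tendsto[OF \<sigma>])
 let ?C = "\<bar>ln m1\<bar> + \<bar>ln m2\<bar> + m2 / m1"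
 have "(%k. nl m1 (F (\<sigma> k) t) - nl m1 (fl t)) ----> 0"
 proof (rule Lim_null_comparison[OF always_eventually], rule allI)
  show "norm (nl m1 (F (\<sigma> k) t) - nl m1 (fl t)) <= ?C * norm (F (\<sigma> k) t - fl t)" for k
   by (rule nl_lip[OF N.flowD(1,3)[OF flow t] Wl[OF t] fl_AE[OF t] m])
  show "(%k. ?C * norm (F (\<sigma> k) t - fl t)) ----> 0"
   by (rule tendsto_mult_right_zero[OF tendsto_norm_zero[OF LIM_zero[OF lim[OF t]]]])
 qed
 thus "(%k. nl m1 (F (\<sigma> k) t)) ----> nl m1 (fl t)" by (rule LIM_zero_cancel)
 have "AE x in lebesgue_on (cell :: (real^'n) set). \<bar>fn (tol2 (%x::real^'n. 1::real)) x\<bar> <= 1" using fn_tol2[OF sqi_const[of "1::real"]] by eventually_elim simp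
 from sqi_mult_bdd[OF this, of "nl m1 (fl t)"] show "sqi (%x. fn (nl m1 (fl t)) x * fn (tol2 (%x. 1)) x)" by (simp add: mult.commute)
qed

text \<open>By \<open>W2sq_partition\<close> it suffices to follow the masses of finitely many
  pieces. They are Lipschitz in time with a common constant and converge at each time, hence
  uniformly in time.\<close>

lemma W2_lim:
 fixes \<rho> :: "nat => real => real^'n => real"
 assumes tr: "!!N. N.track N T (\<rho> N) (F N)" and de: "!!N t. t : {0..T} ==> is_density (\<rho> N t)"
  and trl: "Lim.track T \<rho>l fl" and del: "!!t. t : {0..T} ==> is_density (\<rho>l t)" and \<delta>: "0 < \<delta>"
 shows "\<forall>\<^sub>F k in sequentially. ALL t:{0..T}. W2sq (\<rho> (\<sigma> k) t) (\<rho>l t) < ennreal \<delta>"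
proof -
 define d where "d = sqrt (\<delta> / 3)"
 have d: "0 < d" "d^2 = \<delta> / 3" using \<delta> by (auto simp: d_def)
 have "EX I (A :: nat => (real^'n) set). partition d I A" by (rule cell_partition[OF d(1)])
 then obtain I where "EX A :: nat => (real^'n) set. partition d I A" ..
 then obtain A where P: "partition d I (A :: nat => (real^'n) set)" ..
 note I = partitionD(1)[OF P]
 \<comment> \<open>A third of \<delta> is spent on the mesh and at most a third on the excess
   masses, so the final inequality is strict.\<close>
 define eta where "eta = \<delta> / (3 * real CARD('n) * (real (card I) + 1))"
 have eta: "0 < eta" unfolding eta_def using \<delta> by (intro divide_pos_pos mult_pos_pos) auto
 have small: "real CARD('n) * (real (card I) * eta) <= \<delta> / 3"
 proof -
  have "real CARD('n) * (real (card I) * eta) <= real CARD('n) * ((real (card I) + 1) * eta)" using eta by (intro mult_left_mono mult_right_mono) auto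
  also have "... = \<delta> / 3"
  proof -
   have "N * (M * (\<delta> / (3 * N * M))) = \<delta> / 3" if "0 < N" "0 < M" for N M :: real using that by simp
   thus ?thesis unfolding eta_def by (simp add: add_pos_nonneg add_nonneg_pos)
  qed
  finally show ?thesis .
 qed
 have "\<forall>\<^sub>F k in sequentially. ALL j:I. ALL t:{0..T}. dist (N.pp (\<sigma> k) (F (\<sigma> k) t) \<bullet> tol2 (indicator (A j))) (Lim.pp (fl t) \<bullet> tol2 (indicator (A j))) < eta"
 proof (rule eventually_ball_finite[OF I], rule ballI)
  fix j
  let ?v = "tol2 (indicator (A j)) :: ('n, real) l2"
  have lp: "dist (pp u \<bullet> ?v) (pp w \<bullet> ?v) <= c1 * L * norm ?v * \<bar>s - t\<bar>"
   if "!!u. norm (pp u) <= c1 * norm u" "bounded_linear pp" "norm (u - w) <= L * \<bar>s - t\<bar>" for pp :: "('n, real) l2 => ('n, real) l2" and u w s t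
  proof -
   have "dist (pp u \<bullet> ?v) (pp w \<bullet> ?v) = \<bar>pp (u - w) \<bullet> ?v\<bar>"
    using linear_diff[OF bounded_linear.linear[OF that(2)]] by (simp add: dist_real_def inner_diff_left)
   also have "... <= (c1 * (L * \<bar>s - t\<bar>)) * norm ?v"
    using order_trans[OF that(1) mult_left_mono[OF that(3) less_imp_le[OF c1_pos]]]
    by (intro order_trans[OF Cauchy_Schwarz_ineq2] mult_right_mono) auto
   finally show ?thesis by (simp add: mult_ac)
  qed
  show "\<forall>\<^sub>F k in sequentially. ALL t:{0..T}. dist (N.pp (\<sigma> k) (F (\<sigma> k) t) \<bullet> ?v) (Lim.pp (fl t) \<bullet> ?v) < eta"
  proof (rule uniform_of_equilipschitz[where C="c1 * L * norm ?v"])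
   show "dist (N.pp (\<sigma> n) (F (\<sigma> n) s) \<bullet> ?v) (N.pp (\<sigma> n) (F (\<sigma> n) t) \<bullet> ?v) <= c1 * L * norm ?v * \<bar>s - t\<bar>"
    if "s : {0..T}" "t : {0..T}" for n s t by (rule lp[OF N.norm_pp N.bl_pp F_lip[OF that]])
   show "dist (Lim.pp (fl s) \<bullet> ?v) (Lim.pp (fl t) \<bullet> ?v) <= c1 * L * norm ?v * \<bar>s - t\<bar>"
    if "s : {0..T}" "t : {0..T}" for s t by (rule lp[OF Lim.norm_pp Lim.bl_pp fl_lip[OF that]])
   show "(%n. N.pp (\<sigma> n) (F (\<sigma> n) t) \<bullet> ?v) ----> Lim.pp (fl t) \<bullet> ?v" if "t : {0..T}" for t by (rule pp_lim[OF that])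
   show "0 <= c1 * L * norm ?v" using L c1_pos by simp
  qed (rule eta)
 qed
 thus ?thesis
 proof eventually_elim
  case (elim k)
  show ?case
  proof
   fix t assume t: "t : {0..T}"
   have "(SUM j:I. \<bar>tint (%x. indicator (A j) x * \<rho> (\<sigma> k) t x) - tint (%x. indicator (A j) x * \<rho>l t x)\<bar>) <= (SUM j:I. eta)"
   proof (rule sum_mono)
    fix j assume j: "j : I"
    have sA: "sqi (indicator (A j) :: real^'n => real)"
    by (rule sqi_bounded[OF borel_indicator, of _ 1]) (use bspec[OF partitionD(2)[OF P] j] in \<open>auto simp: indicator_def\<close>)
    have "dist (N.pp (\<sigma> k) (F (\<sigma> k) t) \<bullet> tol2 (indicator (A j))) (Lim.pp (fl t) \<bullet> tol2 (indicator (A j))) < eta"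
    using elim j t by blast
    thus "\<bar>tint (%x. indicator (A j) x * \<rho> (\<sigma> k) t x) - tint (%x. indicator (A j) x * \<rho>l t x)\<bar> <= eta"
    unfolding N.track_inner[OF tr t sA, symmetric] Lim.track_inner[OF trl t sA, symmetric] by (simp add: dist_real_def mult.commute)
   qed
   hence "d^2 + real CARD('n) * (SUM j:I. \<bar>tint (%x. indicator (A j) x * \<rho> (\<sigma> k) t x) - tint (%x. indicator (A j) x * \<rho>l t x)\<bar>) <= \<delta> / 3 + real CARD('n) * (real (card I) * eta)"
    unfolding d(2) by (intro add_left_mono mult_left_mono) auto
   also have "... < \<delta>" using small \<delta> by linarith
   finally have "ennreal (d^2 + real CARD('n) * (SUM j:I. \<bar>tint (%x. indicator (A j) x * \<rho> (\<sigma> k) t x) - tint (%x. indicator (A j) x * \<rho>l t x)\<bar>)) < ennreal \<delta>"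
    using \<delta> by (intro ennreal_lessI)
   thus "W2sq (\<rho> (\<sigma> k) t) (\<rho>l t) < ennreal \<delta>"
    by (rule le_less_trans[OF W2sq_partition[OF P d(1) de[OF t] del[OF t]]])
  qed
 qed
qed

end

section \<open>The effective matrix in normalised form and the limit theorem\<close>

lemma matrix_inv_unique: fixes A C :: "real^'n^'n" assumes "A ** C = mat 1" "C ** A = mat 1" shows "matrix_inv A = C"
proof -
 have inv: "invertible A" unfolding invertible_def using assms by blast
 have "matrix_inv A = matrix_inv A ** (A ** C)" by (simp add: assms)
 also have "... = C" by (simp add: matrix_mul_assoc matrix_inv_mult[OF inv])
 finally show ?thesis .
qed

text \<open>\<open>Bbar\<close> is itself an inverse and enters the limit functionals through its
  inverse; coercivity makes the normalised matrix invertible, so the two inversions cancel. The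
  result is the relation D = p M that the lemmas on dissipation and action assume.\<close>

lemma (in hom) dh_Bbar: "dh x = pi_bar \<pi> x *R matrix_inv (Bbar B \<pi> x)"
proof -
 let ?A = "(1 / pi_bar \<pi> x) *R dh x"
 have p: "0 < pi_bar \<pi> x" by (rule Lim.p_pos)
 have "v = 0" if "?A *v v = 0" for v
 proof -
  have "dh x *v v = 0" using that p by (simp add: scaleR_matrix_vector_assoc[symmetric])
  hence "c0 / C2 * (norm v)^2 <= 0" using dh_coercive[of v x] by simp
  hence "(norm v)^2 <= 0" using d0_pos by (metis mult_le_0_iff not_less zero_less_mult_pos mult_pos_pos)
  thus ?thesis by simp
 qed
 hence "EX C. C ** ?A = mat 1" using matrix_left_invertible_ker by blast
 hence inv: "invertible ?A" by (simp add: invertible_left_inverse)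
 have "Bbar B \<pi> x = matrix_inv ?A" by (simp add: Bbar_def dh_def)
 hence "matrix_inv (Bbar B \<pi> x) = ?A" using matrix_inv_unique[OF matrix_inv_mult(2,1)[OF inv]] by simp
 thus ?thesis using p by simp
qed

theorem theorem4p1:
  fixes B :: "real^'n \<Rightarrow> real^'n^'n"
    and \<pi> :: "real^'n \<Rightarrow> real^'n \<Rightarrow> real"
    and T C1 C2 :: real
    and \<rho> :: "real \<Rightarrow> real \<Rightarrow> real^'n \<Rightarrow> real"
    and h :: "real \<Rightarrow> real^'n \<Rightarrow> real"
    and \<rho>0 :: "real^'n \<Rightarrow> real"
  assumes B_smooth: "\<forall>j k. smooth_fun (\<lambda>y. B y $ j $ k)"
    and B_periodic: "periodic B"
    and B_sym: "\<forall>y. transpose (B y) = B y"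
    and B_bounds: "0 < C1" "C1 \<le> C2"
      "\<forall>y \<xi>. C1 * (\<xi> \<bullet> \<xi>) \<le> \<xi> \<bullet> (B y *v \<xi>) \<and> \<xi> \<bullet> (B y *v \<xi>) \<le> C2 * (\<xi> \<bullet> \<xi>)"
    and pi_smooth: "smooth_fun (\<lambda>z. \<pi> (fst z) (snd z))"
    and pi_periodic_y: "\<forall>x. periodic (\<pi> x)"
    and pi_periodic_x: "\<forall>y. periodic (\<lambda>x. \<pi> x y)"
    and pi_bounds: "\<exists>c C. 0 < c \<and> (\<forall>x y. c \<le> \<pi> x y \<and> \<pi> x y \<le> C)"
    and T_pos: "0 < T"
    and sol: "\<forall>\<epsilon>>0. FP_solution (\<lambda>x. matrix_inv (B_eps B \<epsilon> x)) (pi_eps \<pi> \<epsilon>) T (\<rho> \<epsilon>)"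
    and init_bounds: "\<exists>a b. 0 < a \<and> (\<forall>\<epsilon>>0. \<forall>x\<in>cell. a \<le> \<rho> \<epsilon> 0 x \<and> \<rho> \<epsilon> 0 x \<le> b)"
    and h_def: "\<forall>\<epsilon>>0. is_initial_dt (\<lambda>x. matrix_inv (B_eps B \<epsilon> x)) (pi_eps \<pi> \<epsilon>)
                        (\<lambda>x. \<rho> \<epsilon> 0 x / pi_eps \<pi> \<epsilon> x) (h \<epsilon>)"
    and h_grad: "\<forall>\<epsilon>>0. \<exists>g. has_weak_grad (h \<epsilon>) g"
    and unif_bounds: "\<exists>K::real. \<forall>\<epsilon>>0.
        tnn (\<lambda>x. (\<rho> \<epsilon> 0 x / pi_eps \<pi> \<epsilon> x)\<^sup>2 * pi_eps \<pi> \<epsilon> x) \<le> ennreal K \<and>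
        tnn (\<lambda>x. wgrad (\<lambda>y. \<rho> \<epsilon> 0 y / pi_eps \<pi> \<epsilon> y) x \<bullet>
                 (pi_eps \<pi> \<epsilon> x *\<^sub>R (matrix_inv (B_eps B \<epsilon> x) *v wgrad (\<lambda>y. \<rho> \<epsilon> 0 y / pi_eps \<pi> \<epsilon> y) x)))
          \<le> ennreal K \<and>
        tnn (\<lambda>x. (h \<epsilon> x)\<^sup>2 * pi_eps \<pi> \<epsilon> x) \<le> ennreal K \<and>
        tnn (\<lambda>x. wgrad (h \<epsilon>) x \<bullet> (pi_eps \<pi> \<epsilon> x *\<^sub>R (matrix_inv (B_eps B \<epsilon> x) *v wgrad (h \<epsilon>) x)))
          \<le> ennreal K"
    and rho0_density: "is_density \<rho>0"
    and rho0_W2: "((\<lambda>\<epsilon>. W2sq (\<rho> \<epsilon> 0) \<rho>0) \<longlongrightarrow> 0) (at_right 0)"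
    and well_prepared: "weak_conv (\<lambda>\<epsilon>. \<rho> \<epsilon> 0) \<rho>0 (at_right 0)"
      "((\<lambda>\<epsilon>. rel_entropy (pi_eps \<pi> \<epsilon>) (\<rho> \<epsilon> 0)) \<longlongrightarrow> rel_entropy (pi_bar \<pi>) \<rho>0) (at_right 0)"
  shows "\<exists>(e :: nat \<Rightarrow> real) (\<rho>lim :: real \<Rightarrow> real^'n \<Rightarrow> real).
     (\<forall>k. 0 < e k) \<and> strict_mono (\<lambda>k. 1 / e k) \<and> e \<longlonglongrightarrow> 0 \<and>
     (\<forall>t\<in>{0..T}. is_density (\<rho>lim t) \<and> tnn (\<lambda>x. (\<rho>lim t x)\<^sup>2) < \<infinity>) \<and>
     (\<forall>t\<in>{0..T}. ((\<lambda>s. tnn (\<lambda>x. (\<rho>lim s x - \<rho>lim t x)\<^sup>2)) \<longlongrightarrow> 0) (at t within {0..T})) \<and>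
     (\<forall>\<delta>>0. \<forall>\<^sub>F k in sequentially. \<forall>t\<in>{0..T}. W2sq (\<rho> (e k) t) (\<rho>lim t) < ennreal \<delta>) \<and>
     (AE t in lebesgue_on {0..T}.
        liminf (\<lambda>k. rel_entropy (pi_eps \<pi> (e k)) (\<rho> (e k) t)) \<ge> rel_entropy (pi_bar \<pi>) (\<rho>lim t)) \<and>
     (\<forall>t\<in>{0..T}.
        liminf (\<lambda>k. \<integral>\<^sup>+\<tau>\<in>{0..t}. psi_star (\<lambda>x. matrix_inv (B_eps B (e k) x)) (\<rho> (e k) \<tau>)
                        (\<lambda>x. - (ln (\<rho> (e k) \<tau> x / pi_eps \<pi> (e k) x) + 1)) \<partial>lborel)
        \<ge> (\<integral>\<^sup>+\<tau>\<in>{0..t}. psi_star (\<lambda>x. matrix_inv (Bbar B \<pi> x)) (\<rho>lim \<tau>)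
                        (\<lambda>x. - (ln (\<rho>lim \<tau> x / pi_bar \<pi> x) + 1)) \<partial>lborel)) \<and>
     (\<forall>t\<in>{0..T}.
        liminf (\<lambda>k. action (\<lambda>x. matrix_inv (B_eps B (e k) x)) (\<rho> (e k)) t)
        \<ge> action (\<lambda>x. matrix_inv (Bbar B \<pi> x)) \<rho>lim t)"
proof -
 obtain c0 c1 where c: "0 < c0" "!!x y. c0 <= \<pi> x y & \<pi> x y <= c1" using pi_bounds by blast
 interpret hom B \<pi> C1 C2 c0 c1
  by unfold_locales (use B_smooth B_periodic B_sym B_bounds pi_smooth pi_periodic_y c in blast)+
 obtain a b where a: "0 < a" "!!\<epsilon> x. 0 < \<epsilon> ==> x : cell ==> a <= \<rho> \<epsilon> 0 x & \<rho> \<epsilon> 0 x <= b" using init_bounds by blast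
 obtain K0 where K0: "!!\<epsilon>. 0 < \<epsilon> ==> tnn (%x. (h \<epsilon> x)^2 * pi_eps \<pi> \<epsilon> x) <= ennreal K0"
  "!!\<epsilon>. 0 < \<epsilon> ==> tnn (%x. wgrad (%y. \<rho> \<epsilon> 0 y / pi_eps \<pi> \<epsilon> y) x \<bullet>
    (pi_eps \<pi> \<epsilon> x *R (matrix_inv (B_eps B \<epsilon> x) *v wgrad (%y. \<rho> \<epsilon> 0 y / pi_eps \<pi> \<epsilon> y) x))) <= ennreal K0"
  using unif_bounds by blast
 define K where "K = \<bar>K0\<bar>"
 have KK: "ennreal K0 <= ennreal K" "0 <= K" by (auto simp: K_def ennreal_leI)
 define L where "L = max (sqrt K * sqrt c1) (sqrt K / sqrt c0)"
 \<comment> \<open>The bounds on f = rho / pi: the smallest datum over the largest weight, and the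
   largest datum over the smallest weight for \<open>m2\<close>.\<close>
 define m1 where "m1 = a / c1"
 define m2 where "m2 = b / c0"
 define \<epsilon> where "\<epsilon> N = 1 / real (Suc N)" for N
 have \<epsilon>: "0 < \<epsilon> N" for N by (simp add: \<epsilon>_def)
 define r where "r N = \<rho> (\<epsilon> N)" for N
 define F where "F N t = tol2 (%x. r N t x / pN N x)" for N t
 have fp: "FP_solution (MN N) (pN N) T (r N)" for N using sol \<epsilon>[of N] unfolding r_def \<epsilon>_def by blast
 have FP: "t : {0..T} ==> sqi (%x. r N t x / pN N x)" "EX G. N.flow N T L m1 m2 (F N) G" for N t
 proof -
  have init: "x : cell ==> a <= r N 0 x & r N 0 x <= b" for x unfolding r_def by (rule a(2)[OF \<epsilon>])
  have hh: "is_initial_dt (MN N) (pN N) (%x. r N 0 x / pN N x) (h (\<epsilon> N))" using h_def \<epsilon>[of N] unfolding r_def \<epsilon>_def by blast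
  have K1: "tnn (%x. (h (\<epsilon> N) x)^2 * pN N x) <= ennreal K"
   using order_trans[OF K0(1)[OF \<epsilon>[of N]] KK(1)] unfolding \<epsilon>_def .
  have K2: "tnn (%x. wgrad (%y. r N 0 y / pN N y) x \<bullet> (pN N x *R (MN N x *v wgrad (%y. r N 0 y / pN N y) x))) <= ennreal K"
   using order_trans[OF K0(2)[OF \<epsilon>[of N]] KK(1)] unfolding \<epsilon>_def r_def .
  have L: "sqrt K * sqrt c1 <= L" "sqrt K / sqrt c0 <= L" by (auto simp: L_def)
  note FP = N.FP_flow[OF T_pos DN_eq fp init a(1) hh KK(2) K1 K2 L]
  show "t : {0..T} ==> sqi (%x. r N t x / pN N x)" by (rule FP(1))
  show "EX G. N.flow N T L m1 m2 (F N) G" using FP(2) unfolding F_def[abs_def] m1_def m2_def .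
 qed
 define Gs where "Gs N = (SOME G. N.flow N T L m1 m2 (F N) G)" for N
 have fl: "N.flow N T L m1 m2 (F N) (Gs N)" for N unfolding Gs_def by (rule someI_ex[OF FP(2)])
 have m: "0 < m1" "m1 <= m2"
 proof -
  have ab: "a <= b" using a(2)[of 1 0] by (simp add: mem_cell)
  have "c0 <= c1" using c(2)[of 0 0] by linarith
  thus "0 < m1" "m1 <= m2" unfolding m1_def m2_def using a(1) c(1) ab by (auto intro!: frac_le)
 qed
 have L0: "0 <= L" unfolding L_def using KK(2) c1_pos by (simp add: le_max_iff_disj)
 interpret seqflow B \<pi> C1 C2 c0 c1 T L m1 m2 F Gs by unfold_locales (rule T_pos L0 m fl)+
 obtain \<sigma> fl Gl where lim0: "strict_mono \<sigma>" "ALL t:{0..T}. (%k. F (\<sigma> k) t) ----> fl t & (fl t, Gl t) : W1"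
  using limit_exists by blast
 interpret seqlim B \<pi> C1 C2 c0 c1 T L m1 m2 F Gs \<sigma> fl Gl by unfold_locales (use lim0 in blast)+
 \<comment> \<open>A representative with nonnegative values at every point and measurable on the
   whole space, as \<open>is_density\<close> asks. The maximum changes it only on a null set, since
   the limit of f is at least \<open>m1\<close> almost everywhere.\<close>
 define \<rho>l where "\<rho>l t x = (if x : cell then pi_bar \<pi> x * max m1 (fn (fl t) x) else 0)" for t x
 have dens: "is_density (r N t)" if "t : {0..T}" for N t using fp[of N] that unfolding FP_solution_def by blast
 have tr: "N.track N T (r N) (F N)" for N unfolding N.track_def
 proof (intro ballI conjI)
  fix t assume t: "t : {0..T}"
  show "r N t : bmc" using dens[OF t, of N] by (simp add: is_density_def borel_measurable_integrable)
  show "AE x in lc. r N t x = pN N x * fn (F N t) x"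
   using fn_tol2[OF FP(1)[OF t, of N]] unfolding F_def by eventually_elim (use N.p_pos[of N] in \<open>simp add: less_imp_neq[symmetric]\<close>)
 qed
 have trl: "Lim.track T \<rho>l fl" unfolding Lim.track_def
 proof (intro ballI conjI)
  fix t assume t: "t : {0..T}"
  have "(%x. pi_bar \<pi> x * max m1 (fn (fl t) x)) : bmc" using Lim.p_measurable by measurable
  thus "\<rho>l t : bmc" unfolding \<rho>l_def
   by (subst measurable_cong[of _ _ "%x. pi_bar \<pi> x * max m1 (fn (fl t) x)"]) auto
  have "AE x in lc. x : cell" by (rule AE_I2) simp
  thus "AE x in lc. \<rho>l t x = pi_bar \<pi> x * fn (fl t) x"
   using fl_AE[OF t] by eventually_elim (simp add: \<rho>l_def max_def)
 qed
 have \<rho>lm: "\<rho>l t : borel_measurable lebesgue" for t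
 proof -
  have "(%x. pi_bar \<pi> x * max m1 (fn (fl t) x)) : bmc" using Lim.p_measurable by measurable
  thus ?thesis unfolding \<rho>l_def[abs_def] by (rule borel_measurable_if_I) simp
 qed
 have \<rho>lb: "AE x in lc. \<bar>\<rho>l t x\<bar> <= c1 * m2" if t: "t : {0..T}" for t
  using Lim.trackD(2)[OF trl t] fl_AE[OF t]
  by eventually_elim (use Lim.p_hi Lim.p_pos m less_imp_le[OF c1_pos] in \<open>auto simp: abs_mult less_imp_le intro!: mult_mono\<close>)
 have \<rho>ls: "sqi (\<rho>l t)" if t: "t : {0..T}" for t
  by (rule sqi_bounded[OF Lim.trackD(1)[OF trl t], of "c1 * m2"]) (use \<rho>lb[OF t] in simp)
 have one: "sqi (%x :: real^'n. 1 :: real)" by simp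
 have densl: "is_density (\<rho>l t)" if t: "t : {0..T}" for t
 proof -
  have "N.pp (\<sigma> k) (F (\<sigma> k) t) \<bullet> tol2 (%x. 1) = 1" for k
  proof -
   have "N.pp (\<sigma> k) (F (\<sigma> k) t) \<bullet> tol2 (%x. 1) = tint (%x. r (\<sigma> k) t x * 1)" by (rule N.track_inner[OF tr t one, symmetric])
   also have "... = 1" using dens[OF t, of "\<sigma> k"] by (simp add: is_density_def)
   finally show ?thesis .
  qed
  hence "Lim.pp (fl t) \<bullet> tol2 (%x. 1) = 1" using pp_lim[OF t, of "tol2 (%x. 1)"] by (simp add: LIMSEQ_const_iff)
  moreover have "tint (%x. \<rho>l t x * 1) = Lim.pp (fl t) \<bullet> tol2 (%x. 1)" by (rule Lim.track_inner[OF trl t one])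
  ultimately have "tint (\<rho>l t) = 1" by simp
  moreover have "0 <= \<rho>l t x" for x using Lim.p_pos[of x] m(1) by (simp add: \<rho>l_def less_imp_le)
  ultimately show ?thesis unfolding is_density_def using sqi_integrable[OF \<rho>ls[OF t]] \<rho>lm by blast
 qed
 define e where "e k = \<epsilon> (\<sigma> k)" for k
 have re: "\<rho> (e k) = r (\<sigma> k)" "pi_eps \<pi> (e k) = pN (\<sigma> k)" "B_eps B (e k) = B_eps B (1 / real (Suc (\<sigma> k)))" for k by (simp_all add: e_def r_def \<epsilon>_def)
 have sub: "tau : {0..T}" if "tau : {0..t}" "t : {0..T}" for tau t using that by auto
 note pN' = N.psi_star_flow[OF flow m(1) tr DN_eq]
 note pL' = Lim.psi_star_flow[OF limit_flow m(1) trl dh_Bbar]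
 have pN: "(\<integral>\<^sup>+tau\<in>{0..t}. psi_star (MN (\<sigma> k)) (r (\<sigma> k) tau) (%x. - (ln (r (\<sigma> k) tau x / pN (\<sigma> k) x) + 1)) \<partial>lborel)
   = (\<integral>\<^sup>+tau\<in>{0..t}. ennreal (1/2 * N.ent (\<sigma> k) m1 (F (\<sigma> k) tau) (Gs (\<sigma> k) tau)) \<partial>lborel)" if t: "t : {0..T}" for t k
 proof (rule nn_integral_cong)
  fix tau
  show "psi_star (MN (\<sigma> k)) (r (\<sigma> k) tau) (%x. - (ln (r (\<sigma> k) tau x / pN (\<sigma> k) x) + 1)) * indicator {0..t} tau
   = ennreal (1/2 * N.ent (\<sigma> k) m1 (F (\<sigma> k) tau) (Gs (\<sigma> k) tau)) * indicator {0..t} tau"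
  proof (cases "tau : {0..t}")
   case True
   show ?thesis by (simp only: pN'(1)[OF sub[OF True t]])
  qed simp
 qed
 have pL: "(\<integral>\<^sup>+tau\<in>{0..t}. psi_star (%x. matrix_inv (Bbar B \<pi> x)) (\<rho>l tau) (%x. - (ln (\<rho>l tau x / pi_bar \<pi> x) + 1)) \<partial>lborel)
   = (\<integral>\<^sup>+tau\<in>{0..t}. ennreal (1/2 * Lim.ent m1 (fl tau) (Gl tau)) \<partial>lborel)" if t: "t : {0..T}" for t
 proof (rule nn_integral_cong)
  fix tau
  show "psi_star (%x. matrix_inv (Bbar B \<pi> x)) (\<rho>l tau) (%x. - (ln (\<rho>l tau x / pi_bar \<pi> x) + 1)) * indicator {0..t} tau
   = ennreal (1/2 * Lim.ent m1 (fl tau) (Gl tau)) * indicator {0..t} tau"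
  proof (cases "tau : {0..t}")
   case True
   show ?thesis by (simp only: pL'(1)[OF sub[OF True t]])
  qed simp
 qed
 have L2c: "((%s. tnn (%x. (\<rho>l s x - \<rho>l t x)^2)) \<longlongrightarrow> 0) (at t within {0..T})" if t: "t : {0..T}" for t
 proof (rule tendsto_sandwich)
  show "\<forall>\<^sub>F s in at t within {0..T}. (0::ennreal) <= tnn (%x. (\<rho>l s x - \<rho>l t x)^2)" by simp
  show "\<forall>\<^sub>F s in at t within {0..T}. tnn (%x. (\<rho>l s x - \<rho>l t x)^2) <= ennreal ((c1 * (L * \<bar>s - t\<bar>))^2)"
   unfolding eventually_at_filter
  proof (rule always_eventually, intro allI impI)
   fix s assume s: "s : {0..T}"
   have "tnn (%x. (\<rho>l s x - \<rho>l t x)^2) = (\<integral>\<^sup>+x. ennreal ((norm (pi_bar \<pi> x *R fn (fl s - fl t) x))^2) \<partial>lc)"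
   proof (rule nn_integral_cong_AE)
    show "AE x in lc. ennreal ((\<rho>l s x - \<rho>l t x)^2) = ennreal ((norm (pi_bar \<pi> x *R fn (fl s - fl t) x))^2)"
    using Lim.trackD(2)[OF trl s] Lim.trackD(2)[OF trl t] fn_diff[of "fl s" "fl t"]
    by eventually_elim (simp add: right_diff_distrib[symmetric] power2_abs power_mult_distrib)
   qed
   also have "... = ennreal ((norm (Lim.pp (fl s - fl t)))^2)"
    unfolding Lim.pp_def pw_def by (rule nn_norm_sq[OF sqi_pw[OF Lim.b_pp sqi_fn]])
   also have "... <= ennreal ((c1 * (L * \<bar>s - t\<bar>))^2)"
    by (intro ennreal_leI power_mono order_trans[OF Lim.norm_pp] mult_left_mono fl_lip s t) (use c1_pos in auto)
   finally show "tnn (%x. (\<rho>l s x - \<rho>l t x)^2) <= ennreal ((c1 * (L * \<bar>s - t\<bar>))^2)" .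
  qed
  show "((%s. 0) \<longlongrightarrow> (0::ennreal)) (at t within {0..T})" by (rule tendsto_const)
  have "((%s. ennreal ((c1 * (L * \<bar>s - t\<bar>))^2)) \<longlongrightarrow> ennreal ((c1 * (L * \<bar>t - t\<bar>))^2)) (at t within {0..T})"
   by (intro tendsto_ennrealI tendsto_intros)
  thus "((%s. ennreal ((c1 * (L * \<bar>s - t\<bar>))^2)) \<longlongrightarrow> 0) (at t within {0..T})" by simp
 qed
 have L2f: "tnn (%x. (\<rho>l t x)^2) < \<infinity>" if t: "t : {0..T}" for t
  using nn_norm_sq[OF \<rho>ls[OF t]] by (simp add: power2_abs)
 have entr: "liminf (%k. rel_entropy (pN (\<sigma> k)) (r (\<sigma> k) t)) = rel_entropy (pi_bar \<pi>) (\<rho>l t)" if t: "t : {0..T}" for t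
 proof -
  have 1: "rel_entropy (pN (\<sigma> k)) (r (\<sigma> k) t) = ereal (N.pp (\<sigma> k) (nl m1 (F (\<sigma> k) t)) \<bullet> tol2 (%x. 1))" for k
   by (rule N.rel_entropy_eq[OF N.flowD(1,3)[OF flow t] m(1) N.trackD[OF tr t]])
  have 2: "rel_entropy (pi_bar \<pi>) (\<rho>l t) = ereal (Lim.pp (nl m1 (fl t)) \<bullet> tol2 (%x. 1))"
   by (rule Lim.rel_entropy_eq[OF Wl[OF t] fl_AE[OF t] m(1) Lim.trackD[OF trl t]])
  have "(%k. ereal (N.pp (\<sigma> k) (nl m1 (F (\<sigma> k) t)) \<bullet> tol2 (%x. 1))) ----> ereal (Lim.pp (nl m1 (fl t)) \<bullet> tol2 (%x. 1))"
   using entropy_lim[OF t] by simp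
  from lim_imp_Liminf[OF _ this] show ?thesis unfolding 1 2 by simp
 qed
 \<comment> \<open>The logarithmic potential bounds the limit action from above, its optimality
   bounds each oscillating action from below, and Fatou's lemma connects the two
   dissipations.\<close>
 have act: "action (%x. matrix_inv (Bbar B \<pi> x)) \<rho>l t <= liminf (%k. action (MN (\<sigma> k)) (r (\<sigma> k)) t)" if t: "t : {0..T}" for t
 proof -
  have "action (%x. matrix_inv (Bbar B \<pi> x)) \<rho>l t <= (\<integral>\<^sup>+tau\<in>{0..t}. ennreal (1/2 * Lim.ent m1 (fl tau) (Gl tau)) \<partial>lborel)"
   by (rule Lim.action_le[OF limit_flow m(1) trl dh_Bbar t])
  also have "... <= liminf (%k. \<integral>\<^sup>+tau\<in>{0..t}. ennreal (1/2 * N.ent (\<sigma> k) m1 (F (\<sigma> k) tau) (Gs (\<sigma> k) tau)) \<partial>lborel)" by (rule fatou[OF t])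
  also have "... <= liminf (%k. action (MN (\<sigma> k)) (r (\<sigma> k)) t)"
   by (intro Liminf_mono always_eventually allI N.action_ge[OF flow m tr DN_eq t])
  finally show ?thesis .
 qed
 show ?thesis
 proof (rule exI[of _ e], rule exI[of _ \<rho>l], unfold re, intro conjI ballI allI impI)
  show "0 < e k" for k by (simp add: e_def \<epsilon>)
  show "strict_mono (%k. 1 / e k)" using \<sigma> by (simp add: strict_mono_def e_def \<epsilon>_def)
  show "e ----> 0"
   using LIMSEQ_subseq_LIMSEQ[OF lim_const_over_n[of 1, THEN LIMSEQ_Suc] \<sigma>] by (simp add: o_def e_def[abs_def] \<epsilon>_def)
  show "is_density (\<rho>l t)" if "t : {0..T}" for t by (rule densl[OF that])
  show "tnn (%x. (\<rho>l t x)^2) < \<infinity>" if "t : {0..T}" for t by (rule L2f[OF that])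
  show "((%s. tnn (%x. (\<rho>l s x - \<rho>l t x)^2)) \<longlongrightarrow> 0) (at t within {0..T})" if "t : {0..T}" for t by (rule L2c[OF that])
  show "\<forall>\<^sub>F k in sequentially. ALL t:{0..T}. W2sq (r (\<sigma> k) t) (\<rho>l t) < ennreal \<delta>" if "0 < \<delta>" for \<delta>
   by (rule W2_lim[OF tr dens trl densl that])
  show "AE t in lebesgue_on {0..T}. liminf (%k. rel_entropy (pN (\<sigma> k)) (r (\<sigma> k) t)) >= rel_entropy (pi_bar \<pi>) (\<rho>l t)"
   by (rule AE_I2) (rule eq_refl, rule entr[symmetric], simp)
  fix t assume t: "t : {0..T}"
  show "liminf (%k. \<integral>\<^sup>+tau\<in>{0..t}. psi_star (MN (\<sigma> k)) (r (\<sigma> k) tau) (%x. - (ln (r (\<sigma> k) tau x / pN (\<sigma> k) x) + 1)) \<partial>lborel)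
    >= (\<integral>\<^sup>+tau\<in>{0..t}. psi_star (%x. matrix_inv (Bbar B \<pi> x)) (\<rho>l tau) (%x. - (ln (\<rho>l tau x / pi_bar \<pi> x) + 1)) \<partial>lborel)"
   unfolding pN[OF t] pL[OF t] by (rule fatou[OF t])
  show "liminf (%k. action (MN (\<sigma> k)) (r (\<sigma> k)) t) >= action (%x. matrix_inv (Bbar B \<pi> x)) \<rho>l t" by (rule act[OF t])
 qed
qed

end
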